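(* Let $M_1$ be a singular quasi-Hamiltonian space of $b^m$-type with associated group $G\times H_1$, and let $M_2$ be a quasi-Hamiltonian space with group $G\times H_2$. Then their fusion product $M_1\circledast M_2$, obtained from the quasi-Hamiltonian $(G\times G\times H_1\times H_2)$-space $M_1\times M_2$ by fusing the two factors of $G$, is a $b^m$-singular quasi-Hamiltonian $(G\times H_1\times H_2)$-space.
   Context: Notation: for a Lie group $G$, $\theta^l,\theta^r$ are the left- and right-invariant Maurer–Cartan forms, $(\cdot,\cdot)$ is a fixed invariant positive definite inner product on $\mathfrak g$, and $\chi=\frac1{12}(\theta^l,[\theta^l,\theta^l])\in\Omega^3(G)$. A quasi-Hamiltonian $G$-space is a manifold $M$ with a $G$-action, an invariant 2-form $\sigma$ and an equivariant map $\Phi:M\to G$ (group-valued moment map, $G$ acting on itself by conjugation) such that (i) $d\sigma=-\Phi^*\chi$; (ii) $\iota(\upsilon_\xi)\sigma=\frac12\Phi^*(\theta^l+\theta^r,\xi)$ for $\xi\in\mathfrak g$, $\upsilon_\xi$ the fundamental vector field; (iii) $\ker\sigma_x\cap\ker d_x\Phi=0$ for all $x$. A $b$-manifold $(M,Z)$ is an oriented manifold with an oriented hypersurface $Z$, with defining function $t$. $b^m$-vector fields are those tangent to order $m$ to $Z$ (near $Z$ generated by $t^m\partial_t,\partial_{x_2},\dots$), sections of ${}^{b^m}TM$, and $b^m$-forms are sections of $\Lambda^k({}^{b^m}T^*M)$. A singular quasi-Hamiltonian $G$-space of $b^m$-type (also: $b^m$-singular quasi-Hamiltonian $G$-space) is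 a $b$-manifold $(M,Z)$ with a $G$-action, an invariant $b^m$-form $\sigma$ of degree 2 and an equivariant moment map $\Phi:M\to G$ satisfying (i)–(iii). Fusion: given a (singular) quasi-Hamiltonian $G\times G\times H$-space $(M,\sigma)$ with moment map $(\Phi_1,\Phi_2,\Phi_3)$, fusing the two factors of $G$ means letting $G\times H$ act through the diagonal embedding $(g,h)\mapsto(g,g,h)$ and equipping $M$ with the two-form $\hat\sigma=\sigma-\frac12(\Phi_1^*\theta^l,\Phi_2^*\theta^r)$ and the moment map $\hat\Phi=(\Phi_1\cdot\Phi_2,\Phi_3):M\to G\times H$. Here $M=M_1\times M_2$ with product action, product moment map, sum of the two-forms, and $H=H_1\times H_2$, and the critical hypersurface is $Z_1\times M_2$, $Z_1$ being that of $M_1$.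
   Formalization: M_2 is assumed oriented, since otherwise M_1×M_2 is not orientable and so not a b-manifold; the Lie bracket in χ is that of right-invariant fields and υ_ξ is the velocity of exp(-sξ), because with the usual bracket the printed signs of dσ = -Φ*χ and the fusion form are incompatible. *)

theory Defs
  imports "HOL-Analysis.Analysis" "HOL-Algebra.Group_Action"
begin

section \<open>Model spaces and smooth functions\<close>

text \<open>
  Manifolds are modelled on finite-dimensional inner product spaces. The class euclidean_space
  would exclude dimension 0 (its Basis is nonempty), hence trivial and finite Lie groups and
  discrete manifolds.
\<close>

class fin_dim_inner = real_inner +
  assumes finite_spanning: "\<exists>B. finite B \<and> (\<forall>x. \<exists>c. x = (\<Sum>b\<in>B. c b *\<^sub>R b))"

instance euclidean_space \<subseteq> fin_dim_inner
proof
  have "\<exists>c. x = (\<Sum>b\<in>Basis. c b *\<^sub>R b)" for x :: 'a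
    by (rule exI[of _ "\<lambda>b. x \<bullet> b"]) (simp add: euclidean_representation)
  then show "\<exists>B::'a set. finite B \<and> (\<forall>x. \<exists>c. x = (\<Sum>b\<in>B. c b *\<^sub>R b))"
    by (intro exI[of _ Basis]) auto
qed

instance prod :: (fin_dim_inner, fin_dim_inner) fin_dim_inner
proof
  obtain A :: "'a set" where A: "finite A" "\<And>x. \<exists>c. x = (\<Sum>b\<in>A. c b *\<^sub>R b)"
    using finite_spanning by blast
  obtain B :: "'b set" where B: "finite B" "\<And>x. \<exists>c. x = (\<Sum>b\<in>B. c b *\<^sub>R b)"
    using finite_spanning by blast
  let ?C = "(\<lambda>a. (a, 0::'b)) ` A \<union> (\<lambda>b. (0::'a, b)) ` B"
  have fin: "finite ?C" using A B by simp
  have "span ?C = UNIV"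
  proof -
    have "(x, y) \<in> span ?C" for x y
    proof -
      obtain c where c: "x = (\<Sum>a\<in>A. c a *\<^sub>R a)" using A(2) by blast
      obtain d where d: "y = (\<Sum>b\<in>B. d b *\<^sub>R b)" using B(2) by blast
      have "(x, y) = (\<Sum>a\<in>A. c a *\<^sub>R (a, 0)) + (\<Sum>b\<in>B. d b *\<^sub>R (0, b))"
        by (rule prod_eqI) (simp_all add: c d fst_sum snd_sum)
      also have "\<dots> \<in> span ?C"
        by (intro span_add span_sum span_scale span_base) auto
      finally show ?thesis .
    qed
    then show ?thesis by auto
  qed
  then have "range (\<lambda>c. \<Sum>b\<in>?C. c b *\<^sub>R b) = UNIV"
    by (simp only: span_finite[OF fin])
  then have "\<exists>c. x = (\<Sum>b\<in>?C. c b *\<^sub>R b)" for x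
    by (rule surjD)
  then show "\<exists>B::('a \<times> 'b) set. finite B \<and> (\<forall>x. \<exists>c. x = (\<Sum>b\<in>B. c b *\<^sub>R b))"
    using fin by blast
qed

text \<open>\<open>Ck k S f\<close>, for open \<open>S\<close>: all iterated directional derivatives of order at most \<open>k\<close>
  exist and are continuous on \<open>S\<close>.\<close>

fun Ck :: "nat \<Rightarrow> 'a::real_normed_vector set \<Rightarrow> ('a \<Rightarrow> 'b::real_normed_vector) \<Rightarrow> bool" where
  "Ck 0 S f \<longleftrightarrow> continuous_on S f"
| "Ck (Suc k) S f \<longleftrightarrow> (\<forall>x\<in>S. f differentiable (at x)) \<and>
     (\<forall>v. Ck k S (\<lambda>x. frechet_derivative f (at x) v))"

definition smooth_on :: "'a::real_normed_vector set \<Rightarrow> ('a \<Rightarrow> 'b::real_normed_vector) \<Rightarrow> bool" where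
  "smooth_on S f \<longleftrightarrow> (\<forall>k. Ck k S f)"

definition lin_det :: "('e::fin_dim_inner \<Rightarrow> 'e) \<Rightarrow> real" where
  "lin_det f = (let B = (SOME B. finite B \<and> independent B \<and> span B = UNIV) in
     \<Sum>p | p permutes B. of_int (sign p) * (\<Prod>b\<in>B. representation B (f b) (p b)))"


section \<open>Manifolds\<close>

text \<open>
  A manifold is a Hausdorff second countable space, here a whole type \<open>'m\<close>, with an atlas of charts
  in the model space \<open>'e\<close>. A chart \<open>c\<close> is its domain \<open>fst c\<close> together with its coordinate map
  \<open>snd c\<close>. The atlas need not be maximal. Each point also has a preferred chart \<open>chart_at M x\<close>,
  whose only purpose is to identify the tangent space at \<open>x\<close> with \<open>'e\<close>: a vector \<open>v :: 'e\<close>, seen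
  as a tangent vector at \<open>x\<close>, is the one with components \<open>v\<close> in the chart \<open>chart_at M x\<close>.
\<close>

type_synonym ('m, 'e) chart = "'m set \<times> ('m \<Rightarrow> 'e)"

record ('m, 'e) manifold =
  atlas :: "('m, 'e) chart set"
  chart_at :: "'m \<Rightarrow> ('m, 'e) chart"

definition chart_inv :: "('m, 'e) chart \<Rightarrow> 'e \<Rightarrow> 'm" where
  "chart_inv c = inv_into (fst c) (snd c)"

definition smooth_manifold ::
  "('m::{t2_space, second_countable_topology}, 'e::fin_dim_inner) manifold \<Rightarrow> bool" where
  "smooth_manifold M \<longleftrightarrow>
     (\<forall>c\<in>atlas M. open (fst c) \<and> open (snd c ` fst c) \<and>
        homeomorphism (fst c) (snd c ` fst c) (snd c) (chart_inv c)) \<and>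
     (\<forall>c\<in>atlas M. \<forall>d\<in>atlas M. smooth_on (snd c ` (fst c \<inter> fst d)) (snd d \<circ> chart_inv c)) \<and>
     (\<forall>x. chart_at M x \<in> atlas M \<and> x \<in> fst (chart_at M x))"

definition prod_chart :: "('m, 'e) chart \<Rightarrow> ('n, 'f) chart \<Rightarrow> ('m \<times> 'n, 'e \<times> 'f) chart" where
  "prod_chart c d = (fst c \<times> fst d, map_prod (snd c) (snd d))"

definition prod_manifold ::
  "('m, 'e) manifold \<Rightarrow> ('n, 'f) manifold \<Rightarrow> ('m \<times> 'n, 'e \<times> 'f) manifold" where
  "prod_manifold M N =
     \<lparr>atlas = {prod_chart c d | c d. c \<in> atlas M \<and> d \<in> atlas N},
      chart_at = (\<lambda>(x, y). prod_chart (chart_at M x) (chart_at N y))\<rparr>"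

definition vector_manifold :: "('e, 'e) manifold" where
  "vector_manifold = \<lparr>atlas = {(UNIV, id)}, chart_at = (\<lambda>_. (UNIV, id))\<rparr>"

definition smooth_map_on ::
  "('m::topological_space, 'e::real_normed_vector) manifold \<Rightarrow>
   ('n::topological_space, 'f::real_normed_vector) manifold \<Rightarrow> 'm set \<Rightarrow> ('m \<Rightarrow> 'n) \<Rightarrow> bool" where
  "smooth_map_on M N W f \<longleftrightarrow> open W \<and> continuous_on W f \<and>
     (\<forall>c\<in>atlas M. \<forall>d\<in>atlas N.
        smooth_on (snd c ` (fst c \<inter> W \<inter> f -` fst d)) (snd d \<circ> f \<circ> chart_inv c))"

definition mderiv ::
  "('m, 'e::real_normed_vector) manifold \<Rightarrow> ('n, 'f::real_normed_vector) manifold \<Rightarrow>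
   ('m \<Rightarrow> 'n) \<Rightarrow> 'm \<Rightarrow> 'e \<Rightarrow> 'f" where
  "mderiv M N f x = frechet_derivative
     (snd (chart_at N (f x)) \<circ> f \<circ> chart_inv (chart_at M x)) (at (snd (chart_at M x) x))"

text \<open>\<open>components M c x v\<close>: components in the chart \<open>c\<close> of the tangent vector \<open>v\<close> at \<open>x\<close>.
  \<open>coord_field M c a\<close>: the vector field on \<open>fst c\<close> with constant components \<open>a\<close> in \<open>c\<close>.\<close>

definition components ::
  "('m, 'e::real_normed_vector) manifold \<Rightarrow> ('m, 'e) chart \<Rightarrow> 'm \<Rightarrow> 'e \<Rightarrow> 'e" where
  "components M c x = frechet_derivative
     (snd c \<circ> chart_inv (chart_at M x)) (at (snd (chart_at M x) x))"

definition coord_field ::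
  "('m, 'e::real_normed_vector) manifold \<Rightarrow> ('m, 'e) chart \<Rightarrow> 'e \<Rightarrow> 'm \<Rightarrow> 'e" where
  "coord_field M c a x = frechet_derivative (snd (chart_at M x) \<circ> chart_inv c) (at (snd c x)) a"

definition field_rep ::
  "('m, 'e::real_normed_vector) manifold \<Rightarrow> ('m, 'e) chart \<Rightarrow> ('m \<Rightarrow> 'e) \<Rightarrow> 'e \<Rightarrow> 'e" where
  "field_rep M c X y = components M c (chart_inv c y) (X (chart_inv c y))"

definition smooth_field ::
  "('m::topological_space, 'e::real_normed_vector) manifold \<Rightarrow> 'm set \<Rightarrow> ('m \<Rightarrow> 'e) \<Rightarrow> bool" where
  "smooth_field M W X \<longleftrightarrow> open W \<and> (\<forall>c\<in>atlas M. smooth_on (snd c ` (fst c \<inter> W)) (field_rep M c X))"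

definition field_bracket ::
  "('m, 'e::real_normed_vector) manifold \<Rightarrow> ('m \<Rightarrow> 'e) \<Rightarrow> ('m \<Rightarrow> 'e) \<Rightarrow> 'm \<Rightarrow> 'e" where
  "field_bracket M X Y x = (let c = chart_at M x in
     frechet_derivative (field_rep M c Y) (at (snd c x)) (X x)
   - frechet_derivative (field_rep M c X) (at (snd c x)) (Y x))"

text \<open>
  As every tangent space is identified with \<open>'e\<close>, an orientation is a sign at each point, relative
  to one fixed orientation of \<open>'e\<close>, that is locally constant when transported to a chart.
\<close>

definition orientation ::
  "('m::topological_space, 'e::fin_dim_inner) manifold \<Rightarrow> ('m \<Rightarrow> real) \<Rightarrow> bool" where
  "orientation M s \<longleftrightarrow> (\<forall>x. s x = 1 \<or> s x = -1) \<and>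
     (\<forall>c\<in>atlas M. continuous_on (fst c) (\<lambda>x. s x * sgn (lin_det (components M c x))))"


section \<open>Differential forms\<close>

text \<open>Alternating forms on a linear subspace \<open>V\<close>; their values outside \<open>V\<close> are irrelevant.\<close>

definition linear_functional_on :: "'a::real_vector set \<Rightarrow> ('a \<Rightarrow> real) \<Rightarrow> bool" where
  "linear_functional_on V f \<longleftrightarrow>
     (\<forall>u\<in>V. \<forall>v\<in>V. f (u + v) = f u + f v) \<and> (\<forall>r. \<forall>u\<in>V. f (r *\<^sub>R u) = r * f u)"

definition alternating2_on :: "'a::real_vector set \<Rightarrow> ('a \<Rightarrow> 'a \<Rightarrow> real) \<Rightarrow> bool" where
  "alternating2_on V b \<longleftrightarrow>
     (\<forall>u\<in>V. linear_functional_on V (b u) \<and> linear_functional_on V (\<lambda>v. b v u) \<and> b u u = 0)"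

definition alternating3_on :: "'a::real_vector set \<Rightarrow> ('a \<Rightarrow> 'a \<Rightarrow> 'a \<Rightarrow> real) \<Rightarrow> bool" where
  "alternating3_on V b \<longleftrightarrow>
     (\<forall>u\<in>V. alternating2_on V (b u) \<and> alternating2_on V (\<lambda>v. b v u) \<and>
            alternating2_on V (\<lambda>v w. b v w u))"

type_synonym ('m, 'v) form2 = "'m \<Rightarrow> 'v \<Rightarrow> 'v \<Rightarrow> real"
type_synonym ('m, 'v) form3 = "'m \<Rightarrow> 'v \<Rightarrow> 'v \<Rightarrow> 'v \<Rightarrow> real"

definition smooth_form2 ::
  "('m::topological_space, 'e::real_normed_vector) manifold \<Rightarrow> ('m, 'e) form2 \<Rightarrow> bool" where
  "smooth_form2 M \<omega> \<longleftrightarrow> (\<forall>x. alternating2_on UNIV (\<omega> x)) \<and>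
     (\<forall>W X Y. smooth_field M W X \<and> smooth_field M W Y \<longrightarrow>
        smooth_map_on M vector_manifold W (\<lambda>x. \<omega> x (X x) (Y x)))"

text \<open>The usual coordinate expression, in the preferred chart of \<open>x\<close>; the bracket terms of the
  invariant formula vanish because coordinate fields commute.\<close>

definition ext_deriv2 ::
  "('m, 'e::real_normed_vector) manifold \<Rightarrow> ('m, 'e) form2 \<Rightarrow> ('m, 'e) form3" where
  "ext_deriv2 M \<omega> x u v w =
     (let E = coord_field M (chart_at M x);
          D = (\<lambda>a h. mderiv M (vector_manifold :: (real, real) manifold) h x a)
      in D u (\<lambda>y. \<omega> y (E v y) (E w y))
       - D v (\<lambda>y. \<omega> y (E u y) (E w y))
       + D w (\<lambda>y. \<omega> y (E u y) (E v y)))"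

text \<open>Products of vector-valued alternating forms, in the convention
  \<open>(\<alpha> \<and> \<beta>)(u, v) = \<alpha>(u) \<beta>(v) - \<alpha>(v) \<beta>(u)\<close>, combined through a bilinear map \<open>q\<close>.\<close>

definition wedge11 :: "('a \<Rightarrow> 'b \<Rightarrow> 'c::ab_group_add) \<Rightarrow> ('e \<Rightarrow> 'a) \<Rightarrow> ('e \<Rightarrow> 'b) \<Rightarrow> 'e \<Rightarrow> 'e \<Rightarrow> 'c" where
  "wedge11 q \<alpha> \<beta> u v = q (\<alpha> u) (\<beta> v) - q (\<alpha> v) (\<beta> u)"

definition wedge12 ::
  "('a \<Rightarrow> 'b \<Rightarrow> 'c::ab_group_add) \<Rightarrow> ('e \<Rightarrow> 'a) \<Rightarrow> ('e \<Rightarrow> 'e \<Rightarrow> 'b) \<Rightarrow> 'e \<Rightarrow> 'e \<Rightarrow> 'e \<Rightarrow> 'c" where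
  "wedge12 q \<alpha> \<beta> u v w = q (\<alpha> u) (\<beta> v w) - q (\<alpha> v) (\<beta> u w) + q (\<alpha> w) (\<beta> u v)"


section \<open>Lie groups\<close>

text \<open>The Lie algebra is the tangent space at the identity, hence the type \<open>'e\<close>; \<open>ip\<close> is the
  inner product on it.\<close>

record ('g, 'e) lie_group_data =
  grp :: "'g monoid"
  mfd :: "('g, 'e) manifold"
  ip :: "'e \<Rightarrow> 'e \<Rightarrow> real"

abbreviation gmult :: "('g, 'e) lie_group_data \<Rightarrow> 'g \<Rightarrow> 'g \<Rightarrow> 'g" where
  "gmult G a b \<equiv> a \<otimes>\<^bsub>grp G\<^esub> b"

abbreviation ginv :: "('g, 'e) lie_group_data \<Rightarrow> 'g \<Rightarrow> 'g" where
  "ginv G a \<equiv> inv\<^bsub>grp G\<^esub> a"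

abbreviation gone :: "('g, 'e) lie_group_data \<Rightarrow> 'g" where
  "gone G \<equiv> \<one>\<^bsub>grp G\<^esub>"

definition Ad :: "('g, 'e::real_normed_vector) lie_group_data \<Rightarrow> 'g \<Rightarrow> 'e \<Rightarrow> 'e" where
  "Ad G a = mderiv (mfd G) (mfd G) (\<lambda>h. gmult G (gmult G a h) (ginv G a)) (gone G)"

definition invariant_inner_product :: "('g, 'e::real_normed_vector) lie_group_data \<Rightarrow> bool" where
  "invariant_inner_product G \<longleftrightarrow>
     (\<forall>u. linear_functional_on UNIV (ip G u)) \<and> (\<forall>u v. ip G u v = ip G v u) \<and>
     (\<forall>u. u \<noteq> 0 \<longrightarrow> ip G u u > 0) \<and>
     (\<forall>a u v. ip G (Ad G a u) (Ad G a v) = ip G u v)"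

definition lie_group ::
  "('g::{t2_space, second_countable_topology}, 'e::fin_dim_inner) lie_group_data \<Rightarrow> bool" where
  "lie_group G \<longleftrightarrow> Group.group (grp G) \<and> carrier (grp G) = UNIV \<and> smooth_manifold (mfd G) \<and>
     smooth_map_on (prod_manifold (mfd G) (mfd G)) (mfd G) UNIV (\<lambda>(a, b). gmult G a b) \<and>
     smooth_map_on (mfd G) (mfd G) UNIV (ginv G) \<and>
     invariant_inner_product G"

definition prod_lie :: "('g, 'e) lie_group_data \<Rightarrow> ('h, 'f) lie_group_data \<Rightarrow>
    ('g \<times> 'h, 'e \<times> 'f) lie_group_data" where
  "prod_lie G H =
     \<lparr>grp = grp G \<times>\<times> grp H,
      mfd = prod_manifold (mfd G) (mfd H),
      ip = (\<lambda>u v. ip G (fst u) (fst v) + ip H (snd u) (snd v))\<rparr>"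

text \<open>The left- and right-invariant Maurer--Cartan forms (\<open>g\<^sup>-\<^sup>1 dg\<close> and \<open>dg g\<^sup>-\<^sup>1\<close>).\<close>

definition theta_l :: "('g, 'e::real_normed_vector) lie_group_data \<Rightarrow> 'g \<Rightarrow> 'e \<Rightarrow> 'e" where
  "theta_l G a = mderiv (mfd G) (mfd G) (\<lambda>h. gmult G (ginv G a) h) a"

definition theta_r :: "('g, 'e::real_normed_vector) lie_group_data \<Rightarrow> 'g \<Rightarrow> 'e \<Rightarrow> 'e" where
  "theta_r G a = mderiv (mfd G) (mfd G) (\<lambda>h. gmult G h (ginv G a)) a"

text \<open>
  Sign conventions. The displayed formulas \<open>d\<sigma> = - \<Phi>\<^sup>*\<chi>\<close>,
  \<open>\<iota>(\<upsilon>\<^sub>\<xi>)\<sigma> = (1/2) \<Phi>\<^sup>*(\<theta>\<^sup>l + \<theta>\<^sup>r, \<xi>)\<close> and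
  \<open>\<sigma> - (1/2) (\<Phi>\<^sub>1\<^sup>*\<theta>\<^sup>l, \<Phi>\<^sub>2\<^sup>*\<theta>\<^sup>r)\<close> leave two signs open: that of the Lie bracket
  (left- or right-invariant vector fields) and that of \<open>\<upsilon>\<^sub>\<xi>\<close> (velocity of \<open>exp(s\<xi>)\<close> or
  \<open>exp(-s\<xi>)\<close>). Only one choice makes all three compatible: the bracket of right-invariant fields,
  and \<open>exp(-s\<xi>)\<close>. With it, \<open>(M, \<sigma>, \<Phi>)\<close> satisfies the axioms iff \<open>(M, -\<sigma>, \<Phi>)\<close> satisfies
  them for left-invariant fields and \<open>exp(s\<xi>)\<close>, where the correction term of the fusion form has
  the sign \<open>+\<close>.
\<close>

definition lie_bracket :: "('g, 'e::real_normed_vector) lie_group_data \<Rightarrow> 'e \<Rightarrow> 'e \<Rightarrow> 'e" where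
  "lie_bracket G u v =
     (let R = (\<lambda>w a. mderiv (mfd G) (mfd G) (\<lambda>h. gmult G h a) (gone G) w)
      in field_bracket (mfd G) (R u) (R v) (gone G))"

definition chi :: "('g, 'e::real_normed_vector) lie_group_data \<Rightarrow> ('g, 'e) form3" where
  "chi G a u v w =
     1 / 12 * wedge12 (ip G) (theta_l G a) (wedge11 (lie_bracket G) (theta_l G a) (theta_l G a)) u v w"


section \<open>Quasi-Hamiltonian spaces\<close>

definition smooth_action ::
  "('g::topological_space, 'k::real_normed_vector) lie_group_data \<Rightarrow>
   ('m::topological_space, 'e::real_normed_vector) manifold \<Rightarrow> ('g \<Rightarrow> 'm \<Rightarrow> 'm) \<Rightarrow> bool" where
  "smooth_action G M act \<longleftrightarrow> group_action (grp G) UNIV act \<and>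
     smooth_map_on (prod_manifold (mfd G) M) M UNIV (\<lambda>(a, x). act a x)"

text \<open>The velocity of \<open>exp(-s\<xi>) \<cdot> x\<close> at \<open>s = 0\<close>, by the chain rule.\<close>

definition fundamental_field ::
  "('g, 'k::real_normed_vector) lie_group_data \<Rightarrow> ('m, 'e::real_normed_vector) manifold \<Rightarrow>
   ('g \<Rightarrow> 'm \<Rightarrow> 'm) \<Rightarrow> 'k \<Rightarrow> 'm \<Rightarrow> 'e" where
  "fundamental_field G M act \<xi> x = - mderiv (mfd G) M (\<lambda>a. act a x) (gone G) \<xi>"

definition equivariant_moment_map ::
  "('g::topological_space, 'k::real_normed_vector) lie_group_data \<Rightarrow>
   ('m::topological_space, 'e::real_normed_vector) manifold \<Rightarrow>
   ('g \<Rightarrow> 'm \<Rightarrow> 'm) \<Rightarrow> ('m \<Rightarrow> 'g) \<Rightarrow> bool" where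
  "equivariant_moment_map G M act \<Phi> \<longleftrightarrow> smooth_map_on M (mfd G) UNIV \<Phi> \<and>
     (\<forall>a x. \<Phi> (act a x) = gmult G (gmult G a (\<Phi> x)) (ginv G a))"

definition quasi_hamiltonian ::
  "('g::topological_space, 'k::real_normed_vector) lie_group_data \<Rightarrow>
   ('m::{t2_space, second_countable_topology}, 'e::fin_dim_inner) manifold \<Rightarrow>
   ('g \<Rightarrow> 'm \<Rightarrow> 'm) \<Rightarrow> ('m, 'e) form2 \<Rightarrow> ('m \<Rightarrow> 'g) \<Rightarrow> bool" where
  "quasi_hamiltonian G M act \<sigma> \<Phi> \<longleftrightarrow>
     smooth_manifold M \<and> smooth_action G M act \<and> smooth_form2 M \<sigma> \<and>
     (\<forall>a x u v. \<sigma> (act a x) (mderiv M M (act a) x u) (mderiv M M (act a) x v) = \<sigma> x u v) \<and>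
     equivariant_moment_map G M act \<Phi> \<and>
     (let d\<Phi> = mderiv M (mfd G) \<Phi> in
       (\<forall>x u v w. ext_deriv2 M \<sigma> x u v w = - chi G (\<Phi> x) (d\<Phi> x u) (d\<Phi> x v) (d\<Phi> x w)) \<and>
       (\<forall>\<xi> x v. \<sigma> x (fundamental_field G M act \<xi> x) v =
          1 / 2 * ip G (theta_l G (\<Phi> x) (d\<Phi> x v) + theta_r G (\<Phi> x) (d\<Phi> x v)) \<xi>) \<and>
       (\<forall>x u. (\<forall>v. \<sigma> x u v = 0) \<and> d\<Phi> x u = 0 \<longrightarrow> u = 0))"


section \<open>\<open>b\<^sup>m\<close>-geometry\<close>

text \<open>
  The defining function \<open>def_fun\<close> of \<open>Z\<close> is only required on an open neighbourhood \<open>nbhd\<close> of \<open>Z\<close>;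
  a global one is the case \<open>nbhd B = UNIV\<close>. \<open>Z\<close> is oriented by \<open>orient\<close> and the
  co-orientation \<open>dt\<close>.
\<close>

record ('m, 'e) b_manifold_data =
  space :: "('m, 'e) manifold"
  orient :: "'m \<Rightarrow> real"
  nbhd :: "'m set"
  def_fun :: "'m \<Rightarrow> real"

definition hypersurface :: "('m, 'e) b_manifold_data \<Rightarrow> 'm set" where
  "hypersurface B = {x \<in> nbhd B. def_fun B x = 0}"

abbreviation d_def_fun :: "('m, 'e::real_normed_vector) b_manifold_data \<Rightarrow> 'm \<Rightarrow> 'e \<Rightarrow> real" where
  "d_def_fun B x v \<equiv> mderiv (space B) vector_manifold (def_fun B) x v"

definition b_manifold ::
  "('m::{t2_space, second_countable_topology}, 'e::fin_dim_inner) b_manifold_data \<Rightarrow> bool" where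
  "b_manifold B \<longleftrightarrow> smooth_manifold (space B) \<and> orientation (space B) (orient B) \<and>
     smooth_map_on (space B) vector_manifold (nbhd B) (def_fun B) \<and>
     closed (hypersurface B) \<and>
     (\<forall>x\<in>hypersurface B. \<exists>v. d_def_fun B x v \<noteq> 0)"

text \<open>
  The \<open>b\<^sup>m\<close>-tangent bundle. A vector field \<open>X\<close> is tangent to \<open>Z\<close> to order \<open>m\<close> iff
  \<open>dt(X) = t\<^sup>m f\<close> on \<open>nbhd B\<close> for a smooth \<open>f\<close>, which is then unique; in coordinates
  \<open>(t, x\<^sub>2, \<dots>)\<close> it is \<open>f t\<^sup>m \<partial>\<^sub>t + \<Sum> X\<^sub>i \<partial>\<^sub>i\<close>. The value at \<open>x\<close> of \<open>X\<close> as a section of the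
  \<open>b\<^sup>m\<close>-tangent bundle is the pair \<open>(X x, f x)\<close>, and \<open>fst\<close> is the anchor into the tangent bundle.
  So at points of \<open>Z\<close> the fibre consists of the pairs \<open>(v, r)\<close> with \<open>v\<close> tangent to \<open>Z\<close> and
  \<open>(0, 1)\<close> is \<open>t\<^sup>m \<partial>\<^sub>t\<close>; off \<open>Z\<close> the anchor is bijective, with inverse \<open>bm_lift\<close>.
\<close>

definition bm_fibre ::
  "('m, 'e::real_normed_vector) b_manifold_data \<Rightarrow> nat \<Rightarrow> 'm \<Rightarrow> ('e \<times> real) set" where
  "bm_fibre B m x =
     {(v, r). if x \<in> nbhd B then d_def_fun B x v = def_fun B x ^ m * r else r = 0}"

definition bm_lift ::
  "('m, 'e::real_normed_vector) b_manifold_data \<Rightarrow> nat \<Rightarrow> 'm \<Rightarrow> 'e \<Rightarrow> 'e \<times> real" where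
  "bm_lift B m x v = (v, if x \<in> nbhd B then d_def_fun B x v / def_fun B x ^ m else 0)"

definition bm_field ::
  "('m::topological_space, 'e::real_normed_vector) b_manifold_data \<Rightarrow> nat \<Rightarrow> 'm set \<Rightarrow>
   ('m \<Rightarrow> 'e \<times> real) \<Rightarrow> bool" where
  "bm_field B m W s \<longleftrightarrow> (\<forall>x\<in>W. s x \<in> bm_fibre B m x) \<and> smooth_field (space B) W (fst \<circ> s) \<and>
     smooth_map_on (space B) vector_manifold (W \<inter> nbhd B) (snd \<circ> s)"

definition bm_form2 ::
  "('m::topological_space, 'e::real_normed_vector) b_manifold_data \<Rightarrow> nat \<Rightarrow>
   ('m, 'e \<times> real) form2 \<Rightarrow> bool" where
  "bm_form2 B m \<omega> \<longleftrightarrow> (\<forall>x. alternating2_on (bm_fibre B m x) (\<omega> x)) \<and>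
     (\<forall>W r s. bm_field B m W r \<and> bm_field B m W s \<longrightarrow>
        smooth_map_on (space B) vector_manifold W (\<lambda>x. \<omega> x (r x) (s x)))"

definition bm_form3 ::
  "('m::topological_space, 'e::real_normed_vector) b_manifold_data \<Rightarrow> nat \<Rightarrow>
   ('m, 'e \<times> real) form3 \<Rightarrow> bool" where
  "bm_form3 B m \<omega> \<longleftrightarrow> (\<forall>x. alternating3_on (bm_fibre B m x) (\<omega> x)) \<and>
     (\<forall>W q r s. bm_field B m W q \<and> bm_field B m W r \<and> bm_field B m W s \<longrightarrow>
        smooth_map_on (space B) vector_manifold W (\<lambda>x. \<omega> x (q x) (r x) (s x)))"

text \<open>The exterior derivative of a \<open>b\<^sup>m\<close>-form is the \<open>b\<^sup>m\<close>-form extending the ordinary exterior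
  derivative from the complement of \<open>Z\<close>; it is unique since that complement is dense.\<close>

definition bm_has_ext_deriv ::
  "('m::topological_space, 'e::real_normed_vector) b_manifold_data \<Rightarrow> nat \<Rightarrow>
   ('m, 'e \<times> real) form2 \<Rightarrow> ('m, 'e \<times> real) form3 \<Rightarrow> bool" where
  "bm_has_ext_deriv B m \<omega> \<tau> \<longleftrightarrow> bm_form3 B m \<tau> \<and>
     (\<forall>x. x \<notin> hypersurface B \<longrightarrow> (\<forall>u v w.
        \<tau> x (bm_lift B m x u) (bm_lift B m x v) (bm_lift B m x w) =
        ext_deriv2 (space B) (\<lambda>y u v. \<omega> y (bm_lift B m y u) (bm_lift B m y v)) x u v w))"

text \<open>The action of a diffeomorphism \<open>f\<close> on \<open>b\<^sup>m\<close>-fields: \<open>s'\<close> is the push-forward of \<open>s\<close>. By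
  density of the complement of \<open>Z\<close>, there is at most one \<open>s'\<close> on the image of \<open>W\<close>.\<close>

definition bm_pushforward ::
  "('m::topological_space, 'e::real_normed_vector) b_manifold_data \<Rightarrow> nat \<Rightarrow> ('m \<Rightarrow> 'm) \<Rightarrow> 'm set \<Rightarrow>
   ('m \<Rightarrow> 'e \<times> real) \<Rightarrow> ('m \<Rightarrow> 'e \<times> real) \<Rightarrow> bool" where
  "bm_pushforward B m f W s s' \<longleftrightarrow> bm_field B m (f ` W) s' \<and>
     (\<forall>x\<in>W. fst (s' (f x)) = mderiv (space B) (space B) f x (fst (s x)))"

text \<open>The action of a group on a \<open>b\<close>-manifold has to respect the \<open>b\<^sup>m\<close>-structure: it maps
  \<open>b\<^sup>m\<close>-fields to \<open>b\<^sup>m\<close>-fields. (Fundamental fields are required to be \<open>b\<^sup>m\<close>-fields in the moment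
  map condition below.)\<close>

definition bm_action ::
  "('g::topological_space, 'k::real_normed_vector) lie_group_data \<Rightarrow> nat \<Rightarrow>
   ('m::topological_space, 'e::real_normed_vector) b_manifold_data \<Rightarrow> ('g \<Rightarrow> 'm \<Rightarrow> 'm) \<Rightarrow> bool" where
  "bm_action G m B act \<longleftrightarrow> smooth_action G (space B) act \<and>
     (\<forall>a W s. bm_field B m W s \<longrightarrow> (\<exists>s'. bm_pushforward B m (act a) W s s'))"

definition bm_invariant ::
  "nat \<Rightarrow> ('m::topological_space, 'e::real_normed_vector) b_manifold_data \<Rightarrow> ('g \<Rightarrow> 'm \<Rightarrow> 'm) \<Rightarrow>
   ('m, 'e \<times> real) form2 \<Rightarrow> bool" where
  "bm_invariant m B act \<omega> \<longleftrightarrow> (\<forall>a W r s r' s'.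
     bm_field B m W r \<and> bm_field B m W s \<and>
     bm_pushforward B m (act a) W r r' \<and> bm_pushforward B m (act a) W s s' \<longrightarrow>
     (\<forall>x\<in>W. \<omega> (act a x) (r' (act a x)) (s' (act a x)) = \<omega> x (r x) (s x)))"

definition singular_quasi_hamiltonian ::
  "('g::topological_space, 'k::real_normed_vector) lie_group_data \<Rightarrow> nat \<Rightarrow>
   ('m::{t2_space, second_countable_topology}, 'e::fin_dim_inner) b_manifold_data \<Rightarrow>
   ('g \<Rightarrow> 'm \<Rightarrow> 'm) \<Rightarrow> ('m, 'e \<times> real) form2 \<Rightarrow> ('m \<Rightarrow> 'g) \<Rightarrow> bool" where
  "singular_quasi_hamiltonian G m B act \<sigma> \<Phi> \<longleftrightarrow>
     b_manifold B \<and> bm_action G m B act \<and> bm_form2 B m \<sigma> \<and> bm_invariant m B act \<sigma> \<and>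
     equivariant_moment_map G (space B) act \<Phi> \<and>
     (let d\<Phi> = (\<lambda>x p. mderiv (space B) (mfd G) \<Phi> x (fst p)) in
       bm_has_ext_deriv B m \<sigma> (\<lambda>x p q r. - chi G (\<Phi> x) (d\<Phi> x p) (d\<Phi> x q) (d\<Phi> x r)) \<and>
       (\<forall>\<xi>. \<exists>s. bm_field B m UNIV s \<and> fst \<circ> s = fundamental_field G (space B) act \<xi> \<and>
          (\<forall>x. \<forall>p\<in>bm_fibre B m x. \<sigma> x (s x) p =
             1 / 2 * ip G (theta_l G (\<Phi> x) (d\<Phi> x p) + theta_r G (\<Phi> x) (d\<Phi> x p)) \<xi>)) \<and>
       (\<forall>x. \<forall>p\<in>bm_fibre B m x. (\<forall>q\<in>bm_fibre B m x. \<sigma> x p q = 0) \<and> d\<Phi> x p = 0 \<longrightarrow> p = 0))"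


section \<open>Products and fusion\<close>

text \<open>The product with a manifold \<open>N\<close> oriented by \<open>s\<close>; the hypersurface is \<open>Z \<times> N\<close>.\<close>

definition prod_b_manifold ::
  "('m, 'e) b_manifold_data \<Rightarrow> ('n, 'f) manifold \<Rightarrow> ('n \<Rightarrow> real) \<Rightarrow>
   ('m \<times> 'n, 'e \<times> 'f) b_manifold_data" where
  "prod_b_manifold B N s =
     \<lparr>space = prod_manifold (space B) N,
      orient = (\<lambda>(x, y). orient B x * s y),
      nbhd = nbhd B \<times> UNIV,
      def_fun = def_fun B \<circ> fst\<rparr>"

text \<open>The product of a \<open>G \<times> H\<^sub>1\<close>-space and a \<open>G \<times> H\<^sub>2\<close>-space as a \<open>G \<times> G \<times> (H\<^sub>1 \<times> H\<^sub>2)\<close>-space.\<close>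

definition prod_action ::
  "('g \<times> 'h1 \<Rightarrow> 'm \<Rightarrow> 'm) \<Rightarrow> ('g \<times> 'h2 \<Rightarrow> 'n \<Rightarrow> 'n) \<Rightarrow>
   'g \<times> 'g \<times> ('h1 \<times> 'h2) \<Rightarrow> 'm \<times> 'n \<Rightarrow> 'm \<times> 'n" where
  "prod_action act1 act2 = (\<lambda>(g1, g2, h1, h2) (x, y). (act1 (g1, h1) x, act2 (g2, h2) y))"

definition prod_moment ::
  "('m \<Rightarrow> 'g \<times> 'h1) \<Rightarrow> ('n \<Rightarrow> 'g \<times> 'h2) \<Rightarrow> 'm \<times> 'n \<Rightarrow> 'g \<times> 'g \<times> ('h1 \<times> 'h2)" where
  "prod_moment \<Phi>1 \<Phi>2 =
     (\<lambda>(x, y). (fst (\<Phi>1 x), fst (\<Phi>2 y), (snd (\<Phi>1 x), snd (\<Phi>2 y))))"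

definition prod_bm_form2 ::
  "('m, 'e \<times> real) form2 \<Rightarrow> ('n, 'f) form2 \<Rightarrow> ('m \<times> 'n, ('e \<times> 'f) \<times> real) form2" where
  "prod_bm_form2 \<sigma>1 \<sigma>2 =
     (\<lambda>(x, y) ((u1, u2), r) ((v1, v2), r'). \<sigma>1 x (u1, r) (v1, r') + \<sigma>2 y u2 v2)"

definition fusion_action :: "('g \<times> 'g \<times> 'h \<Rightarrow> 'm \<Rightarrow> 'm) \<Rightarrow> 'g \<times> 'h \<Rightarrow> 'm \<Rightarrow> 'm" where
  "fusion_action act = (\<lambda>(g, h). act (g, g, h))"

definition fusion_moment ::
  "('g, 'k) lie_group_data \<Rightarrow> ('m \<Rightarrow> 'g \<times> 'g \<times> 'h) \<Rightarrow> 'm \<Rightarrow> 'g \<times> 'h" where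
  "fusion_moment G \<Phi> x = (case \<Phi> x of (a1, a2, b) \<Rightarrow> (gmult G a1 a2, b))"

definition fusion_form ::
  "('g, 'k::real_normed_vector) lie_group_data \<Rightarrow> ('m, 'e::real_normed_vector) b_manifold_data \<Rightarrow>
   ('m \<Rightarrow> 'g \<times> 'g \<times> 'h) \<Rightarrow> ('m, 'e \<times> real) form2 \<Rightarrow> ('m, 'e \<times> real) form2" where
  "fusion_form G B \<Phi> \<sigma> x p q =
     (let \<Phi>1 = (\<lambda>y. fst (\<Phi> y)); \<Phi>2 = (\<lambda>y. fst (snd (\<Phi> y)))
      in \<sigma> x p q - 1 / 2 * wedge11 (ip G)
           (\<lambda>v. theta_l G (\<Phi>1 x) (mderiv (space B) (mfd G) \<Phi>1 x v))
           (\<lambda>v. theta_r G (\<Phi>2 x) (mderiv (space B) (mfd G) \<Phi>2 x v))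
           (fst p) (fst q))"

end

theory Submission
  imports Defs "Jordan_Normal_Form.Determinant"
begin

text \<open>
  The fusion product is built in two steps, and each step preserves the axioms of a singular
  quasi-Hamiltonian space.

  The first step is the product \<open>M\<^sub>1 \<times> M\<^sub>2\<close>, a singular space for \<open>G \<times> G \<times> (H\<^sub>1 \<times> H\<^sub>2)\<close>
  (\<open>singular_quasi_hamiltonian_product\<close>). Its axioms are conjunctions of those of the factors as far as
  they concern single points. Smoothness is not of this kind: a \<open>b\<^sup>m\<close>-field of the product depends on both
  variables, and the hypotheses on \<open>M\<^sub>1\<close> speak of fields depending on the first one alone. Near a point
  the \<open>b\<^sup>m\<close>-tangent bundle of \<open>M\<^sub>1\<close> is spanned by finitely many \<open>b\<^sup>m\<close>-fields of \<open>M\<^sub>1\<close>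
  (\<open>bm_local_frame\<close>), and expanding in them leaves coefficients that are smooth functions on the product.
  This gives smoothness of the two-form (\<open>bm_form2_prod\<close>) and, locally, push-forwards of \<open>b\<^sup>m\<close>-fields under
  the group (\<open>bm_pushforward_prod\<close>). The local push-forwards agree on overlaps, because a quotient by
  \<open>t\<^sup>m\<close> is determined by its values on the dense complement of the hypersurface
  (\<open>def_fun_power_divide_glue\<close>). The product orientation is locally constant because determinants are
  multiplicative on products (\<open>lin_det_map_prod\<close>).

  The second step fuses two factors of \<open>G\<close> in an arbitrary singular space for \<open>G \<times> G \<times> H\<close>
  (\<open>singular_quasi_hamiltonian_fusion\<close>). Write \<open>\<alpha> = \<Phi>\<^sub>1\<^sup>*\<theta>\<^sup>l\<close> and
  \<open>\<beta> = \<Phi>\<^sub>2\<^sup>*\<theta>\<^sup>r\<close>. Then \<open>(\<Phi>\<^sub>1 \<Phi>\<^sub>2)\<^sup>*\<theta>\<^sup>l\<close> and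
  \<open>(\<Phi>\<^sub>1 \<Phi>\<^sub>2)\<^sup>*\<theta>\<^sup>r\<close> are conjugates of \<open>\<alpha> + \<beta>\<close> (\<open>theta_gmult\<close>), so
  \<open>(\<Phi>\<^sub>1 \<Phi>\<^sub>2)\<^sup>*\<chi>\<close> is \<open>1/2 (\<alpha> + \<beta>, [\<alpha> + \<beta>, \<alpha> + \<beta>])\<close>, the bracket being evaluated without
  antisymmetrisation on the arguments. It exceeds the sum of the pull-backs under \<open>\<Phi>\<^sub>1\<close> and
  \<open>\<Phi>\<^sub>2\<close> by mixed terms, and by the Maurer--Cartan equations these make up the exterior derivative of
  the correction \<open>1/2 (\<alpha>, \<beta>)\<close> (\<open>ext_deriv2_fused\<close>). By equivariance \<open>\<alpha>\<close> and \<open>\<beta>\<close> take the values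
  \<open>\<xi> - Ad \<Phi>\<^sub>1\<^sup>-\<^sup>1 \<xi>\<close> and \<open>Ad \<Phi>\<^sub>2 \<xi> - \<xi>\<close> on the fundamental fields of \<open>(\<xi>, \<xi>, \<eta>)\<close>. This
  yields the moment map condition (\<open>moment_condition_fused\<close>). For nondegeneracy, a vector killed by the
  derivative of \<open>\<Phi>\<^sub>1 \<Phi>\<^sub>2\<close> satisfies \<open>\<beta> = - \<alpha>\<close>; if it also lies in the kernel of the fused form,
  pairing it with the fundamental fields of \<open>(\<xi>, 0, 0)\<close> gives \<open>(\<alpha>, \<xi>) = 0\<close> for all \<open>\<xi>\<close>. So
  \<open>\<alpha> = \<beta> = 0\<close>, and the nondegeneracy of the given space applies (\<open>nondegenerate_fused\<close>).

  The facts on Lie groups behind this are the Maurer--Cartan equations and the invariance of the bracket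
  and of the triple product \<open>(u, [v, w])\<close>. In coordinates at the identity the bracket is the
  antisymmetrised mixed second derivative of the group law (\<open>lie_bracket_eq\<close>), and each of these facts
  comes from applying the second-order chain rule (\<open>D2_compose\<close>) to an identity between products and
  inverses.
\<close>

section \<open>Finite-dimensional inner product spaces\<close>

lemma orthonormal_basis_exists:
  "\<exists>B::'a::fin_dim_inner set. finite B \<and> (\<forall>b\<in>B. norm b = 1) \<and> pairwise Linear_Algebra.orthogonal B \<and> span B = UNIV"
proof -
  obtain A :: "'a set" where A: "finite A" "\<And>x. \<exists>c. x = (\<Sum>b\<in>A. c b *\<^sub>R b)"
    using finite_spanning by blast
  have spA: "span A = UNIV"
  proof -
    have "x \<in> span A" for x
    proof -
      obtain c where "x = (\<Sum>b\<in>A. c b *\<^sub>R b)" using A(2) by blast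
      then show ?thesis by (auto intro: span_sum span_scale span_base)
    qed
    then show ?thesis by blast
  qed
  obtain C where C: "finite C" "span C = span A" "pairwise Linear_Algebra.orthogonal C"
    using basis_orthogonal[OF A(1)] by blast
  let ?n = "\<lambda>b::'a. (1 / norm b) *\<^sub>R b"
  let ?B = "?n ` (C - {0})"
  have "C - {0} \<subseteq> span ?B"
  proof
    fix b assume b: "b \<in> C - {0}"
    then have "norm b *\<^sub>R ?n b \<in> span ?B" by (intro span_scale span_base) auto
    then show "b \<in> span ?B" using b by simp
  qed
  then have "span (C - {0}) \<subseteq> span ?B" by (rule span_minimal) (rule subspace_span)
  then have sp: "span ?B = UNIV" using C(2) spA by (simp only: span_delete_0) auto
  have "pairwise Linear_Algebra.orthogonal ?B"
    using C(3) by (fastforce simp: pairwise_def Linear_Algebra.orthogonal_def)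
  then show ?thesis using C(1) sp by (intro exI[of _ ?B]) auto
qed

text \<open>The class provides no more than a finite spanning set. One orthonormal basis, chosen once
  and for all, replaces coordinates throughout.\<close>

definition onb :: "'a::fin_dim_inner set" where
  "onb = (SOME B. finite B \<and> (\<forall>b\<in>B. norm b = 1) \<and> pairwise Linear_Algebra.orthogonal B \<and> span B = UNIV)"

lemma onb: "finite (onb :: 'a::fin_dim_inner set)" "\<And>b::'a. b \<in> onb \<Longrightarrow> norm b = 1"
  "pairwise Linear_Algebra.orthogonal (onb :: 'a set)" "span (onb :: 'a set) = UNIV"
  using someI_ex[OF orthonormal_basis_exists[where 'a='a]] unfolding onb_def[symmetric] by auto

lemma onb_expansion: "(\<Sum>b\<in>onb. inner x b *\<^sub>R b) = (x::'a::fin_dim_inner)"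
proof -
  have "x \<in> span onb" by (simp add: onb(4))
  then obtain c where c: "x = (\<Sum>b\<in>onb. c b *\<^sub>R b)" by (auto simp: span_finite onb(1))
  have "inner x b = c b" if b: "b \<in> onb" for b
  proof -
    have "inner x b = (\<Sum>a\<in>onb. c a * inner a b)" by (simp add: c inner_sum_left)
    also have "\<dots> = (\<Sum>a\<in>onb. if a = b then c a else 0)"
    proof (rule sum.cong)
      fix a :: 'a assume a: "a \<in> onb"
      have "inner b b = 1" using onb(2)[OF b] by (simp add: norm_eq_1)
      then show "c a * inner a b = (if a = b then c a else 0)"
        using onb(3) a b by (auto simp: pairwise_def Linear_Algebra.orthogonal_def)
    qed simp
    finally show ?thesis using b by (simp add: onb(1))
  qed
  then show ?thesis using c by simp
qed

lemma linear_onb_expansion: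
  fixes f :: "'a::fin_dim_inner \<Rightarrow> 'b::real_vector"
  assumes "linear f"
  shows "f x = (\<Sum>b\<in>onb. inner x b *\<^sub>R f b)"
proof -
  have "f x = f (\<Sum>b\<in>onb. inner x b *\<^sub>R b)" by (simp add: onb_expansion)
  then show ?thesis by (simp add: linear_sum[OF assms] linear_cmul[OF assms])
qed

lemma linear_imp_bounded_linear:
  fixes f :: "'a::fin_dim_inner \<Rightarrow> 'b::real_normed_vector"
  assumes "linear f"
  shows "bounded_linear f"
proof -
  have "f = (\<lambda>x. \<Sum>b\<in>onb. inner x b *\<^sub>R f b)"
    using linear_onb_expansion[OF assms] by blast
  moreover have "bounded_linear (\<lambda>x. \<Sum>b\<in>onb. inner x b *\<^sub>R f b)"
    by (intro bounded_linear_sum bounded_linear_scaleR_const bounded_linear_inner_left)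
  ultimately show ?thesis by simp
qed

lemma bilinear_imp_bounded_bilinear:
  fixes q :: "'a::fin_dim_inner \<Rightarrow> 'b::fin_dim_inner \<Rightarrow> 'c::real_normed_vector"
  assumes l: "\<And>v. linear (\<lambda>u. q u v)" and r: "\<And>u. linear (q u)"
  shows "bounded_bilinear q"
proof
  show "\<exists>K. \<forall>a b. norm (q a b) \<le> norm a * norm b * K"
  proof (intro exI[of _ "\<Sum>i\<in>onb. \<Sum>j\<in>onb. norm (q i j)"] allI)
    fix a b
    have "q a b = (\<Sum>i\<in>onb. inner a i *\<^sub>R (\<Sum>j\<in>onb. inner b j *\<^sub>R q i j))"
      using linear_onb_expansion[OF l, of a b] linear_onb_expansion[OF r, of _ b] by simp
    then have "norm (q a b) \<le> (\<Sum>i\<in>onb. \<Sum>j\<in>onb. norm (inner a i *\<^sub>R inner b j *\<^sub>R q i j))"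
      by (simp only: scaleR_sum_right) (intro order_trans[OF norm_sum] sum_mono norm_sum)
    also have "\<dots> \<le> (\<Sum>i\<in>onb. \<Sum>j\<in>onb. norm a * norm b * norm (q i j))"
    proof (intro sum_mono)
      fix i :: 'a and j :: 'b assume ij: "i \<in> onb" "j \<in> onb"
      have "\<bar>inner a i\<bar> \<le> norm a" "\<bar>inner b j\<bar> \<le> norm b"
        using Cauchy_Schwarz_ineq2[of a i] Cauchy_Schwarz_ineq2[of b j] ij by (simp_all add: onb(2))
      then have "\<bar>inner a i\<bar> * (\<bar>inner b j\<bar> * norm (q i j)) \<le> norm a * (norm b * norm (q i j))"
        by (intro mult_mono) auto
      then show "norm (inner a i *\<^sub>R inner b j *\<^sub>R q i j) \<le> norm a * norm b * norm (q i j)"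
        by (simp add: mult.assoc abs_mult)
    qed
    finally show "norm (q a b) \<le> norm a * norm b * (\<Sum>i\<in>onb. \<Sum>j\<in>onb. norm (q i j))"
      by (simp add: sum_distrib_left)
  qed
qed (simp_all add: linear_add[OF l] linear_add[OF r] linear_cmul[OF l] linear_cmul[OF r])

section \<open>Calculus of smooth functions\<close>

abbreviation D :: "('a::real_normed_vector \<Rightarrow> 'b::real_normed_vector) \<Rightarrow> 'a \<Rightarrow> 'a \<Rightarrow> 'b" where
  "D f x \<equiv> frechet_derivative f (at x)"

lemma D_eqI: "(f has_derivative f') (at x) \<Longrightarrow> D f x = f'"
  using frechet_derivative_at by metis

lemma has_derivative_D: "f differentiable (at x) \<Longrightarrow> (f has_derivative D f x) (at x)"
  by (simp add: frechet_derivative_works[symmetric])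

lemma D_cong_ev:
  assumes "eventually (\<lambda>y. f y = g y) (nhds x)" shows "D f x = D g x"
proof -
  have *: "(f has_derivative d) (at x) \<longleftrightarrow> (g has_derivative d) (at x)" for d
  proof -
    obtain S where S: "open S" "x \<in> S" "\<And>y. y \<in> S \<Longrightarrow> f y = g y"
      using assms by (auto simp: eventually_nhds)
    show ?thesis
      using has_derivative_transform_within_open[OF _ S(1,2), of f d UNIV g]
        has_derivative_transform_within_open[OF _ S(1,2), of g d UNIV f] S(3) by auto
  qed
  show ?thesis unfolding frechet_derivative_def by (simp add: *)
qed

text \<open>Congruence appears as a hypothesis because this rule is used in the inductive proof of
  congruence itself.\<close>

lemma Ck_SucI:
  assumes "open S" "\<And>x. x \<in> S \<Longrightarrow> (f has_derivative f' x) (at x)" "\<And>v. Ck k S (\<lambda>x. f' x v)"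
    and cong: "\<And>f g :: 'a::real_normed_vector \<Rightarrow> 'b::real_normed_vector.
       (\<And>x. x \<in> S \<Longrightarrow> f x = g x) \<Longrightarrow> Ck k S f \<Longrightarrow> Ck k S g"
  shows "Ck (Suc k) S (f :: 'a \<Rightarrow> 'b)"
proof -
  have "Ck k S (\<lambda>x. D f x v)" for v
    by (rule cong[OF _ assms(3)[of v]]) (simp add: D_eqI[OF assms(2)])
  then show ?thesis using assms(2) by (auto simp: differentiable_def)
qed

text \<open>At order \<open>k + 1\<close> the derivatives at each point enter, and these depend on a
  neighbourhood; hence \<open>S\<close> is open.\<close>

lemma Ck_cong:
  assumes "open S"
  shows "(\<And>x. x \<in> S \<Longrightarrow> f x = g x) \<Longrightarrow> Ck k S f \<Longrightarrow> Ck k S g"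
proof (induction k arbitrary: f g)
  case 0 then show ?case by (metis Ck.simps(1) continuous_on_cong)
next
  case (Suc k)
  have "(g has_derivative D f x) (at x)" if x: "x \<in> S" for x
    using has_derivative_transform_within_open[OF has_derivative_D assms x, of f g] Suc.prems x
    by auto
  moreover have "Ck k S (\<lambda>x. D f x v)" for v using Suc.prems by simp
  ultimately show ?case by (intro Ck_SucI[OF assms, where f' = "D f"]) (use Suc.IH in blast)+
qed

lemma Ck_SucI':
  assumes "open S" "\<And>x. x \<in> S \<Longrightarrow> (f has_derivative f' x) (at x)" "\<And>v. Ck k S (\<lambda>x. f' x v)"
  shows "Ck (Suc k) S f"
  by (rule Ck_SucI[OF assms(1,2,3)]) (use Ck_cong[OF assms(1)] in blast)+

lemma Ck_subset: "Ck k S f \<Longrightarrow> T \<subseteq> S \<Longrightarrow> Ck k T f"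
  by (induction k arbitrary: f) (auto intro: continuous_on_subset)

lemma Ck_Suc_has_derivative: "Ck (Suc k) S f \<Longrightarrow> x \<in> S \<Longrightarrow> (f has_derivative D f x) (at x)"
  by (simp add: has_derivative_D)

lemma Ck_SucD: "Ck (Suc k) S f \<Longrightarrow> Ck k S f"
proof (induction k arbitrary: f)
  case 0 then show ?case
    by (auto intro!: differentiable_imp_continuous_on differentiable_at_imp_differentiable_on)
next
  case (Suc k) then show ?case by (metis Ck.simps(2))
qed

lemma Ck_local:
  "(\<And>x. x \<in> S \<Longrightarrow> \<exists>U. open U \<and> x \<in> U \<and> Ck k U f) \<Longrightarrow> Ck k S f"
proof (induction k arbitrary: f)
  case 0
  then show ?case
    by (simp, metis continuous_at_imp_continuous_on continuous_on_eq_continuous_at)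
next
  case (Suc k)
  have "f differentiable (at x)" if "x \<in> S" for x using Suc.prems[OF that] by auto
  moreover have "Ck k S (\<lambda>x. D f x v)" for v
    by (rule Suc.IH) (use Suc.prems in fastforce)
  ultimately show ?case by simp
qed

lemma Ck_const: "Ck k S (\<lambda>x. c)"
  by (induction k arbitrary: c) auto

lemma Ck_bounded_linear: assumes "bounded_linear L" shows "Ck k S L"
proof (cases k)
  case 0 then show ?thesis using assms by (simp add: linear_continuous_on)
next
  case (Suc n)
  have "D L x = L" for x by (intro D_eqI bounded_linear.has_derivative[OF assms has_derivative_ident])
  then show ?thesis using Suc assms Ck_const
    by (auto simp: bounded_linear_imp_differentiable)
qed

lemma Ck_add: "open S \<Longrightarrow> Ck k S f \<Longrightarrow> Ck k S g \<Longrightarrow> Ck k S (\<lambda>x. f x + g x)"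
proof (induction k arbitrary: f g)
  case 0 then show ?case by (auto intro: continuous_intros)
next
  case (Suc k)
  then show ?case
    by (intro Ck_SucI'[where f' = "\<lambda>x v. D f x v + D g x v"])
       (auto intro!: has_derivative_add has_derivative_D)
qed

lemma Ck_bounded_bilinear:
  assumes "bounded_bilinear q" "open S"
  shows "Ck k S f \<Longrightarrow> Ck k S g \<Longrightarrow> Ck k S (\<lambda>x. q (f x) (g x))"
proof (induction k arbitrary: f g)
  case 0 then show ?case by (auto intro: bounded_bilinear.continuous_on[OF assms(1)])
next
  case (Suc k)
  note S = Ck_SucD[OF Suc.prems(1)] Ck_SucD[OF Suc.prems(2)]
  show ?case
    using Suc.prems S
    by (intro Ck_SucI'[where f' = "\<lambda>x v. q (f x) (D g x v) + q (D f x v) (g x)"] assms Ck_add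
        bounded_bilinear.FDERIV[OF assms(1)] Ck_Suc_has_derivative Suc.IH) auto
qed

lemma Ck_bounded_linear_comp:
  assumes "bounded_linear L" "open S"
  shows "Ck k S f \<Longrightarrow> Ck k S (\<lambda>x. L (f x))"
proof (induction k arbitrary: f)
  case 0 then show ?case by (auto intro: bounded_linear.continuous_on[OF assms(1)])
next
  case (Suc k)
  then show ?case
    by (intro Ck_SucI'[where f' = "\<lambda>x v. L (D f x v)"] assms
        bounded_linear.has_derivative[OF assms(1)] Ck_Suc_has_derivative) auto
qed

lemma Ck_Pair: "open S \<Longrightarrow> Ck k S f \<Longrightarrow> Ck k S g \<Longrightarrow> Ck k S (\<lambda>x. (f x, g x))"
proof (induction k arbitrary: f g)
  case 0 then show ?case by (auto intro: continuous_intros)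
next
  case (Suc k)
  then show ?case
    by (intro Ck_SucI'[where f' = "\<lambda>x v. (D f x v, D g x v)"] has_derivative_Pair
        Ck_Suc_has_derivative) auto
qed

lemma Ck_sum: "open S \<Longrightarrow> (\<And>i. i \<in> I \<Longrightarrow> Ck k S (f i)) \<Longrightarrow> Ck k S (\<lambda>x. \<Sum>i\<in>I. f i x)"
  by (induction I rule: infinite_finite_induct) (auto simp: Ck_const intro: Ck_add)

text \<open>\<open>Ck\<close> controls the derivative of \<open>g\<close> in each fixed direction, while
  the chain rule applies it to the moving direction \<open>D f x v\<close>. Expanding the latter in the
  orthonormal basis reduces the moving direction to fixed ones.\<close>

lemma Ck_compose:
  fixes f :: "'a::real_normed_vector \<Rightarrow> 'b::fin_dim_inner" and g :: "'b \<Rightarrow> 'c::real_normed_vector"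
  assumes "open S" "open T"
  shows "Ck k T g \<Longrightarrow> Ck k S f \<Longrightarrow> f ` S \<subseteq> T \<Longrightarrow> Ck k S (\<lambda>x. g (f x))"
proof (induction k arbitrary: g)
  case 0 then show ?case using continuous_on_compose2 by fastforce
next
  case (Suc k)
  have D: "D g y w = (\<Sum>b\<in>onb. inner w b *\<^sub>R D g y b)" if "y \<in> T" for y w
    using Suc.prems that by (intro linear_onb_expansion linear_frechet_derivative) simp
  have f: "Ck k S f" "\<And>v. Ck k S (\<lambda>x. D f x v)" using Ck_SucD[OF Suc.prems(2)] Suc.prems by auto
  show ?case
  proof (rule Ck_SucI'[OF \<open>open S\<close>, where f' = "\<lambda>x v. D g (f x) (D f x v)"])
    show "((\<lambda>x. g (f x)) has_derivative (\<lambda>v. D g (f x) (D f x v))) (at x)" if "x \<in> S" for x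
      using Suc.prems that
      by (intro has_derivative_compose[of f _ _ _ g] Ck_Suc_has_derivative[of k _ f]
          Ck_Suc_has_derivative[of k _ g]) auto
    show "Ck k S (\<lambda>x. D g (f x) (D f x v))" for v
    proof (rule Ck_cong[OF \<open>open S\<close>])
      show "Ck k S (\<lambda>x. \<Sum>b\<in>onb. inner (D f x v) b *\<^sub>R D g (f x) b)"
        using Suc.prems f
        by (intro Ck_sum Ck_bounded_bilinear[OF bounded_bilinear_scaleR]
            Ck_bounded_linear_comp[OF bounded_linear_inner_left] Suc.IH assms) auto
    qed (use D Suc.prems in auto)
  qed
qed

lemma Ck_inverse: "Ck k (- {0::real}) inverse"
proof (induction k)
  case 0 then show ?case by (auto intro: continuous_intros)
next
  case (Suc k)
  show ?case
  proof (rule Ck_SucI'[where f' = "\<lambda>x v. - (inverse x * v * inverse x)"])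
    show "(inverse has_derivative (\<lambda>v. - (inverse x * v * inverse x))) (at x)"
      if "x \<in> - {0}" for x :: real
      using that by (auto intro!: derivative_eq_intros)
    show "Ck k (- {0}) (\<lambda>x::real. - (inverse x * v * inverse x))" for v
      by (intro Ck_bounded_linear_comp[OF bounded_linear_minus[OF bounded_linear_ident]]
          Ck_bounded_bilinear[OF bounded_bilinear_mult] Suc Ck_const) auto
  qed auto
qed

subsection \<open>Germs of smooth functions\<close>

text \<open>Germs compose without any bookkeeping of domains, which is why smoothness is handled
  pointwise from here on.\<close>

definition smooth_near :: "('a::real_normed_vector \<Rightarrow> 'b::real_normed_vector) \<Rightarrow> 'a \<Rightarrow> bool" where
  "smooth_near f x \<longleftrightarrow> (\<exists>S. open S \<and> x \<in> S \<and> smooth_on S f)"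

lemma smooth_on_iff_near: "open S \<Longrightarrow> smooth_on S f \<longleftrightarrow> (\<forall>x\<in>S. smooth_near f x)"
  unfolding smooth_near_def smooth_on_def by (metis Ck_local)

lemma smooth_near_eventually: "smooth_near f x \<Longrightarrow> eventually (smooth_near f) (nhds x)"
  unfolding smooth_near_def eventually_nhds by blast

lemma smooth_near_cong:
  assumes "smooth_near f x" "eventually (\<lambda>y. f y = g y) (nhds x)" shows "smooth_near g x"
proof -
  obtain S where S: "open S" "x \<in> S" "smooth_on S f" using assms by (auto simp: smooth_near_def)
  obtain T where T: "open T" "x \<in> T" "\<And>y. y \<in> T \<Longrightarrow> f y = g y"
    using assms by (auto simp: eventually_nhds)
  have "Ck k (S \<inter> T) g" for k
    by (rule Ck_cong[where f = f]) (use S T in \<open>auto simp: smooth_on_def intro: Ck_subset\<close>)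
  then show ?thesis unfolding smooth_near_def smooth_on_def using S T by blast
qed

lemma smooth_near_differentiable: "smooth_near f x \<Longrightarrow> f differentiable (at x)"
  unfolding smooth_near_def smooth_on_def using Ck.simps(2) by blast

lemma smooth_near_has_derivative: "smooth_near f x \<Longrightarrow> (f has_derivative D f x) (at x)"
  by (simp add: has_derivative_D smooth_near_differentiable)

lemma smooth_near_isCont: "smooth_near f x \<Longrightarrow> isCont f x"
  by (simp add: differentiable_imp_continuous_within smooth_near_differentiable)

lemma linear_D: "smooth_near f x \<Longrightarrow> linear (D f x)"
  by (simp add: linear_frechet_derivative smooth_near_differentiable)

lemma smooth_near_D: "smooth_near f x \<Longrightarrow> smooth_near (\<lambda>y. D f y v) x"
  unfolding smooth_near_def smooth_on_def using Ck.simps(2) by blast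

lemma smooth_near_binop:
  assumes "smooth_near f x" "smooth_near g x"
    "\<And>k S. open S \<Longrightarrow> Ck k S f \<Longrightarrow> Ck k S g \<Longrightarrow> Ck k S h"
  shows "smooth_near h x"
proof -
  obtain S where S: "open S" "x \<in> S" "smooth_on S f" using assms by (auto simp: smooth_near_def)
  obtain T where T: "open T" "x \<in> T" "smooth_on T g" using assms by (auto simp: smooth_near_def)
  have "Ck k (S \<inter> T) h" for k
    by (rule assms(3)) (use S T in \<open>auto simp: smooth_on_def intro: Ck_subset\<close>)
  then show ?thesis unfolding smooth_near_def smooth_on_def using S T by blast
qed

lemma smooth_near_const [simp, intro]: "smooth_near (\<lambda>x. c) x"
  unfolding smooth_near_def smooth_on_def using Ck_const by blast

lemma smooth_near_bounded_linear: "bounded_linear L \<Longrightarrow> smooth_near L x"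
  unfolding smooth_near_def smooth_on_def using Ck_bounded_linear by blast

lemma smooth_near_ident [simp, intro]: "smooth_near (\<lambda>x. x) x"
  by (rule smooth_near_bounded_linear[OF bounded_linear_ident])

lemma smooth_near_fst [simp, intro]: "smooth_near fst x"
  by (rule smooth_near_bounded_linear[OF bounded_linear_fst])

lemma smooth_near_snd [simp, intro]: "smooth_near snd x"
  by (rule smooth_near_bounded_linear[OF bounded_linear_snd])

lemma smooth_near_linear: "linear (L::'a::fin_dim_inner \<Rightarrow> _) \<Longrightarrow> smooth_near L x"
  by (rule smooth_near_bounded_linear[OF linear_imp_bounded_linear])

lemma smooth_near_add: "smooth_near f x \<Longrightarrow> smooth_near g x \<Longrightarrow> smooth_near (\<lambda>x. f x + g x) x"
  by (erule (1) smooth_near_binop) (auto intro: Ck_add)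

lemma smooth_near_bilinear:
  "bounded_bilinear q \<Longrightarrow> smooth_near f x \<Longrightarrow> smooth_near g x \<Longrightarrow> smooth_near (\<lambda>x. q (f x) (g x)) x"
  by (erule (1) smooth_near_binop) (auto intro: Ck_bounded_bilinear)

lemma smooth_near_linear_comp: "bounded_linear L \<Longrightarrow> smooth_near f x \<Longrightarrow> smooth_near (\<lambda>x. L (f x)) x"
  by (rule smooth_near_binop[of f x f]) (auto intro: Ck_bounded_linear_comp)

lemma smooth_near_Pair: "smooth_near f x \<Longrightarrow> smooth_near g x \<Longrightarrow> smooth_near (\<lambda>x. (f x, g x)) x"
  by (erule (1) smooth_near_binop) (auto intro: Ck_Pair)

lemma smooth_near_sum:
  "(\<And>i. i \<in> I \<Longrightarrow> smooth_near (f i) x) \<Longrightarrow> smooth_near (\<lambda>x. \<Sum>i\<in>I. f i x) x"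
  by (induction I rule: infinite_finite_induct) (auto intro: smooth_near_add)

lemma smooth_near_compose:
  fixes f :: "'a::real_normed_vector \<Rightarrow> 'b::fin_dim_inner"
  assumes f: "smooth_near f x" and g: "smooth_near g (f x)"
  shows "smooth_near (\<lambda>x. g (f x)) x"
proof -
  obtain S where S: "open S" "x \<in> S" "smooth_on S f" using f by (auto simp: smooth_near_def)
  obtain T where T: "open T" "f x \<in> T" "smooth_on T g" using g by (auto simp: smooth_near_def)
  have "continuous_on S f" using S(3) unfolding smooth_on_def by (metis Ck.simps(1))
  then have o: "open (S \<inter> f -` T)" using S(1) T(1) by (simp add: continuous_on_open_vimage Int_commute)
  have "Ck k (S \<inter> f -` T) (\<lambda>x. g (f x))" for k
    by (rule Ck_compose[OF o T(1)]) (use S T in \<open>auto simp: smooth_on_def intro: Ck_subset\<close>)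
  then show ?thesis unfolding smooth_near_def smooth_on_def using o S T by blast
qed

lemma smooth_near_inverse: "smooth_near f x \<Longrightarrow> f x \<noteq> (0::real) \<Longrightarrow> smooth_near (\<lambda>x. inverse (f x)) x"
  by (rule smooth_near_compose) (auto simp: smooth_near_def smooth_on_def intro: exI[of _ "- {0}"] Ck_inverse)

lemma D_compose:
  "smooth_near f x \<Longrightarrow> smooth_near g (f x) \<Longrightarrow> D (\<lambda>x. g (f x)) x v = D g (f x) (D f x v)"
  using frechet_derivative_compose[of f x g, OF smooth_near_differentiable smooth_near_differentiable]
  by (simp add: o_def)

lemma D_Pair: "smooth_near f x \<Longrightarrow> smooth_near g x \<Longrightarrow> D (\<lambda>x. (f x, g x)) x v = (D f x v, D g x v)"
  by (subst D_eqI[OF has_derivative_Pair]) (auto intro: smooth_near_has_derivative)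

lemma D_bounded_linear: "bounded_linear L \<Longrightarrow> D L x = L"
  by (intro D_eqI bounded_linear.has_derivative[OF _ has_derivative_ident])

lemma D_bilinear:
  "bounded_bilinear q \<Longrightarrow> smooth_near f x \<Longrightarrow> smooth_near g x \<Longrightarrow>
   D (\<lambda>x. q (f x) (g x)) x v = q (f x) (D g x v) + q (D f x v) (g x)"
  by (subst D_eqI[OF bounded_bilinear.FDERIV]) (auto intro: smooth_near_has_derivative)

lemma D_add: "smooth_near f x \<Longrightarrow> smooth_near g x \<Longrightarrow> D (\<lambda>x. f x + g x) x v = D f x v + D g x v"
  by (subst D_eqI[OF has_derivative_add]) (auto intro: smooth_near_has_derivative)

lemma isCont_eventually:
  "isCont f x \<Longrightarrow> eventually P (nhds (f x)) \<Longrightarrow> eventually (\<lambda>y. P (f y)) (nhds x)"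
  using eventually_compose_filterlim[of P "nhds (f x)" f "nhds x"]
  by (simp add: continuous_at tendsto_at_iff_tendsto_nhds)

text \<open>A derivative taken at a moving point in a moving direction; the direction is expanded in the
  orthonormal basis as in \<open>Ck_compose\<close>.\<close>

lemma smooth_near_D_apply:
  fixes f :: "'a::fin_dim_inner \<Rightarrow> 'b::real_normed_vector" and p :: "'c::real_normed_vector \<Rightarrow> 'a"
  assumes f: "smooth_near f (p x)" and p: "smooth_near p x" and V: "smooth_near V x"
  shows "smooth_near (\<lambda>y. D f (p y) (V y)) x"
proof (rule smooth_near_cong)
  show "smooth_near (\<lambda>y. \<Sum>b\<in>onb. inner (V y) b *\<^sub>R D f (p y) b) x"
    by (intro smooth_near_sum smooth_near_bilinear[OF bounded_bilinear_scaleR]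
        smooth_near_linear_comp[OF bounded_linear_inner_left] V
        smooth_near_compose[OF p] smooth_near_D f)
  have "eventually (\<lambda>y. smooth_near f (p y)) (nhds x)"
    by (rule isCont_eventually[OF smooth_near_isCont[OF p] smooth_near_eventually[OF f]])
  then show "eventually (\<lambda>y. (\<Sum>b\<in>onb. inner (V y) b *\<^sub>R D f (p y) b) = D f (p y) (V y)) (nhds x)"
    by eventually_elim (metis linear_onb_expansion linear_D)
qed

subsection \<open>Second derivatives\<close>

definition D2 :: "('a::real_normed_vector \<Rightarrow> 'b::real_normed_vector) \<Rightarrow> 'a \<Rightarrow> 'a \<Rightarrow> 'a \<Rightarrow> 'b" where
  "D2 f x u v = D (\<lambda>y. D f y v) x u"

lemma D2_cong_ev:
  assumes "eventually (\<lambda>y. f y = g y) (nhds x)" shows "D2 f x = D2 g x"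
proof -
  have "eventually (\<lambda>y. eventually (\<lambda>z. f z = g z) (nhds y)) (nhds x)"
    using assms by (simp add: eventually_eventually)
  then have "eventually (\<lambda>y. D f y = D g y) (nhds x)"
    by eventually_elim (rule D_cong_ev)
  then have "eventually (\<lambda>y. D f y v = D g y v) (nhds x)" for v by eventually_elim simp
  then show ?thesis unfolding D2_def by (intro ext) (metis D_cong_ev)
qed

lemma D2_linear_left: "smooth_near f x \<Longrightarrow> linear (\<lambda>u. D2 f x u v)"
  unfolding D2_def by (intro linear_D smooth_near_D)

lemma D2_linear_right:
  assumes f: "smooth_near f x" shows "linear (D2 f x u)"
proof (rule linearI)
  have ev: "eventually (\<lambda>y. linear (D f y)) (nhds x)"
    using smooth_near_eventually[OF f] by eventually_elim (rule linear_D)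
  fix v w :: 'a and r :: real
  have "D2 f x u (v + w) = D (\<lambda>y. D f y v + D f y w) x u" unfolding D2_def
    by (rule fun_cong[OF D_cong_ev]) (use ev in eventually_elim, simp add: linear_add)
  then show "D2 f x u (v + w) = D2 f x u v + D2 f x u w"
    unfolding D2_def using f by (simp add: D_add smooth_near_D)
  have "D2 f x u (r *\<^sub>R v) = D (\<lambda>y. r *\<^sub>R D f y v) x u" unfolding D2_def
    by (rule fun_cong[OF D_cong_ev]) (use ev in eventually_elim, simp add: linear_cmul)
  also have "\<dots> = r *\<^sub>R D (\<lambda>y. D f y v) x u"
    by (subst D_compose[where g = "\<lambda>z. r *\<^sub>R z"])
       (auto simp: f smooth_near_D smooth_near_bounded_linear bounded_linear_scaleR_right D_bounded_linear)
  finally show "D2 f x u (r *\<^sub>R v) = r *\<^sub>R D2 f x u v" unfolding D2_def .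
qed

lemma D_D_apply:
  fixes g :: "'b::fin_dim_inner \<Rightarrow> 'c::real_normed_vector" and p V :: "'a::real_normed_vector \<Rightarrow> 'b"
  assumes p: "smooth_near p x" and g: "smooth_near g (p x)" and V: "smooth_near V x"
  shows "D (\<lambda>y. D g (p y) (V y)) x u = D2 g (p x) (D p x u) (V x) + D g (p x) (D V x u)"
proof -
  have ev: "eventually (\<lambda>y. smooth_near g (p y)) (nhds x)"
    by (rule isCont_eventually[OF smooth_near_isCont[OF p] smooth_near_eventually[OF g]])
  have "D (\<lambda>y. D g (p y) (V y)) x u = D (\<lambda>y. \<Sum>b\<in>onb. inner (V y) b *\<^sub>R D g (p y) b) x u"
    by (rule fun_cong[OF D_cong_ev]) (use ev in eventually_elim, metis linear_onb_expansion linear_D)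
  also have "\<dots> = (\<Sum>b\<in>onb. inner (V x) b *\<^sub>R D (\<lambda>z. D g z b) (p x) (D p x u)
                     + inner (D V x u) b *\<^sub>R D g (p x) b)"
  proof -
    have s: "smooth_near (\<lambda>y. inner (V y) b) x" "smooth_near (\<lambda>y. D g (p y) b) x" for b
      by (intro smooth_near_linear_comp[OF bounded_linear_inner_left] V
        smooth_near_compose[OF p] smooth_near_D g)+
    have 1: "D (\<lambda>y. inner (V y) b *\<^sub>R D g (p y) b) x u =
      inner (V x) b *\<^sub>R D (\<lambda>z. D g z b) (p x) (D p x u) + inner (D V x u) b *\<^sub>R D g (p x) b" for b
      by (subst D_bilinear[OF bounded_bilinear_scaleR s])
         (simp add: D_compose[OF p smooth_near_D[OF g]]
          D_compose[where g="\<lambda>z. inner z b", OF V smooth_near_bounded_linear[OF bounded_linear_inner_left]]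
          D_bounded_linear[OF bounded_linear_inner_left])
    have "((\<lambda>y. \<Sum>b\<in>onb. inner (V y) b *\<^sub>R D g (p y) b) has_derivative
        (\<lambda>u. \<Sum>b\<in>onb. D (\<lambda>y. inner (V y) b *\<^sub>R D g (p y) b) x u)) (at x)"
      by (intro has_derivative_sum smooth_near_has_derivative
          smooth_near_bilinear[OF bounded_bilinear_scaleR] s)
    from D_eqI[OF this] show ?thesis by (simp add: 1)
  qed
  also have "\<dots> = D2 g (p x) (D p x u) (\<Sum>b\<in>onb. inner (V x) b *\<^sub>R b)
      + D g (p x) (\<Sum>b\<in>onb. inner (D V x u) b *\<^sub>R b)"
    by (simp add: sum.distrib D2_def[of g, symmetric] linear_sum[OF D2_linear_right[OF g]] linear_sum[OF linear_D[OF g]]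
       linear_cmul[OF D2_linear_right[OF g]] linear_cmul[OF linear_D[OF g]])
  finally show ?thesis by (simp add: onb_expansion)
qed

text \<open>The second-order chain rule. Applied to identities between products and inverses, it yields
  all facts on the Lie bracket below.\<close>

lemma D2_compose:
  fixes f :: "'a::real_normed_vector \<Rightarrow> 'b::fin_dim_inner"
  assumes f: "smooth_near f x" and g: "smooth_near g (f x)"
  shows "D2 (\<lambda>x. g (f x)) x u v = D2 g (f x) (D f x u) (D f x v) + D g (f x) (D2 f x u v)"
proof -
  have ev: "eventually (\<lambda>y. smooth_near f y \<and> smooth_near g (f y)) (nhds x)"
    using smooth_near_eventually[OF f]
      isCont_eventually[OF smooth_near_isCont[OF f] smooth_near_eventually[OF g]]
    by (rule eventually_conj)
  have "D2 (\<lambda>x. g (f x)) x u v = D (\<lambda>y. D g (f y) (D f y v)) x u" unfolding D2_def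
    by (rule fun_cong[OF D_cong_ev]) (use ev in eventually_elim, simp add: D_compose)
  then show ?thesis
    using D_D_apply[OF f g smooth_near_D[OF f]] by (simp add: D2_def)
qed

lemma D2_bounded_linear: "bounded_linear L \<Longrightarrow> D2 L x u v = 0"
  by (simp add: D2_def D_bounded_linear)

lemma D2_const [simp]: "D2 (\<lambda>x. c) x u v = 0"
  by (simp add: D2_def)

lemma D2_Pair:
  assumes f: "smooth_near f x" and g: "smooth_near g x"
  shows "D2 (\<lambda>x. (f x, g x)) x u v = (D2 f x u v, D2 g x u v)"
proof -
  have "D2 (\<lambda>x. (f x, g x)) x u v = D (\<lambda>y. (D f y v, D g y v)) x u" unfolding D2_def
    by (rule fun_cong[OF D_cong_ev])
       (use smooth_near_eventually[OF f] smooth_near_eventually[OF g] in eventually_elim, simp add: D_Pair)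
  then show ?thesis by (simp add: D_Pair smooth_near_D f g D2_def)
qed

text \<open>The mean value theorem is applied first along \<open>u\<close> and then along
  \<open>v\<close>. As the second difference does not change when \<open>u\<close> and \<open>v\<close>
  are exchanged, the second derivative is symmetric in the limit \<open>h \<rightarrow>
  0\<close>.\<close>

lemma second_difference:
  fixes f :: "'a::real_normed_vector \<Rightarrow> real"
  assumes S: "\<And>s t. 0 \<le> s \<Longrightarrow> s \<le> h \<Longrightarrow> 0 \<le> t \<Longrightarrow> t \<le> h \<Longrightarrow> smooth_near f (x + s *\<^sub>R u + t *\<^sub>R v)"
    and h: "h > 0"
  obtains s t where "0 < s" "s < h" "0 < t" "t < h"
    "f (x + h *\<^sub>R u + h *\<^sub>R v) - f (x + h *\<^sub>R u) - f (x + h *\<^sub>R v) + f x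
       = h * h * D2 f (x + s *\<^sub>R u + t *\<^sub>R v) v u"
proof -
  let ?p = "\<lambda>s t. x + s *\<^sub>R u + t *\<^sub>R v"
  have d1: "((\<lambda>s. f (?p s t)) has_real_derivative D f (?p s t) u) (at s)"
    if "0 \<le> s" "s \<le> h" "0 \<le> t" "t \<le> h" for s t
  proof -
    have 1: "((\<lambda>s. ?p s t) has_derivative (\<lambda>r. r *\<^sub>R u)) (at s)" by (auto intro!: derivative_eq_intros)
    note sm = smooth_near_has_derivative[OF S[OF that]]
    from has_derivative_compose[OF 1 sm]
    have "((\<lambda>s. f (?p s t)) has_derivative (\<lambda>r. D f (?p s t) (r *\<^sub>R u))) (at s)" .
    then show ?thesis unfolding has_field_derivative_def
      by (rule has_derivative_eq_rhs) (simp add: fun_eq_iff linear_cmul[OF linear_D[OF S[OF that]]])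
  qed
  have d2: "((\<lambda>t. D f (?p s t) u) has_real_derivative D2 f (?p s t) v u) (at t)"
    if "0 \<le> s" "s \<le> h" "0 \<le> t" "t \<le> h" for s t
  proof -
    have 1: "((\<lambda>t. ?p s t) has_derivative (\<lambda>r. r *\<^sub>R v)) (at t)" by (auto intro!: derivative_eq_intros)
    note sm = smooth_near_has_derivative[OF smooth_near_D[OF S[OF that]]]
    from has_derivative_compose[OF 1 sm]
    have "((\<lambda>t. D f (?p s t) u) has_derivative (\<lambda>r. D2 f (?p s t) (r *\<^sub>R v) u)) (at t)"
      unfolding D2_def .
    then show ?thesis unfolding has_field_derivative_def
      by (rule has_derivative_eq_rhs) (simp add: fun_eq_iff linear_cmul[OF D2_linear_left[OF S[OF that]]])
  qed
  obtain s where s: "0 < s" "s < h"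
    "(f (?p h h) - f (?p h 0)) - (f (?p 0 h) - f (?p 0 0)) = (h - 0) * (D f (?p s h) u - D f (?p s 0) u)"
    using MVT2[of 0 h "\<lambda>s. f (?p s h) - f (?p s 0)" "\<lambda>s. D f (?p s h) u - D f (?p s 0) u"] h
    by (fastforce intro!: derivative_intros d1)
  obtain t where t: "0 < t" "t < h" "D f (?p s h) u - D f (?p s 0) u = (h - 0) * D2 f (?p s t) v u"
    using MVT2[of 0 h "\<lambda>t. D f (?p s t) u" "\<lambda>t. D2 f (?p s t) v u"] h s d2 by fastforce
  show thesis by (rule that[OF s(1,2) t(1,2)]) (use s(3) t(3) in simp)
qed

lemma D2_symmetric_real:
  fixes f :: "'a::real_normed_vector \<Rightarrow> real"
  assumes f: "smooth_near f x"
  shows "D2 f x u v = D2 f x v u"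
proof (rule ccontr)
  assume ne: "D2 f x u v \<noteq> D2 f x v u"
  define e where "e = \<bar>D2 f x u v - D2 f x v u\<bar> / 2"
  have e: "e > 0" using ne by (simp add: e_def)
  obtain S where S: "open S" "x \<in> S" "\<And>y. y \<in> S \<Longrightarrow> smooth_near f y"
    using smooth_near_eventually[OF f] by (auto simp: eventually_nhds)
  obtain r0 where r0: "r0 > 0" "\<And>y. dist y x < r0 \<Longrightarrow> y \<in> S"
    using S(1,2) open_dist by blast
  have c: "isCont (\<lambda>y. D2 f y a b) x" for a b
    unfolding D2_def by (intro smooth_near_isCont smooth_near_D f)
  obtain r1 where r1: "r1 > 0" "\<And>y. dist y x < r1 \<Longrightarrow> \<bar>D2 f y u v - D2 f x u v\<bar> < e"
    using c[of u v] e unfolding continuous_at dist_real_def[symmetric]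
    by (metis continuous_at_eps_delta dist_real_def c)
  obtain r2 where r2: "r2 > 0" "\<And>y. dist y x < r2 \<Longrightarrow> \<bar>D2 f y v u - D2 f x v u\<bar> < e"
    using c[of v u] e by (metis continuous_at_eps_delta dist_real_def)
  define r where "r = min r0 (min r1 r2)"
  have r: "r > 0" using r0 r1 r2 by (simp add: r_def)
  \<comment> \<open>With this \<open>h\<close> the parallelogram lies in the ball of radius
    \<open>r\<close>; the summand 1 covers \<open>u = v = 0\<close>.\<close>
  define h where "h = r / (2 * (norm u + norm v + 1))"
  have n: "norm u + norm v + 1 > 0" by (smt (verit) norm_ge_zero)
  have h: "h > 0" using r n by (simp add: h_def)
  have near: "dist (x + s *\<^sub>R u + t *\<^sub>R v) x < r" if "0 \<le> s" "s \<le> h" "0 \<le> t" "t \<le> h" for s t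
  proof -
    have "dist (x + s *\<^sub>R u + t *\<^sub>R v) x = norm (s *\<^sub>R u + t *\<^sub>R v)" by (simp add: dist_norm algebra_simps)
    also have "\<dots> \<le> s * norm u + t * norm v" using that by (metis abs_of_nonneg norm_scaleR norm_triangle_ineq)
    also have "\<dots> \<le> h * norm u + h * norm v" using that by (intro add_mono mult_right_mono) auto
    also have "\<dots> \<le> h * (norm u + norm v + 1)" using h by (simp add: algebra_simps)
    also have "\<dots> = r / 2" 
    proof -
      have "r / (2 * N) * N = r / 2" if "N > 0" for N :: real using that by (simp add: field_simps)
      then show ?thesis unfolding h_def using n by blast
    qed
    also have "\<dots> < r" using r by simp
    finally show ?thesis .
  qed
  have sm: "smooth_near f (x + s *\<^sub>R u + t *\<^sub>R v)" if "0 \<le> s" "s \<le> h" "0 \<le> t" "t \<le> h" for s t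
    using near[OF that] r0(2) S(3) by (simp add: r_def)
  have sm': "smooth_near f (x + s *\<^sub>R v + t *\<^sub>R u)" if "0 \<le> s" "s \<le> h" "0 \<le> t" "t \<le> h" for s t
    using sm[of t s] that by (simp add: algebra_simps)
  obtain s t where st: "0 < s" "s < h" "0 < t" "t < h"
    "f (x + h *\<^sub>R u + h *\<^sub>R v) - f (x + h *\<^sub>R u) - f (x + h *\<^sub>R v) + f x
       = h * h * D2 f (x + s *\<^sub>R u + t *\<^sub>R v) v u"
    using second_difference[of h f x u v, OF sm h] by blast
  obtain s' t' where st': "0 < s'" "s' < h" "0 < t'" "t' < h"
    "f (x + h *\<^sub>R v + h *\<^sub>R u) - f (x + h *\<^sub>R v) - f (x + h *\<^sub>R u) + f x
       = h * h * D2 f (x + s' *\<^sub>R v + t' *\<^sub>R u) u v"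
    using second_difference[of h f x v u, OF sm' h] by blast
  have "h * h * D2 f (x + s *\<^sub>R u + t *\<^sub>R v) v u = h * h * D2 f (x + s' *\<^sub>R v + t' *\<^sub>R u) u v"
    using st(5) st'(5) by (simp add: algebra_simps)
  then have eq: "D2 f (x + s *\<^sub>R u + t *\<^sub>R v) v u = D2 f (x + s' *\<^sub>R v + t' *\<^sub>R u) u v"
    using h by simp
  have "\<bar>D2 f (x + s *\<^sub>R u + t *\<^sub>R v) v u - D2 f x v u\<bar> < e"
    using near[of s t] st r2(2) by (simp add: r_def)
  moreover have "\<bar>D2 f (x + s' *\<^sub>R v + t' *\<^sub>R u) u v - D2 f x u v\<bar> < e"
    using near[of t' s'] st' r1(2) by (simp add: r_def algebra_simps)
  moreover have "\<bar>D2 f x u v - D2 f x v u\<bar> \<le> \<bar>c - D2 f x v u\<bar> + \<bar>c - D2 f x u v\<bar>" for c by linarith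
  ultimately show False using eq by (simp add: e_def) (smt (verit))
qed

lemma D2_symmetric:
  fixes f :: "'a::real_normed_vector \<Rightarrow> 'b::fin_dim_inner"
  assumes f: "smooth_near f x"
  shows "D2 f x u v = D2 f x v u"
proof -
  have "inner (D2 f x u v) w = D2 (\<lambda>x. inner (f x) w) x u v" for u v w
    by (subst D2_compose[OF f smooth_near_bounded_linear[OF bounded_linear_inner_left]])
       (simp add: D2_bounded_linear D_bounded_linear bounded_linear_inner_left)
  moreover have "smooth_near (\<lambda>x. inner (f x) w) x" for w
    by (rule smooth_near_linear_comp[OF bounded_linear_inner_left f])
  ultimately have "inner (D2 f x u v) w = inner (D2 f x v u) w" for w
    by (simp add: D2_symmetric_real[of _ x u v])
  then show ?thesis using vector_eq_rdot by blast
qed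

section \<open>Smooth maps between manifolds\<close>

text \<open>The conditions of \<open>smooth_manifold\<close>, stated for an arbitrary topological space:
  a model space, whose class does not include second countability, is then a manifold as well, and maps
  into it are covered by the same lemmas.\<close>

definition smooth_atlas :: "('m::topological_space, 'e::fin_dim_inner) manifold \<Rightarrow> bool" where
  "smooth_atlas M \<longleftrightarrow>
     (\<forall>c\<in>atlas M. open (fst c) \<and> open (snd c ` fst c) \<and>
        homeomorphism (fst c) (snd c ` fst c) (snd c) (chart_inv c)) \<and>
     (\<forall>c\<in>atlas M. \<forall>d\<in>atlas M. smooth_on (snd c ` (fst c \<inter> fst d)) (snd d \<circ> chart_inv c)) \<and>
     (\<forall>x. chart_at M x \<in> atlas M \<and> x \<in> fst (chart_at M x))"

lemma smooth_manifold_atlas: "smooth_manifold M \<longleftrightarrow> smooth_atlas M"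
  by (simp add: smooth_manifold_def smooth_atlas_def)

subsection \<open>Charts\<close>

lemma chart_at [simp]: "smooth_atlas M \<Longrightarrow> chart_at M x \<in> atlas M"
  "smooth_atlas M \<Longrightarrow> x \<in> fst (chart_at M x)"
  by (auto simp: smooth_atlas_def)

lemma filterlim_nhds_iff_continuous_on:
  "open S \<Longrightarrow> continuous_on S f \<longleftrightarrow> (\<forall>x\<in>S. filterlim f (nhds (f x)) (nhds x))"
  unfolding continuous_on_def
  by (metis at_within_open_NO_MATCH at_within_open tendsto_at_iff_tendsto_nhds)

lemma chart_domain_open: "smooth_atlas M \<Longrightarrow> c \<in> atlas M \<Longrightarrow> open (fst c)"
  unfolding smooth_atlas_def by (elim conjE ballE) auto

lemma open_Int_vimage: "continuous_on W f \<Longrightarrow> open W \<Longrightarrow> open B \<Longrightarrow> open (W \<inter> f -` B)"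
  using continuous_on_open_vimage[of W f] by (simp add: Int_commute)

lemma smooth_near_filterlim: "smooth_near f x \<Longrightarrow> filterlim f (nhds (f x)) (nhds x)"
  using smooth_near_isCont[of f x] unfolding continuous_at tendsto_at_iff_tendsto_nhds .

context
  fixes M :: "('m::topological_space, 'e::fin_dim_inner) manifold" and c
  assumes M: "smooth_atlas M" and c: "c \<in> atlas M"
begin

lemma chart_open: "open (fst c)" and chart_image_open: "open (snd c ` fst c)"
  and chart_homeo: "homeomorphism (fst c) (snd c ` fst c) (snd c) (chart_inv c)"
  using M c unfolding smooth_atlas_def by blast+

lemma chart_inv_chart: "x \<in> fst c \<Longrightarrow> chart_inv c (snd c x) = x"
  using chart_homeo by (auto simp: homeomorphism_def)

lemma chart_filterlim: "x \<in> fst c \<Longrightarrow> filterlim (snd c) (nhds (snd c x)) (nhds x)"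
  using chart_homeo filterlim_nhds_iff_continuous_on[OF chart_open] by (auto simp: homeomorphism_def)

lemma chart_inv_filterlim: "x \<in> fst c \<Longrightarrow> filterlim (chart_inv c) (nhds x) (nhds (snd c x))"
proof -
  assume x: "x \<in> fst c"
  have "continuous_on (snd c ` fst c) (chart_inv c)" using chart_homeo by (simp add: homeomorphism_def)
  then have "filterlim (chart_inv c) (nhds (chart_inv c (snd c x))) (nhds (snd c x))"
    using x unfolding filterlim_nhds_iff_continuous_on[OF chart_image_open] by blast
  then show ?thesis by (simp add: chart_inv_chart[OF x])
qed

lemma eventually_chart_domain: "x \<in> fst c \<Longrightarrow> eventually (\<lambda>y. y \<in> fst c) (nhds x)"
  using chart_open by (auto simp: eventually_nhds)

lemma eventually_chart_inv:
  "x \<in> fst c \<Longrightarrow> eventually P (nhds x) \<Longrightarrow> eventually (\<lambda>z. P (chart_inv c z)) (nhds (snd c x))"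
  by (rule eventually_compose_filterlim[OF _ chart_inv_filterlim])

lemma eventually_chart:
  "x \<in> fst c \<Longrightarrow> eventually P (nhds (snd c x)) \<Longrightarrow> eventually (\<lambda>z. P (snd c z)) (nhds x)"
  by (rule eventually_compose_filterlim[OF _ chart_filterlim])

lemma eventually_chart_chart_inv:
  assumes "x \<in> fst c" shows "eventually (\<lambda>z. snd c (chart_inv c z) = z) (nhds (snd c x))"
proof -
  have "eventually (\<lambda>z. z \<in> snd c ` fst c) (nhds (snd c x))"
    using chart_image_open assms by (auto simp: eventually_nhds)
  then show ?thesis by eventually_elim (auto simp: chart_inv_chart)
qed

lemma open_chart_image: "open U \<Longrightarrow> open (snd c ` (fst c \<inter> U))"
proof -
  assume U: "open U"
  have "snd c ` (fst c \<inter> U) = snd c ` fst c \<inter> chart_inv c -` U"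
    by (auto simp: chart_inv_chart)
  then show ?thesis
    using chart_homeo continuous_on_open_vimage[OF chart_image_open, of "chart_inv c"] U
    by (auto simp: homeomorphism_def Int_commute)
qed

lemma transition_smooth:
  assumes d: "d \<in> atlas M" and x: "x \<in> fst c" "x \<in> fst d"
  shows "smooth_near (snd d \<circ> chart_inv c) (snd c x)"
proof -
  have "smooth_on (snd c ` (fst c \<inter> fst d)) (snd d \<circ> chart_inv c)"
    using M[unfolded smooth_atlas_def, THEN conjunct2, THEN conjunct1, rule_format, OF c d] .
  moreover have "open (snd c ` (fst c \<inter> fst d))"
    by (rule open_chart_image[OF chart_domain_open[OF M d]])
  ultimately show ?thesis using x by (auto simp: smooth_on_iff_near)
qed

end

subsection \<open>Germs of smooth maps\<close>

definition smooth_at ::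
  "('m::topological_space, 'e::real_normed_vector) manifold \<Rightarrow>
   ('n::topological_space, 'f::real_normed_vector) manifold \<Rightarrow> ('m \<Rightarrow> 'n) \<Rightarrow> 'm \<Rightarrow> bool" where
  "smooth_at M N f x \<longleftrightarrow> (\<exists>W. x \<in> W \<and> smooth_map_on M N W f)"

lemma smooth_at_eventually: "smooth_at M N f x \<Longrightarrow> eventually (smooth_at M N f) (nhds x)"
  unfolding smooth_at_def eventually_nhds smooth_map_on_def by blast

lemma smooth_at_filterlim: "smooth_at M N f x \<Longrightarrow> filterlim f (nhds (f x)) (nhds x)"
  unfolding smooth_at_def smooth_map_on_def by (metis filterlim_nhds_iff_continuous_on)

lemma smooth_at_pull_eventually:
  "smooth_at M N f x \<Longrightarrow> eventually P (nhds (f x)) \<Longrightarrow> eventually (\<lambda>y. P (f y)) (nhds x)"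
  by (rule eventually_compose_filterlim[OF _ smooth_at_filterlim])

text \<open>Since transition maps are smooth, one pair of charts around \<open>x\<close> and \<open>f
  x\<close> decides smoothness. Continuity has to be asked for separately, because the coordinate
  expression carries no information wherever \<open>f\<close> leaves the domain of
  \<open>d\<close>.\<close>

lemma smooth_at_charts:
  assumes M: "smooth_atlas M" and N: "smooth_atlas N"
    and c: "c \<in> atlas M" "x \<in> fst c" and d: "d \<in> atlas N" "f x \<in> fst d"
  shows "smooth_at M N f x \<longleftrightarrow>
    filterlim f (nhds (f x)) (nhds x) \<and> smooth_near (\<lambda>z. snd d (f (chart_inv c z))) (snd c x)"
proof safe
  assume s: "smooth_at M N f x"
  then show "filterlim f (nhds (f x)) (nhds x)" by (rule smooth_at_filterlim)
  obtain W where W: "x \<in> W" "open W" "continuous_on W f"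
    "smooth_on (snd c ` (fst c \<inter> W \<inter> f -` fst d)) (snd d \<circ> f \<circ> chart_inv c)"
    using s c d unfolding smooth_at_def smooth_map_on_def by blast
  have "open (W \<inter> f -` fst d)"
    using open_Int_vimage[OF W(3,2) chart_open[OF N d(1)]] .
  then have "open (snd c ` (fst c \<inter> W \<inter> f -` fst d))"
    using open_chart_image[OF M c(1)] by (simp add: Int_assoc)
  then show "smooth_near (\<lambda>z. snd d (f (chart_inv c z))) (snd c x)"
    using W(1,4) c(2) d(2) by (auto simp: smooth_on_iff_near o_def)
next
  assume lim: "filterlim f (nhds (f x)) (nhds x)"
    and s: "smooth_near (\<lambda>z. snd d (f (chart_inv c z))) (snd c x)"
  have "eventually (\<lambda>y. y \<in> fst c \<and> f y \<in> fst d \<and>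
          smooth_near (\<lambda>z. snd d (f (chart_inv c z))) (snd c y)) (nhds x)"
    using eventually_chart_domain[OF M c] eventually_chart[OF M c smooth_near_eventually[OF s]]
      eventually_compose_filterlim[OF eventually_chart_domain[OF N d] lim]
    by eventually_elim auto
  then obtain U where U: "open U" "x \<in> U" and Uy: "\<And>y. y \<in> U \<Longrightarrow> y \<in> fst c" "\<And>y. y \<in> U \<Longrightarrow> f y \<in> fst d"
    "\<And>y. y \<in> U \<Longrightarrow> smooth_near (\<lambda>z. snd d (f (chart_inv c z))) (snd c y)"
    unfolding eventually_nhds by auto
  have evU: "eventually (\<lambda>y. y \<in> U) (nhds y)" if "y \<in> U" for y
    using U that by (auto simp: eventually_nhds)
  have lim': "filterlim f (nhds (f y)) (nhds y)" if y: "y \<in> U" for y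
  proof -
    have "filterlim (\<lambda>y. snd d (f (chart_inv c (snd c y)))) (nhds (snd d (f (chart_inv c (snd c y))))) (nhds y)"
      by (rule filterlim_compose[OF smooth_near_filterlim[OF Uy(3)[OF y]] chart_filterlim[OF M c(1) Uy(1)[OF y]]])
    then have "filterlim (\<lambda>y. snd d (f (chart_inv c (snd c y)))) (nhds (snd d (f y))) (nhds y)"
      using chart_inv_chart[OF M c(1) Uy(1)[OF y]] by simp
    then have 1: "filterlim (\<lambda>y. chart_inv d (snd d (f (chart_inv c (snd c y))))) (nhds (f y)) (nhds y)"
      by (rule filterlim_compose[OF chart_inv_filterlim[OF N d(1) Uy(2)[OF y]]])
    show ?thesis
      by (rule filterlim_cong[THEN iffD1, OF refl refl _ 1])
         (use evU[OF y] in \<open>eventually_elim, simp add: chart_inv_chart[OF M c(1) Uy(1)] chart_inv_chart[OF N d(1) Uy(2)]\<close>)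
  qed
  have "smooth_on (snd c' ` (fst c' \<inter> U \<inter> f -` fst d')) (snd d' \<circ> f \<circ> chart_inv c')"
    if c': "c' \<in> atlas M" and d': "d' \<in> atlas N" for c' d'
  proof -
    have cont: "continuous_on U f" using lim' filterlim_nhds_iff_continuous_on[OF U(1)] by blast
    have o: "open (snd c' ` (fst c' \<inter> U \<inter> f -` fst d'))"
      using open_chart_image[OF M c'] open_Int_vimage[OF cont U(1)] chart_open[OF N d']
      by (simp add: Int_assoc)
    have "smooth_near (snd d' \<circ> f \<circ> chart_inv c') (snd c' y)"
      if y: "y \<in> fst c'" "y \<in> U" "f y \<in> fst d'" for y
    proof (rule smooth_near_cong)
      let ?t1 = "snd c \<circ> chart_inv c'" and ?t2 = "snd d' \<circ> chart_inv d"
      have 1: "smooth_near (\<lambda>z. snd d (f (chart_inv c (?t1 z)))) (snd c' y)"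
        by (rule smooth_near_compose[OF transition_smooth[OF M c' c(1) y(1) Uy(1)[OF y(2)]]])
           (simp add: chart_inv_chart[OF M c' y(1)] Uy(3)[OF y(2)])
      show "smooth_near (\<lambda>z. ?t2 (snd d (f (chart_inv c (?t1 z))))) (snd c' y)"
        by (rule smooth_near_compose[OF 1], use transition_smooth[OF N d(1) d' Uy(2)[OF y(2)] y(3)] in
           \<open>simp add: o_def chart_inv_chart[OF M c' y(1)] chart_inv_chart[OF M c(1) Uy(1)[OF y(2)]]\<close>)
      have "eventually (\<lambda>z. chart_inv c' z \<in> U) (nhds (snd c' y))"
        by (rule eventually_chart_inv[OF M c' y(1) evU[OF y(2)]])
      then show "eventually (\<lambda>z. ?t2 (snd d (f (chart_inv c (?t1 z)))) = (snd d' \<circ> f \<circ> chart_inv c') z) (nhds (snd c' y))"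
        by eventually_elim (simp add: chart_inv_chart[OF M c(1) Uy(1)] chart_inv_chart[OF N d(1) Uy(2)])
    qed
    then show ?thesis unfolding smooth_on_iff_near[OF o] by auto
  qed
  then have "smooth_map_on M N U f"
    unfolding smooth_map_on_def using U(1) lim' filterlim_nhds_iff_continuous_on[OF U(1), of f] by blast
  then show "smooth_at M N f x" unfolding smooth_at_def using U(2) by blast
qed

lemma smooth_map_on_iff:
  assumes M: "smooth_atlas M" and N: "smooth_atlas N"
  shows "smooth_map_on M N W f \<longleftrightarrow> open W \<and> (\<forall>x\<in>W. smooth_at M N f x)"
proof
  assume "smooth_map_on M N W f"
  then show "open W \<and> (\<forall>x\<in>W. smooth_at M N f x)" by (auto simp: smooth_at_def smooth_map_on_def)
next
  assume a: "open W \<and> (\<forall>x\<in>W. smooth_at M N f x)"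
  have cont: "continuous_on W f"
    using a filterlim_nhds_iff_continuous_on[of W f] smooth_at_filterlim by blast
  have "smooth_on (snd c ` (fst c \<inter> W \<inter> f -` fst d)) (snd d \<circ> f \<circ> chart_inv c)"
    if c: "c \<in> atlas M" and d: "d \<in> atlas N" for c d
  proof -
    have o: "open (snd c ` (fst c \<inter> W \<inter> f -` fst d))"
      using open_chart_image[OF M c] open_Int_vimage[OF cont] a chart_open[OF N d]
      by (simp add: Int_assoc)
    show ?thesis unfolding smooth_on_iff_near[OF o]
      using a smooth_at_charts[OF M N c _ d] by (auto simp: o_def)
  qed
  then show "smooth_map_on M N W f" using a cont by (simp add: smooth_map_on_def)
qed

lemma smooth_at_cong:
  assumes M: "smooth_atlas M" and N: "smooth_atlas N"
    and f: "smooth_at M N f x" and ev: "eventually (\<lambda>y. f y = g y) (nhds x)"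
  shows "smooth_at M N g x"
proof -
  have x: "f x = g x" using ev by (rule eventually_nhds_x_imp_x)
  have charts: "smooth_at M N h x \<longleftrightarrow> filterlim h (nhds (h x)) (nhds x) \<and>
      smooth_near (\<lambda>z. snd (chart_at N (g x)) (h (chart_inv (chart_at M x) z))) (snd (chart_at M x) x)"
    if "h x = g x" for h
    using smooth_at_charts[OF M N chart_at[OF M], where d = "chart_at N (g x)" and f = h] chart_at[OF N] that
    by simp
  have "filterlim g (nhds (g x)) (nhds x)"
    using smooth_at_filterlim[OF f] filterlim_cong[OF refl refl ev, of "nhds (f x)"] x by simp
  moreover have "smooth_near (\<lambda>z. snd (chart_at N (g x)) (g (chart_inv (chart_at M x) z))) (snd (chart_at M x) x)"
    by (rule smooth_near_cong[OF conjunct2[OF charts[THEN iffD1, OF x f]]])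
       (use eventually_chart_inv[OF M chart_at[OF M] ev] in \<open>auto elim: eventually_mono\<close>)
  ultimately show ?thesis using charts[of g] by simp
qed

lemma smooth_at_compose:
  assumes M: "smooth_atlas M" and N: "smooth_atlas N" and P: "smooth_atlas P"
    and g: "smooth_at N P g (f x)" and f: "smooth_at M N f x"
  shows "smooth_at M P (\<lambda>x. g (f x)) x"
proof -
  let ?c = "chart_at M x" and ?d = "chart_at N (f x)" and ?e = "chart_at P (g (f x))"
  have f': "smooth_near (\<lambda>z. snd ?d (f (chart_inv ?c z))) (snd ?c x)"
    using smooth_at_charts[OF M N chart_at[OF M] chart_at[OF N]] f by blast
  have g': "smooth_near (\<lambda>z. snd ?e (g (chart_inv ?d z))) (snd ?d (f x))"
    using smooth_at_charts[OF N P chart_at[OF N] chart_at[OF P]] g by blast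
  have "smooth_near (\<lambda>z. snd ?e (g (f (chart_inv ?c z)))) (snd ?c x)"
  proof (rule smooth_near_cong)
    show "smooth_near (\<lambda>z. snd ?e (g (chart_inv ?d (snd ?d (f (chart_inv ?c z)))))) (snd ?c x)"
      by (rule smooth_near_compose[OF f']) (simp add: chart_inv_chart[OF M chart_at[OF M]] g')
    have "eventually (\<lambda>z. f (chart_inv ?c z) \<in> fst ?d) (nhds (snd ?c x))"
      by (intro eventually_chart_inv[OF M chart_at[OF M]] smooth_at_pull_eventually[OF f]
          eventually_chart_domain[OF N chart_at[OF N]])
    then show "eventually (\<lambda>z. snd ?e (g (chart_inv ?d (snd ?d (f (chart_inv ?c z))))) =
         snd ?e (g (f (chart_inv ?c z)))) (nhds (snd ?c x))"
      by eventually_elim (simp add: chart_inv_chart[OF N chart_at(1)[OF N]])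
  qed
  then show ?thesis
    using smooth_at_charts[OF M P chart_at[OF M] chart_at[OF P]]
      filterlim_compose[OF smooth_at_filterlim[OF g] smooth_at_filterlim[OF f]] by blast
qed

lemma smooth_at_const: "smooth_atlas M \<Longrightarrow> smooth_atlas N \<Longrightarrow> smooth_at M N (\<lambda>x. a) x"
  by (subst smooth_at_charts[of M N "chart_at M x" x "chart_at N a"]) auto

lemma smooth_at_ident:
  assumes M: "smooth_atlas M" shows "smooth_at M M (\<lambda>x. x) x"
  using transition_smooth[OF M chart_at(1)[OF M] chart_at(1)[OF M] chart_at(2)[OF M] chart_at(2)[OF M], of x]
  by (subst smooth_at_charts[OF M M chart_at[OF M] chart_at[OF M]]) (simp add: filterlim_ident o_def)

subsection \<open>The derivative\<close>

lemma mderiv_eq_D: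
  "mderiv M N f x = D (\<lambda>z. snd (chart_at N (f x)) (f (chart_inv (chart_at M x) z))) (snd (chart_at M x) x)"
  by (simp add: mderiv_def o_def)

lemma mderiv_cong:
  assumes M: "smooth_atlas M" and ev: "eventually (\<lambda>y. f y = g y) (nhds x)"
  shows "mderiv M N f x = mderiv M N g x"
proof -
  have x: "f x = g x" using ev by (rule eventually_nhds_x_imp_x)
  show ?thesis unfolding mderiv_eq_D x
    by (rule D_cong_ev) (use eventually_chart_inv[OF M chart_at[OF M] ev] in \<open>auto elim: eventually_mono\<close>)
qed

lemma smooth_at_rep:
  assumes "smooth_atlas M" "smooth_atlas N" "smooth_at M N f x"
  shows "smooth_near (\<lambda>z. snd (chart_at N (f x)) (f (chart_inv (chart_at M x) z))) (snd (chart_at M x) x)"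
  using smooth_at_charts[OF assms(1,2) chart_at[OF assms(1)] chart_at[OF assms(2)]] assms(3) by blast

lemma linear_mderiv:
  assumes "smooth_atlas M" "smooth_atlas N" "smooth_at M N f x"
  shows "linear (mderiv M N f x)"
  unfolding mderiv_eq_D by (rule linear_D[OF smooth_at_rep[OF assms]])

lemma mderiv_compose:
  assumes M: "smooth_atlas M" and N: "smooth_atlas N" and P: "smooth_atlas P"
    and g: "smooth_at N P g (f x)" and f: "smooth_at M N f x"
  shows "mderiv M P (\<lambda>x. g (f x)) x v = mderiv N P g (f x) (mderiv M N f x v)"
proof -
  let ?c = "chart_at M x" and ?d = "chart_at N (f x)" and ?e = "chart_at P (g (f x))"
  have "mderiv M P (\<lambda>x. g (f x)) x v
      = D (\<lambda>z. snd ?e (g (chart_inv ?d (snd ?d (f (chart_inv ?c z)))))) (snd ?c x) v"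
    unfolding mderiv_eq_D
  proof (rule fun_cong[OF D_cong_ev])
    have "eventually (\<lambda>z. f (chart_inv ?c z) \<in> fst ?d) (nhds (snd ?c x))"
      by (intro eventually_chart_inv[OF M chart_at[OF M]] smooth_at_pull_eventually[OF f]
          eventually_chart_domain[OF N chart_at[OF N]])
    then show "eventually (\<lambda>z. snd ?e (g (f (chart_inv ?c z))) =
        snd ?e (g (chart_inv ?d (snd ?d (f (chart_inv ?c z)))))) (nhds (snd ?c x))"
      by eventually_elim (simp add: chart_inv_chart[OF N chart_at(1)[OF N]])
  qed
  also have "\<dots> = mderiv N P g (f x) (mderiv M N f x v)"
    unfolding mderiv_eq_D
    using D_compose[OF smooth_at_rep[OF M N f], of "\<lambda>z. snd ?e (g (chart_inv ?d z))" v]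
      smooth_at_rep[OF N P g]
    by (simp add: chart_inv_chart[OF M chart_at[OF M]])
  finally show ?thesis .
qed

lemma mderiv_const: "mderiv M N (\<lambda>x. a) x v = 0"
  by (simp add: mderiv_eq_D)

lemma mderiv_ident:
  assumes M: "smooth_atlas M" shows "mderiv M M (\<lambda>x. x) x v = v"
proof -
  have "mderiv M M (\<lambda>x. x) x = D (\<lambda>z. z) (snd (chart_at M x) x)"
    unfolding mderiv_eq_D by (rule D_cong_ev[OF eventually_chart_chart_inv[OF M chart_at[OF M]]])
  then show ?thesis by simp
qed

subsection \<open>Vector spaces as manifolds\<close>

lemma chart_inv_id: "chart_inv (UNIV, id) = id"
  by (auto simp: chart_inv_def inv_into_def)

lemma vector_manifold_simps [simp]:
  "atlas vector_manifold = {(UNIV, id)}" "chart_at vector_manifold x = (UNIV, id)"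
  by (auto simp: vector_manifold_def)

lemma smooth_atlas_vector [simp, intro]: "smooth_atlas (vector_manifold :: ('e::fin_dim_inner, 'e) manifold)"
  unfolding smooth_atlas_def
  by (simp add: chart_inv_id homeomorphism_def smooth_on_iff_near continuous_on_id) (auto simp: id_def intro: smooth_near_ident)

lemma smooth_at_vector_charts:
  fixes f :: "'m::topological_space \<Rightarrow> 'b::fin_dim_inner"
  assumes M: "smooth_atlas M" and c: "c \<in> atlas M" "x \<in> fst c"
  shows "smooth_at M vector_manifold f x \<longleftrightarrow> smooth_near (\<lambda>z. f (chart_inv c z)) (snd c x)"
proof -
  note * = smooth_at_charts[OF M smooth_atlas_vector c, of "(UNIV, id)" f]
  have "filterlim f (nhds (f x)) (nhds x)" if s: "smooth_near (\<lambda>z. f (chart_inv c z)) (snd c x)"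
  proof -
    have "filterlim (\<lambda>z. f (chart_inv c z)) (nhds (f x)) (nhds (snd c x))"
      using smooth_near_filterlim[OF s] chart_inv_chart[OF M c] by simp
    from filterlim_compose[OF this chart_filterlim[OF M c]]
    show ?thesis
      by (rule filterlim_cong[THEN iffD1, OF refl refl, rotated])
        (use eventually_chart_domain[OF M c] in \<open>eventually_elim, simp add: chart_inv_chart[OF M c(1)]\<close>)
  qed
  then show ?thesis using * by auto
qed

lemma smooth_at_vector_vector:
  "smooth_at vector_manifold vector_manifold f (x::'a::fin_dim_inner) \<longleftrightarrow> smooth_near (f :: 'a \<Rightarrow> 'b::fin_dim_inner) x"
  using smooth_at_vector_charts[OF smooth_atlas_vector, of "(UNIV, id)" x f] by (simp add: chart_inv_id)

lemma mderiv_vector: "mderiv M vector_manifold f x = D (\<lambda>z. f (chart_inv (chart_at M x) z)) (snd (chart_at M x) x)"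
  by (simp add: mderiv_eq_D)

lemma mderiv_vector_vector: "mderiv vector_manifold vector_manifold f x = D f x"
  by (simp add: mderiv_eq_D chart_inv_id)

lemma mderiv_from_vector: "mderiv vector_manifold M f x = D (\<lambda>z. snd (chart_at M (f x)) (f z)) x"
  by (simp add: mderiv_eq_D chart_inv_id)

context
  fixes M :: "('m::topological_space, 'e::fin_dim_inner) manifold"
  assumes M: "smooth_atlas M"
begin

lemmas vector_chart_iff = smooth_at_vector_charts[OF M chart_at[OF M]]

lemma smooth_at_near_compose:
  fixes f :: "'m \<Rightarrow> 'b::fin_dim_inner" and h :: "'b \<Rightarrow> 'c::fin_dim_inner"
  assumes "smooth_at M vector_manifold f x" "smooth_near h (f x)"
  shows "smooth_at M vector_manifold (\<lambda>x. h (f x)) x"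
  using smooth_at_compose[OF M smooth_atlas_vector smooth_atlas_vector, of h f x] assms
  by (simp add: smooth_at_vector_vector)

lemma smooth_at_vector_bilinear:
  fixes q :: "'b::fin_dim_inner \<Rightarrow> 'c::fin_dim_inner \<Rightarrow> 'd::fin_dim_inner"
  assumes "bounded_bilinear q" "smooth_at M vector_manifold f x" "smooth_at M vector_manifold g x"
  shows "smooth_at M vector_manifold (\<lambda>x. q (f x) (g x)) x"
  using assms(2,3) unfolding vector_chart_iff by (rule smooth_near_bilinear[OF assms(1)])

lemma smooth_at_vector_add:
  fixes f g :: "'m \<Rightarrow> 'b::fin_dim_inner"
  assumes "smooth_at M vector_manifold f x" "smooth_at M vector_manifold g x"
  shows "smooth_at M vector_manifold (\<lambda>x. f x + g x) x"
  using assms unfolding vector_chart_iff by (rule smooth_near_add)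

lemma smooth_at_vector_linear:
  fixes f :: "'m \<Rightarrow> 'b::fin_dim_inner" and L :: "'b \<Rightarrow> 'c::fin_dim_inner"
  assumes "linear L" "smooth_at M vector_manifold f x"
  shows "smooth_at M vector_manifold (\<lambda>x. L (f x)) x"
  by (rule smooth_at_near_compose[OF assms(2) smooth_near_linear[OF assms(1)]])

lemma smooth_at_vector_uminus:
  fixes f :: "'m \<Rightarrow> 'b::fin_dim_inner"
  shows "smooth_at M vector_manifold f x \<Longrightarrow> smooth_at M vector_manifold (\<lambda>x. - f x) x"
  by (rule smooth_at_vector_linear[where L = uminus]) (auto intro: linearI)

lemma smooth_at_vector_diff:
  fixes f g :: "'m \<Rightarrow> 'b::fin_dim_inner"
  assumes "smooth_at M vector_manifold f x" "smooth_at M vector_manifold g x"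
  shows "smooth_at M vector_manifold (\<lambda>x. f x - g x) x"
  using smooth_at_vector_add[OF assms(1) smooth_at_vector_uminus[OF assms(2)]] by simp

lemma smooth_at_vector_sum:
  fixes f :: "'i \<Rightarrow> 'm \<Rightarrow> 'b::fin_dim_inner"
  assumes "\<And>i. i \<in> I \<Longrightarrow> smooth_at M vector_manifold (f i) x"
  shows "smooth_at M vector_manifold (\<lambda>x. \<Sum>i\<in>I. f i x) x"
  using assms unfolding vector_chart_iff by (rule smooth_near_sum)

lemma smooth_at_real_inverse:
  fixes f :: "'m \<Rightarrow> real"
  shows "smooth_at M vector_manifold f x \<Longrightarrow> f x \<noteq> 0 \<Longrightarrow> smooth_at M vector_manifold (\<lambda>x. inverse (f x)) x"
  unfolding vector_chart_iff by (rule smooth_near_inverse) (auto simp: chart_inv_chart[OF M chart_at[OF M]])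

lemma smooth_at_real_power:
  fixes f :: "'m \<Rightarrow> real"
  assumes f: "smooth_at M vector_manifold f x" shows "smooth_at M vector_manifold (\<lambda>x. f x ^ n) x"
proof (induction n)
  case 0 show ?case by (simp add: smooth_at_const[OF M smooth_atlas_vector])
next
  case (Suc n)
  then show ?case using smooth_at_vector_bilinear[OF bounded_bilinear_mult f Suc] by simp
qed

lemma smooth_at_D_apply:
  fixes h :: "'b::fin_dim_inner \<Rightarrow> 'c::fin_dim_inner"
  assumes "smooth_near h (p x)" "smooth_at M vector_manifold p x" "smooth_at M vector_manifold V x"
  shows "smooth_at M vector_manifold (\<lambda>y. D h (p y) (V y)) x"
  using assms unfolding vector_chart_iff by (auto intro!: smooth_near_D_apply simp: chart_inv_chart[OF M chart_at[OF M]])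

lemma mderiv_vector_bilinear:
  fixes q :: "'b::fin_dim_inner \<Rightarrow> 'c::fin_dim_inner \<Rightarrow> 'd::fin_dim_inner"
  assumes "bounded_bilinear q" "smooth_at M vector_manifold f x" "smooth_at M vector_manifold g x"
  shows "mderiv M vector_manifold (\<lambda>x. q (f x) (g x)) x v =
    q (f x) (mderiv M vector_manifold g x v) + q (mderiv M vector_manifold f x v) (g x)"
  using assms unfolding mderiv_vector vector_chart_iff by (simp add: D_bilinear[OF assms(1)] chart_inv_chart[OF M chart_at[OF M]])

lemma mderiv_vector_add:
  fixes f g :: "'m \<Rightarrow> 'b::fin_dim_inner"
  assumes "smooth_at M vector_manifold f x" "smooth_at M vector_manifold g x"
  shows "mderiv M vector_manifold (\<lambda>x. f x + g x) x v =
    mderiv M vector_manifold f x v + mderiv M vector_manifold g x v"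
  using assms unfolding mderiv_vector vector_chart_iff by (simp add: D_add)

lemma mderiv_vector_linear:
  fixes f :: "'m \<Rightarrow> 'b::fin_dim_inner" and L :: "'b \<Rightarrow> 'c::fin_dim_inner"
  assumes L: "linear L" and f: "smooth_at M vector_manifold f x"
  shows "mderiv M vector_manifold (\<lambda>x. L (f x)) x v = L (mderiv M vector_manifold f x v)"
  using mderiv_compose[OF M smooth_atlas_vector smooth_atlas_vector, of L f x v] f smooth_near_linear[OF L]
  by (simp add: smooth_at_vector_vector mderiv_vector_vector D_bounded_linear[OF linear_imp_bounded_linear[OF L]])

lemma chart_smooth: "c \<in> atlas M \<Longrightarrow> x \<in> fst c \<Longrightarrow> smooth_at M vector_manifold (snd c) x"
  using transition_smooth[OF M chart_at(1)[OF M] _ chart_at(2)[OF M], of c x] by (simp add: vector_chart_iff o_def)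

lemma chart_inv_smooth:
  assumes c: "c \<in> atlas M" "x \<in> fst c" shows "smooth_at vector_manifold M (chart_inv c) (snd c x)"
proof -
  have "snd c x \<in> fst (UNIV, id)" "(UNIV, id) \<in> atlas vector_manifold" by auto
  moreover have "chart_inv c (snd c x) \<in> fst c" using c by (simp add: chart_inv_chart[OF M])
  moreover have "smooth_near (\<lambda>z. snd c (chart_inv c z)) (snd c x)"
    by (rule smooth_near_cong[OF smooth_near_ident])
       (use eventually_chart_chart_inv[OF M c] in \<open>auto elim: eventually_mono\<close>)
  ultimately show ?thesis
    using smooth_at_charts[OF smooth_atlas_vector M, of "(UNIV, id)" "snd c x" c "chart_inv c"]
      chart_inv_filterlim[OF M c] c by (simp add: chart_inv_id chart_inv_chart[OF M])
qed

text \<open>Components and coordinate fields are derivatives of a chart and of its inverse. So every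
  change of chart is an instance of the chain rule.\<close>

lemma components_eq: "components M c x = mderiv M vector_manifold (snd c) x"
  by (simp add: components_def mderiv_vector o_def)

lemma coord_field_eq: "c \<in> atlas M \<Longrightarrow> x \<in> fst c \<Longrightarrow> coord_field M c a x = mderiv vector_manifold M (chart_inv c) (snd c x) a"
  by (simp add: coord_field_def mderiv_from_vector o_def chart_inv_chart[OF M])

lemma components_coord_field:
  assumes c: "c \<in> atlas M" "x \<in> fst c" shows "components M c x (coord_field M c a x) = a"
proof -
  have "components M c x (coord_field M c a x) = mderiv vector_manifold vector_manifold (\<lambda>z. snd c (chart_inv c z)) (snd c x) a"
    unfolding components_eq coord_field_eq[OF c]
    using mderiv_compose[OF smooth_atlas_vector M smooth_atlas_vector, of "snd c" "chart_inv c" "snd c x" a]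
      chart_smooth[OF c] chart_inv_smooth[OF c] chart_inv_chart[OF M c] by simp
  also have "\<dots> = mderiv vector_manifold vector_manifold (\<lambda>z. z) (snd c x) a"
    by (rule fun_cong[OF mderiv_cong[OF smooth_atlas_vector eventually_chart_chart_inv[OF M c]]])
  finally show ?thesis by (simp add: mderiv_ident)
qed

lemma coord_field_components:
  assumes c: "c \<in> atlas M" "x \<in> fst c" shows "coord_field M c (components M c x v) x = v"
proof -
  have "coord_field M c (components M c x v) x = mderiv M M (\<lambda>y. chart_inv c (snd c y)) x v"
    unfolding components_eq coord_field_eq[OF c]
    using mderiv_compose[OF M smooth_atlas_vector M, of "chart_inv c" "snd c" x v]
      chart_smooth[OF c] chart_inv_smooth[OF c] by simp
  also have "\<dots> = mderiv M M (\<lambda>y. y) x v"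
    by (rule fun_cong[OF mderiv_cong[OF M]])
       (use eventually_chart_domain[OF M c] in \<open>eventually_elim, simp add: chart_inv_chart[OF M c(1)]\<close>)
  finally show ?thesis by (simp add: mderiv_ident M)
qed

lemma linear_components: "c \<in> atlas M \<Longrightarrow> x \<in> fst c \<Longrightarrow> linear (components M c x)"
  unfolding components_eq by (intro linear_mderiv M smooth_atlas_vector chart_smooth)

lemma linear_coord_field: "c \<in> atlas M \<Longrightarrow> x \<in> fst c \<Longrightarrow> linear (\<lambda>a. coord_field M c a x)"
  by (simp add: coord_field_eq linear_mderiv M chart_inv_smooth)

lemma components_chart_at [simp]: "components M (chart_at M x) x = (\<lambda>v. v)"
  using mderiv_ident[OF M, of x] by (auto simp: components_def mderiv_def o_def)

lemma coord_field_chart_at: "coord_field M (chart_at M x) a x = a"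
  using coord_field_components[OF chart_at[OF M], of x a] by simp

end

section \<open>Product manifolds\<close>

lemma chart_at_prod [simp]:
  "chart_at (prod_manifold M N) (x, y) = prod_chart (chart_at M x) (chart_at N y)"
  by (simp add: prod_manifold_def)

lemma prod_chart_atlas [simp, intro]:
  "c \<in> atlas M \<Longrightarrow> d \<in> atlas N \<Longrightarrow> prod_chart c d \<in> atlas (prod_manifold M N)"
  by (simp add: prod_manifold_def del: split_paired_Ex) blast

lemma prod_atlas_cases:
  assumes "e \<in> atlas (prod_manifold M N)"
  obtains c d where "e = prod_chart c d" "c \<in> atlas M" "d \<in> atlas N"
  using assms unfolding prod_manifold_def by auto

lemma fst_prod_chart [simp]: "fst (prod_chart c d) = fst c \<times> fst d"
  and snd_prod_chart [simp]: "snd (prod_chart c d) = map_prod (snd c) (snd d)"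
  by (simp_all add: prod_chart_def)

context
  fixes M :: "('m::topological_space, 'e::fin_dim_inner) manifold"
    and N :: "('n::topological_space, 'f::fin_dim_inner) manifold"
  assumes M: "smooth_atlas M" and N: "smooth_atlas N"
begin

lemma chart_inv_prod_chart:
  assumes c: "c \<in> atlas M" and d: "d \<in> atlas N" and p: "p \<in> (snd c ` fst c) \<times> (snd d ` fst d)"
  shows "chart_inv (prod_chart c d) p = (chart_inv c (fst p), chart_inv d (snd p))"
proof -
  obtain x y where xy: "x \<in> fst c" "y \<in> fst d" "p = (snd c x, snd d y)" using p by auto
  have "inj_on (map_prod (snd c) (snd d)) (fst c \<times> fst d)"
    using chart_inv_chart[OF M c] chart_inv_chart[OF N d] by (intro map_prod_inj_on) (auto intro: inj_on_inverseI)
  from inv_into_f_f[OF this, of "(x, y)"] show ?thesis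
    using xy by (simp add: chart_inv_def[of "prod_chart c d"] chart_inv_chart[OF M c] chart_inv_chart[OF N d])
qed

lemma eventually_prod_chart_inv:
  assumes c: "c \<in> atlas M" "x \<in> fst c" and d: "d \<in> atlas N" "y \<in> fst d"
  shows "eventually (\<lambda>p. p \<in> (snd c ` fst c) \<times> (snd d ` fst d)) (nhds (snd c x, snd d y))"
  using c d chart_image_open[OF M c(1)] chart_image_open[OF N d(1)]
  unfolding eventually_nhds by (intro exI[of _ "(snd c ` fst c) \<times> (snd d ` fst d)"]) (auto intro: open_Times)

lemma smooth_atlas_prod: "smooth_atlas (prod_manifold M N)"
  unfolding smooth_atlas_def
proof (intro conjI ballI allI)
  fix e assume "e \<in> atlas (prod_manifold M N)"
  then obtain c d where e: "e = prod_chart c d" and c: "c \<in> atlas M" and d: "d \<in> atlas N"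
    by (rule prod_atlas_cases)
  show "open (fst e)" using chart_open[OF M c] chart_open[OF N d] by (simp add: e open_Times)
  have im: "snd e ` fst e = (snd c ` fst c) \<times> (snd d ` fst d)" by (auto simp: e)
  show "open (snd e ` fst e)" unfolding im
    using chart_image_open[OF M c] chart_image_open[OF N d] by (simp add: open_Times)
  have cc: "continuous_on (fst c) (snd c)" "continuous_on (snd c ` fst c) (chart_inv c)"
    and cd: "continuous_on (fst d) (snd d)" "continuous_on (snd d ` fst d) (chart_inv d)"
    using chart_homeo[OF M c] chart_homeo[OF N d] by (auto simp: homeomorphism_def)
  have 1: "continuous_on (fst e) (snd e)"
  proof -
    have "continuous_on (fst c \<times> fst d) (\<lambda>p. (snd c (fst p), snd d (snd p)))"
      by (intro continuous_on_Pair continuous_on_compose2[OF cc(1)] continuous_on_compose2[OF cd(1)]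
         continuous_on_fst continuous_on_snd continuous_on_id) auto
    then show ?thesis by (simp add: e map_prod_def case_prod_unfold)
  qed
  have "continuous_on (snd e ` fst e) (\<lambda>p. (chart_inv c (fst p), chart_inv d (snd p)))" unfolding im
    by (intro continuous_on_Pair continuous_on_compose2[OF cc(2)] continuous_on_compose2[OF cd(2)]
       continuous_on_fst continuous_on_snd continuous_on_id) auto
  then have 2: "continuous_on (snd e ` fst e) (chart_inv e)"
    by (rule continuous_on_eq) (unfold im, simp add: e chart_inv_prod_chart[OF c d] mem_Times_iff)
  show "homeomorphism (fst e) (snd e ` fst e) (snd e) (chart_inv e)"
    by (rule homeomorphismI[OF 1 2])
       (auto simp: e chart_inv_prod_chart[OF c d] chart_inv_chart[OF M c] chart_inv_chart[OF N d])
  fix e' assume "e' \<in> atlas (prod_manifold M N)"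
  then obtain c' d' where e': "e' = prod_chart c' d'" and c': "c' \<in> atlas M" and d': "d' \<in> atlas N"
    by (rule prod_atlas_cases)
  have "snd e ` (fst e \<inter> fst e') = (snd c ` (fst c \<inter> fst c')) \<times> (snd d ` (fst d \<inter> fst d'))"
    by (auto simp: e e')
  then have o: "open (snd e ` (fst e \<inter> fst e'))"
    using open_chart_image[OF M c] open_chart_image[OF N d] chart_open[OF M c'] chart_open[OF N d']
    by (simp add: open_Times)
  have "smooth_near (snd e' \<circ> chart_inv e) (snd c x, snd d y)"
    if x: "x \<in> fst c" "x \<in> fst c'" and y: "y \<in> fst d" "y \<in> fst d'" for x y
  proof (rule smooth_near_cong)
    have "smooth_near (\<lambda>p. (snd c' \<circ> chart_inv c) (fst p)) (snd c x, snd d y)"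
      by (rule smooth_near_compose[OF smooth_near_fst]) (simp only: fst_conv, rule transition_smooth[OF M c c' x])
    moreover have "smooth_near (\<lambda>p. (snd d' \<circ> chart_inv d) (snd p)) (snd c x, snd d y)"
      by (rule smooth_near_compose[OF smooth_near_snd]) (simp only: snd_conv, rule transition_smooth[OF N d d' y])
    ultimately show "smooth_near (\<lambda>p. ((snd c' \<circ> chart_inv c) (fst p), (snd d' \<circ> chart_inv d) (snd p)))
        (snd c x, snd d y)" by (rule smooth_near_Pair)
    show "eventually (\<lambda>p. ((snd c' \<circ> chart_inv c) (fst p), (snd d' \<circ> chart_inv d) (snd p)) =
        (snd e' \<circ> chart_inv e) p) (nhds (snd c x, snd d y))"
      using eventually_prod_chart_inv[OF c x(1) d y(1)]
      by eventually_elim (simp add: e e' chart_inv_prod_chart[OF c d])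
  qed
  then show "smooth_on (snd e ` (fst e \<inter> fst e')) (snd e' \<circ> chart_inv e)"
    unfolding smooth_on_iff_near[OF o] by (auto simp: e e')
next
  fix p show "chart_at (prod_manifold M N) p \<in> atlas (prod_manifold M N)"
    by (cases p) (use M N in auto)
  show "p \<in> fst (chart_at (prod_manifold M N) p)" by (cases p) (use M N in auto)
qed

lemma smooth_at_fst_mderiv:
  "smooth_at (prod_manifold M N) M fst p" (is ?s)
  "mderiv (prod_manifold M N) M fst p v = fst v"
proof -
  obtain x y where p: "p = (x, y)" by fastforce
  let ?c = "chart_at M x" and ?d = "chart_at N y"
  note cd = chart_at[OF M, of x] chart_at[OF N, of y]
  have ev: "eventually (\<lambda>z. fst z = snd ?c (fst (chart_inv (prod_chart ?c ?d) z))) (nhds (snd ?c x, snd ?d y))"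
    using eventually_prod_chart_inv[OF cd]
    by eventually_elim (auto simp: chart_inv_prod_chart[OF cd(1,3)] chart_inv_chart[OF M cd(1)])
  have "smooth_near (\<lambda>z. snd ?c (fst (chart_inv (prod_chart ?c ?d) z))) (snd ?c x, snd ?d y)"
    by (rule smooth_near_cong[OF smooth_near_fst ev])
  moreover have "filterlim fst (nhds (fst p)) (nhds p)"
    using tendsto_fst[OF filterlim_ident, of p] by simp
  ultimately show ?s
    using smooth_at_charts[OF smooth_atlas_prod M, of "prod_chart ?c ?d" p ?c fst] cd by (auto simp: p)
  have "mderiv (prod_manifold M N) M fst p = D fst (snd ?c x, snd ?d y)"
    unfolding mderiv_eq_D p by (rule sym, simp, rule D_cong_ev[OF ev])
  then show "mderiv (prod_manifold M N) M fst p v = fst v"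
    by (simp add: D_bounded_linear bounded_linear_fst)
qed

lemma smooth_at_snd_mderiv:
  "smooth_at (prod_manifold M N) N snd p" (is ?s)
  "mderiv (prod_manifold M N) N snd p v = snd v"
proof -
  obtain x y where p: "p = (x, y)" by fastforce
  let ?c = "chart_at M x" and ?d = "chart_at N y"
  note cd = chart_at[OF M, of x] chart_at[OF N, of y]
  have ev: "eventually (\<lambda>z. snd z = snd ?d (snd (chart_inv (prod_chart ?c ?d) z))) (nhds (snd ?c x, snd ?d y))"
    using eventually_prod_chart_inv[OF cd]
    by eventually_elim (auto simp: chart_inv_prod_chart[OF cd(1,3)] chart_inv_chart[OF N cd(3)])
  have "smooth_near (\<lambda>z. snd ?d (snd (chart_inv (prod_chart ?c ?d) z))) (snd ?c x, snd ?d y)"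
    by (rule smooth_near_cong[OF smooth_near_snd ev])
  moreover have "filterlim snd (nhds (snd p)) (nhds p)"
    using tendsto_snd[OF filterlim_ident, of p] by simp
  ultimately show ?s
    using smooth_at_charts[OF smooth_atlas_prod N, of "prod_chart ?c ?d" p ?d snd] cd by (auto simp: p)
  have "mderiv (prod_manifold M N) N snd p = D snd (snd ?c x, snd ?d y)"
    unfolding mderiv_eq_D p by (rule sym, simp, rule D_cong_ev[OF ev])
  then show "mderiv (prod_manifold M N) N snd p v = snd v"
    by (simp add: D_bounded_linear bounded_linear_snd)
qed

lemma smooth_at_Pair_mderiv:
  fixes P :: "('p::topological_space, 'g::fin_dim_inner) manifold"
  assumes P: "smooth_atlas P" and f: "smooth_at P M f x" and g: "smooth_at P N g x"
  shows "smooth_at P (prod_manifold M N) (\<lambda>x. (f x, g x)) x"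
    "mderiv P (prod_manifold M N) (\<lambda>x. (f x, g x)) x v = (mderiv P M f x v, mderiv P N g x v)"
proof -
  note rep = smooth_at_rep[OF P M f] smooth_at_rep[OF P N g]
  have "filterlim (\<lambda>x. (f x, g x)) (nhds (f x, g x)) (nhds x)"
    using tendsto_Pair[OF smooth_at_filterlim[OF f] smooth_at_filterlim[OF g]] .
  then show "smooth_at P (prod_manifold M N) (\<lambda>x. (f x, g x)) x"
    using smooth_at_charts[OF P smooth_atlas_prod chart_at[OF P],
        of "prod_chart (chart_at M (f x)) (chart_at N (g x))" "\<lambda>x. (f x, g x)" x] M N smooth_near_Pair[OF rep]
    by auto
  show "mderiv P (prod_manifold M N) (\<lambda>x. (f x, g x)) x v = (mderiv P M f x v, mderiv P N g x v)"
    unfolding mderiv_eq_D using D_Pair[OF rep] by simp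
qed

end

lemma prod_vector_manifold: "prod_manifold vector_manifold vector_manifold = vector_manifold"
proof -
  have 1: "prod_chart (UNIV, id) (UNIV, id) = (UNIV, id)"
    by (simp add: prod_chart_def prod.map_id0)
  then have 2: "{prod_chart c d | c d. c \<in> {(UNIV, id)} \<and> d \<in> {(UNIV, id)}} = {(UNIV, id)}" by simp
  show ?thesis unfolding prod_manifold_def
    by (simp only: vector_manifold_simps 1 2) (simp add: vector_manifold_def case_prod_unfold)
qed

context
  fixes M :: "('m::topological_space, 'e::fin_dim_inner) manifold"
    and N :: "('n::topological_space, 'f::fin_dim_inner) manifold"
  assumes M: "smooth_atlas M" and N: "smooth_atlas N"
begin

lemma components_prod:
  assumes c: "c \<in> atlas M" "x \<in> fst c" and d: "d \<in> atlas N" "y \<in> fst d"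
  shows "components (prod_manifold M N) (prod_chart c d) (x, y) (u, v) = (components M c x u, components N d y v)"
proof -
  let ?P = "prod_manifold M N"
  note P = smooth_atlas_prod[OF M N]
  have f: "smooth_at ?P M fst (x, y)" "smooth_at ?P N snd (x, y)"
    by (rule smooth_at_fst_mderiv[OF M N], rule smooth_at_snd_mderiv[OF M N])
  have s: "smooth_at ?P vector_manifold (\<lambda>p. snd c (fst p)) (x, y)"
    "smooth_at ?P vector_manifold (\<lambda>p. snd d (snd p)) (x, y)"
    by (rule smooth_at_compose[OF P M smooth_atlas_vector _ f(1)], simp add: chart_smooth[OF M c],
        rule smooth_at_compose[OF P N smooth_atlas_vector _ f(2)], simp add: chart_smooth[OF N d])
  have "components ?P (prod_chart c d) (x, y) (u, v)
     = mderiv ?P (prod_manifold vector_manifold vector_manifold) (\<lambda>p. (snd c (fst p), snd d (snd p))) (x, y) (u, v)"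
    unfolding components_eq[OF P] prod_vector_manifold by (simp add: map_prod_def case_prod_unfold)
  also have "\<dots> = (mderiv ?P vector_manifold (\<lambda>p. snd c (fst p)) (x, y) (u, v),
       mderiv ?P vector_manifold (\<lambda>p. snd d (snd p)) (x, y) (u, v))"
    by (rule smooth_at_Pair_mderiv[OF smooth_atlas_vector smooth_atlas_vector P s])
  also have "\<dots> = (components M c x u, components N d y v)"
    using mderiv_compose[OF P M smooth_atlas_vector _ f(1), of "snd c" "(u, v)"]
      mderiv_compose[OF P N smooth_atlas_vector _ f(2), of "snd d" "(u, v)"]
    by (simp add: chart_smooth[OF M c] chart_smooth[OF N d] smooth_at_fst_mderiv[OF M N]
        smooth_at_snd_mderiv[OF M N] components_eq[OF M] components_eq[OF N])
  finally show ?thesis .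
qed

lemma coord_field_prod:
  assumes c: "c \<in> atlas M" "x \<in> fst c" and d: "d \<in> atlas N" "y \<in> fst d"
  shows "coord_field (prod_manifold M N) (prod_chart c d) (a, b) (x, y) = (coord_field M c a x, coord_field N d b y)"
proof -
  let ?v = "(coord_field M c a x, coord_field N d b y)"
  have "components (prod_manifold M N) (prod_chart c d) (x, y) ?v = (a, b)"
    by (simp add: components_prod[OF c d] components_coord_field[OF M c] components_coord_field[OF N d])
  then show ?thesis
    using coord_field_components[OF smooth_atlas_prod[OF M N], of "prod_chart c d" "(x, y)" ?v] c d by auto
qed

end

section \<open>Vector fields along smooth maps\<close>

text \<open>A tangent vector at a point is stored by its components in the preferred chart of that point,
  which jumps from point to point. So smoothness of a field is tested in one chart kept fixed near
  the point. Allowing fields along a map \<open>q\<close> makes the notion stable under push-forward,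
  restriction to slices and pairing.\<close>

definition field_along ::
  "('m::topological_space, 'e::fin_dim_inner) manifold \<Rightarrow> ('q::topological_space, 'f::fin_dim_inner) manifold \<Rightarrow>
   ('m \<Rightarrow> 'q) \<Rightarrow> ('m \<Rightarrow> 'f) \<Rightarrow> 'm \<Rightarrow> bool" where
  "field_along M Q q V x \<longleftrightarrow>
     smooth_at M vector_manifold (\<lambda>y. components Q (chart_at Q (q x)) (q y) (V y)) x"

lemma mderiv_vector_chart:
  fixes h :: "'q::topological_space \<Rightarrow> 'b::fin_dim_inner"
  assumes Q: "smooth_atlas Q" and h: "smooth_at Q vector_manifold h u" and c: "c \<in> atlas Q" "u \<in> fst c"
  shows "mderiv Q vector_manifold h u v = D (\<lambda>z. h (chart_inv c z)) (snd c u) (components Q c u v)"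
proof -
  have "mderiv Q vector_manifold h u = mderiv Q vector_manifold (\<lambda>y. h (chart_inv c (snd c y))) u"
    by (rule mderiv_cong[OF Q])
      (use eventually_chart_domain[OF Q c] in \<open>eventually_elim, simp add: chart_inv_chart[OF Q c(1)]\<close>)
  moreover have "smooth_at vector_manifold vector_manifold (\<lambda>z. h (chart_inv c z)) (snd c u)"
    using smooth_at_compose[OF smooth_atlas_vector Q smooth_atlas_vector _ chart_inv_smooth[OF Q c], of h] h
    by (simp add: chart_inv_chart[OF Q c])
  ultimately show ?thesis
    using mderiv_compose[OF Q smooth_atlas_vector smooth_atlas_vector _ chart_smooth[OF Q c], of "\<lambda>z. h (chart_inv c z)" v]
    by (simp add: mderiv_vector_vector components_eq[OF Q])
qed

context
  fixes M :: "('m::topological_space, 'e::fin_dim_inner) manifold"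
    and Q :: "('q::topological_space, 'f::fin_dim_inner) manifold"
  assumes M: "smooth_atlas M" and Q: "smooth_atlas Q"
begin

lemma field_along_mderiv_vector:
  fixes h :: "'q \<Rightarrow> 'b::fin_dim_inner"
  assumes q: "smooth_at M Q q x" and c: "c \<in> atlas Q" "q x \<in> fst c"
    and V: "smooth_at M vector_manifold (\<lambda>y. components Q c (q y) (V y)) x"
    and h: "smooth_at Q vector_manifold h (q x)"
  shows "smooth_at M vector_manifold (\<lambda>y. mderiv Q vector_manifold h (q y) (V y)) x"
proof (rule smooth_at_cong[OF M smooth_atlas_vector])
  have 1: "smooth_near (\<lambda>z. h (chart_inv c z)) (snd c (q x))"
    using h smooth_at_vector_charts[OF Q c] by blast
  have 2: "smooth_at M vector_manifold (\<lambda>y. snd c (q y)) x"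
    by (rule smooth_at_compose[OF M Q smooth_atlas_vector chart_smooth[OF Q c] q])
  show "smooth_at M vector_manifold (\<lambda>y. D (\<lambda>z. h (chart_inv c z)) (snd c (q y)) (components Q c (q y) (V y))) x"
    by (rule smooth_at_D_apply[OF M, OF _ 2 V]) (rule 1)
  show "eventually (\<lambda>y. D (\<lambda>z. h (chart_inv c z)) (snd c (q y)) (components Q c (q y) (V y)) =
      mderiv Q vector_manifold h (q y) (V y)) (nhds x)"
    using smooth_at_pull_eventually[OF q smooth_at_eventually[OF h]]
      smooth_at_pull_eventually[OF q eventually_chart_domain[OF Q c]]
    by eventually_elim (simp add: mderiv_vector_chart[OF Q _ c(1)])
qed

lemma field_along_chart:
  assumes q: "smooth_at M Q q x" and c: "c \<in> atlas Q" "q x \<in> fst c"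
  shows "field_along M Q q V x \<longleftrightarrow> smooth_at M vector_manifold (\<lambda>y. components Q c (q y) (V y)) x"
  using field_along_mderiv_vector[OF q chart_at[OF Q] _ chart_smooth[OF Q c]]
    field_along_mderiv_vector[OF q c _ chart_smooth[OF Q chart_at[OF Q]]]
  unfolding field_along_def components_eq[OF Q] by blast

text \<open>By the chain rule, the components of the push-forward are derivatives, along
  \<open>V\<close>, of the coordinates of \<open>f\<close>.\<close>

lemma field_along_push:
  fixes N :: "('n::topological_space, 'g::fin_dim_inner) manifold"
  assumes N: "smooth_atlas N"
    and q: "smooth_at M Q q x" and f: "smooth_at Q N f (q x)" and V: "field_along M Q q V x"
  shows "field_along M N (\<lambda>y. f (q y)) (\<lambda>y. mderiv Q N f (q y) (V y)) x"
  unfolding field_along_def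
proof (rule smooth_at_cong[OF M smooth_atlas_vector])
  let ?d = "chart_at N (f (q x))"
  have "smooth_at Q vector_manifold (\<lambda>u. snd ?d (f u)) (q x)"
    by (rule smooth_at_compose[OF Q N smooth_atlas_vector chart_smooth[OF N chart_at[OF N]] f])
  then show "smooth_at M vector_manifold (\<lambda>y. mderiv Q vector_manifold (\<lambda>u. snd ?d (f u)) (q y) (V y)) x"
    using field_along_mderiv_vector[OF q chart_at[OF Q], of V] V unfolding field_along_def by blast
  show "eventually (\<lambda>y. mderiv Q vector_manifold (\<lambda>u. snd ?d (f u)) (q y) (V y) =
      components N ?d (f (q y)) (mderiv Q N f (q y) (V y))) (nhds x)"
    using smooth_at_pull_eventually[OF q smooth_at_eventually[OF f]]
      smooth_at_pull_eventually[OF q smooth_at_pull_eventually[OF f eventually_chart_domain[OF N chart_at[OF N]]]]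
    by eventually_elim
      (simp add: components_eq[OF N] mderiv_compose[OF Q N smooth_atlas_vector chart_smooth[OF N chart_at(1)[OF N]]])
qed

lemma field_along_add:
  assumes q: "smooth_at M Q q x" and "field_along M Q q V x" "field_along M Q q V' x"
  shows "field_along M Q q (\<lambda>y. V y + V' y) x"
  unfolding field_along_def
  by (rule smooth_at_cong[OF M smooth_atlas_vector smooth_at_vector_add[OF M assms(2,3)[unfolded field_along_def]]])
     (use smooth_at_pull_eventually[OF q eventually_chart_domain[OF Q chart_at[OF Q]]] in
       \<open>eventually_elim, simp add: linear_add[OF linear_components[OF Q]] Q\<close>)

lemma field_along_scale:
  assumes q: "smooth_at M Q q x" and "smooth_at M vector_manifold a x" "field_along M Q q V x"
  shows "field_along M Q q (\<lambda>y. a y *\<^sub>R V y) x"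
  unfolding field_along_def
  by (rule smooth_at_cong[OF M smooth_atlas_vector
        smooth_at_vector_bilinear[OF M bounded_bilinear_scaleR assms(2) assms(3)[unfolded field_along_def]]])
     (use smooth_at_pull_eventually[OF q eventually_chart_domain[OF Q chart_at[OF Q]]] in
       \<open>eventually_elim, simp add: linear_cmul[OF linear_components[OF Q]] Q\<close>)

lemma field_along_coord_field:
  assumes q: "smooth_at M Q q x" and c: "c \<in> atlas Q" "q x \<in> fst c" and a: "smooth_at M vector_manifold a x"
  shows "field_along M Q q (\<lambda>y. coord_field Q c (a y) (q y)) x"
  unfolding field_along_chart[OF q c]
  by (rule smooth_at_cong[OF M smooth_atlas_vector a])
     (use smooth_at_pull_eventually[OF q eventually_chart_domain[OF Q c]] in
       \<open>eventually_elim, simp add: components_coord_field[OF Q] c\<close>)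

lemma field_along_zero: "smooth_at M Q q x \<Longrightarrow> field_along M Q q (\<lambda>y. 0) x"
  using field_along_scale[of q x "\<lambda>y. 0" "\<lambda>y. coord_field Q (chart_at Q (q x)) 0 (q y)"]
    field_along_coord_field[of q x "chart_at Q (q x)" "\<lambda>y. 0"] Q
  by (simp add: smooth_at_const[OF M smooth_atlas_vector])

lemma field_along_reparam:
  fixes P :: "('p::topological_space, 'g::fin_dim_inner) manifold"
  assumes P: "smooth_atlas P" and g: "smooth_at P M g x" and V: "field_along M Q q V (g x)"
  shows "field_along P Q (\<lambda>y. q (g y)) (\<lambda>y. V (g y)) x"
  using smooth_at_compose[OF P M smooth_atlas_vector V[unfolded field_along_def] g]
  unfolding field_along_def by simp

end

lemma field_along_Pair:
  fixes M :: "('m::topological_space, 'e::fin_dim_inner) manifold"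
    and Q :: "('q::topological_space, 'f::fin_dim_inner) manifold"
    and R :: "('r::topological_space, 'g::fin_dim_inner) manifold"
  assumes M: "smooth_atlas M" and Q: "smooth_atlas Q" and R: "smooth_atlas R"
    and q: "smooth_at M Q q x" and r: "smooth_at M R r x"
    and V: "field_along M Q q V x" and U: "field_along M R r U x"
  shows "field_along M (prod_manifold Q R) (\<lambda>y. (q y, r y)) (\<lambda>y. (V y, U y)) x"
  unfolding field_along_def
proof (rule smooth_at_cong[OF M smooth_atlas_vector])
  let ?c = "chart_at Q (q x)" and ?d = "chart_at R (r x)"
  show "smooth_at M vector_manifold (\<lambda>y. (components Q ?c (q y) (V y), components R ?d (r y) (U y))) x"
    using smooth_at_Pair_mderiv(1)[OF smooth_atlas_vector smooth_atlas_vector M V[unfolded field_along_def] U[unfolded field_along_def]]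
    unfolding prod_vector_manifold .
  show "eventually (\<lambda>y. (components Q ?c (q y) (V y), components R ?d (r y) (U y)) =
      components (prod_manifold Q R) (chart_at (prod_manifold Q R) (q x, r x)) (q y, r y) (V y, U y)) (nhds x)"
    using smooth_at_pull_eventually[OF q eventually_chart_domain[OF Q chart_at[OF Q]]]
     smooth_at_pull_eventually[OF r eventually_chart_domain[OF R chart_at[OF R]]]
    by eventually_elim (simp add: components_prod[OF Q R] Q R)
qed

abbreviation field_at :: "('m::topological_space, 'e::fin_dim_inner) manifold \<Rightarrow> ('m \<Rightarrow> 'e) \<Rightarrow> 'm \<Rightarrow> bool" where
  "field_at M X x \<equiv> field_along M M (\<lambda>y. y) X x"

lemma smooth_field_iff:
  assumes M: "smooth_atlas M"
  shows "smooth_field M W X \<longleftrightarrow> open W \<and> (\<forall>x\<in>W. field_at M X x)"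
proof -
  have *: "smooth_near (field_rep M c X) (snd c x) \<longleftrightarrow> field_at M X x" if "c \<in> atlas M" "x \<in> fst c" for c x
    unfolding field_along_chart[OF M M smooth_at_ident[OF M] that] smooth_at_vector_charts[OF M that]
    by (simp add: field_rep_def[abs_def])
  have "smooth_on (snd c ` (fst c \<inter> W)) (field_rep M c X) \<longleftrightarrow> (\<forall>x\<in>fst c \<inter> W. field_at M X x)"
    if c: "c \<in> atlas M" and W: "open W" for c
    using smooth_on_iff_near[OF open_chart_image[OF M c W], of "field_rep M c X"] *[OF c] by auto
  then show ?thesis unfolding smooth_field_def using chart_at[OF M] by blast
qed

section \<open>Determinants and the orientation of a product\<close>

definition is_basis :: "'e::real_vector set \<Rightarrow> bool" where
  "is_basis B \<longleftrightarrow> finite B \<and> independent B \<and> span B = UNIV"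

definition enumerates :: "nat \<Rightarrow> (nat \<Rightarrow> 'e) \<Rightarrow> 'e::real_vector set \<Rightarrow> bool" where
  "enumerates n b B \<longleftrightarrow> is_basis B \<and> bij_betw b {0..<n} B"

text \<open>Matrices act on rows: \<open>f (b i) = \<Sum>j. A\<^sub>i\<^sub>j (c j)\<close>.\<close>

definition matrix_of ::
  "nat \<Rightarrow> (nat \<Rightarrow> 'e::real_vector) \<Rightarrow> (nat \<Rightarrow> 'f::real_vector) \<Rightarrow> 'f set \<Rightarrow> ('e \<Rightarrow> 'f) \<Rightarrow> real mat" where
  "matrix_of n b c C f = mat n n (\<lambda>(i, j). representation C (f (b i)) (c j))"

lemma basis_exists_fin_dim: "\<exists>B::'e::fin_dim_inner set. is_basis B"
proof -
  obtain B :: "'e set" where B: "B \<subseteq> onb" "independent B" "onb \<subseteq> span B"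
    using maximal_independent_subset[of onb] by auto
  have "span onb \<subseteq> span B" using B(3) by (rule span_minimal) (rule subspace_span)
  then have "span B = UNIV" by (auto simp: onb(4))
  then show ?thesis using B finite_subset[OF B(1) onb(1)] by (auto simp: is_basis_def)
qed

lemma enumerates_expansion:
  assumes b: "enumerates n b B"
  shows "(\<Sum>i=0..<n. representation B v (b i) *\<^sub>R b i) = v"
proof -
  have B: "finite B" "independent B" "v \<in> span B" using b by (auto simp: enumerates_def is_basis_def)
  have "(\<Sum>i=0..<n. representation B v (b i) *\<^sub>R b i) = (\<Sum>c\<in>B. representation B v c *\<^sub>R c)"
    using b sum.reindex_bij_betw[of b "{0..<n}" B "\<lambda>c. representation B v c *\<^sub>R c"] by (simp add: enumerates_def)
  then show ?thesis using sum_representation_eq[OF B(2,3,1)] by simp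
qed

lemma enumerates_representation:
  assumes b: "enumerates n b B" and j: "j < n"
  shows "representation B (\<Sum>i=0..<n. x i *\<^sub>R b i) (b j) = x j"
proof -
  have B: "finite B" "independent B" "\<And>v. v \<in> span B" using b by (auto simp: enumerates_def is_basis_def)
  have "representation B (x i *\<^sub>R b i) (b j) = (if i = j then x j else 0)" if "i < n" for i
  proof -
    have "b i \<in> B" "b i = b j \<longleftrightarrow> i = j" using b that j by (auto simp: enumerates_def bij_betw_def inj_on_def)
    then show ?thesis by (auto simp: representation_scale[OF B(2,3)] representation_basis[OF B(2)])
  qed
  then show ?thesis using j by (simp add: representation_sum[OF B(2,3)])
qed

lemma matrix_of_compose:
  assumes c: "enumerates n c C" and d: "enumerates n d (E :: 'g::real_vector set)" and g: "linear g"
  shows "matrix_of n b d E (\<lambda>v. g (f v)) = matrix_of n b c C f * matrix_of n c d E g"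
proof (rule eq_matI)
  fix i j assume "i < dim_row (matrix_of n b c C f * matrix_of n c d E g)"
    "j < dim_col (matrix_of n b c C f * matrix_of n c d E g)"
  then have ij: "i < n" "j < n" by (auto simp: matrix_of_def)
  have E: "independent E" "\<And>v. v \<in> span E" using d by (auto simp: enumerates_def is_basis_def)
  have "g (f (b i)) = g (\<Sum>k=0..<n. representation C (f (b i)) (c k) *\<^sub>R c k)"
    by (simp only: enumerates_expansion[OF c])
  also have "\<dots> = (\<Sum>k=0..<n. representation C (f (b i)) (c k) *\<^sub>R g (c k))"
    by (simp add: linear_sum[OF g] linear_cmul[OF g])
  finally have "representation E (g (f (b i))) (d j) =
      (\<Sum>k=0..<n. representation C (f (b i)) (c k) * representation E (g (c k)) (d j))"
    by (simp add: representation_sum[OF E] representation_scale[OF E])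
  then show "matrix_of n b d E (\<lambda>v. g (f v)) $$ (i, j) = (matrix_of n b c C f * matrix_of n c d E g) $$ (i, j)"
    using ij by (simp add: matrix_of_def scalar_prod_def)
qed (auto simp: matrix_of_def)

lemma matrix_of_ident:
  assumes b: "enumerates n b B" shows "matrix_of n b b B (\<lambda>v. v) = 1\<^sub>m n"
proof (rule eq_matI)
  fix i j assume "i < dim_row (1\<^sub>m n)" "j < dim_col (1\<^sub>m n)"
  then have ij: "i < n" "j < n" by auto
  then have "b i \<in> B" "b i = b j \<longleftrightarrow> i = j" "b j = b i \<longleftrightarrow> i = j"
    using b by (auto simp: enumerates_def bij_betw_def inj_on_def)
  then show "matrix_of n b b B (\<lambda>v. v) $$ (i, j) = 1\<^sub>m n $$ (i, j)"
    using ij b by (simp add: matrix_of_def enumerates_def is_basis_def representation_basis)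
qed (auto simp: matrix_of_def)

text \<open>\<open>lin_det\<close> refers to an arbitrarily chosen basis, and the one chosen in a
  product is unrelated to those chosen in the factors. So the determinant has to be moved to bases of
  one's own choice.\<close>

lemma det_matrix_of_basis_change:
  assumes b: "enumerates n b B" and c: "enumerates n c C" and f: "linear f"
  shows "det (matrix_of n b b B f) = det (matrix_of n c c C f)"
proof -
  let ?P = "matrix_of n b c C (\<lambda>v. v)" and ?Q = "matrix_of n c b B (\<lambda>v. v)" and ?F = "matrix_of n c c C f"
  have cm: "?P \<in> carrier_mat n n" "?Q \<in> carrier_mat n n" "?F \<in> carrier_mat n n" by (auto simp: matrix_of_def)
  have "matrix_of n b b B f = ?P * matrix_of n c b B f"
    using matrix_of_compose[OF c b f, of b "\<lambda>v. v"] by simp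
  also have "matrix_of n c b B f = ?F * ?Q"
    using matrix_of_compose[OF c b linear_ident, of c f] by simp
  finally have "det (matrix_of n b b B f) = det ?P * (det ?F * det ?Q)"
    using cm by (simp add: det_mult[of _ n])
  moreover have "det ?P * det ?Q = 1"
  proof -
    have "?P * ?Q = 1\<^sub>m n"
      using matrix_of_compose[OF c b linear_ident, of b "\<lambda>v. v"] matrix_of_ident[OF b] by simp
    then show ?thesis using det_mult[OF cm(1,2)] by (simp only: det_one)
  qed
  ultimately show ?thesis by (metis mult.assoc mult.commute mult.right_neutral)
qed

text \<open>\<open>lin_det\<close> sums over permutations of an unordered basis, \<open>det\<close> over
  those of an initial segment of the naturals; an enumeration of the basis conjugates the ones into the
  others and preserves signs.\<close>

lemma permutation_sum_eq_det:
  assumes b: "bij_betw b {0..<n} B" and B: "finite B"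
  shows "(\<Sum>p | p permutes B. of_int (sign p) * (\<Prod>x\<in>B. g x (p x))) =
    det (mat n n (\<lambda>(i, j). g (b i) (b j)) :: real mat)"
proof -
  let ?A = "{0..<n}" and ?\<phi> = "map_permutation {0..<n} b"
  have inj: "inj_on b ?A" using b by (simp add: bij_betw_def)
  have "?\<phi> = (\<lambda>\<pi> x. if x \<in> B then b (\<pi> (inv_into ?A b x)) else x)"
    using b by (auto simp: fun_eq_iff map_permutation_def restrict_id_def bij_betw_def)
  then have \<phi>: "bij_betw ?\<phi> {p. p permutes ?A} {p. p permutes B}"
    using bij_betw_permutations[OF b] by simp
  have "(\<Sum>p | p permutes B. of_int (sign p) * (\<Prod>x\<in>B. g x (p x))) =
      (\<Sum>q | q permutes ?A. of_int (sign (?\<phi> q)) * (\<Prod>x\<in>B. g x (?\<phi> q x)))"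
    by (rule sum.reindex_bij_betw[OF \<phi>, symmetric])
  also have "\<dots> = (\<Sum>q | q permutes ?A. of_int (sign q) * (\<Prod>i\<in>?A. g (b i) (b (q i))))"
  proof (rule sum.cong)
    fix q assume "q \<in> {q. q permutes ?A}"
    then have q: "q permutes ?A" by simp
    have "(\<Prod>x\<in>B. g x (?\<phi> q x)) = (\<Prod>i\<in>?A. g (b i) (?\<phi> q (b i)))"
      by (rule prod.reindex_bij_betw[OF b, symmetric])
    also have "\<dots> = (\<Prod>i\<in>?A. g (b i) (b (q i)))"
      by (rule prod.cong) (simp_all add: map_permutation_apply[OF inj])
    finally show "of_int (sign (?\<phi> q)) * (\<Prod>x\<in>B. g x (?\<phi> q x)) =
        of_int (sign q) * (\<Prod>i\<in>?A. g (b i) (b (q i)))"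
      by (simp add: sign_map_permutation[OF inj q])
  qed simp
  also have "\<dots> = det (mat n n (\<lambda>(i, j). g (b i) (b j)))"
    unfolding det_def
  proof (simp only: dim_row_mat dim_col_mat simp_thms if_True, rule sum.cong[OF refl])
    fix q assume "q \<in> {q. q permutes ?A}"
    then have "q i < n" if "i < n" for i using that permutes_in_image[of q ?A i] by simp
    then show "of_int (sign q) * (\<Prod>i = 0..<n. g (b i) (b (q i))) =
      of_int (sign q) * (\<Prod>i = 0..<n. mat n n (\<lambda>(i, j). g (b i) (b j)) $$ (i, q i))" by simp
  qed
  finally show ?thesis .
qed

lemma lin_det_eq_det:
  fixes f :: "'e::fin_dim_inner \<Rightarrow> 'e"
  assumes b: "enumerates n b B" and f: "linear f"
  shows "lin_det f = det (matrix_of n b b B f)"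
proof -
  let ?B = "SOME B::'e set. finite B \<and> independent B \<and> span B = UNIV"
  have B: "is_basis ?B" unfolding is_basis_def using someI_ex[OF basis_exists_fin_dim[unfolded is_basis_def]] .
  then have fin: "finite ?B" by (simp add: is_basis_def)
  obtain h where h: "bij_betw h B ?B"
    using bij_if_span_eq_span_bases[of B ?B] b B by (auto simp: enumerates_def is_basis_def)
  have hb: "bij_betw (h \<circ> b) {0..<n} ?B"
    using b h by (auto simp: enumerates_def intro: bij_betw_trans)
  then have e: "enumerates n (h \<circ> b) ?B" using B by (simp add: enumerates_def)
  have "lin_det f = det (matrix_of n (h \<circ> b) (h \<circ> b) ?B f)"
    unfolding lin_det_def Let_def matrix_of_def by (rule permutation_sum_eq_det[OF hb fin])
  then show ?thesis using det_matrix_of_basis_change[OF e b f] by simp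
qed

text \<open>In the union of bases of the two factors the matrix is block diagonal.\<close>

lemma lin_det_map_prod:
  fixes f :: "'e::fin_dim_inner \<Rightarrow> 'e" and g :: "'f::fin_dim_inner \<Rightarrow> 'f"
  assumes f: "linear f" and g: "linear g"
  shows "lin_det (map_prod f g) = lin_det f * lin_det g"
proof -
  obtain A :: "'e set" where A: "is_basis A" using basis_exists_fin_dim by blast
  obtain B :: "'f set" where B: "is_basis B" using basis_exists_fin_dim by blast
  obtain a where a: "bij_betw a {0..<card A} A" using A ex_bij_betw_nat_finite by (auto simp: is_basis_def)
  obtain b where b: "bij_betw b {0..<card B} B" using B ex_bij_betw_nat_finite by (auto simp: is_basis_def)
  define n where "n = card A"
  define m where "m = card B"
  have a: "enumerates n a A" and b: "enumerates m b B" using A B a b by (auto simp: enumerates_def n_def m_def)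
  define c where "c i = (if i < n then (a i, 0) else (0, b (i - n)))" for i
  let ?C = "c ` {0..<n + m}"
  have sum_c: "(\<Sum>i=0..<n + m. x i *\<^sub>R c i) = ((\<Sum>i=0..<n. x i *\<^sub>R a i), (\<Sum>j=0..<m. x (n + j) *\<^sub>R b j))" for x
  proof -
    have "(\<Sum>i=0..<n + m. x i *\<^sub>R c i) = (\<Sum>i=0..<n. x i *\<^sub>R c i) + (\<Sum>i=n..<n + m. x i *\<^sub>R c i)"
      by (simp add: sum.atLeastLessThan_concat)
    also have "(\<Sum>i=n..<n + m. x i *\<^sub>R c i) = (\<Sum>j=0..<m. x (n + j) *\<^sub>R c (n + j))"
      using sum.shift_bounds_nat_ivl[of "\<lambda>i. x i *\<^sub>R c i" 0 n m] by (simp add: add.commute)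
    also have "(\<Sum>j=0..<m. x (n + j) *\<^sub>R c (n + j)) = (0, (\<Sum>j=0..<m. x (n + j) *\<^sub>R b j))"
      by (simp add: c_def prod_eq_iff fst_sum snd_sum)
    also have "(\<Sum>i=0..<n. x i *\<^sub>R c i) = ((\<Sum>i=0..<n. x i *\<^sub>R a i), 0)"
      by (simp add: c_def prod_eq_iff fst_sum snd_sum)
    finally show ?thesis by simp
  qed
  have zero_a: "x i = 0" if "(\<Sum>i=0..<n. x i *\<^sub>R a i) = 0" "i < n" for x i
    using enumerates_representation[OF a that(2), of x] that(1) by (simp add: representation_zero)
  have zero_b: "x i = 0" if "(\<Sum>i=0..<m. x i *\<^sub>R b i) = 0" "i < m" for x i
    using enumerates_representation[OF b that(2), of x] that(1) by (simp add: representation_zero)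
  have nz: "a i \<noteq> 0" if "i < n" for i
    using a that dependent_zero[of A] by (auto simp: enumerates_def is_basis_def bij_betw_def)
  have nz': "b i \<noteq> 0" if "i < m" for i
    using b that dependent_zero[of B] by (auto simp: enumerates_def is_basis_def bij_betw_def)
  have inj: "inj_on c {0..<n + m}"
  proof (rule inj_onI)
    fix i j assume ij: "i \<in> {0..<n + m}" "j \<in> {0..<n + m}" "c i = c j"
    have i: "inj_on a {0..<n}" "inj_on b {0..<m}" using a b by (auto simp: enumerates_def bij_betw_def)
    consider "i < n" "j < n" | "i < n" "\<not> j < n" | "\<not> i < n" "j < n" | "\<not> i < n" "\<not> j < n" by blast
    then show "i = j"
    proof cases
      case 1 then show ?thesis using ij i(1) by (simp add: c_def inj_on_def)
    next
      case 4
      then have "b (i - n) = b (j - n)" "i - n < m" "j - n < m" using ij by (auto simp: c_def)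
      then have "i - n = j - n" using i(2) by (simp add: inj_on_def)
      then show ?thesis using 4 by simp
    qed (use ij nz[of i] nz[of j] in \<open>auto simp: c_def\<close>)
  qed
  have indep: "independent ?C"
  proof
    assume "dependent ?C"
    then obtain u v where u: "v \<in> ?C" "u v \<noteq> 0" "(\<Sum>v\<in>?C. u v *\<^sub>R v) = 0"
      unfolding dependent_finite[OF finite_imageI[OF finite_atLeastLessThan]] by blast
    have "(\<Sum>i=0..<n + m. u (c i) *\<^sub>R c i) = 0"
      using u(3) by (simp add: sum.reindex[OF inj])
    then have z: "(\<Sum>i=0..<n. u (c i) *\<^sub>R a i) = 0" "(\<Sum>j=0..<m. u (c (n + j)) *\<^sub>R b j) = 0"
      using sum_c[of "\<lambda>i. u (c i)"] by (simp_all add: prod_eq_iff)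
    obtain i where i: "i < n + m" "v = c i" using u(1) by auto
    show False
      using zero_a[OF z(1), of i] zero_b[OF z(2), of "i - n"] i u(2) by (cases "i < n") auto
  qed
  have "v \<in> span ?C" for v
  proof -
    let ?x = "\<lambda>i. if i < n then representation A (fst v) (a i) else representation B (snd v) (b (i - n))"
    have "v = (\<Sum>i=0..<n + m. ?x i *\<^sub>R c i)"
      using enumerates_expansion[OF a, of "fst v"] enumerates_expansion[OF b, of "snd v"]
      by (subst sum_c) simp
    also have "\<dots> \<in> span ?C" by (intro span_sum span_scale span_base) auto
    finally show ?thesis .
  qed
  then have c: "enumerates (n + m) c ?C"
    using indep inj by (auto simp: enumerates_def is_basis_def bij_betw_def)
  have lin: "linear (map_prod f g)"
    by (rule linearI) (auto simp: map_prod_def case_prod_unfold linear_add[OF f] linear_add[OF g] linear_cmul[OF f] linear_cmul[OF g])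
  let ?Mf = "matrix_of n a a A f" and ?Mg = "matrix_of m b b B g"
  have cm: "?Mf \<in> carrier_mat n n" "?Mg \<in> carrier_mat m m" by (auto simp: matrix_of_def)
  have "matrix_of (n + m) c c ?C (map_prod f g) = four_block_mat ?Mf (0\<^sub>m n m) (0\<^sub>m m n) ?Mg"
  proof (rule eq_matI)
    fix i j assume "i < dim_row (four_block_mat ?Mf (0\<^sub>m n m) (0\<^sub>m m n) ?Mg)"
      "j < dim_col (four_block_mat ?Mf (0\<^sub>m n m) (0\<^sub>m m n) ?Mg)"
    then have ij: "i < n + m" "j < n + m" by (auto simp: matrix_of_def)
    let ?x = "\<lambda>j. four_block_mat ?Mf (0\<^sub>m n m) (0\<^sub>m m n) ?Mg $$ (i, j)"
    have "map_prod f g (c i) = (\<Sum>j=0..<n + m. ?x j *\<^sub>R c j)"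
    proof (cases "i < n")
      case True
      then have "(\<Sum>j=0..<n. ?x j *\<^sub>R a j) = (\<Sum>j=0..<n. representation A (f (a i)) (a j) *\<^sub>R a j)"
        "(\<Sum>j=0..<m. ?x (n + j) *\<^sub>R b j) = 0"
        by (auto simp: matrix_of_def)
      then show ?thesis using True by (subst sum_c) (simp add: c_def enumerates_expansion[OF a] linear_0[OF g])
    next
      case False
      then have "(\<Sum>j=0..<n. ?x j *\<^sub>R a j) = 0"
        "(\<Sum>j=0..<m. ?x (n + j) *\<^sub>R b j) = (\<Sum>j=0..<m. representation B (g (b (i - n))) (b j) *\<^sub>R b j)"
        using ij by (auto simp: matrix_of_def)
      then show ?thesis using False by (subst sum_c) (simp add: c_def enumerates_expansion[OF b] linear_0[OF f])
    qed
    then show "matrix_of (n + m) c c ?C (map_prod f g) $$ (i, j) = ?x j"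
      using ij enumerates_representation[OF c ij(2), of ?x] by (simp add: matrix_of_def)
  qed (auto simp: matrix_of_def)
  then show ?thesis
    using det_four_block_mat_lower_left_zero[OF cm(1) _ refl cm(2), of "0\<^sub>m n m"]
    by (simp add: lin_det_eq_det[OF c lin] lin_det_eq_det[OF a f] lin_det_eq_det[OF b g])
qed

text \<open>The signs of the factors multiply, and so do the determinants of the coordinate
  changes.\<close>

lemma orientation_prod:
  assumes M: "smooth_atlas M" and N: "smooth_atlas N" and s: "orientation M s" and r: "orientation N r"
  shows "orientation (prod_manifold M N) (\<lambda>(x, y). s x * r y)"
  unfolding orientation_def
proof (intro conjI allI ballI)
  fix p :: "'a \<times> 'c"
  show "(case p of (x, y) \<Rightarrow> s x * r y) = 1 \<or> (case p of (x, y) \<Rightarrow> s x * r y) = - 1"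
  proof -
    obtain x y where p: "p = (x, y)" by fastforce
    have "s x = 1 \<or> s x = - 1" "r y = 1 \<or> r y = - 1" using s r unfolding orientation_def by blast+
    then show ?thesis by (auto simp: p)
  qed
next
  fix e assume "e \<in> atlas (prod_manifold M N)"
  then obtain c d where e: "e = prod_chart c d" and c: "c \<in> atlas M" and d: "d \<in> atlas N"
    by (rule prod_atlas_cases)
  have 1: "continuous_on (fst c) (\<lambda>x. s x * sgn (lin_det (components M c x)))"
    "continuous_on (fst d) (\<lambda>x. r x * sgn (lin_det (components N d x)))"
    using s r c d by (auto simp: orientation_def)
  have "continuous_on (fst c \<times> fst d) (\<lambda>p. (s (fst p) * sgn (lin_det (components M c (fst p)))) *
      (r (snd p) * sgn (lin_det (components N d (snd p)))))"
    by (intro continuous_on_mult continuous_on_compose2[OF 1(1)] continuous_on_compose2[OF 1(2)]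
        continuous_on_fst continuous_on_snd continuous_on_id) auto
  then show "continuous_on (fst e) (\<lambda>p. (case p of (x, y) \<Rightarrow> s x * r y) *
      sgn (lin_det (components (prod_manifold M N) e p)))"
    unfolding e fst_prod_chart
  proof (rule continuous_on_eq)
    fix p assume "p \<in> fst c \<times> fst d"
    then obtain x y where p: "p = (x, y)" "x \<in> fst c" "y \<in> fst d" by auto
    have "components (prod_manifold M N) (prod_chart c d) p = map_prod (components M c x) (components N d y)"
      using components_prod[OF M N c p(2) d p(3)] by (auto simp: p(1))
    then show "s (fst p) * sgn (lin_det (components M c (fst p))) * (r (snd p) * sgn (lin_det (components N d (snd p)))) =
      (case p of (x, y) \<Rightarrow> s x * r y) * sgn (lin_det (components (prod_manifold M N) (prod_chart c d) p))"
      using p by (simp add: lin_det_map_prod linear_components[OF M c] linear_components[OF N d] sgn_mult)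
  qed
qed

section \<open>Lie groups\<close>

lemma lie_group_smooth_atlas: "lie_group G \<Longrightarrow> smooth_atlas (mfd G)"
  by (simp add: lie_group_def smooth_manifold_atlas)

text \<open>The Lie algebra is the tangent space at the identity, so it is the preferred chart at the
  identity that has to be used as coordinate system.\<close>

definition gcoord :: "('g, 'e) lie_group_data \<Rightarrow> 'g \<Rightarrow> 'e" where
  "gcoord G = snd (chart_at (mfd G) (gone G))"

definition gpoint :: "('g, 'e) lie_group_data \<Rightarrow> 'e \<Rightarrow> 'g" where
  "gpoint G = chart_inv (chart_at (mfd G) (gone G))"

abbreviation gorigin :: "('g, 'e) lie_group_data \<Rightarrow> 'e" where
  "gorigin G \<equiv> gcoord G (gone G)"

definition mult_rep :: "('g, 'e) lie_group_data \<Rightarrow> 'e \<times> 'e \<Rightarrow> 'e" where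
  "mult_rep G p = gcoord G (gmult G (gpoint G (fst p)) (gpoint G (snd p)))"

definition inv_rep :: "('g, 'e) lie_group_data \<Rightarrow> 'e \<Rightarrow> 'e" where
  "inv_rep G z = gcoord G (ginv G (gpoint G z))"

text \<open>The second-order part of the group law at the identity. Its antisymmetrisation is the Lie
  bracket.\<close>

definition mult_hess :: "('g, 'e::real_normed_vector) lie_group_data \<Rightarrow> 'e \<Rightarrow> 'e \<Rightarrow> 'e" where
  "mult_hess G a b = D2 (mult_rep G) (gorigin G, gorigin G) (a, 0) (0, b)"

lemma smooth_near_Pair_const:
  "smooth_near (\<lambda>p. (p, c)) x" "smooth_near (\<lambda>p. (c, p)) x"
  "D (\<lambda>p. (p, c)) x v = (v, 0)" "D (\<lambda>p. (c, p)) x v = (0, v)"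
  "D2 (\<lambda>p. (p, c)) x u v = 0" "D2 (\<lambda>p. (c, p)) x u v = 0"
  by (auto intro: smooth_near_Pair simp: D_Pair D2_Pair D2_bounded_linear[OF bounded_linear_ident] zero_prod_def)

context
  fixes G :: "('g::{t2_space, second_countable_topology}, 'e::fin_dim_inner) lie_group_data"
  assumes G: "lie_group G"
begin

lemma group_atlas: "smooth_atlas (mfd G)"
  by (rule lie_group_smooth_atlas[OF G])

lemma group_square_atlas: "smooth_atlas (prod_manifold (mfd G) (mfd G))"
  by (rule smooth_atlas_prod[OF group_atlas group_atlas])

lemma group_laws:
  "gmult G (gmult G a b) c = gmult G a (gmult G b c)" "gmult G (gone G) a = a" "gmult G a (gone G) = a"
  "gmult G (ginv G a) a = gone G" "gmult G a (ginv G a) = gone G"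
  "ginv G (gmult G a b) = gmult G (ginv G b) (ginv G a)" "ginv G (ginv G a) = a" "ginv G (gone G) = gone G"
  "gmult G a (gmult G (ginv G a) b) = b" "gmult G (ginv G a) (gmult G a b) = b"
proof -
  interpret Group.group "grp G" using G by (simp add: lie_group_def)
  have c: "x \<in> carrier (grp G)" for x using G by (simp add: lie_group_def)
  note c [simp]
  show "gmult G (gmult G a b) c = gmult G a (gmult G b c)" by (rule m_assoc) auto
  show "gmult G (gone G) a = a" "gmult G a (gone G) = a" "gmult G (ginv G a) a = gone G"
    "gmult G a (ginv G a) = gone G" "ginv G (ginv G a) = a" "ginv G (gone G) = gone G" by auto
  show "ginv G (gmult G a b) = gmult G (ginv G b) (ginv G a)" by (rule inv_mult_group) auto
  show "gmult G a (gmult G (ginv G a) b) = b" "gmult G (ginv G a) (gmult G a b) = b"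
    by (simp_all add: m_assoc[symmetric] del: m_assoc)
qed

lemma smooth_gmult:
  assumes M: "smooth_atlas M" and f: "smooth_at M (mfd G) f x" and g: "smooth_at M (mfd G) g x"
  shows "smooth_at M (mfd G) (\<lambda>y. gmult G (f y) (g y)) x"
proof -
  have "smooth_at (prod_manifold (mfd G) (mfd G)) (mfd G) (\<lambda>(a, b). gmult G a b) (f x, g x)"
    using G smooth_map_on_iff[OF group_square_atlas group_atlas] by (auto simp: lie_group_def)
  from smooth_at_compose[OF M group_square_atlas group_atlas this smooth_at_Pair_mderiv(1)[OF group_atlas group_atlas M f g]] show ?thesis by simp
qed

lemma smooth_ginv:
  assumes M: "smooth_atlas M" and f: "smooth_at M (mfd G) f x"
  shows "smooth_at M (mfd G) (\<lambda>y. ginv G (f y)) x"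
proof -
  have "smooth_at (mfd G) (mfd G) (ginv G) (f x)"
    using G smooth_map_on_iff[OF group_atlas group_atlas] by (auto simp: lie_group_def)
  from smooth_at_compose[OF M group_atlas group_atlas this f] show ?thesis .
qed

lemma smooth_gconst: "smooth_atlas M \<Longrightarrow> smooth_at M (mfd G) (\<lambda>y. a) x"
  by (rule smooth_at_const[OF _ group_atlas])

lemma smooth_gident: "smooth_at (mfd G) (mfd G) (\<lambda>h. h) x"
  by (rule smooth_at_ident[OF group_atlas])

lemmas gsmooth = smooth_gmult smooth_ginv smooth_gconst smooth_gident

subsection \<open>The group law in coordinates\<close>

lemma gpoint_gorigin: "gpoint G (gorigin G) = gone G"
  by (simp add: gpoint_def gcoord_def chart_inv_chart[OF group_atlas] group_atlas)

lemma eventually_gpoint_gcoord: "eventually (\<lambda>h. gpoint G (gcoord G h) = h) (nhds (gone G))"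
  using eventually_chart_domain[OF group_atlas chart_at[OF group_atlas]]
  by eventually_elim (simp add: gpoint_def gcoord_def chart_inv_chart[OF group_atlas] group_atlas)

lemma eventually_gcoord_gpoint: "eventually (\<lambda>z. gcoord G (gpoint G z) = z) (nhds (gorigin G))"
  unfolding gpoint_def gcoord_def by (rule eventually_chart_chart_inv[OF group_atlas chart_at[OF group_atlas]])

lemma smooth_gcoord:
  assumes M: "smooth_atlas M" and f: "smooth_at M (mfd G) f x" "f x = gone G"
  shows "smooth_at M vector_manifold (\<lambda>y. gcoord G (f y)) x"
  using smooth_at_compose[OF M group_atlas smooth_atlas_vector, of "gcoord G" f x] f
    chart_smooth[OF group_atlas chart_at[OF group_atlas], of "gone G"] by (simp add: gcoord_def)

lemma smooth_gpoint:
  assumes M: "smooth_atlas M" and f: "smooth_at M vector_manifold f x" "f x = gorigin G"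
  shows "smooth_at M (mfd G) (\<lambda>y. gpoint G (f y)) x"
  using smooth_at_compose[OF M smooth_atlas_vector group_atlas, of "gpoint G" f x] f
    chart_inv_smooth[OF group_atlas chart_at[OF group_atlas], of "gone G"] by (simp add: gcoord_def gpoint_def)

lemma mderiv_at_one: "f x = gone G \<Longrightarrow> mderiv M (mfd G) f x = mderiv M vector_manifold (\<lambda>y. gcoord G (f y)) x"
  by (simp add: mderiv_eq_D gcoord_def)

lemma mderiv_from_one: "mderiv (mfd G) vector_manifold f (gone G) = D (\<lambda>z. f (gpoint G z)) (gorigin G)"
  by (simp add: mderiv_eq_D gcoord_def gpoint_def)

lemma smooth_mult_rep: "smooth_near (mult_rep G) (gorigin G, gorigin G)"
proof -
  have 1: "smooth_at vector_manifold (mfd G) (\<lambda>p. gpoint G (fst p)) (gorigin G, gorigin G)"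
    "smooth_at vector_manifold (mfd G) (\<lambda>p. gpoint G (snd p)) (gorigin G, gorigin G)"
    by (rule smooth_gpoint; simp add: smooth_at_vector_vector)+
  show ?thesis
    using smooth_gcoord[OF smooth_atlas_vector smooth_gmult[OF smooth_atlas_vector 1]]
    by (simp add: gpoint_gorigin group_laws smooth_at_vector_vector mult_rep_def[abs_def])
qed

lemma mult_rep_gorigin: "mult_rep G (gorigin G, gorigin G) = gorigin G"
  by (simp add: mult_rep_def gpoint_gorigin group_laws)

lemma mult_rep_unit:
  "eventually (\<lambda>p. mult_rep G (p, gorigin G) = p) (nhds (gorigin G))"
  "eventually (\<lambda>p. mult_rep G (gorigin G, p) = p) (nhds (gorigin G))"
  using eventually_gcoord_gpoint
  by (auto simp: mult_rep_def gpoint_gorigin group_laws elim: eventually_mono)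

lemma D_mult_rep: "D (mult_rep G) (gorigin G, gorigin G) (a, b) = a + b"
proof -
  note s = smooth_mult_rep
  have 1: "D (mult_rep G) (gorigin G, gorigin G) (a, 0) = a"
    using D_compose[OF smooth_near_Pair_const(1), of "mult_rep G" "gorigin G" "gorigin G" a] s
      D_cong_ev[OF mult_rep_unit(1)] by (simp add: smooth_near_Pair_const)
  have 2: "D (mult_rep G) (gorigin G, gorigin G) (0, b) = b"
    using D_compose[OF smooth_near_Pair_const(2), of "mult_rep G" "gorigin G" "gorigin G" b] s
      D_cong_ev[OF mult_rep_unit(2)] by (simp add: smooth_near_Pair_const)
  have "D (mult_rep G) (gorigin G, gorigin G) ((a, 0) + (0, b)) = a + b"
    by (simp only: linear_add[OF linear_D[OF s]] 1 2)
  then show ?thesis by simp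
qed

text \<open>Multiplying by the identity is the identity map, so only mixed second derivatives
  survive.\<close>

lemma D2_mult_rep_pure:
  "D2 (mult_rep G) (gorigin G, gorigin G) (a, 0) (b, 0) = 0"
  "D2 (mult_rep G) (gorigin G, gorigin G) (0, a) (0, b) = 0"
proof -
  note s = smooth_mult_rep
  show "D2 (mult_rep G) (gorigin G, gorigin G) (a, 0) (b, 0) = 0"
    using D2_compose[OF smooth_near_Pair_const(1), of "mult_rep G" "gorigin G" "gorigin G" a b] s
      D2_cong_ev[OF mult_rep_unit(1)]
    by (simp add: smooth_near_Pair_const D2_bounded_linear[OF bounded_linear_ident] linear_0[OF linear_D])
  show "D2 (mult_rep G) (gorigin G, gorigin G) (0, a) (0, b) = 0"
    using D2_compose[OF smooth_near_Pair_const(2), of "mult_rep G" "gorigin G" "gorigin G" a b] s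
      D2_cong_ev[OF mult_rep_unit(2)]
    by (simp add: smooth_near_Pair_const D2_bounded_linear[OF bounded_linear_ident] linear_0[OF linear_D])
qed

lemma D2_mult_rep:
  "D2 (mult_rep G) (gorigin G, gorigin G) (a, b) (c, d) = mult_hess G a d + mult_hess G c b"
proof -
  note s = smooth_mult_rep
  have "D2 (mult_rep G) (gorigin G, gorigin G) ((a, 0) + (0, b)) ((c, 0) + (0, d))
     = mult_hess G a d + D2 (mult_rep G) (gorigin G, gorigin G) (0, b) (c, 0)"
    by (simp only: linear_add[OF D2_linear_left[OF s]] linear_add[OF D2_linear_right[OF s]]
        D2_mult_rep_pure mult_hess_def) simp
  then show ?thesis by (simp add: D2_symmetric[OF s, of "(0, b)"] mult_hess_def)
qed

lemma linear_mult_hess: "linear (\<lambda>a. mult_hess G a b)" "linear (mult_hess G a)"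
proof -
  have 1: "linear (\<lambda>a::'e. (a, 0::'e))" "linear (\<lambda>b::'e. (0::'e, b))" by (auto intro!: linearI)
  show "linear (\<lambda>a. mult_hess G a b)" unfolding mult_hess_def
    using linear_compose[OF 1(1) D2_linear_left[OF smooth_mult_rep]] by (simp add: o_def)
  show "linear (mult_hess G a)" unfolding mult_hess_def
    using linear_compose[OF 1(2) D2_linear_right[OF smooth_mult_rep]] by (simp add: o_def)
qed

text \<open>In coordinates the right-invariant field of \<open>w\<close> is \<open>y \<mapsto> D \<mu>
  (e, y) (w, 0)\<close> for the group law \<open>\<mu>\<close>. Its derivative at \<open>e\<close> is a
  mixed second derivative of \<open>\<mu>\<close>.\<close>

lemma lie_bracket_eq: "lie_bracket G u v = mult_hess G v u - mult_hess G u v"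
proof -
  let ?e = "gorigin G"
  let ?R = "\<lambda>w a. mderiv (mfd G) (mfd G) (\<lambda>h. gmult G h a) (gone G) w"
  have sm: "smooth_at (mfd G) (mfd G) (\<lambda>h. gmult G h a) h" for a h by (intro gsmooth group_atlas)
  have R1: "?R w (gone G) = w" for w by (simp add: group_laws mderiv_ident[OF group_atlas])
  have rep: "eventually (\<lambda>y. field_rep (mfd G) (chart_at (mfd G) (gone G)) (?R w) y
      = D (mult_rep G) (?e, y) (w, 0)) (nhds ?e)" for w
  proof -
    have dom: "eventually (\<lambda>y. gpoint G y \<in> fst (chart_at (mfd G) (gone G))) (nhds ?e)"
      unfolding gpoint_def gcoord_def
      by (rule eventually_chart_inv[OF group_atlas chart_at[OF group_atlas] eventually_chart_domain[OF group_atlas chart_at[OF group_atlas]]])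
    have "eventually (\<lambda>y. smooth_near (mult_rep G) (?e, y)) (nhds ?e)"
      by (rule isCont_eventually[OF smooth_near_isCont[OF smooth_near_Pair_const(2)]
            smooth_near_eventually[OF smooth_mult_rep]])
    then show ?thesis using dom
    proof eventually_elim
      case (elim y)
      let ?c = "chart_at (mfd G) (gone G)"
      have c: "gpoint G y \<in> fst ?c" "?c \<in> atlas (mfd G)" using elim group_atlas by auto
      have "field_rep (mfd G) ?c (?R w) y =
          mderiv (mfd G) vector_manifold (\<lambda>h. snd ?c (gmult G h (gpoint G y))) (gone G) w"
        unfolding field_rep_def components_eq[OF group_atlas] gpoint_def[symmetric]
        using mderiv_compose[OF group_atlas group_atlas smooth_atlas_vector, of "snd ?c" "\<lambda>h. gmult G h (gpoint G y)" "gone G" w]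
          chart_smooth[OF group_atlas c(2,1)] sm by (simp add: group_laws)
      also have "\<dots> = D (\<lambda>z. mult_rep G (z, y)) ?e w"
        unfolding mderiv_from_one by (simp add: mult_rep_def gcoord_def)
      also have "\<dots> = D (mult_rep G) (?e, y) (w, 0)"
        using D_compose[OF smooth_near_Pair_const(1), of "mult_rep G" ?e y w] elim(1)
        by (simp add: smooth_near_Pair_const)
      finally show ?case .
    qed
  qed
  have "D (field_rep (mfd G) (chart_at (mfd G) (gone G)) (?R w)) ?e u = mult_hess G w u" for w u
  proof -
    have "D (field_rep (mfd G) (chart_at (mfd G) (gone G)) (?R w)) ?e u
        = D (\<lambda>y. D (mult_rep G) (?e, y) (w, 0)) ?e u"
      by (rule fun_cong[OF D_cong_ev[OF rep]])
    also have "\<dots> = mult_hess G w u"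
      using D_D_apply[OF smooth_near_Pair_const(2) smooth_mult_rep, of "\<lambda>_. (w, 0)" u]
      by (simp add: smooth_near_Pair_const D2_mult_rep linear_0[OF linear_mult_hess(1)]
          linear_0[OF linear_D[OF smooth_mult_rep], unfolded zero_prod_def] zero_prod_def[symmetric]
          linear_0[OF linear_D[OF smooth_mult_rep]])
    finally show ?thesis .
  qed
  then show ?thesis
    unfolding lie_bracket_def field_bracket_def Let_def gcoord_def[symmetric] R1 by simp
qed

lemma smooth_inv_rep: "smooth_near (inv_rep G) (gorigin G)"
  and inv_rep_gorigin: "inv_rep G (gorigin G) = gorigin G"
proof -
  have "smooth_at vector_manifold (mfd G) (\<lambda>z. gpoint G z) (gorigin G)"
    by (rule smooth_gpoint; simp add: smooth_at_vector_vector)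
  from smooth_gcoord[OF smooth_atlas_vector smooth_ginv[OF smooth_atlas_vector this]]
  show "smooth_near (inv_rep G) (gorigin G)"
    by (simp add: gpoint_gorigin group_laws smooth_at_vector_vector inv_rep_def[abs_def])
  show "inv_rep G (gorigin G) = gorigin G" by (simp add: inv_rep_def gpoint_gorigin group_laws)
qed

lemma eventually_gpoint_inv_rep:
  "eventually (\<lambda>z. gpoint G (inv_rep G z) = ginv G (gpoint G z)) (nhds (gorigin G))"
proof -
  have "smooth_at vector_manifold (mfd G) (\<lambda>z. gpoint G z) (gorigin G)"
    by (rule smooth_gpoint; simp add: smooth_at_vector_vector)
  from smooth_at_pull_eventually[OF smooth_ginv[OF smooth_atlas_vector this], of "\<lambda>h. gpoint G (gcoord G h) = h"]
  show ?thesis using eventually_gpoint_gcoord by (simp add: gpoint_gorigin group_laws inv_rep_def)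
qed

text \<open>From \<open>p p\<^sup>-\<^sup>1 = 1\<close>.\<close>

lemma D_inv_rep: "D (inv_rep G) (gorigin G) a = - a"
proof -
  let ?e = "gorigin G"
  have "D (\<lambda>z. mult_rep G (z, inv_rep G z)) ?e a = D (\<lambda>z. ?e) ?e a"
    by (rule fun_cong[OF D_cong_ev])
       (use eventually_gpoint_inv_rep in \<open>eventually_elim, simp add: mult_rep_def group_laws\<close>)
  moreover have "D (\<lambda>z. mult_rep G (z, inv_rep G z)) ?e a = a + D (inv_rep G) ?e a"
    using D_compose[OF smooth_near_Pair[OF smooth_near_ident smooth_inv_rep], of "mult_rep G" a]
    by (simp add: inv_rep_gorigin smooth_mult_rep D_Pair smooth_inv_rep D_mult_rep)
  ultimately show ?thesis by (simp add: eq_neg_iff_add_eq_0 add.commute)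
qed

subsection \<open>Derivatives of products and inverses\<close>

lemma mderiv_gmult_one:
  assumes M: "smooth_atlas M" and f: "smooth_at M (mfd G) f x" "f x = gone G"
    and g: "smooth_at M (mfd G) g x" "g x = gone G"
  shows "mderiv M (mfd G) (\<lambda>y. gmult G (f y) (g y)) x v = mderiv M (mfd G) f x v + mderiv M (mfd G) g x v"
proof -
  let ?c = "chart_at M x"
  have sf: "smooth_near (\<lambda>z. gcoord G (f (chart_inv ?c z))) (snd ?c x)"
    and sg: "smooth_near (\<lambda>z. gcoord G (g (chart_inv ?c z))) (snd ?c x)"
    using smooth_gcoord[OF M f] smooth_gcoord[OF M g] by (simp_all add: smooth_at_vector_charts[OF M chart_at[OF M]])
  have ev: "eventually (\<lambda>z. gpoint G (gcoord G (f (chart_inv ?c z))) = f (chart_inv ?c z)) (nhds (snd ?c x))"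
     "eventually (\<lambda>z. gpoint G (gcoord G (g (chart_inv ?c z))) = g (chart_inv ?c z)) (nhds (snd ?c x))"
    using eventually_gpoint_gcoord f g
    by (auto intro!: eventually_chart_inv[OF M chart_at[OF M]]
        smooth_at_pull_eventually[OF f(1)] smooth_at_pull_eventually[OF g(1)])
  have "mderiv M (mfd G) (\<lambda>y. gmult G (f y) (g y)) x v =
      D (\<lambda>z. mult_rep G (gcoord G (f (chart_inv ?c z)), gcoord G (g (chart_inv ?c z)))) (snd ?c x) v"
    unfolding mderiv_at_one[of "\<lambda>y. gmult G (f y) (g y)" x, unfolded f(2) g(2) group_laws, OF refl] mderiv_vector
    by (rule fun_cong[OF D_cong_ev]) (use ev in \<open>eventually_elim, simp add: mult_rep_def\<close>)
  also have "\<dots> = D (\<lambda>z. gcoord G (f (chart_inv ?c z))) (snd ?c x) v + D (\<lambda>z. gcoord G (g (chart_inv ?c z))) (snd ?c x) v"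
    using D_compose[OF smooth_near_Pair[OF sf sg], of "mult_rep G" v] f(2) g(2)
    by (simp add: chart_inv_chart[OF M chart_at[OF M]] smooth_mult_rep D_Pair[OF sf sg] D_mult_rep)
  finally show ?thesis
    by (simp add: mderiv_at_one[of f, OF f(2)] mderiv_at_one[of g, OF g(2)] mderiv_vector)
qed

lemma mderiv_ginv_one:
  assumes M: "smooth_atlas M" and f: "smooth_at M (mfd G) f x" "f x = gone G"
  shows "mderiv M (mfd G) (\<lambda>y. ginv G (f y)) x v = - mderiv M (mfd G) f x v"
  using mderiv_gmult_one[OF M f smooth_ginv[OF M f(1)], of v] f(2)
  by (simp add: group_laws mderiv_const eq_neg_iff_add_eq_0 add.commute)

subsection \<open>The adjoint action and the Maurer--Cartan forms\<close>

lemma smooth_conj: "smooth_at (mfd G) (mfd G) (\<lambda>h. gmult G (gmult G a h) (ginv G a)) h"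
  by (intro gsmooth group_atlas)

lemma linear_Ad: "linear (Ad G a)"
  unfolding Ad_def by (rule linear_mderiv[OF group_atlas group_atlas smooth_conj])

lemma mderiv_conj:
  assumes M: "smooth_atlas M" and f: "smooth_at M (mfd G) f x" "f x = gone G"
  shows "mderiv M (mfd G) (\<lambda>y. gmult G (gmult G a (f y)) (ginv G a)) x v = Ad G a (mderiv M (mfd G) f x v)"
  unfolding Ad_def
  using mderiv_compose[OF M group_atlas group_atlas, of "\<lambda>h. gmult G (gmult G a h) (ginv G a)" f x v] smooth_conj f by simp

lemma Ad_one: "Ad G (gone G) v = v"
  by (simp add: Ad_def group_laws mderiv_ident[OF group_atlas])

lemma Ad_mult: "Ad G (gmult G a b) v = Ad G a (Ad G b v)"
  using mderiv_conj[OF group_atlas smooth_conj, of b "gone G" a v]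
  by (simp add: Ad_def group_laws)

lemma Ad_inv: "Ad G a (Ad G (ginv G a) v) = v" "Ad G (ginv G a) (Ad G a v) = v"
  by (simp_all add: Ad_mult[symmetric] group_laws Ad_one)

text \<open>The value of a Maurer--Cartan form on the derivative of \<open>f\<close> is the derivative
  of a map that passes through the identity. The derivatives of such maps add up under products.\<close>

lemma theta_l_mderiv:
  assumes M: "smooth_atlas M" and f: "smooth_at M (mfd G) f x"
  shows "theta_l G (f x) (mderiv M (mfd G) f x v) = mderiv M (mfd G) (\<lambda>y. gmult G (ginv G (f x)) (f y)) x v"
  unfolding theta_l_def
  by (rule mderiv_compose[symmetric, OF M group_atlas group_atlas _ f]) (intro gsmooth group_atlas)

lemma theta_r_mderiv:
  assumes M: "smooth_atlas M" and f: "smooth_at M (mfd G) f x"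
  shows "theta_r G (f x) (mderiv M (mfd G) f x v) = mderiv M (mfd G) (\<lambda>y. gmult G (f y) (ginv G (f x))) x v"
  unfolding theta_r_def
  by (rule mderiv_compose[symmetric, OF M group_atlas group_atlas _ f, of "\<lambda>h. gmult G h (ginv G (f x))"]) (intro gsmooth group_atlas)

lemma linear_theta_l: "linear (theta_l G a)" and linear_theta_r: "linear (theta_r G a)"
  unfolding theta_l_def theta_r_def by (intro linear_mderiv gsmooth group_atlas)+

lemma theta_r_eq_Ad: "theta_r G a w = Ad G a (theta_l G a w)"
proof -
  have s: "smooth_at (mfd G) (mfd G) (\<lambda>h. gmult G (ginv G a) h) a" by (intro gsmooth group_atlas)
  show ?thesis
    using mderiv_conj[OF group_atlas s, of a w] by (simp add: theta_l_def theta_r_def group_laws)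
qed

lemma theta_l_eq_0_iff: "theta_l G a w = 0 \<longleftrightarrow> w = 0"
proof
  assume "theta_l G a w = 0"
  moreover have "mderiv (mfd G) (mfd G) (\<lambda>h. gmult G a h) (gone G) (theta_l G a w) = w"
    unfolding theta_l_def
    using mderiv_compose[OF group_atlas group_atlas group_atlas, of "\<lambda>h. gmult G a h" "\<lambda>h. gmult G (ginv G a) h" a w]
    by (simp add: group_laws mderiv_ident[OF group_atlas] gsmooth group_atlas)
  moreover have "linear (mderiv (mfd G) (mfd G) (\<lambda>h. gmult G a h) (gone G))"
    by (intro linear_mderiv gsmooth group_atlas)
  ultimately show "w = 0" by (metis linear_0)
qed (simp add: linear_0[OF linear_theta_l])

text \<open>The map \<open>y \<mapsto> f(x)\<^sup>-\<^sup>1 f(y) g(y) g(x)\<^sup>-\<^sup>1\<close>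
  passes through the identity at \<open>x\<close>, where it has derivative
  \<open>f\<^sup>*\<theta>\<^sup>l + g\<^sup>*\<theta>\<^sup>r\<close>. Conjugating it by
  \<open>g(x)\<^sup>-\<^sup>1\<close> or by \<open>f(x)\<close> gives the maps whose derivatives are the
  two Maurer--Cartan forms on the product.\<close>

lemma theta_gmult:
  assumes M: "smooth_atlas M" and f: "smooth_at M (mfd G) f x" and g: "smooth_at M (mfd G) g x"
  defines "s \<equiv> \<lambda>v. theta_l G (f x) (mderiv M (mfd G) f x v) + theta_r G (g x) (mderiv M (mfd G) g x v)"
  shows "theta_l G (gmult G (f x) (g x)) (mderiv M (mfd G) (\<lambda>y. gmult G (f y) (g y)) x v) = Ad G (ginv G (g x)) (s v)"
    "theta_r G (gmult G (f x) (g x)) (mderiv M (mfd G) (\<lambda>y. gmult G (f y) (g y)) x v) = Ad G (f x) (s v)"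
proof -
  let ?m = "\<lambda>y. gmult G (gmult G (ginv G (f x)) (f y)) (gmult G (g y) (ginv G (g x)))"
  have sm: "smooth_at M (mfd G) (\<lambda>y. gmult G (ginv G (f x)) (f y)) x"
    "smooth_at M (mfd G) (\<lambda>y. gmult G (g y) (ginv G (g x))) x"
    "smooth_at M (mfd G) (\<lambda>y. gmult G (f y) (g y)) x" "smooth_at M (mfd G) ?m x"
    by (intro gsmooth M f g)+
  have m: "mderiv M (mfd G) ?m x v = s v"
    unfolding s_def theta_l_mderiv[OF M f] theta_r_mderiv[OF M g]
    by (rule mderiv_gmult_one[OF M sm(1) _ sm(2)]) (simp_all add: group_laws)
  have m1: "?m x = gone G" by (simp add: group_laws)
  show "theta_l G (gmult G (f x) (g x)) (mderiv M (mfd G) (\<lambda>y. gmult G (f y) (g y)) x v) = Ad G (ginv G (g x)) (s v)"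
    using theta_l_mderiv[OF M sm(3), of v] mderiv_conj[OF M sm(4) m1, of "ginv G (g x)" v]
    by (simp add: m) (simp add: group_laws)
  show "theta_r G (gmult G (f x) (g x)) (mderiv M (mfd G) (\<lambda>y. gmult G (f y) (g y)) x v) = Ad G (f x) (s v)"
    using theta_r_mderiv[OF M sm(3), of v] mderiv_conj[OF M sm(4) m1, of "f x" v]
    by (simp add: m) (simp add: group_laws)
qed

text \<open>Conjugation by a fixed element commutes with forming \<open>f(x)\<^sup>-\<^sup>1
  f(y)\<close> and \<open>f(y) f(x)\<^sup>-\<^sup>1\<close>.\<close>

lemma theta_conj:
  assumes M: "smooth_atlas M" and f: "smooth_at M (mfd G) f x"
  shows "theta_l G (gmult G (gmult G a (f x)) (ginv G a))
       (mderiv M (mfd G) (\<lambda>y. gmult G (gmult G a (f y)) (ginv G a)) x v) = Ad G a (theta_l G (f x) (mderiv M (mfd G) f x v))"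
    "theta_r G (gmult G (gmult G a (f x)) (ginv G a))
       (mderiv M (mfd G) (\<lambda>y. gmult G (gmult G a (f y)) (ginv G a)) x v) = Ad G a (theta_r G (f x) (mderiv M (mfd G) f x v))"
proof -
  have sm: "smooth_at M (mfd G) (\<lambda>y. gmult G (ginv G (f x)) (f y)) x"
    "smooth_at M (mfd G) (\<lambda>y. gmult G (f y) (ginv G (f x))) x"
    "smooth_at M (mfd G) (\<lambda>y. gmult G (gmult G a (f y)) (ginv G a)) x"
    by (intro gsmooth M f)+
  show "theta_l G (gmult G (gmult G a (f x)) (ginv G a))
       (mderiv M (mfd G) (\<lambda>y. gmult G (gmult G a (f y)) (ginv G a)) x v) = Ad G a (theta_l G (f x) (mderiv M (mfd G) f x v))"
    using theta_l_mderiv[OF M sm(3), of v] mderiv_conj[OF M sm(1), of a v] theta_l_mderiv[OF M f, of v]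
    by (simp add: group_laws)
  show "theta_r G (gmult G (gmult G a (f x)) (ginv G a))
       (mderiv M (mfd G) (\<lambda>y. gmult G (gmult G a (f y)) (ginv G a)) x v) = Ad G a (theta_r G (f x) (mderiv M (mfd G) f x v))"
    using theta_r_mderiv[OF M sm(3), of v] mderiv_conj[OF M sm(2), of a v] theta_r_mderiv[OF M f, of v]
    by (simp add: group_laws)
qed

text \<open>Inversion exchanges the two forms up to sign, so facts about \<open>\<theta>\<^sup>r\<close>
  follow from those about \<open>\<theta>\<^sup>l\<close>.\<close>

lemma theta_r_eq_theta_l_inv:
  assumes M: "smooth_atlas M" and f: "smooth_at M (mfd G) f x"
  shows "theta_r G (f x) (mderiv M (mfd G) f x v)
    = - theta_l G (ginv G (f x)) (mderiv M (mfd G) (\<lambda>y. ginv G (f y)) x v)"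
proof -
  have sm: "smooth_at M (mfd G) (\<lambda>y. gmult G (f y) (ginv G (f x))) x" by (intro gsmooth M f)
  show ?thesis
    using theta_l_mderiv[OF M smooth_ginv[OF M f], of v] mderiv_ginv_one[OF M sm, of v] theta_r_mderiv[OF M f, of v]
    by (simp add: group_laws)
qed

subsection \<open>Invariance of the bracket and the inner product\<close>

lemma lie_bracket_linear: "linear (lie_bracket G u)" "linear (\<lambda>u. lie_bracket G u v)"
  unfolding lie_bracket_eq[abs_def] by (intro linear_compose_sub linear_mult_hess)+

lemma lie_bracket_antisym: "lie_bracket G u v = - lie_bracket G v u"
  by (simp add: lie_bracket_eq)

text \<open>Let \<open>c\<close> be conjugation by \<open>g\<close>. Differentiate \<open>c(p q) = c(p)
  c(q)\<close> once in \<open>p\<close> and once in \<open>q\<close>. The only other term, the second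
  derivative of \<open>c\<close>, is symmetric and drops out of the bracket.\<close>

lemma Ad_lie_bracket: "Ad G g (lie_bracket G a b) = lie_bracket G (Ad G g a) (Ad G g b)"
proof -
  let ?e = "gorigin G"
  define c where "c z = gcoord G (gmult G (gmult G g (gpoint G z)) (ginv G g))" for z
  have sp: "smooth_at vector_manifold (mfd G) (\<lambda>z. gpoint G z) ?e"
    by (rule smooth_gpoint; simp add: smooth_at_vector_vector)
  have smg: "smooth_at vector_manifold (mfd G) (\<lambda>z. gmult G (gmult G g (gpoint G z)) (ginv G g)) ?e"
    by (intro gsmooth sp smooth_atlas_vector)
  have sc: "smooth_near c ?e" and ce: "c ?e = ?e"
    using smooth_gcoord[OF smooth_atlas_vector smg]
    by (simp_all add: gpoint_gorigin group_laws smooth_at_vector_vector c_def[abs_def])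
  have Dc: "D c ?e v = Ad G g v" for v
    unfolding Ad_def using mderiv_at_one[of "\<lambda>h. gmult G (gmult G g h) (ginv G g)" "gone G" "mfd G"]
    by (simp add: group_laws mderiv_from_one c_def[abs_def])
  have evc: "eventually (\<lambda>z. gpoint G (c z) = gmult G (gmult G g (gpoint G z)) (ginv G g)) (nhds ?e)"
    using smooth_at_pull_eventually[OF smg, of "\<lambda>h. gpoint G (gcoord G h) = h"] eventually_gpoint_gcoord
    by (simp add: gpoint_gorigin group_laws c_def)
  have evp: "eventually (\<lambda>p. P (fst p)) (nhds (?e, ?e))" "eventually (\<lambda>p. P (snd p)) (nhds (?e, ?e))"
    if "eventually P (nhds ?e)" for P
    using isCont_eventually[OF smooth_near_isCont[OF smooth_near_fst], of P "(?e, ?e)"]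
      isCont_eventually[OF smooth_near_isCont[OF smooth_near_snd], of P "(?e, ?e)"] that by simp_all
  have evm: "eventually (\<lambda>p. gpoint G (mult_rep G p) = gmult G (gpoint G (fst p)) (gpoint G (snd p))) (nhds (?e, ?e))"
  proof -
    have 1: "smooth_at vector_manifold (mfd G) (\<lambda>p. gpoint G (fst p)) (?e, ?e)"
      "smooth_at vector_manifold (mfd G) (\<lambda>p. gpoint G (snd p)) (?e, ?e)"
      by (rule smooth_gpoint; simp add: smooth_at_vector_vector)+
    from smooth_at_pull_eventually[OF smooth_gmult[OF smooth_atlas_vector 1], of "\<lambda>h. gpoint G (gcoord G h) = h"]
    show ?thesis using eventually_gpoint_gcoord by (simp add: gpoint_gorigin group_laws mult_rep_def)
  qed
  let ?F = "\<lambda>p. (c (fst p), c (snd p))"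
  have sF1: "smooth_near (\<lambda>p. c (fst p)) (?e, ?e)" "smooth_near (\<lambda>p. c (snd p)) (?e, ?e)"
    by (rule smooth_near_compose[OF smooth_near_fst]; simp add: sc)
       (rule smooth_near_compose[OF smooth_near_snd]; simp add: sc)
  note sF = smooth_near_Pair[OF sF1]
  have DF: "D ?F (?e, ?e) (a, b) = (Ad G g a, Ad G g b)" for a b
    using D_compose[OF smooth_near_fst, of c "(?e, ?e)" "(a, b)"] D_compose[OF smooth_near_snd, of c "(?e, ?e)" "(a, b)"]
    by (simp add: D_Pair[OF sF1] sc Dc D_bounded_linear bounded_linear_fst bounded_linear_snd)
  have D2F: "D2 ?F (?e, ?e) (a, 0) (0, b) = 0" for a b
    using D2_compose[OF smooth_near_fst, of c "(?e, ?e)" "(a, 0)" "(0, b)"]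
      D2_compose[OF smooth_near_snd, of c "(?e, ?e)" "(a, 0)" "(0, b)"]
    by (simp add: D2_Pair[OF sF1] sc D_bounded_linear bounded_linear_fst bounded_linear_snd D2_bounded_linear
       linear_0[OF linear_D[OF sc]] linear_0[OF D2_linear_left[OF sc]] linear_0[OF D2_linear_right[OF sc]] zero_prod_def)
  have eq: "eventually (\<lambda>p. c (mult_rep G p) = mult_rep G (?F p)) (nhds (?e, ?e))"
    using evp(1)[OF evc] evp(2)[OF evc] evm
    by eventually_elim (simp add: c_def[of "mult_rep G _"] mult_rep_def[of G "(_, _)"] group_laws)
  have "Ad G g (mult_hess G a b) = mult_hess G (Ad G g a) (Ad G g b) - D2 c ?e a b" for a b
  proof -
    have "D2 (\<lambda>p. c (mult_rep G p)) (?e, ?e) (a, 0) (0, b) = D2 c ?e a b + Ad G g (mult_hess G a b)"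
      using D2_compose[OF smooth_mult_rep, of c "(a, 0)" "(0, b)"]
      by (simp add: mult_rep_gorigin sc D_mult_rep Dc mult_hess_def)
    moreover have "D2 (\<lambda>p. mult_rep G (?F p)) (?e, ?e) (a, 0) (0, b) = mult_hess G (Ad G g a) (Ad G g b)"
      using D2_compose[OF sF, of "mult_rep G" "(a, 0)" "(0, b)"]
      by (simp add: ce smooth_mult_rep DF D2F linear_0[OF linear_Ad] D2_mult_rep
          linear_0[OF linear_mult_hess(1)] linear_0[OF linear_D[OF smooth_mult_rep]])
    ultimately show ?thesis using D2_cong_ev[OF eq] by (metis add_diff_cancel_left')
  qed
  then show ?thesis
    by (simp add: lie_bracket_eq linear_diff[OF linear_Ad] D2_symmetric[OF sc, of a b])
qed

lemma ip_facts:
  "linear (ip G u)" "linear (\<lambda>u. ip G u v)" "ip G u v = ip G v u" "ip G (Ad G a u) (Ad G a v) = ip G u v"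
  "ip G u u = 0 \<longleftrightarrow> u = 0"
proof -
  have i: "\<forall>u. linear_functional_on UNIV (ip G u)" "\<And>u v. ip G u v = ip G v u"
    "\<forall>u. u \<noteq> 0 \<longrightarrow> ip G u u > 0" "\<forall>a u v. ip G (Ad G a u) (Ad G a v) = ip G u v"
    using G unfolding lie_group_def invariant_inner_product_def by blast+
  show 1: "linear (ip G u)" for u
    using i(1) by (intro linearI) (simp_all add: linear_functional_on_def)
  have "(\<lambda>u. ip G u v) = ip G v" using i(2) by auto
  then show "linear (\<lambda>u. ip G u v)" using 1 by simp
  show "ip G u v = ip G v u" by (rule i(2))
  show "ip G (Ad G a u) (Ad G a v) = ip G u v" using i(4) by blast
  show "ip G u u = 0 \<longleftrightarrow> u = 0" using i(3) linear_0[OF 1] by force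
qed

lemma bounded_bilinear_ip: "bounded_bilinear (ip G)"
  by (intro bilinear_imp_bounded_bilinear ip_facts)

text \<open>Differentiate the invariance of the inner product under \<open>Ad g\<close> at the identity.
  The derivative of \<open>g \<mapsto> Ad g u\<close> in the direction \<open>a\<close> is \<open>- [a,
  u]\<close>, because the bracket is that of right-invariant fields. It is found by differentiating
  \<open>(p q p\<^sup>-\<^sup>1) p = p q\<close>, which avoids second derivatives of the
  inverse.\<close>

lemma ip_lie_bracket: "ip G (lie_bracket G a u) v = - ip G u (lie_bracket G a v)"
proof -
  let ?e = "gorigin G"
  let ?n = "\<lambda>p. gmult G (gmult G (gpoint G (fst p)) (gpoint G (snd p))) (ginv G (gpoint G (fst p)))"
  define N where "N p = gcoord G (?n p)" for p
  have 1: "smooth_at vector_manifold (mfd G) (\<lambda>p. gpoint G (fst p)) (?e, ?e)"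
    "smooth_at vector_manifold (mfd G) (\<lambda>p. gpoint G (snd p)) (?e, ?e)"
    by (rule smooth_gpoint; simp add: smooth_at_vector_vector)+
  have sn: "smooth_at vector_manifold (mfd G) ?n (?e, ?e)" by (intro gsmooth 1 smooth_atlas_vector)
  have sN: "smooth_near N (?e, ?e)" and Ne: "N (?e, ?e) = ?e"
    using smooth_gcoord[OF smooth_atlas_vector sn]
    by (simp_all add: gpoint_gorigin group_laws smooth_at_vector_vector N_def[abs_def])
  have evn: "eventually (\<lambda>p. gpoint G (N p) = ?n p) (nhds (?e, ?e))"
    using smooth_at_pull_eventually[OF sn, of "\<lambda>h. gpoint G (gcoord G h) = h"] eventually_gpoint_gcoord
    by (simp add: gpoint_gorigin group_laws N_def)
  have DN1: "D N (?e, ?e) (a, 0) = 0" for a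
  proof -
    have "(\<lambda>p. N (p, ?e)) = (\<lambda>p. ?e)" by (simp add: N_def gpoint_gorigin group_laws)
    then show ?thesis
      using D_compose[OF smooth_near_Pair_const(1), of N ?e ?e a] sN by (simp add: smooth_near_Pair_const)
  qed
  have DN2: "eventually (\<lambda>p. \<forall>u. D N (p, ?e) (0, u) = Ad G (gpoint G p) u) (nhds ?e)"
  proof -
    have "eventually (\<lambda>p. smooth_near N (p, ?e)) (nhds ?e)"
      by (rule isCont_eventually[OF smooth_near_isCont[OF smooth_near_Pair_const(1)] smooth_near_eventually[OF sN]])
    then show ?thesis
    proof eventually_elim
      case (elim p)
      have "D N (p, ?e) (0, u) = D (\<lambda>q. N (p, q)) ?e u" for u
        using D_compose[OF smooth_near_Pair_const(2), of N p ?e u] elim by (simp add: smooth_near_Pair_const)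
      moreover have "D (\<lambda>q. N (p, q)) ?e u = Ad G (gpoint G p) u" for u
        unfolding Ad_def
        using mderiv_at_one[of "\<lambda>h. gmult G (gmult G (gpoint G p) h) (ginv G (gpoint G p))" "gone G" "mfd G"]
        by (simp add: group_laws mderiv_from_one N_def)
      ultimately show ?case by simp
    qed
  qed
  have DNe: "D N (?e, ?e) (0, u) = u" for u
    using eventually_nhds_x_imp_x[OF DN2] by (simp add: gpoint_gorigin Ad_one)
  have D2N: "D2 N (?e, ?e) (a, 0) (0, u) = - lie_bracket G a u" for a u
  proof -
    let ?F = "\<lambda>p. (N p, fst p)"
    note sF = smooth_near_Pair[OF sN smooth_near_fst]
    have "D2 (\<lambda>p. mult_rep G (?F p)) (?e, ?e) (a, 0) (0, u) = mult_hess G u a + D2 N (?e, ?e) (a, 0) (0, u)"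
      using D2_compose[OF sF, of "mult_rep G" "(a, 0)" "(0, u)"]
      by (simp add: Ne smooth_mult_rep D_Pair[OF sN smooth_near_fst] D2_Pair[OF sN smooth_near_fst] DN1 DNe
         D_bounded_linear bounded_linear_fst D2_bounded_linear D2_mult_rep D_mult_rep linear_0[OF linear_mult_hess(1)])
    moreover have "eventually (\<lambda>p. mult_rep G (?F p) = mult_rep G p) (nhds (?e, ?e))"
      using evn by eventually_elim (simp add: mult_rep_def group_laws)
    ultimately show ?thesis
      using D2_cong_ev by (fastforce simp: lie_bracket_eq mult_hess_def)
  qed
  have sD: "smooth_near (\<lambda>p. D N (p, ?e) (0, u)) ?e" for u
    by (rule smooth_near_D_apply[OF sN smooth_near_Pair_const(1) smooth_near_const])
  have DD: "D (\<lambda>p. D N (p, ?e) (0, u)) ?e a = - lie_bracket G a u" for u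
    using D_D_apply[OF smooth_near_Pair_const(1) sN smooth_near_const, of "(0, u)" a]
    by (simp add: smooth_near_Pair_const D2N linear_0[OF linear_D[OF sN]])
  have "D (\<lambda>p. ip G (D N (p, ?e) (0, u)) (D N (p, ?e) (0, v))) ?e a = D (\<lambda>p. ip G u v) ?e a"
    by (rule fun_cong[OF D_cong_ev]) (use DN2 in \<open>eventually_elim, simp add: ip_facts(4)\<close>)
  then show ?thesis
    using D_bilinear[OF bounded_bilinear_ip sD sD, of u v a]
    by (simp add: DD DNe linear_neg[OF ip_facts(1)] linear_neg[OF ip_facts(2)])
qed

text \<open>The invariant alternating form of which \<open>\<chi>\<close> is one half, evaluated on
  \<open>\<theta>\<^sup>l\<close>.\<close>

definition triple :: "'e \<Rightarrow> 'e \<Rightarrow> 'e \<Rightarrow> real" where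
  "triple u v w = ip G u (lie_bracket G v w)"

lemma triple_linear: "linear (\<lambda>u. triple u v w)" "linear (\<lambda>v. triple u v w)" "linear (triple u v)"
proof -
  show "linear (\<lambda>u. triple u v w)" unfolding triple_def by (rule ip_facts)
  show "linear (\<lambda>v. triple u v w)" unfolding triple_def
    using linear_compose[OF lie_bracket_linear(2) ip_facts(1)] by (simp add: o_def)
  show "linear (triple u v)" unfolding triple_def
    using linear_compose[OF lie_bracket_linear(1) ip_facts(1)] by (simp add: o_def)
qed

lemma triple_swap: "triple u w v = - triple u v w" "triple v u w = - triple u v w" "triple w v u = - triple u v w"
proof -
  show 1: "triple u w v = - triple u v w" for u v w
    using lie_bracket_antisym[of w v] by (simp add: triple_def linear_neg[OF ip_facts(1)])
  show 2: "triple w v u = - triple u v w" for u v w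
    using ip_lie_bracket[of v w u] ip_facts(3)[of u "lie_bracket G v w"] ip_facts(3)[of w "lie_bracket G v u"]
    by (simp add: triple_def)
  show "triple v u w = - triple u v w"
    using 1[of v u w] 2[of v w u] 1[of u v w] by simp
qed

lemma triple_Ad: "triple (Ad G a u) (Ad G a v) (Ad G a w) = triple u v w"
  by (simp add: triple_def Ad_lie_bracket[symmetric] ip_facts(4))

lemma chi_eq: "chi G a u v w = 1 / 2 * triple (theta_l G a u) (theta_l G a v) (theta_l G a w)"
proof -
  \<comment> \<open>The factor 1/12 becomes 1/2 because the two wedge products have three times two
    terms, all equal.\<close>
  have "triple b c a = triple a b c" "triple c a b = triple a b c" for a b c
    using triple_swap(1)[of b a c] triple_swap(2)[of a b c] triple_swap(1)[of c b a] triple_swap(3)[of a b c]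
    by simp_all
  note s = this triple_swap
  show ?thesis
    unfolding chi_def wedge12_def wedge11_def linear_diff[OF ip_facts(1)] triple_def[symmetric]
    using s[of "theta_l G a u" "theta_l G a v" "theta_l G a w"] by simp
qed

subsection \<open>The Maurer--Cartan equations\<close>

definition quot_rep :: "'e \<times> 'e \<Rightarrow> 'e" where
  "quot_rep p = gcoord G (gmult G (ginv G (gpoint G (fst p))) (gpoint G (snd p)))"

text \<open>The second pair of directions does not move \<open>p\<close>, so second derivatives of the
  inverse do not enter.\<close>

lemma quot_rep:
  shows "smooth_near quot_rep (gorigin G, gorigin G)"
    and "D quot_rep (gorigin G, gorigin G) (a, b) = b - a"
    and "D2 quot_rep (gorigin G, gorigin G) (a, a) (0, b) = - mult_hess G a b"
proof -
  let ?e = "gorigin G"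
  have 1: "smooth_at vector_manifold (mfd G) (\<lambda>p. gpoint G (fst p)) (?e, ?e)"
    "smooth_at vector_manifold (mfd G) (\<lambda>p. gpoint G (snd p)) (?e, ?e)"
    by (rule smooth_gpoint; simp add: smooth_at_vector_vector)+
  have 2: "smooth_at vector_manifold (mfd G) (\<lambda>p. gmult G (ginv G (gpoint G (fst p))) (gpoint G (snd p))) (?e, ?e)"
    by (intro gsmooth 1 smooth_atlas_vector)
  show "smooth_near quot_rep (?e, ?e)"
    using smooth_gcoord[OF smooth_atlas_vector 2]
    by (simp add: gpoint_gorigin group_laws smooth_at_vector_vector quot_rep_def[abs_def])
  let ?F = "\<lambda>p. (inv_rep G (fst p), snd p)"
  have si: "smooth_near (\<lambda>p. inv_rep G (fst p)) (?e, ?e)"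
    by (rule smooth_near_compose[OF smooth_near_fst]) (simp add: smooth_inv_rep)
  have sF: "smooth_near ?F (?e, ?e)" by (rule smooth_near_Pair[OF si smooth_near_snd])
  have "eventually (\<lambda>p. gpoint G (inv_rep G (fst p)) = ginv G (gpoint G (fst p))) (nhds (?e, ?e))"
    using isCont_eventually[OF smooth_near_isCont[OF smooth_near_fst], of _ "(?e, ?e)"] eventually_gpoint_inv_rep by simp
  then have eq: "eventually (\<lambda>p. quot_rep p = mult_rep G (?F p)) (nhds (?e, ?e))"
    by eventually_elim (simp add: quot_rep_def mult_rep_def)
  have DF: "D ?F (?e, ?e) (a, b) = (- a, b)" for a b
    using D_compose[OF smooth_near_fst, of "inv_rep G" "(?e, ?e)" "(a, b)"]
    by (simp add: D_Pair[OF si smooth_near_snd] smooth_inv_rep D_inv_rep D_bounded_linear bounded_linear_fst bounded_linear_snd)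
  have D2F: "D2 ?F (?e, ?e) (a, a) (0, b) = 0" for a b
    using D2_compose[OF smooth_near_fst, of "inv_rep G" "(?e, ?e)" "(a, a)" "(0, b)"]
    by (simp add: D2_Pair[OF si smooth_near_snd] smooth_inv_rep D_bounded_linear bounded_linear_fst bounded_linear_snd
       D2_bounded_linear linear_0[OF D2_linear_right[OF smooth_inv_rep]] linear_0[OF linear_D[OF smooth_inv_rep]] zero_prod_def)
  show "D quot_rep (?e, ?e) (a, b) = b - a"
    using D_compose[OF sF, of "mult_rep G" "(a, b)"] D_cong_ev[OF eq]
    by (simp add: inv_rep_gorigin smooth_mult_rep DF D_mult_rep)
  show "D2 quot_rep (?e, ?e) (a, a) (0, b) = - mult_hess G a b"
    using D2_compose[OF sF, of "mult_rep G" "(a, a)" "(0, b)"] D2_cong_ev[OF eq]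
    by (simp add: inv_rep_gorigin smooth_mult_rep DF D2F D2_mult_rep linear_0[OF linear_D[OF smooth_mult_rep]]
        linear_0[OF linear_mult_hess(1)] linear_neg[OF linear_mult_hess(1)])
qed

text \<open>Write \<open>\<psi>(z) = \<phi>(x)\<^sup>-\<^sup>1 \<phi>(z)\<close>. Near \<open>x\<close> the form \<open>\<phi>\<^sup>*\<theta>\<^sup>l\<close> is the derivative in the
  second variable of \<open>\<psi>(z')\<^sup>-\<^sup>1 \<psi>(z)\<close> on the diagonal. When its derivative is antisymmetrised, the
  second derivatives of \<open>\<psi>\<close> cancel and the mixed derivative of the group law remains.\<close>

lemma maurer_cartan_left:
  fixes M :: "('m::topological_space, 'f::fin_dim_inner) manifold"
  assumes M: "smooth_atlas M" and f: "smooth_at M (mfd G) f x"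
  defines "A \<equiv> \<lambda>v y. theta_l G (f y) (mderiv M (mfd G) f y (coord_field M (chart_at M x) v y))"
  shows "smooth_at M vector_manifold (A v) x"
    and "mderiv M vector_manifold (A v) x u - mderiv M vector_manifold (A u) x v = lie_bracket G (A u x) (A v x)"
proof -
  let ?e = "gorigin G" and ?c = "chart_at M x"
  let ?z = "snd ?c x"
  define \<psi> where "\<psi> z = gcoord G (gmult G (ginv G (f x)) (f (chart_inv ?c z)))" for z
  note c = chart_at[OF M, of x]
  have s1: "smooth_at M (mfd G) (\<lambda>y. gmult G (ginv G (f x)) (f y)) x" by (intro gsmooth M f)
  have s\<psi>: "smooth_near \<psi> ?z"
    using smooth_gcoord[OF M s1] by (simp add: group_laws smooth_at_vector_charts[OF M c] \<psi>_def[abs_def])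
  have \<psi>z: "\<psi> ?z = ?e" by (simp add: \<psi>_def chart_inv_chart[OF M c] group_laws)
  have ev\<psi>: "eventually (\<lambda>z. gpoint G (\<psi> z) = gmult G (ginv G (f x)) (f (chart_inv ?c z))) (nhds ?z)"
    using eventually_chart_inv[OF M c smooth_at_pull_eventually[OF s1, of "\<lambda>h. gpoint G (gcoord G h) = h"]]
      eventually_gpoint_gcoord by (simp add: \<psi>_def group_laws)
  then have ev\<psi>2: "eventually (\<lambda>z'. eventually (\<lambda>z. gpoint G (\<psi> z) = gmult G (ginv G (f x)) (f (chart_inv ?c z))) (nhds z')) (nhds ?z)"
    by (simp add: eventually_eventually)
  have sP: "smooth_near (\<lambda>z. (\<psi> z, \<psi> z)) ?z" by (rule smooth_near_Pair[OF s\<psi> s\<psi>])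
  have "eventually (smooth_near quot_rep) (nhds (\<psi> ?z, \<psi> ?z))"
    unfolding \<psi>z by (rule smooth_near_eventually[OF quot_rep(1)])
  then have evq: "eventually (\<lambda>z. smooth_near quot_rep (\<psi> z, \<psi> z)) (nhds ?z)"
    using isCont_eventually[OF smooth_near_isCont[OF sP]] by blast
  have rep: "eventually (\<lambda>z'. A v (chart_inv ?c z') = D quot_rep (\<psi> z', \<psi> z') (0, D \<psi> z' v)) (nhds ?z)" for v
    using eventually_chart_inv[OF M c eventually_chart_domain[OF M c]] eventually_chart_chart_inv[OF M c]
      eventually_chart_inv[OF M c smooth_at_eventually[OF f]] ev\<psi>2 evq smooth_near_eventually[OF s\<psi>]
  proof eventually_elim
    case (elim z')
    let ?y = "chart_inv ?c z'"
    have y: "?y \<in> fst ?c" "snd ?c ?y = z'" "smooth_at M (mfd G) f ?y" using elim by auto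
    have gy: "gpoint G (\<psi> z') = gmult G (ginv G (f x)) (f ?y)" using elim(4) by (rule eventually_nhds_x_imp_x)
    have s2: "smooth_at M (mfd G) (\<lambda>w. gmult G (ginv G (f ?y)) (f w)) ?y" by (intro gsmooth M y)
    have "A v ?y = mderiv M vector_manifold (\<lambda>w. gcoord G (gmult G (ginv G (f ?y)) (f w))) ?y (coord_field M ?c v ?y)"
      unfolding A_def theta_l_mderiv[OF M y(3)]
      by (subst mderiv_at_one) (simp_all add: group_laws)
    also have "\<dots> = D (\<lambda>z. gcoord G (gmult G (ginv G (f ?y)) (f (chart_inv ?c z)))) z' v"
      using mderiv_vector_chart[OF M smooth_gcoord[OF M s2] c(1) y(1), of "coord_field M ?c v ?y"]
      by (simp add: group_laws y(2) components_coord_field[OF M c(1) y(1)])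
    also have "\<dots> = D (\<lambda>z. quot_rep (\<psi> z', \<psi> z)) z' v"
    proof (rule fun_cong[OF D_cong_ev])
      show "eventually (\<lambda>z. gcoord G (gmult G (ginv G (f ?y)) (f (chart_inv ?c z))) = quot_rep (\<psi> z', \<psi> z)) (nhds z')"
        using elim(4) by eventually_elim (simp add: quot_rep_def gy group_laws)
    qed
    also have "\<dots> = D quot_rep (\<psi> z', \<psi> z') (0, D \<psi> z' v)"
      using D_compose[OF smooth_near_Pair[OF smooth_near_const elim(6)], of quot_rep "\<psi> z'" v] elim(5)
      by (simp add: D_Pair[OF smooth_near_const elim(6)])
    finally show ?case .
  qed
  have sV: "smooth_near (\<lambda>z. (0, D \<psi> z v)) ?z" for v
    by (rule smooth_near_Pair[OF smooth_near_const smooth_near_D[OF s\<psi>]])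
  have sQ: "smooth_near quot_rep (\<psi> ?z, \<psi> ?z)" using quot_rep(1) by (simp add: \<psi>z)
  have "smooth_near (\<lambda>z. A v (chart_inv ?c z)) ?z"
    by (rule smooth_near_cong[OF smooth_near_D_apply[OF sQ sP sV[of v]]])
       (use rep[of v] in \<open>eventually_elim, simp\<close>)
  then show "smooth_at M vector_manifold (A v) x" by (simp add: smooth_at_vector_charts[OF M c])
  have Ax: "A v x = D \<psi> ?z v" for v
    using eventually_nhds_x_imp_x[OF rep[of v]] by (simp add: \<psi>z quot_rep(2) chart_inv_chart[OF M c])
  have dA: "mderiv M vector_manifold (A v) x u = - mult_hess G (A u x) (A v x) + D2 \<psi> ?z u v" for u v
  proof -
    have "mderiv M vector_manifold (A v) x u = D (\<lambda>z. D quot_rep (\<psi> z, \<psi> z) (0, D \<psi> z v)) ?z u"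
      unfolding mderiv_vector by (rule fun_cong[OF D_cong_ev[OF rep]])
    also have "\<dots> = D2 quot_rep (?e, ?e) (A u x, A u x) (0, A v x) + D quot_rep (?e, ?e) (0, D2 \<psi> ?z u v)"
      using D_D_apply[OF sP sQ sV, of v u]
      by (simp add: \<psi>z D_Pair s\<psi> smooth_near_D Ax D2_def[symmetric])
    finally show ?thesis by (simp add: quot_rep)
  qed
  show "mderiv M vector_manifold (A v) x u - mderiv M vector_manifold (A u) x v = lie_bracket G (A u x) (A v x)"
    by (simp add: dA lie_bracket_eq D2_symmetric[OF s\<psi>, of u v])
qed

lemma maurer_cartan_right:
  fixes M :: "('m::topological_space, 'f::fin_dim_inner) manifold"
  assumes M: "smooth_atlas M" and f: "smooth_at M (mfd G) f x"
  defines "B \<equiv> \<lambda>v y. theta_r G (f y) (mderiv M (mfd G) f y (coord_field M (chart_at M x) v y))"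
  shows "smooth_at M vector_manifold (B v) x"
    and "mderiv M vector_manifold (B v) x u - mderiv M vector_manifold (B u) x v = - lie_bracket G (B u x) (B v x)"
proof -
  define A where "A = (\<lambda>v y. theta_l G (ginv G (f y)) (mderiv M (mfd G) (\<lambda>y. ginv G (f y)) y (coord_field M (chart_at M x) v y)))"
  have sA: "smooth_at M vector_manifold (A v) x" for v
    unfolding A_def by (rule maurer_cartan_left(1)[OF M smooth_ginv[OF M f]])
  have mcA: "mderiv M vector_manifold (A v) x u - mderiv M vector_manifold (A u) x v = lie_bracket G (A u x) (A v x)"
    unfolding A_def by (rule maurer_cartan_left(2)[OF M smooth_ginv[OF M f]])
  have ev: "eventually (\<lambda>y. - A v y = B v y) (nhds x)" for v
    using smooth_at_eventually[OF f] by eventually_elim (simp add: A_def B_def theta_r_eq_theta_l_inv[OF M])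
  show "smooth_at M vector_manifold (B v) x"
    by (rule smooth_at_cong[OF M smooth_atlas_vector smooth_at_vector_uminus[OF M sA] ev])
  have dB: "mderiv M vector_manifold (B v) x u = - mderiv M vector_manifold (A v) x u" for u v
    using fun_cong[OF mderiv_cong[OF M ev[of v]], of vector_manifold u]
      mderiv_vector_linear[OF M _ sA, of uminus v u] by (simp add: linear_uminus linearI)
  have Bx: "B v x = - A v x" for v using eventually_nhds_x_imp_x[OF ev[of v]] by simp
  show "mderiv M vector_manifold (B v) x u - mderiv M vector_manifold (B u) x v = - lie_bracket G (B u x) (B v x)"
    by (simp add: dB Bx linear_neg[OF lie_bracket_linear(1)] linear_neg[OF lie_bracket_linear(2)] flip: mcA)
qed

text \<open>For coordinate fields this came with the Maurer--Cartan equations; other fields are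
  combinations of them with smooth coefficients.\<close>

lemma theta_field_smooth:
  fixes M :: "('m::topological_space, 'f::fin_dim_inner) manifold"
  assumes M: "smooth_atlas M" and f: "smooth_at M (mfd G) f x" and X: "field_at M X x"
  shows "smooth_at M vector_manifold (\<lambda>y. theta_l G (f y) (mderiv M (mfd G) f y (X y))) x"
    and "smooth_at M vector_manifold (\<lambda>y. theta_r G (f y) (mderiv M (mfd G) f y (X y))) x"
proof -
  let ?c = "chart_at M x"
  let ?a = "\<lambda>b y. inner (components M ?c y (X y)) b"
  have a: "smooth_at M vector_manifold (?a b) x" for b
    using X unfolding field_along_def
    by (rule smooth_at_near_compose[OF M _ smooth_near_bounded_linear[OF bounded_linear_inner_left]])
  have *: "smooth_at M vector_manifold (\<lambda>y. L y (mderiv M (mfd G) f y (X y))) x"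
    if L: "\<And>y. linear (L y)" and s: "\<And>b. smooth_at M vector_manifold (\<lambda>y. L y (mderiv M (mfd G) f y (coord_field M ?c b y))) x"
    for L :: "'m \<Rightarrow> 'e \<Rightarrow> 'e"
  proof (rule smooth_at_cong[OF M smooth_atlas_vector])
    show "smooth_at M vector_manifold (\<lambda>y. \<Sum>b\<in>onb. ?a b y *\<^sub>R L y (mderiv M (mfd G) f y (coord_field M ?c b y))) x"
      by (intro smooth_at_vector_sum[OF M] smooth_at_vector_bilinear[OF M bounded_bilinear_scaleR] a s)
    show "eventually (\<lambda>y. (\<Sum>b\<in>onb. ?a b y *\<^sub>R L y (mderiv M (mfd G) f y (coord_field M ?c b y))) =
        L y (mderiv M (mfd G) f y (X y))) (nhds x)"
      using smooth_at_eventually[OF f] eventually_chart_domain[OF M chart_at[OF M]]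
    proof eventually_elim
      case (elim y)
      have lin: "linear (\<lambda>b. L y (mderiv M (mfd G) f y (coord_field M ?c b y)))"
        using linear_compose[OF linear_coord_field[OF M chart_at(1)[OF M] elim(2)]
            linear_compose[OF linear_mderiv[OF M group_atlas elim(1)] L[of y]]] by (simp add: o_def)
      show ?case
        using linear_onb_expansion[OF lin, of "components M ?c y (X y)"]
        by (simp add: coord_field_components[OF M chart_at(1)[OF M] elim(2)])
    qed
  qed
  show "smooth_at M vector_manifold (\<lambda>y. theta_l G (f y) (mderiv M (mfd G) f y (X y))) x"
    by (rule *[OF linear_theta_l maurer_cartan_left(1)[OF M f]])
  show "smooth_at M vector_manifold (\<lambda>y. theta_r G (f y) (mderiv M (mfd G) f y (X y))) x"
    by (rule *[OF linear_theta_r maurer_cartan_right(1)[OF M f]])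
qed

end

lemma triple_cyclic:
  assumes L: "lie_group L"
  shows "triple L v w u = triple L u v w" "triple L w u v = triple L u v w"
  using triple_swap(1)[OF L, of v u w] triple_swap(2)[OF L, of u v w] triple_swap(1)[OF L, of w v u] triple_swap(3)[OF L, of u v w]
  by linarith+

lemma triple_smooth:
  assumes L: "lie_group L" and M: "smooth_atlas M"
    and s: "smooth_at M vector_manifold f x" "smooth_at M vector_manifold g x" "smooth_at M vector_manifold h x"
  shows "smooth_at M vector_manifold (\<lambda>y. triple L (f y) (g y) (h y)) x"
proof -
  have "bounded_bilinear (lie_bracket L)"
    by (intro bilinear_imp_bounded_bilinear lie_bracket_linear[OF L])
  from smooth_at_vector_bilinear[OF M bounded_bilinear_ip[OF L] s(1) smooth_at_vector_bilinear[OF M this s(2,3)]]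
  show ?thesis unfolding triple_def[OF L] .
qed

section \<open>Products of Lie groups\<close>

lemma smooth_at_map_prod_mderiv:
  assumes M: "smooth_atlas M" and N: "smooth_atlas N" and P: "smooth_atlas P" and Q: "smooth_atlas Q"
    and f: "smooth_at M P f (fst p)" and g: "smooth_at N Q g (snd p)"
  shows "smooth_at (prod_manifold M N) (prod_manifold P Q) (\<lambda>p. (f (fst p), g (snd p))) p"
    "mderiv (prod_manifold M N) (prod_manifold P Q) (\<lambda>p. (f (fst p), g (snd p))) p v
      = (mderiv M P f (fst p) (fst v), mderiv N Q g (snd p) (snd v))"
proof -
  note MN = smooth_atlas_prod[OF M N]
  note pr = smooth_at_fst_mderiv[OF M N, of p] smooth_at_snd_mderiv[OF M N, of p]
  have s: "smooth_at (prod_manifold M N) P (\<lambda>p. f (fst p)) p" "smooth_at (prod_manifold M N) Q (\<lambda>p. g (snd p)) p"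
    by (rule smooth_at_compose[OF MN M P f pr(1)], rule smooth_at_compose[OF MN N Q g pr(3)])
  show "smooth_at (prod_manifold M N) (prod_manifold P Q) (\<lambda>p. (f (fst p), g (snd p))) p"
    by (rule smooth_at_Pair_mderiv[OF P Q MN s])
  show "mderiv (prod_manifold M N) (prod_manifold P Q) (\<lambda>p. (f (fst p), g (snd p))) p v
      = (mderiv M P f (fst p) (fst v), mderiv N Q g (snd p) (snd v))"
    using smooth_at_Pair_mderiv(2)[OF P Q MN s, of v] mderiv_compose[OF MN M P f pr(1), of v]
      mderiv_compose[OF MN N Q g pr(3), of v] pr by simp
qed

lemma ip_pos: "lie_group G \<Longrightarrow> w \<noteq> 0 \<Longrightarrow> ip G w w > 0"
  by (simp add: lie_group_def invariant_inner_product_def)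

lemma prod_lie_simps [simp]: "mfd (prod_lie G H) = prod_manifold (mfd G) (mfd H)"
  "ip (prod_lie G H) u v = ip G (fst u) (fst v) + ip H (snd u) (snd v)"
  "gone (prod_lie G H) = (gone G, gone H)"
  "gmult (prod_lie G H) p = (\<lambda>q. (gmult G (fst p) (fst q), gmult H (snd p) (snd q)))"
  by (simp_all add: prod_lie_def DirProd_def case_prod_unfold)

context
  fixes G :: "('g::{t2_space, second_countable_topology}, 'e::fin_dim_inner) lie_group_data"
    and H :: "('h::{t2_space, second_countable_topology}, 'f::fin_dim_inner) lie_group_data"
  assumes G: "lie_group G" and H: "lie_group H"
begin

lemma ginv_prod_lie [simp]: "ginv (prod_lie G H) = (\<lambda>p. (ginv G (fst p), ginv H (snd p)))"
proof
  fix p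
  show "ginv (prod_lie G H) p = (ginv G (fst p), ginv H (snd p))"
    using G H inv_DirProd[of "grp G" "grp H" "fst p" "snd p"] by (simp add: prod_lie_def lie_group_def)
qed

lemma group_product_atlas: "smooth_atlas (prod_manifold (mfd G) (mfd H))"
  by (rule smooth_atlas_prod[OF group_atlas[OF G] group_atlas[OF H]])

lemma Ad_prod_lie: "Ad (prod_lie G H) p v = (Ad G (fst p) (fst v), Ad H (snd p) (snd v))"
  unfolding Ad_def using smooth_at_map_prod_mderiv(2)[OF group_atlas[OF G] group_atlas[OF H] group_atlas[OF G] group_atlas[OF H],
    of "\<lambda>h. gmult G (gmult G (fst p) h) (ginv G (fst p))" "(gone G, gone H)"
       "\<lambda>h. gmult H (gmult H (snd p) h) (ginv H (snd p))" v] smooth_conj[OF G] smooth_conj[OF H]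
  by simp

lemma theta_l_prod_lie: "theta_l (prod_lie G H) p v = (theta_l G (fst p) (fst v), theta_l H (snd p) (snd v))"
  unfolding theta_l_def
  using smooth_at_map_prod_mderiv(2)[OF group_atlas[OF G] group_atlas[OF H] group_atlas[OF G] group_atlas[OF H],
    of "\<lambda>h. gmult G (ginv G (fst p)) h" p "\<lambda>h. gmult H (ginv H (snd p)) h" v]
  by (simp add: gsmooth[OF G] gsmooth[OF H] group_atlas[OF G] group_atlas[OF H])

lemma theta_r_prod_lie: "theta_r (prod_lie G H) p v = (theta_r G (fst p) (fst v), theta_r H (snd p) (snd v))"
  unfolding theta_r_def
  using smooth_at_map_prod_mderiv(2)[OF group_atlas[OF G] group_atlas[OF H] group_atlas[OF G] group_atlas[OF H],
    of "\<lambda>h. gmult G h (ginv G (fst p))" p "\<lambda>h. gmult H h (ginv H (snd p))" v]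
  by (simp add: gsmooth[OF G] gsmooth[OF H] group_atlas[OF G] group_atlas[OF H])

lemma lie_group_prod: "lie_group (prod_lie G H)"
proof -
  let ?m = "prod_manifold (mfd G) (mfd H)"
  note mm = smooth_atlas_prod[OF group_product_atlas group_product_atlas]
  note pr = smooth_at_fst_mderiv(1)[OF group_atlas[OF G] group_atlas[OF H]] smooth_at_snd_mderiv(1)[OF group_atlas[OF G] group_atlas[OF H]]
    smooth_at_fst_mderiv(1)[OF group_product_atlas group_product_atlas] smooth_at_snd_mderiv(1)[OF group_product_atlas group_product_atlas]
  have grp: "Group.group (grp (prod_lie G H))" "carrier (grp (prod_lie G H)) = UNIV"
    using G H by (auto simp: lie_group_def prod_lie_def intro: DirProd_group)
  have "smooth_at (prod_manifold ?m ?m) ?m (\<lambda>p. (gmult G (fst (fst p)) (fst (snd p)), gmult H (snd (fst p)) (snd (snd p)))) p" for p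
    by (intro smooth_at_Pair_mderiv(1)[OF group_atlas[OF G] group_atlas[OF H] mm] smooth_gmult[OF G mm] smooth_gmult[OF H mm]
        smooth_at_compose[OF mm group_product_atlas group_atlas[OF G]] smooth_at_compose[OF mm group_product_atlas group_atlas[OF H]] pr)
  then have mult: "smooth_map_on (prod_manifold ?m ?m) ?m UNIV (\<lambda>(a, b). gmult (prod_lie G H) a b)"
    unfolding smooth_map_on_iff[OF mm group_product_atlas] by (simp add: case_prod_unfold)
  have "smooth_at ?m ?m (\<lambda>p. (ginv G (fst p), ginv H (snd p))) p" for p
    by (intro smooth_at_Pair_mderiv(1)[OF group_atlas[OF G] group_atlas[OF H] group_product_atlas] smooth_ginv[OF G group_product_atlas] smooth_ginv[OF H group_product_atlas] pr)
  then have inv: "smooth_map_on ?m ?m UNIV (ginv (prod_lie G H))"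
    unfolding smooth_map_on_iff[OF group_product_atlas group_product_atlas] by simp
  have "invariant_inner_product (prod_lie G H)"
    unfolding invariant_inner_product_def
  proof (intro conjI allI impI)
    fix u v :: "'e \<times> 'f" and a
    show "linear_functional_on UNIV (ip (prod_lie G H) u)"
      by (simp add: linear_functional_on_def linear_add[OF ip_facts(1)[OF G]] linear_add[OF ip_facts(1)[OF H]]
          linear_cmul[OF ip_facts(1)[OF G]] linear_cmul[OF ip_facts(1)[OF H]] algebra_simps)
    show "ip (prod_lie G H) u v = ip (prod_lie G H) v u"
      by (simp add: ip_facts(3)[OF G, of "fst u"] ip_facts(3)[OF H, of "snd u"])
    show "ip (prod_lie G H) (Ad (prod_lie G H) a u) (Ad (prod_lie G H) a v) = ip (prod_lie G H) u v"
      by (simp add: Ad_prod_lie ip_facts(4)[OF G] ip_facts(4)[OF H])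
    assume "u \<noteq> 0"
    then have "fst u \<noteq> 0 \<or> snd u \<noteq> 0" by (auto simp: prod_eq_iff)
    moreover have "w \<noteq> 0 \<Longrightarrow> ip G w w > 0" "w' \<noteq> 0 \<Longrightarrow> ip H w' w' > 0" for w w'
      by (simp_all add: ip_pos[OF G] ip_pos[OF H])
    moreover have "ip G 0 0 = 0" "ip H 0 0 = 0" by (simp_all add: ip_facts(5)[OF G] ip_facts(5)[OF H])
    ultimately show "0 < ip (prod_lie G H) u u"
      by (cases "fst u = 0"; cases "snd u = 0") (simp_all add: add_pos_pos)
  qed
  then show ?thesis using grp mult inv group_product_atlas by (simp add: lie_group_def smooth_manifold_atlas)
qed

text \<open>In product coordinates the group law of the product is componentwise, hence so are its
  second derivatives.\<close>

lemma lie_bracket_prod_lie: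
  "lie_bracket (prod_lie G H) u v = (lie_bracket G (fst u) (fst v), lie_bracket H (snd u) (snd v))"
proof -
  let ?P = "prod_lie G H"
  let ?o = "(gorigin ?P, gorigin ?P)"
  have o: "gcoord ?P (gone G, gone H) = (gorigin G, gorigin H)" by (simp add: gcoord_def)
  define L1 where "L1 p = (fst (fst p), fst (snd p))" for p :: "('e \<times> 'f) \<times> ('e \<times> 'f)"
  define L2 where "L2 p = (snd (fst p), snd (snd p))" for p :: "('e \<times> 'f) \<times> ('e \<times> 'f)"
  have L: "bounded_linear L1" "bounded_linear L2"
    by (auto intro!: linear_imp_bounded_linear linearI simp: L1_def L2_def)
  have Lo: "L1 ?o = (gorigin G, gorigin G)" "L2 ?o = (gorigin H, gorigin H)" by (auto simp: L1_def L2_def o)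
  have s: "smooth_near (\<lambda>p. mult_rep G (L1 p)) ?o" "smooth_near (\<lambda>p. mult_rep H (L2 p)) ?o"
    by (rule smooth_near_compose[OF smooth_near_bounded_linear[OF L(1)]], unfold Lo, rule smooth_mult_rep[OF G],
        rule smooth_near_compose[OF smooth_near_bounded_linear[OF L(2)]], unfold Lo, rule smooth_mult_rep[OF H])
  have gp: "eventually (\<lambda>z. gpoint ?P z = (gpoint G (fst z), gpoint H (snd z))) (nhds (gorigin ?P))"
    using eventually_prod_chart_inv[OF group_atlas[OF G] group_atlas[OF H] chart_at[OF group_atlas[OF G]] chart_at[OF group_atlas[OF H]], of "gone G" "gone H"]
    unfolding prod_lie_simps o unfolding gcoord_def
    by eventually_elim (simp add: gpoint_def chart_inv_prod_chart[OF group_atlas[OF G] group_atlas[OF H]] group_atlas[OF G] group_atlas[OF H])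
  have gp': "eventually (\<lambda>p. gpoint ?P (fst p) = (gpoint G (fst (fst p)), gpoint H (snd (fst p))) \<and>
      gpoint ?P (snd p) = (gpoint G (fst (snd p)), gpoint H (snd (snd p)))) (nhds ?o)"
    using isCont_eventually[OF smooth_near_isCont[OF smooth_near_fst], of _ ?o]
      isCont_eventually[OF smooth_near_isCont[OF smooth_near_snd], of _ ?o] gp
    by (intro eventually_conj) simp_all
  then have eq: "eventually (\<lambda>p. mult_rep ?P p = (mult_rep G (L1 p), mult_rep H (L2 p))) (nhds ?o)"
    by eventually_elim (simp add: mult_rep_def L1_def L2_def, simp add: gcoord_def)
  have "mult_hess ?P a b = (mult_hess G (fst a) (fst b), mult_hess H (snd a) (snd b))" for a b
  proof -
    have "mult_hess ?P a b = (D2 (\<lambda>p. mult_rep G (L1 p)) ?o (a, 0) (0, b), D2 (\<lambda>p. mult_rep H (L2 p)) ?o (a, 0) (0, b))"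
      unfolding mult_hess_def by (simp only: D2_cong_ev[OF eq] D2_Pair[OF s])
    then show ?thesis
      using D2_compose[OF smooth_near_bounded_linear[OF L(1)], where g = "mult_rep G" and x = ?o and u = "(a, 0)" and v = "(0, b)"]
       D2_compose[OF smooth_near_bounded_linear[OF L(2)], where g = "mult_rep H" and x = ?o and u = "(a, 0)" and v = "(0, b)"]
      unfolding Lo D_bounded_linear[OF L(1)] D_bounded_linear[OF L(2)] D2_bounded_linear[OF L(1)] D2_bounded_linear[OF L(2)]
        linear_0[OF linear_D[OF smooth_mult_rep[OF G]]] linear_0[OF linear_D[OF smooth_mult_rep[OF H]]]
      by (simp add: smooth_mult_rep[OF G] smooth_mult_rep[OF H] mult_hess_def L1_def L2_def)
  qed
  then show ?thesis
    by (simp add: lie_bracket_eq[OF lie_group_prod] lie_bracket_eq[OF G] lie_bracket_eq[OF H])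
qed

lemma chi_prod_lie:
  "chi (prod_lie G H) p u v w = chi G (fst p) (fst u) (fst v) (fst w) + chi H (snd p) (snd u) (snd v) (snd w)"
  unfolding chi_def wedge12_def wedge11_def theta_l_prod_lie lie_bracket_prod_lie
  by (simp add: algebra_simps)

end

section \<open>Smooth actions\<close>

lemma smooth_action_smooth:
  assumes L: "smooth_atlas (mfd L)" and M: "smooth_atlas M" and act: "smooth_action L M act"
  shows "smooth_at M M (act a) x" "smooth_at (mfd L) M (\<lambda>a. act a x) a"
proof -
  note LM = smooth_atlas_prod[OF L M]
  have s: "smooth_at (prod_manifold (mfd L) M) M (\<lambda>(a, x). act a x) p" for p
    using act unfolding smooth_action_def smooth_map_on_iff[OF LM M] by blast
  have "smooth_at M (prod_manifold (mfd L) M) (\<lambda>x. (a, x)) x"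
    by (intro smooth_at_Pair_mderiv[OF L M M] smooth_at_const smooth_at_ident M L)
  from smooth_at_compose[OF M LM M s this] show "smooth_at M M (act a) x" by simp
  have "smooth_at (mfd L) (prod_manifold (mfd L) M) (\<lambda>a. (a, x)) a"
    by (intro smooth_at_Pair_mderiv[OF L M L] smooth_at_const smooth_at_ident M L)
  from smooth_at_compose[OF L LM M s this] show "smooth_at (mfd L) M (\<lambda>a. act a x) a" by simp
qed

lemma smooth_action_laws:
  assumes L: "lie_group L" and act: "smooth_action L M act"
  shows "act (gone L) x = x" "act (gmult L a b) x = act a (act b x)"
    "act a (act (ginv L a) x) = x" "act (ginv L a) (act a x) = x"
proof -
  interpret group_action "grp L" UNIV act using act by (simp add: smooth_action_def)
  have c: "a \<in> carrier (grp L)" for a using L by (simp add: lie_group_def)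
  show 1: "act (gone L) x = x" for x using fun_cong[OF id_eq_one, of x] by simp
  show 2: "act (gmult L a b) x = act a (act b x)" for a b x by (rule composition_rule[OF _ c c]) simp
  show "act a (act (ginv L a) x) = x" "act (ginv L a) (act a x) = x"
    by (simp_all add: 2[symmetric] group_laws[OF L] 1)
qed

section \<open>Forms on \<open>b\<^sup>m\<close>-manifolds\<close>

lemma linear_functional_onI: "linear f \<Longrightarrow> linear_functional_on V f"
  by (simp add: linear_functional_on_def linear_add linear_cmul)

lemma alternating2_on_antisym:
  assumes "alternating2_on V b" "u \<in> V" "v \<in> V" "u + v \<in> V"
  shows "b v u = - b u v"
proof -
  have "b x x = 0" "b x (y + z) = b x y + b x z" "b (y + z) x = b y x + b z x" if "x \<in> V" "y \<in> V" "z \<in> V" for x y z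
    using assms(1) that unfolding alternating2_on_def linear_functional_on_def by blast+
  note r = this
  show ?thesis
    using r(1)[of "u + v" u u] r(1)[of u u u] r(1)[of v u u] r(2)[of "u + v" u v] r(3)[of u u v] r(3)[of v u v] assms(2-4)
    by simp
qed

context
  fixes B :: "('m::{t2_space, second_countable_topology}, 'e::fin_dim_inner) b_manifold_data"
  assumes B: "b_manifold B"
begin

lemma space_atlas: "smooth_atlas (space B)"
  using B by (simp add: b_manifold_def smooth_manifold_atlas)

lemma open_nbhd: "open (nbhd B)"
  using B by (simp add: b_manifold_def smooth_map_on_def)

lemma def_fun_smooth: "x \<in> nbhd B \<Longrightarrow> smooth_at (space B) vector_manifold (def_fun B) x"
  using B smooth_map_on_iff[OF space_atlas smooth_atlas_vector] by (auto simp: b_manifold_def)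

lemma subspace_bm_fibre: "subspace (bm_fibre B m x)"
proof (cases "x \<in> nbhd B")
  case True
  have l: "linear (d_def_fun B x)" by (rule linear_mderiv[OF space_atlas smooth_atlas_vector def_fun_smooth[OF True]])
  show ?thesis
    using True by (auto simp: subspace_def bm_fibre_def zero_prod_def linear_0[OF l] linear_add[OF l] linear_cmul[OF l] algebra_simps)
next
  case False then show ?thesis by (auto simp: subspace_def bm_fibre_def zero_prod_def)
qed

lemma bm_field_iff:
  "bm_field B m W s \<longleftrightarrow> open W \<and> (\<forall>x\<in>W. s x \<in> bm_fibre B m x \<and> field_at (space B) (\<lambda>y. fst (s y)) x \<and>
     (x \<in> nbhd B \<longrightarrow> smooth_at (space B) vector_manifold (\<lambda>y. snd (s y)) x))"
  unfolding bm_field_def smooth_field_iff[OF space_atlas] smooth_map_on_iff[OF space_atlas smooth_atlas_vector] o_def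
  using open_nbhd by (auto intro: open_Int)

text \<open>Away from the hypersurface the quotient \<open>dt(X) / t\<^sup>m\<close> is smooth.\<close>

lemma bm_field_lift:
  assumes W: "open W" "W \<inter> hypersurface B = {}" and X: "\<And>x. x \<in> W \<Longrightarrow> field_at (space B) X x"
  shows "bm_field B m W (\<lambda>y. bm_lift B m y (X y))"
  unfolding bm_field_iff
proof (intro conjI ballI impI)
  fix x assume x: "x \<in> W"
  have t: "def_fun B y \<noteq> 0" if "y \<in> W" "y \<in> nbhd B" for y using W that by (auto simp: hypersurface_def)
  show "bm_lift B m x (X x) \<in> bm_fibre B m x" using t[OF x] by (auto simp: bm_lift_def bm_fibre_def)
  show "field_at (space B) (\<lambda>y. fst (bm_lift B m y (X y))) x" using X[OF x] by (simp add: bm_lift_def)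
  assume n: "x \<in> nbhd B"
  have t0: "def_fun B x ^ m \<noteq> 0" using t[OF x n] by simp
  have "smooth_at (space B) vector_manifold (\<lambda>y. d_def_fun B y (X y)) x"
    using field_along_mderiv_vector[OF space_atlas space_atlas smooth_at_ident[OF space_atlas] chart_at[OF space_atlas] X[OF x, unfolded field_along_def] def_fun_smooth[OF n]] .
  from smooth_at_vector_bilinear[OF space_atlas bounded_bilinear_mult this
      smooth_at_real_inverse[OF space_atlas smooth_at_real_power[OF space_atlas def_fun_smooth[OF n]] t0]]
  show "smooth_at (space B) vector_manifold (\<lambda>y. snd (bm_lift B m y (X y))) x"
  proof (rule smooth_at_cong[OF space_atlas smooth_atlas_vector])
    have "eventually (\<lambda>y. y \<in> nbhd B) (nhds x)" using open_nbhd n by (auto simp: eventually_nhds)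
    then show "eventually (\<lambda>y. d_def_fun B y (X y) * inverse (def_fun B y ^ m) = snd (bm_lift B m y (X y))) (nhds x)"
      by eventually_elim (simp add: bm_lift_def divide_inverse)
  qed
qed (use W in auto)

text \<open>The exterior derivative of a \<open>b\<^sup>m\<close>-form is computed off the hypersurface
  by differentiating these functions.\<close>

lemma bm_form2_lift_coord_smooth:
  assumes \<omega>: "bm_form2 B m \<omega>" and x: "x \<notin> hypersurface B"
  shows "smooth_at (space B) vector_manifold (\<lambda>y. \<omega> y (bm_lift B m y (coord_field (space B) (chart_at (space B) x) v y))
     (bm_lift B m y (coord_field (space B) (chart_at (space B) x) w y))) x"
proof -
  let ?c = "chart_at (space B) x"
  let ?W = "fst ?c \<inter> - hypersurface B"
  have W: "open ?W"
    using B chart_open[OF space_atlas chart_at(1)[OF space_atlas]] by (auto simp: b_manifold_def intro: open_Int)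
  have "field_at (space B) (coord_field (space B) ?c v) y" if "y \<in> ?W" for y v
    using field_along_coord_field[OF space_atlas space_atlas smooth_at_ident[OF space_atlas], of ?c y "\<lambda>_. v"] that space_atlas
    by (simp add: smooth_at_const)
  then have "bm_field B m ?W (\<lambda>y. bm_lift B m y (coord_field (space B) ?c v y))" for v
    by (intro bm_field_lift W) auto
  then have "smooth_map_on (space B) vector_manifold ?W (\<lambda>y. \<omega> y (bm_lift B m y (coord_field (space B) ?c v y))
     (bm_lift B m y (coord_field (space B) ?c w y)))"
    using \<omega> unfolding bm_form2_def by blast
  then show ?thesis
    using x space_atlas unfolding smooth_map_on_iff[OF space_atlas smooth_atlas_vector] by simp
qed

text \<open>The pull-back of an ordinary form involves a \<open>b\<^sup>m\<close>-vector only through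
  its anchor, so it extends over the hypersurface.\<close>

lemma bm_form3_pullback_chi:
  fixes L :: "('l::{t2_space, second_countable_topology}, 'f::fin_dim_inner) lie_group_data"
  assumes L: "lie_group L" and \<phi>: "\<And>x. smooth_at (space B) (mfd L) \<phi> x"
  shows "bm_form3 B m (\<lambda>x p q r. - chi L (\<phi> x) (mderiv (space B) (mfd L) \<phi> x (fst p))
    (mderiv (space B) (mfd L) \<phi> x (fst q)) (mderiv (space B) (mfd L) \<phi> x (fst r)))"
  unfolding bm_form3_def chi_eq[OF L]
proof (intro conjI allI impI)
  fix x
  let ?A = "\<lambda>p :: 'e \<times> real. theta_l L (\<phi> x) (mderiv (space B) (mfd L) \<phi> x (fst p))"
  have lin: "linear ?A"
    using linear_compose[OF linear_compose[OF linear_fst linear_mderiv[OF space_atlas group_atlas[OF L] \<phi>]] linear_theta_l[OF L]]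
    by (simp add: o_def)
  have z: "triple L u u v = 0" "triple L u v u = 0" "triple L v u u = 0" for u v
    using triple_swap(1)[OF L, of v u u] triple_swap(2)[OF L, of u u v] triple_swap(3)[OF L, of u v u] by simp_all
  have tl: "linear (\<lambda>p. - (1 / 2 * triple L (?A p) b c))" "linear (\<lambda>p. - (1 / 2 * triple L b (?A p) c))"
    "linear (\<lambda>p. - (1 / 2 * triple L b c (?A p)))" for b c
    by (intro linearI; simp only: linear_add[OF lin] linear_cmul[OF lin]
        linear_add[OF triple_linear(1)[OF L]] linear_add[OF triple_linear(2)[OF L]] linear_add[OF triple_linear(3)[OF L]]
        linear_cmul[OF triple_linear(1)[OF L]] linear_cmul[OF triple_linear(2)[OF L]] linear_cmul[OF triple_linear(3)[OF L]];
        simp add: algebra_simps)+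
  show "alternating3_on (bm_fibre B m x) (\<lambda>p q r. - (1 / 2 * triple L (?A p) (?A q) (?A r)))"
    unfolding alternating3_on_def alternating2_on_def
    by (intro ballI conjI linear_functional_onI tl) (simp_all only: z)
next
  fix W q r s assume qrs: "bm_field B m W q \<and> bm_field B m W r \<and> bm_field B m W s"
  have f: "field_at (space B) (\<lambda>y. fst (q y)) x" "field_at (space B) (\<lambda>y. fst (r y)) x" "field_at (space B) (\<lambda>y. fst (s y)) x"
    if "x \<in> W" for x using qrs that by (auto simp: bm_field_iff)
  have "open W" using qrs by (simp add: bm_field_iff)
  then show "smooth_map_on (space B) vector_manifold W (\<lambda>x. - (1 / 2 * triple L
      (theta_l L (\<phi> x) (mderiv (space B) (mfd L) \<phi> x (fst (q x)))) (theta_l L (\<phi> x) (mderiv (space B) (mfd L) \<phi> x (fst (r x))))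
      (theta_l L (\<phi> x) (mderiv (space B) (mfd L) \<phi> x (fst (s x))))))"
    unfolding smooth_map_on_iff[OF space_atlas smooth_atlas_vector]
    by (intro conjI ballI smooth_at_vector_uminus[OF space_atlas]
        smooth_at_vector_bilinear[OF space_atlas bounded_bilinear_mult] smooth_at_const[OF space_atlas smooth_atlas_vector]
        triple_smooth[OF L space_atlas] theta_field_smooth(1)[OF L space_atlas \<phi>] f) auto
qed

end

section \<open>Fusion\<close>

text \<open>For \<open>f\<close> passing through the identity, both \<open>k\<^sup>-\<^sup>1 (f k
  f\<^sup>-\<^sup>1) = (k\<^sup>-\<^sup>1 f k) f\<^sup>-\<^sup>1\<close> and \<open>(f k
  f\<^sup>-\<^sup>1) k\<^sup>-\<^sup>1 = f (k f\<^sup>-\<^sup>1 k\<^sup>-\<^sup>1)\<close> are products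
  of maps through the identity.\<close>

lemma theta_conj_orbit:
  fixes v
  assumes G: "lie_group G" and P: "smooth_atlas P" and f: "smooth_at P (mfd G) f p" "f p = gone G"
  defines "w \<equiv> mderiv P (mfd G) f p v"
  shows "theta_l G k (mderiv P (mfd G) (\<lambda>a. gmult G (gmult G (f a) k) (ginv G (f a))) p v) = Ad G (ginv G k) w - w"
    "theta_r G k (mderiv P (mfd G) (\<lambda>a. gmult G (gmult G (f a) k) (ginv G (f a))) p v) = w - Ad G k w"
proof -
  note sm = gsmooth[OF G]
  have si: "smooth_at P (mfd G) (\<lambda>a. ginv G (f a)) p" "mderiv P (mfd G) (\<lambda>a. ginv G (f a)) p v = - w"
    unfolding w_def by (intro sm P f, rule mderiv_ginv_one[OF G P f])
  have s: "smooth_at P (mfd G) (\<lambda>a. gmult G (gmult G (f a) k) (ginv G (f a))) p"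
    "smooth_at P (mfd G) (\<lambda>a. gmult G (gmult G (ginv G k) (f a)) (ginv G (ginv G k))) p"
    "smooth_at P (mfd G) (\<lambda>a. gmult G (gmult G k (ginv G (f a))) (ginv G k)) p"
    by (intro sm P f)+
  show "theta_l G k (mderiv P (mfd G) (\<lambda>a. gmult G (gmult G (f a) k) (ginv G (f a))) p v) = Ad G (ginv G k) w - w"
    using theta_l_mderiv[OF G P s(1), of v] mderiv_gmult_one[OF G P s(2) _ si(1), of v] mderiv_conj[OF G P f, of "ginv G k" v]
    by (simp add: f group_laws[OF G] si(2) w_def)
  show "theta_r G k (mderiv P (mfd G) (\<lambda>a. gmult G (gmult G (f a) k) (ginv G (f a))) p v) = w - Ad G k w"
    using theta_r_mderiv[OF G P s(1), of v] mderiv_gmult_one[OF G P f s(3), of v] mderiv_conj[OF G P si(1), of k v]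
    by (simp add: f group_laws[OF G] si(2) w_def linear_neg[OF linear_Ad[OF G]])
qed

lemma group_action_pullback:
  assumes K: "Group.group K" and act: "group_action L UNIV act"
    and h: "h \<in> hom K L"
  shows "group_action K UNIV (\<lambda>a. act (h a))"
proof -
  have "group_hom L (BijGroup UNIV) act" using act by (simp add: group_action_def)
  then have "act \<in> hom L (BijGroup UNIV)"
    by (simp add: group_hom_def group_hom_axioms_def)
  then show ?thesis
    using hom_compose[OF h, of act "BijGroup UNIV"] K
    by (simp add: group_action_def group_hom_def group_hom_axioms_def o_def group_BijGroup)
qed

text \<open>Fusion does not refer to a product structure of the underlying manifold, so the space is an
  arbitrary one with group \<open>G \<times> G \<times> H\<close>.\<close>

locale fusion =
  fixes G :: "('g::{t2_space, second_countable_topology}, 'k::fin_dim_inner) lie_group_data"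
    and H :: "('h::{t2_space, second_countable_topology}, 'l::fin_dim_inner) lie_group_data"
    and m :: nat
    and B :: "('m::{t2_space, second_countable_topology}, 'e::fin_dim_inner) b_manifold_data"
    and act :: "'g \<times> 'g \<times> 'h \<Rightarrow> 'm \<Rightarrow> 'm" and \<sigma> :: "('m, 'e \<times> real) form2" and \<Phi> :: "'m \<Rightarrow> 'g \<times> 'g \<times> 'h"
  assumes G: "lie_group G" and H: "lie_group H"
    and Q: "singular_quasi_hamiltonian (prod_lie G (prod_lie G H)) m B act \<sigma> \<Phi>"
begin

abbreviation "M \<equiv> space B"
definition "\<Phi>1 = (\<lambda>x. fst (\<Phi> x))"
definition "\<Phi>2 = (\<lambda>x. fst (snd (\<Phi> x)))"
definition "\<Phi>3 = (\<lambda>x. snd (snd (\<Phi> x)))"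
text \<open>The left form is pulled back along the first factor and the right form along the second,
  since these two add up in the derivative of \<open>\<Phi>1 \<Phi>2\<close>.\<close>

definition "\<alpha> x v = theta_l G (\<Phi>1 x) (mderiv M (mfd G) \<Phi>1 x v)"
definition "\<beta> x v = theta_r G (\<Phi>2 x) (mderiv M (mfd G) \<Phi>2 x v)"
definition "\<gamma> x v = theta_l H (\<Phi>3 x) (mderiv M (mfd H) \<Phi>3 x v)"

lemma GH_lie: "lie_group (prod_lie G H)" by (rule lie_group_prod[OF G H])

lemmas K_atlases = group_atlas[OF G] group_atlas[OF H] group_product_atlas[OF G H] group_product_atlas[OF G GH_lie, unfolded prod_lie_simps]

lemma Q_facts: "b_manifold B" "bm_action (prod_lie G (prod_lie G H)) m B act" "bm_form2 B m \<sigma>" "bm_invariant m B act \<sigma>"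
  "equivariant_moment_map (prod_lie G (prod_lie G H)) M act \<Phi>"
  using Q by (simp_all add: singular_quasi_hamiltonian_def)

lemma M_atlas: "smooth_atlas M" by (rule space_atlas[OF Q_facts(1)])

lemma \<Phi>_smooth: "smooth_at M (mfd G) \<Phi>1 x" "smooth_at M (mfd G) \<Phi>2 x" "smooth_at M (mfd H) \<Phi>3 x"
proof -
  have s: "smooth_at M (prod_manifold (mfd G) (prod_manifold (mfd G) (mfd H))) \<Phi> x"
    using Q_facts(5) smooth_map_on_iff[OF M_atlas K_atlases(4)] by (simp add: equivariant_moment_map_def)
  note pr = smooth_at_fst_mderiv(1)[OF K_atlases(1,3)] smooth_at_snd_mderiv(1)[OF K_atlases(1,3)]
    smooth_at_fst_mderiv(1)[OF K_atlases(1,2)] smooth_at_snd_mderiv(1)[OF K_atlases(1,2)]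
  have s2: "smooth_at M (prod_manifold (mfd G) (mfd H)) (\<lambda>x. snd (\<Phi> x)) x"
    by (rule smooth_at_compose[OF M_atlas K_atlases(4,3) pr(2) s])
  show "smooth_at M (mfd G) \<Phi>1 x" unfolding \<Phi>1_def by (rule smooth_at_compose[OF M_atlas K_atlases(4,1) pr(1) s])
  show "smooth_at M (mfd G) \<Phi>2 x" unfolding \<Phi>2_def by (rule smooth_at_compose[OF M_atlas K_atlases(3,1) pr(3) s2])
  show "smooth_at M (mfd H) \<Phi>3 x" unfolding \<Phi>3_def by (rule smooth_at_compose[OF M_atlas K_atlases(3,2) pr(4) s2])
qed

lemma \<Phi>_mderiv: "mderiv M (mfd (prod_lie G (prod_lie G H))) \<Phi> x v
    = (mderiv M (mfd G) \<Phi>1 x v, mderiv M (mfd G) \<Phi>2 x v, mderiv M (mfd H) \<Phi>3 x v)"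
proof -
  have "\<Phi> = (\<lambda>x. (\<Phi>1 x, \<Phi>2 x, \<Phi>3 x))" by (simp add: \<Phi>1_def \<Phi>2_def \<Phi>3_def)
  then show ?thesis
    using smooth_at_Pair_mderiv(2)[OF K_atlases(1,3) M_atlas \<Phi>_smooth(1) smooth_at_Pair_mderiv(1)[OF K_atlases(1,2) M_atlas \<Phi>_smooth(2,3)], of x v]
      smooth_at_Pair_mderiv(2)[OF K_atlases(1,2) M_atlas \<Phi>_smooth(2,3), of x v]
    by simp
qed

lemma \<Phi>_equivariant:
  "\<Phi>1 (act a x) = gmult G (gmult G (fst a) (\<Phi>1 x)) (ginv G (fst a))"
  "\<Phi>2 (act a x) = gmult G (gmult G (fst (snd a)) (\<Phi>2 x)) (ginv G (fst (snd a)))"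
  "\<Phi>3 (act a x) = gmult H (gmult H (snd (snd a)) (\<Phi>3 x)) (ginv H (snd (snd a)))"
proof -
  let ?K = "prod_lie G (prod_lie G H)"
  have "\<Phi> (act a x) = gmult ?K (gmult ?K a (\<Phi> x)) (ginv ?K a)"
    using Q_facts(5) unfolding equivariant_moment_map_def by blast
  then show "\<Phi>1 (act a x) = gmult G (gmult G (fst a) (\<Phi>1 x)) (ginv G (fst a))"
    "\<Phi>2 (act a x) = gmult G (gmult G (fst (snd a)) (\<Phi>2 x)) (ginv G (fst (snd a)))"
    "\<Phi>3 (act a x) = gmult H (gmult H (snd (snd a)) (\<Phi>3 x)) (ginv H (snd (snd a)))"
    by (simp_all add: \<Phi>1_def \<Phi>2_def \<Phi>3_def ginv_prod_lie[OF G GH_lie] ginv_prod_lie[OF G H])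
qed

lemma \<alpha>\<beta>\<gamma>_linear: "linear (\<alpha> x)" "linear (\<beta> x)" "linear (\<gamma> x)"
proof -
  have "linear (\<lambda>v. theta_l G (\<Phi>1 x) (mderiv M (mfd G) \<Phi>1 x v))" "linear (\<lambda>v. theta_r G (\<Phi>2 x) (mderiv M (mfd G) \<Phi>2 x v))"
    "linear (\<lambda>v. theta_l H (\<Phi>3 x) (mderiv M (mfd H) \<Phi>3 x v))"
    using linear_compose[OF linear_mderiv[OF M_atlas K_atlases(1) \<Phi>_smooth(1)] linear_theta_l[OF G]]
     linear_compose[OF linear_mderiv[OF M_atlas K_atlases(1) \<Phi>_smooth(2)] linear_theta_r[OF G]]
     linear_compose[OF linear_mderiv[OF M_atlas K_atlases(2) \<Phi>_smooth(3)] linear_theta_l[OF H]] by (simp_all add: o_def)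
  then show "linear (\<alpha> x)" "linear (\<beta> x)" "linear (\<gamma> x)" by (simp_all add: \<alpha>_def[abs_def] \<beta>_def[abs_def] \<gamma>_def[abs_def])
qed

lemma \<alpha>\<beta>\<gamma>_field: 
  assumes "field_at M X x"
  shows "smooth_at M vector_manifold (\<lambda>y. \<alpha> y (X y)) x" "smooth_at M vector_manifold (\<lambda>y. \<beta> y (X y)) x"
    "smooth_at M vector_manifold (\<lambda>y. \<gamma> y (X y)) x"
  unfolding \<alpha>_def \<beta>_def \<gamma>_def
  by (rule theta_field_smooth[OF G M_atlas \<Phi>_smooth(1) assms] theta_field_smooth[OF G M_atlas \<Phi>_smooth(2) assms]
      theta_field_smooth[OF H M_atlas \<Phi>_smooth(3) assms])+

abbreviation "fused_form \<equiv> fusion_form G B \<Phi> \<sigma>"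
abbreviation "fused_moment \<equiv> fusion_moment G \<Phi>"
abbreviation "fused_action \<equiv> fusion_action act"
abbreviation "d_fused_moment \<equiv> mderiv M (mfd (prod_lie G H)) fused_moment"

lemma fused_form_eq: "fused_form x p q = \<sigma> x p q
    - 1 / 2 * (ip G (\<alpha> x (fst p)) (\<beta> x (fst q)) - ip G (\<alpha> x (fst q)) (\<beta> x (fst p)))"
  by (simp add: fusion_form_def Let_def wedge11_def \<alpha>_def \<beta>_def \<Phi>1_def \<Phi>2_def)

lemma fused_moment_eq: "fused_moment = (\<lambda>x. (gmult G (\<Phi>1 x) (\<Phi>2 x), \<Phi>3 x))"
  by (simp add: fun_eq_iff fusion_moment_def \<Phi>1_def \<Phi>2_def \<Phi>3_def case_prod_unfold)

lemma fused_moment_smooth: "smooth_at M (mfd (prod_lie G H)) fused_moment x"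
  and d_fused_moment_eq: "d_fused_moment x v = (mderiv M (mfd G) (\<lambda>x. gmult G (\<Phi>1 x) (\<Phi>2 x)) x v, mderiv M (mfd H) \<Phi>3 x v)"
  unfolding fused_moment_eq prod_lie_simps
  by (intro smooth_at_Pair_mderiv[OF K_atlases(1,2) M_atlas] smooth_gmult[OF G M_atlas] \<Phi>_smooth)+

lemma theta_l_d_fused_moment: "theta_l (prod_lie G H) (fused_moment x) (d_fused_moment x v) = (Ad G (ginv G (\<Phi>2 x)) (\<alpha> x v + \<beta> x v), \<gamma> x v)"
  unfolding theta_l_prod_lie[OF G H] d_fused_moment_eq
  using theta_gmult(1)[OF G M_atlas \<Phi>_smooth(1,2)] by (simp add: fused_moment_eq \<alpha>_def \<beta>_def \<gamma>_def)

lemma theta_r_d_fused_moment: "theta_r (prod_lie G H) (fused_moment x) (d_fused_moment x v) = (Ad G (\<Phi>1 x) (\<alpha> x v + \<beta> x v), Ad H (\<Phi>3 x) (\<gamma> x v))"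
  unfolding theta_r_prod_lie[OF G H] d_fused_moment_eq
  using theta_gmult(2)[OF G M_atlas \<Phi>_smooth(1,2)] by (simp add: fused_moment_eq \<alpha>_def \<beta>_def \<gamma>_def theta_r_eq_Ad[OF H])

lemma chi_d_fused_moment: "chi (prod_lie G H) (fused_moment x) (d_fused_moment x u) (d_fused_moment x v) (d_fused_moment x w) =
   1 / 2 * triple G (\<alpha> x u + \<beta> x u) (\<alpha> x v + \<beta> x v) (\<alpha> x w + \<beta> x w) + 1 / 2 * triple H (\<gamma> x u) (\<gamma> x v) (\<gamma> x w)"
  using theta_l_d_fused_moment[of x, unfolded theta_l_prod_lie[OF G H]]
  by (simp add: chi_prod_lie[OF G H] chi_eq[OF G] chi_eq[OF H] triple_Ad[OF G])

lemma chi_d\<Phi>: "chi (prod_lie G (prod_lie G H)) (\<Phi> x) (mderiv M (mfd (prod_lie G (prod_lie G H))) \<Phi> x u)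
     (mderiv M (mfd (prod_lie G (prod_lie G H))) \<Phi> x v) (mderiv M (mfd (prod_lie G (prod_lie G H))) \<Phi> x w) =
   1 / 2 * (triple G (\<alpha> x u) (\<alpha> x v) (\<alpha> x w) + triple G (\<beta> x u) (\<beta> x v) (\<beta> x w) + triple H (\<gamma> x u) (\<gamma> x v) (\<gamma> x w))"
proof -
  have "triple G (theta_l G (\<Phi>2 x) a) (theta_l G (\<Phi>2 x) b) (theta_l G (\<Phi>2 x) c)
      = triple G (theta_r G (\<Phi>2 x) a) (theta_r G (\<Phi>2 x) b) (theta_r G (\<Phi>2 x) c)" for a b c
    by (simp add: theta_r_eq_Ad[OF G] triple_Ad[OF G])
  then show ?thesis
    unfolding chi_prod_lie[OF G GH_lie] chi_prod_lie[OF G H] \<Phi>_mderiv chi_eq[OF G] chi_eq[OF H]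
    by (simp add: \<alpha>_def \<beta>_def \<gamma>_def \<Phi>1_def[symmetric, THEN fun_cong] algebra_simps)
       (simp add: \<Phi>1_def \<Phi>2_def \<Phi>3_def)
qed

subsection \<open>The fundamental fields\<close>

lemmas smooth_act = Q_facts(2)[unfolded bm_action_def, THEN conjunct1]

lemmas act_smooth = smooth_action_smooth(1)[OF group_atlas[OF lie_group_prod[OF G GH_lie]] M_atlas smooth_act]
  and orbit_smooth = smooth_action_smooth(2)[OF group_atlas[OF lie_group_prod[OF G GH_lie]] M_atlas smooth_act]
  and act_one = smooth_action_laws(1)[OF lie_group_prod[OF G GH_lie] smooth_act]

abbreviation "fund \<equiv> fundamental_field (prod_lie G (prod_lie G H)) M act"

text \<open>By equivariance \<open>\<Phi>1\<close> and \<open>\<Phi>2\<close> map orbits to conjugation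
  orbits. The signs are opposite to those of \<open>theta_conj_orbit\<close>, as fundamental fields are
  velocities of \<open>exp(-s\<xi>)\<close>.\<close>

lemma \<alpha>_fund: "\<alpha> x (fund (\<xi>1, \<xi>2, \<eta>) x) = \<xi>1 - Ad G (ginv G (\<Phi>1 x)) \<xi>1"
  and \<beta>_fund: "\<beta> x (fund (\<xi>1, \<xi>2, \<eta>) x) = Ad G (\<Phi>2 x) \<xi>2 - \<xi>2"
proof -
  let ?K = "prod_manifold (mfd G) (prod_manifold (mfd G) (mfd H))"
  let ?o = "(gone G, gone G, gone H)"
  let ?v = "(\<xi>1, \<xi>2, \<eta>)"
  note pr = smooth_at_fst_mderiv[OF K_atlases(1,3), of ?o] smooth_at_snd_mderiv[OF K_atlases(1,3), of ?o]
    smooth_at_fst_mderiv[OF K_atlases(1,2), of "snd ?o"]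
  have s: "smooth_at ?K (mfd G) (\<lambda>a. fst (snd a)) ?o"
    and d: "mderiv ?K (mfd G) (\<lambda>a. fst (snd a)) ?o ?v = \<xi>2"
    using smooth_at_compose[OF K_atlases(4,3,1) pr(5) pr(3)] mderiv_compose[OF K_atlases(4,3,1) pr(5) pr(3), of ?v]
    by (simp_all add: pr smooth_at_fst_mderiv(2)[OF K_atlases(1,2)])
  have o: "smooth_at ?K M (\<lambda>a. act a x) ?o" using orbit_smooth by simp
  have "\<alpha> x (- fund ?v x) = theta_l G (\<Phi>1 x) (mderiv ?K (mfd G) (\<lambda>a. \<Phi>1 (act a x)) ?o ?v)"
    unfolding \<alpha>_def fundamental_field_def using mderiv_compose[OF K_atlases(4) M_atlas K_atlases(1) \<Phi>_smooth(1) o, of ?v] act_one[of x] by simp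
  also have "\<dots> = Ad G (ginv G (\<Phi>1 x)) \<xi>1 - \<xi>1"
    unfolding \<Phi>_equivariant
    using theta_conj_orbit(1)[OF G K_atlases(4) pr(1), where v = ?v and k = "\<Phi>1 x"] by (simp add: pr(2))
  finally show "\<alpha> x (fund ?v x) = \<xi>1 - Ad G (ginv G (\<Phi>1 x)) \<xi>1"
    by (simp add: linear_neg[OF \<alpha>\<beta>\<gamma>_linear(1)] minus_equation_iff[of "\<alpha> x _"])
  have "\<beta> x (- fund ?v x) = theta_r G (\<Phi>2 x) (mderiv ?K (mfd G) (\<lambda>a. \<Phi>2 (act a x)) ?o ?v)"
    unfolding \<beta>_def fundamental_field_def using mderiv_compose[OF K_atlases(4) M_atlas K_atlases(1) \<Phi>_smooth(2) o, of ?v] act_one[of x] by simp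
  also have "\<dots> = \<xi>2 - Ad G (\<Phi>2 x) \<xi>2"
    unfolding \<Phi>_equivariant
    using theta_conj_orbit(2)[OF G K_atlases(4) s, where v = ?v and k = "\<Phi>2 x"] d by simp
  finally show "\<beta> x (fund ?v x) = Ad G (\<Phi>2 x) \<xi>2 - \<xi>2"
    by (simp add: linear_neg[OF \<alpha>\<beta>\<gamma>_linear(2)] minus_equation_iff[of "\<beta> x _"])
qed

lemma fundamental_field_fusion: "fundamental_field (prod_lie G H) M fused_action (\<xi>, \<eta>) = fund (\<xi>, \<xi>, \<eta>)"
proof
  fix x
  let ?K = "prod_manifold (mfd G) (prod_manifold (mfd G) (mfd H))" and ?L = "prod_manifold (mfd G) (mfd H)"
  let ?o = "(gone G, gone H)"
  have i: "smooth_at ?L ?L (\<lambda>a. a) ?o" by (rule smooth_at_ident[OF K_atlases(3)])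
  note pr = smooth_at_fst_mderiv[OF K_atlases(1,2), of ?o]
  note d = smooth_at_Pair_mderiv[OF K_atlases(1,3,3) pr(1) i, unfolded pr(2) mderiv_ident[OF K_atlases(3)]]
  have o: "smooth_at ?K M (\<lambda>a. act a x) (fst ?o, ?o)" using orbit_smooth by simp
  have "mderiv ?L M (\<lambda>a. act (fst a, a) x) ?o (\<xi>, \<eta>) = mderiv ?K M (\<lambda>a. act a x) (gone G, gone G, gone H) (\<xi>, \<xi>, \<eta>)"
    using mderiv_compose[OF K_atlases(3,4) M_atlas o d(1), of "(\<xi>, \<eta>)"] by (simp add: d(2))
  then show "fundamental_field (prod_lie G H) M fused_action (\<xi>, \<eta>) x = fund (\<xi>, \<xi>, \<eta>) x"
    by (simp add: fundamental_field_def fusion_action_def case_prod_unfold)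
qed

lemma moment_condition:
  obtains s where "bm_field B m UNIV s" "fst \<circ> s = fund (\<xi>1, \<xi>2, \<eta>)"
    "\<And>x p. p \<in> bm_fibre B m x \<Longrightarrow> \<sigma> x (s x) p = 1 / 2 * (ip G (\<alpha> x (fst p) + Ad G (\<Phi>1 x) (\<alpha> x (fst p))) \<xi>1
       + ip G (Ad G (ginv G (\<Phi>2 x)) (\<beta> x (fst p)) + \<beta> x (fst p)) \<xi>2 + ip H (\<gamma> x (fst p) + Ad H (\<Phi>3 x) (\<gamma> x (fst p))) \<eta>)"
proof -
  let ?K = "prod_lie G (prod_lie G H)"
  have th: "theta_l ?K (\<Phi> x) (mderiv M (mfd ?K) \<Phi> x v) + theta_r ?K (\<Phi> x) (mderiv M (mfd ?K) \<Phi> x v)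
     = (\<alpha> x v + Ad G (\<Phi>1 x) (\<alpha> x v), Ad G (ginv G (\<Phi>2 x)) (\<beta> x v) + \<beta> x v, \<gamma> x v + Ad H (\<Phi>3 x) (\<gamma> x v))" for x v
    unfolding \<Phi>_mderiv theta_l_prod_lie[OF G GH_lie] theta_r_prod_lie[OF G GH_lie] theta_l_prod_lie[OF G H] theta_r_prod_lie[OF G H]
    by (simp add: \<alpha>_def \<beta>_def \<gamma>_def theta_r_eq_Ad[OF G] theta_r_eq_Ad[OF H] Ad_inv[OF G])
       (simp add: \<Phi>1_def \<Phi>2_def \<Phi>3_def theta_r_eq_Ad[OF G] theta_r_eq_Ad[OF H] Ad_inv[OF G])
  have "\<forall>\<xi>. \<exists>s. bm_field B m UNIV s \<and> fst \<circ> s = fund \<xi> \<and> (\<forall>x. \<forall>p\<in>bm_fibre B m x. \<sigma> x (s x) p =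
      1 / 2 * ip ?K (theta_l ?K (\<Phi> x) (mderiv M (mfd ?K) \<Phi> x (fst p))
        + theta_r ?K (\<Phi> x) (mderiv M (mfd ?K) \<Phi> x (fst p))) \<xi>)"
    using Q unfolding singular_quasi_hamiltonian_def Let_def by (elim conjE) assumption
  from spec[OF this, of "(\<xi>1, \<xi>2, \<eta>)"]
  obtain s where "bm_field B m UNIV s" "fst \<circ> s = fund (\<xi>1, \<xi>2, \<eta>)"
    "\<And>x p. p \<in> bm_fibre B m x \<Longrightarrow> \<sigma> x (s x) p = 1 / 2 * ip ?K (theta_l ?K (\<Phi> x) (mderiv M (mfd ?K) \<Phi> x (fst p))
        + theta_r ?K (\<Phi> x) (mderiv M (mfd ?K) \<Phi> x (fst p))) (\<xi>1, \<xi>2, \<eta>)"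
    by (elim exE conjE) blast
  note s = this
  show thesis by (rule that[OF s(1,2)]) 
      (subst s(3), assumption, unfold th, unfold prod_lie_simps fst_conv snd_conv, simp only: add.assoc)
qed

subsection \<open>The axioms for the fused space\<close>

lemma fused_action_eq: "fused_action = (\<lambda>a. act (fst a, a))"
  by (auto simp: fusion_action_def)

lemma bm_action_fused: "bm_action (prod_lie G H) m B fused_action"
proof -
  let ?K = "prod_lie G (prod_lie G H)" and ?L = "prod_lie G H"
  note LM = smooth_atlas_prod[OF K_atlases(3) M_atlas] and KM = smooth_atlas_prod[OF K_atlases(4) M_atlas]
  note grp = GH_lie lie_group_prod[OF G GH_lie]
  have "group_action (grp ?L) UNIV (\<lambda>a. act (fst a, a))"
  proof (rule group_action_pullback)
    show "Group.group (grp ?L)" using grp(1) by (simp add: lie_group_def)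
    show "group_action (grp ?K) UNIV act" using Q_facts(2) by (simp add: bm_action_def smooth_action_def)
    show "(\<lambda>a. (fst a, a)) \<in> hom (grp ?L) (grp ?K)"
      using grp(2) by (intro homI) (simp_all add: lie_group_def del: split_paired_All)
  qed
  moreover have "smooth_map_on (prod_manifold (mfd ?L) M) M UNIV (\<lambda>(a, x). act (fst a, a) x)"
    unfolding prod_lie_simps smooth_map_on_iff[OF LM M_atlas]
  proof (intro conjI ballI)
    fix p :: "('g \<times> 'h) \<times> 'm"
    let ?K' = "prod_manifold (mfd G) (prod_manifold (mfd G) (mfd H))"
    note pr = smooth_at_fst_mderiv(1)[OF K_atlases(3) M_atlas, of p] smooth_at_snd_mderiv(1)[OF K_atlases(3) M_atlas, of p]
    have "smooth_at (prod_manifold (prod_manifold (mfd G) (mfd H)) M) (prod_manifold ?K' M) (\<lambda>p. ((fst (fst p), fst p), snd p)) p"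
      by (intro smooth_at_Pair_mderiv(1)[OF K_atlases(4) M_atlas LM] smooth_at_Pair_mderiv(1)[OF K_atlases(1,3) LM] pr
          smooth_at_compose[OF LM K_atlases(3,1)] smooth_at_fst_mderiv(1)[OF K_atlases(1,2)])
    moreover have "smooth_at (prod_manifold ?K' M) M (\<lambda>(a, x). act a x) ((fst (fst p), fst p), snd p)"
    proof -
      have "smooth_map_on (prod_manifold ?K' M) M UNIV (\<lambda>(a, x). act a x)"
        using Q_facts(2) unfolding bm_action_def smooth_action_def prod_lie_simps by blast
      then show ?thesis unfolding smooth_map_on_iff[OF KM M_atlas] by blast
    qed
    ultimately show "smooth_at (prod_manifold (prod_manifold (mfd G) (mfd H)) M) M (\<lambda>(a, x). act (fst a, a) x) p"
      using smooth_at_compose[OF LM KM M_atlas, of "\<lambda>(a, x). act a x" "\<lambda>p. ((fst (fst p), fst p), snd p)" p]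
      by (simp add: case_prod_unfold)
  qed simp
  ultimately show ?thesis
    using Q_facts(2) unfolding bm_action_def smooth_action_def fused_action_eq by blast
qed

lemma bm_form2_fused: "bm_form2 B m fused_form"
  unfolding bm_form2_def
proof (intro conjI allI impI)
  fix x
  have \<sigma>: "alternating2_on (bm_fibre B m x) (\<sigma> x)" using Q_facts(3) by (simp add: bm_form2_def)
  note lin = linear_add[OF \<alpha>\<beta>\<gamma>_linear(1)] linear_add[OF \<alpha>\<beta>\<gamma>_linear(2)] linear_cmul[OF \<alpha>\<beta>\<gamma>_linear(1)] linear_cmul[OF \<alpha>\<beta>\<gamma>_linear(2)]
    linear_add[OF ip_facts(1)[OF G]] linear_add[OF ip_facts(2)[OF G]] linear_cmul[OF ip_facts(1)[OF G]] linear_cmul[OF ip_facts(2)[OF G]]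
  show "alternating2_on (bm_fibre B m x) (fused_form x)"
    using \<sigma> unfolding alternating2_on_def linear_functional_on_def
    by (auto simp: fused_form_eq lin algebra_simps simp del: split_paired_All)
next
  fix W r s assume rs: "bm_field B m W r \<and> bm_field B m W s"
  have \<sigma>: "smooth_map_on M vector_manifold W (\<lambda>x. \<sigma> x (r x) (s x))" using Q_facts(3) rs unfolding bm_form2_def by blast
  show "smooth_map_on M vector_manifold W (\<lambda>x. fused_form x (r x) (s x))"
    unfolding smooth_map_on_iff[OF M_atlas smooth_atlas_vector] fused_form_eq
  proof (intro conjI ballI)
    show "open W" using rs by (simp add: bm_field_iff[OF Q_facts(1)])
    fix x assume x: "x \<in> W"
    have f: "field_at M (\<lambda>y. fst (r y)) x" "field_at M (\<lambda>y. fst (s y)) x"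
      using rs x by (auto simp: bm_field_iff[OF Q_facts(1)])
    note ip = smooth_at_vector_bilinear[OF M_atlas bounded_bilinear_ip[OF G]]
    show "smooth_at M vector_manifold (\<lambda>x. \<sigma> x (r x) (s x) - 1 / 2 *
       (ip G (\<alpha> x (fst (r x))) (\<beta> x (fst (s x))) - ip G (\<alpha> x (fst (s x))) (\<beta> x (fst (r x))))) x"
      using \<sigma> x unfolding smooth_map_on_iff[OF M_atlas smooth_atlas_vector]
      by (intro smooth_at_vector_diff[OF M_atlas] ip \<alpha>\<beta>\<gamma>_field f smooth_at_vector_bilinear[OF M_atlas bounded_bilinear_mult]
          smooth_at_const[OF M_atlas smooth_atlas_vector]) blast
  qed
qed

lemma bm_invariant_fused: "bm_invariant m B fused_action fused_form"
  unfolding bm_invariant_def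
proof (intro allI impI ballI)
  fix a :: "'g \<times> 'h" and W r s r' s' x
  assume h: "bm_field B m W r \<and> bm_field B m W s \<and> bm_pushforward B m (fused_action a) W r r' \<and>
    bm_pushforward B m (fused_action a) W s s'" and x: "x \<in> W"
  let ?a = "(fst a, a)"
  have fa: "fused_action a = act ?a" by (simp add: fused_action_eq)
  have \<sigma>: "\<sigma> (act ?a x) (r' (act ?a x)) (s' (act ?a x)) = \<sigma> x (r x) (s x)"
    using Q_facts(4) h x unfolding bm_invariant_def fa by blast
  have push: "fst (r' (act ?a x)) = mderiv M M (act ?a) x (fst (r x))" "fst (s' (act ?a x)) = mderiv M M (act ?a) x (fst (s x))"
    using h x by (auto simp: bm_pushforward_def fa)
  \<comment> \<open>By equivariance \<open>\<alpha>\<close> and \<open>\<beta>\<close> are both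
    transformed by \<open>Ad g\<close> for the same \<open>g\<close>, which leaves their inner product
    unchanged.\<close>
  have \<alpha>': "\<alpha> (act ?a x) (mderiv M M (act ?a) x v) = Ad G (fst a) (\<alpha> x v)" for v
    using mderiv_compose[OF M_atlas M_atlas K_atlases(1) \<Phi>_smooth(1) act_smooth[of ?a x], of v] theta_conj(1)[OF G M_atlas \<Phi>_smooth(1)[of x], of "fst a" v]
    by (simp add: \<alpha>_def \<Phi>_equivariant)
  have \<beta>': "\<beta> (act ?a x) (mderiv M M (act ?a) x v) = Ad G (fst a) (\<beta> x v)" for v
    using mderiv_compose[OF M_atlas M_atlas K_atlases(1) \<Phi>_smooth(2) act_smooth[of ?a x], of v] theta_conj(2)[OF G M_atlas \<Phi>_smooth(2)[of x], of "fst a" v]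
    by (simp add: \<beta>_def \<Phi>_equivariant)
  show "fused_form (fused_action a x) (r' (fused_action a x)) (s' (fused_action a x)) = fused_form x (r x) (s x)"
    unfolding fused_form_eq fa \<sigma> push \<alpha>' \<beta>' ip_facts(4)[OF G] ..
qed

lemma equivariant_fused: "equivariant_moment_map (prod_lie G H) M fused_action fused_moment"
  unfolding equivariant_moment_map_def
proof (intro conjI allI)
  show "smooth_map_on M (mfd (prod_lie G H)) UNIV fused_moment"
    using fused_moment_smooth unfolding prod_lie_simps smooth_map_on_iff[OF M_atlas K_atlases(3)] by simp
  fix a x
  show "fused_moment (fused_action a x) = gmult (prod_lie G H) (gmult (prod_lie G H) a (fused_moment x)) (ginv (prod_lie G H) a)"
    by (simp add: fused_action_eq fused_moment_eq \<Phi>_equivariant ginv_prod_lie[OF G H] group_laws[OF G] group_laws[OF H])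
qed

lemma bm_form3_chi:
  "bm_form3 B m (\<lambda>x p q r. - chi (prod_lie G H) (fused_moment x) (d_fused_moment x (fst p)) (d_fused_moment x (fst q)) (d_fused_moment x (fst r)))"
  by (rule bm_form3_pullback_chi[OF Q_facts(1) GH_lie fused_moment_smooth])

text \<open>Exterior derivative of the correction term. By the Maurer--Cartan equations
  \<open>d(\<alpha> \<and> \<beta>)\<close> consists of the mixed terms of \<open>(\<alpha> + \<beta>, [\<alpha> + \<beta>, \<alpha> + \<beta>])\<close>, which is what
  the pull-back of \<open>\<chi>\<close> under \<open>\<Phi>\<^sub>1 \<Phi>\<^sub>2\<close> has in excess of the sum of the two pull-backs.\<close>

lemma ext_deriv2_fused:
  assumes x: "x \<notin> hypersurface B"
  shows "ext_deriv2 M (\<lambda>y u v. fused_form y (bm_lift B m y u) (bm_lift B m y v)) x u v w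
    = - chi (prod_lie G H) (fused_moment x) (d_fused_moment x u) (d_fused_moment x v) (d_fused_moment x w)"
proof -
  let ?c = "chart_at M x" and ?l = "bm_lift B m"
  let ?E = "coord_field M ?c"
  define a where "a v y = \<alpha> y (?E v y)" for v y
  define b where "b v y = \<beta> y (?E v y)" for v y
  define s where "s v w y = \<sigma> y (?l y (?E v y)) (?l y (?E w y))" for v w y
  let ?d = "\<lambda>f u. mderiv M vector_manifold f x u"
  have sa: "smooth_at M vector_manifold (a v) x" and mca: "?d (a v) u - ?d (a u) v = lie_bracket G (a u x) (a v x)" for u v
    unfolding a_def[abs_def] \<alpha>_def by (rule maurer_cartan_left[OF G M_atlas \<Phi>_smooth(1)])+
  have sb: "smooth_at M vector_manifold (b v) x" and mcb: "?d (b v) u - ?d (b u) v = - lie_bracket G (b u x) (b v x)" for u v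
    unfolding b_def[abs_def] \<beta>_def by (rule maurer_cartan_right[OF G M_atlas \<Phi>_smooth(2)])+
  have ss: "smooth_at M vector_manifold (s v w) x" for v w
    unfolding s_def[abs_def] by (rule bm_form2_lift_coord_smooth[OF Q_facts(1,3) x])
  have ax: "a v x = \<alpha> x v" "b v x = \<beta> x v" for v by (simp_all add: a_def b_def coord_field_chart_at[OF M_atlas])
  note bil = smooth_at_vector_bilinear[OF M_atlas bounded_bilinear_ip[OF G]]
  note dbil = mderiv_vector_bilinear[OF M_atlas bounded_bilinear_ip[OF G] sa sb]
  have sw: "smooth_at M vector_manifold (\<lambda>y. ip G (a v y) (b w y) - ip G (a w y) (b v y)) x" for v w
    by (intro smooth_at_vector_diff[OF M_atlas] bil sa sb)
  have dw: "?d (\<lambda>y. ip G (a v y) (b w y) - ip G (a w y) (b v y)) u =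
      ip G (a v x) (?d (b w) u) + ip G (?d (a v) u) (b w x) - (ip G (a w x) (?d (b v) u) + ip G (?d (a w) u) (b v x))" for u v w
  proof -
    have "?d (\<lambda>y. ip G (a v y) (b w y) + - ip G (a w y) (b v y)) u =
        ?d (\<lambda>y. ip G (a v y) (b w y)) u + ?d (\<lambda>y. - ip G (a w y) (b v y)) u"
      by (intro mderiv_vector_add[OF M_atlas] smooth_at_vector_uminus[OF M_atlas] bil sa sb)
    moreover have "?d (\<lambda>y. - ip G (a w y) (b v y)) u = - ?d (\<lambda>y. ip G (a w y) (b v y)) u"
      by (rule mderiv_vector_linear[OF M_atlas, of uminus, OF _ bil[OF sa sb]]) (auto intro: linearI)
    ultimately show ?thesis by (simp add: dbil)
  qed
  have dh: "?d (\<lambda>y. fused_form y (?l y (?E v y)) (?l y (?E w y))) u =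
      ?d (s v w) u - 1 / 2 * ?d (\<lambda>y. ip G (a v y) (b w y) - ip G (a w y) (b v y)) u" for u v w
  proof -
    define k :: real where "k = - 1 / 2"
    have 1: "(\<lambda>y. fused_form y (?l y (?E v y)) (?l y (?E w y))) =
        (\<lambda>y. s v w y + k * (ip G (a v y) (b w y) - ip G (a w y) (b v y)))"
      by (simp add: fun_eq_iff fused_form_eq s_def a_def b_def bm_lift_def k_def)
    have 2: "?d (\<lambda>y. k * (ip G (a v y) (b w y) - ip G (a w y) (b v y))) u =
        k * ?d (\<lambda>y. ip G (a v y) (b w y) - ip G (a w y) (b v y)) u"
      by (rule mderiv_vector_linear[OF M_atlas, of "\<lambda>r. k * r", OF _ sw]) (auto intro!: linearI simp: algebra_simps)
    have 3: "smooth_at M vector_manifold (\<lambda>y. k * (ip G (a v y) (b w y) - ip G (a w y) (b v y))) x"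
      by (intro smooth_at_vector_bilinear[OF M_atlas bounded_bilinear_mult] sw smooth_at_const[OF M_atlas smooth_atlas_vector])
    show ?thesis unfolding 1 mderiv_vector_add[OF M_atlas ss 3] 2 by (simp add: k_def)
  qed
  \<comment> \<open>The Maurer--Cartan equations exchange \<open>u\<close> and \<open>v\<close> in the
    derivatives, at the price of a bracket. In the alternating sum below all derivatives of
    \<open>\<alpha>\<close> and \<open>\<beta>\<close> then cancel.\<close>
  have ta: "ip G (?d (a v) u) z = ip G (?d (a u) v) z + triple G z (\<alpha> x u) (\<alpha> x v)" for u v z
    using mca[of v u] linear_diff[OF ip_facts(2)[OF G, of z], of "?d (a v) u" "?d (a u) v"] ip_facts(3)[OF G, of "lie_bracket G (a u x) (a v x)" z]
    by (simp add: ax triple_def[OF G])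
  have tb: "ip G z (?d (b v) u) = ip G z (?d (b u) v) - triple G z (\<beta> x u) (\<beta> x v)" for u v z
    using mcb[of v u] linear_diff[OF ip_facts(1)[OF G, of z], of "?d (b v) u" "?d (b u) v"] linear_neg[OF ip_facts(1)[OF G]]
    by (simp add: ax triple_def[OF G])
  note cyc = triple_cyclic[OF G]
  let ?t = "triple G"
  have old: "?d (s v w) u - ?d (s u w) v + ?d (s u v) w =
     - (1 / 2 * (?t (\<alpha> x u) (\<alpha> x v) (\<alpha> x w) + ?t (\<beta> x u) (\<beta> x v) (\<beta> x w) + triple H (\<gamma> x u) (\<gamma> x v) (\<gamma> x w)))"
  proof -
    let ?K = "prod_lie G (prod_lie G H)"
    have "bm_has_ext_deriv B m \<sigma> (\<lambda>x p q r. - chi ?K (\<Phi> x) (mderiv M (mfd ?K) \<Phi> x (fst p)) (mderiv M (mfd ?K) \<Phi> x (fst q)) (mderiv M (mfd ?K) \<Phi> x (fst r)))"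
      using Q unfolding singular_quasi_hamiltonian_def Let_def by (elim conjE) assumption
    then have "- chi ?K (\<Phi> x) (mderiv M (mfd ?K) \<Phi> x (fst (?l x u))) (mderiv M (mfd ?K) \<Phi> x (fst (?l x v))) (mderiv M (mfd ?K) \<Phi> x (fst (?l x w)))
       = ext_deriv2 M (\<lambda>y u v. \<sigma> y (?l y u) (?l y v)) x u v w"
      using x unfolding bm_has_ext_deriv_def by blast
    then show ?thesis unfolding chi_d\<Phi> by (simp add: ext_deriv2_def Let_def s_def[abs_def] bm_lift_def)
  qed
  have "ext_deriv2 M (\<lambda>y u v. fused_form y (?l y u) (?l y v)) x u v w =
     (?d (s v w) u - ?d (s u w) v + ?d (s u v) w) - 1 / 2 *
       (?t (\<beta> x w) (\<alpha> x u) (\<alpha> x v) - ?t (\<beta> x v) (\<alpha> x u) (\<alpha> x w) + ?t (\<beta> x u) (\<alpha> x v) (\<alpha> x w)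
      - ?t (\<alpha> x v) (\<beta> x u) (\<beta> x w) + ?t (\<alpha> x w) (\<beta> x u) (\<beta> x v) + ?t (\<alpha> x u) (\<beta> x v) (\<beta> x w))"
    using ta[of v u "\<beta> x w"] ta[of w u "\<beta> x v"] ta[of w v "\<beta> x u"] tb[of "\<alpha> x v" w u] tb[of "\<alpha> x w" v u] tb[of "\<alpha> x u" w v]
    unfolding ext_deriv2_def Let_def dh dw ax by (simp add: algebra_simps)
  \<comment> \<open>The six remaining terms are the mixed ones in the expansion of the triple product of
    \<open>\<alpha> + \<beta>\<close>.\<close>
  also have "\<dots> = - (1 / 2 * ?t (\<alpha> x u + \<beta> x u) (\<alpha> x v + \<beta> x v) (\<alpha> x w + \<beta> x w) + 1 / 2 * triple H (\<gamma> x u) (\<gamma> x v) (\<gamma> x w))"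
    unfolding old
    using cyc(2)[of "\<beta> x w" "\<alpha> x u" "\<alpha> x v"] triple_swap(2)[OF G, of "\<alpha> x u" "\<beta> x v" "\<alpha> x w"]
      triple_swap(2)[OF G, of "\<beta> x u" "\<alpha> x v" "\<beta> x w"] cyc(2)[of "\<alpha> x w" "\<beta> x u" "\<beta> x v"]
    by (simp add: linear_add[OF triple_linear(1)[OF G]] linear_add[OF triple_linear(2)[OF G]] linear_add[OF triple_linear(3)[OF G]] algebra_simps)
  finally show ?thesis unfolding chi_d_fused_moment .
qed

lemma ip_Ad_ginv: "ip G (Ad G (ginv G a) u) v = ip G u (Ad G a v)"
  using ip_facts(4)[OF G, of a "Ad G (ginv G a) u" v] by (simp add: Ad_inv[OF G])

text \<open>With \<open>\<alpha>\<close> and \<open>\<beta>\<close> evaluated on a vector, the given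
  moment map condition for \<open>(\<zeta>, \<zeta>, \<eta>)\<close> pairs \<open>\<zeta>\<close> with
  \<open>\<alpha> + Ad \<Phi>1 \<alpha> + Ad \<Phi>2\<^sup>-\<^sup>1 \<beta> + \<beta>\<close>. The
  correction term removes \<open>\<alpha>\<close> and \<open>\<beta>\<close> and adds \<open>Ad
  \<Phi>2\<^sup>-\<^sup>1 \<alpha>\<close> and \<open>Ad \<Phi>1 \<beta>\<close>. What results is the
  sum of the two conjugates of \<open>\<alpha> + \<beta>\<close> in \<open>theta_gmult\<close>.\<close>

lemma moment_condition_fused:
  "\<exists>s. bm_field B m UNIV s \<and> fst \<circ> s = fundamental_field (prod_lie G H) M fused_action \<xi> \<and>
     (\<forall>x. \<forall>p\<in>bm_fibre B m x. fused_form x (s x) p = 1 / 2 * ip (prod_lie G H)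
        (theta_l (prod_lie G H) (fused_moment x) (d_fused_moment x (fst p)) + theta_r (prod_lie G H) (fused_moment x) (d_fused_moment x (fst p))) \<xi>)"
proof -
  obtain \<zeta> \<eta> where \<xi>: "\<xi> = (\<zeta>, \<eta>)" by fastforce
  obtain s where s: "bm_field B m UNIV s" "fst \<circ> s = fund (\<zeta>, \<zeta>, \<eta>)"
    and eq: "\<And>x p. p \<in> bm_fibre B m x \<Longrightarrow> \<sigma> x (s x) p = 1 / 2 * (ip G (\<alpha> x (fst p) + Ad G (\<Phi>1 x) (\<alpha> x (fst p))) \<zeta>
       + ip G (Ad G (ginv G (\<Phi>2 x)) (\<beta> x (fst p)) + \<beta> x (fst p)) \<zeta> + ip H (\<gamma> x (fst p) + Ad H (\<Phi>3 x) (\<gamma> x (fst p))) \<eta>)"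
    using moment_condition[of \<zeta> \<zeta> \<eta>] by blast
  have fs: "fst (s x) = fund (\<zeta>, \<zeta>, \<eta>) x" for x using fun_cong[OF s(2), of x] by simp
  have "fused_form x (s x) p = 1 / 2 * ip (prod_lie G H)
        (theta_l (prod_lie G H) (fused_moment x) (d_fused_moment x (fst p)) + theta_r (prod_lie G H) (fused_moment x) (d_fused_moment x (fst p))) \<xi>"
    if p: "p \<in> bm_fibre B m x" for x p
  proof -
    let ?a = "\<alpha> x (fst p)" and ?b = "\<beta> x (fst p)"
    have 1: "ip G (\<zeta> - Ad G (ginv G (\<Phi>1 x)) \<zeta>) ?b = ip G ?b \<zeta> - ip G (Ad G (\<Phi>1 x) ?b) \<zeta>"
      by (simp add: linear_diff[OF ip_facts(2)[OF G]] ip_Ad_ginv ip_facts(3)[OF G, of \<zeta>])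
    have 2: "ip G ?a (Ad G (\<Phi>2 x) \<zeta> - \<zeta>) = ip G (Ad G (ginv G (\<Phi>2 x)) ?a) \<zeta> - ip G ?a \<zeta>"
      by (simp add: linear_diff[OF ip_facts(1)[OF G]] ip_Ad_ginv)
    show ?thesis
      unfolding fused_form_eq fs \<alpha>_fund \<beta>_fund eq[OF p] 1 2 theta_l_d_fused_moment theta_r_d_fused_moment \<xi>
      unfolding prod_lie_simps
      by (simp add: linear_add[OF linear_Ad[OF G]] linear_add[OF ip_facts(2)[OF G]] algebra_simps)
  qed
  then show ?thesis using s by (auto simp: \<xi> fundamental_field_fusion)
qed

text \<open>On the kernel of the derivative of \<open>\<Phi>1 \<Phi>2\<close> one has \<open>\<beta> = -
  \<alpha>\<close>. Pairing a vector in both kernels with the fundamental fields of the first factor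
  alone, which are not fundamental fields of the fused action, then gives \<open>(\<alpha>, \<xi>) =
  0\<close> for all \<open>\<xi>\<close>.\<close>

lemma nondegenerate_fused:
  assumes p: "p \<in> bm_fibre B m x" and ker: "\<forall>q\<in>bm_fibre B m x. fused_form x p q = 0" and d: "d_fused_moment x (fst p) = 0"
  shows "p = 0"
proof -
  let ?a = "\<alpha> x (fst p)" and ?b = "\<beta> x (fst p)"
  have "theta_l (prod_lie G H) (fused_moment x) (d_fused_moment x (fst p)) = 0"
    unfolding d by (rule linear_0[OF linear_theta_l[OF GH_lie]])
  then have t: "Ad G (ginv G (\<Phi>2 x)) (?a + ?b) = 0" "\<gamma> x (fst p) = 0"
    unfolding theta_l_d_fused_moment by (simp_all add: zero_prod_def)
  have "?a + ?b = 0"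
    using Ad_inv(1)[OF G, of "\<Phi>2 x" "?a + ?b"] t(1) linear_0[OF linear_Ad[OF G]] by simp
  then have b: "?b = - ?a" by (simp add: eq_neg_iff_add_eq_0 add.commute)
  have "ip G ?a \<xi> = 0" for \<xi>
  proof -
    obtain s where s: "bm_field B m UNIV s" "fst \<circ> s = fund (\<xi>, 0, 0)"
      and eq: "\<And>x p. p \<in> bm_fibre B m x \<Longrightarrow> \<sigma> x (s x) p = 1 / 2 * (ip G (\<alpha> x (fst p) + Ad G (\<Phi>1 x) (\<alpha> x (fst p))) \<xi>
       + ip G (Ad G (ginv G (\<Phi>2 x)) (\<beta> x (fst p)) + \<beta> x (fst p)) 0 + ip H (\<gamma> x (fst p) + Ad H (\<Phi>3 x) (\<gamma> x (fst p))) 0)"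
      using moment_condition[of \<xi> 0 0] by blast
    have fs: "fst (s x) = fund (\<xi>, 0, 0) x" using fun_cong[OF s(2), of x] by simp
    have sx: "s x \<in> bm_fibre B m x" using s(1) by (simp add: bm_field_def)
    have "s x + p \<in> bm_fibre B m x" using subspace_bm_fibre[OF Q_facts(1)] sx p by (simp add: subspace_def)
    then have anti: "\<sigma> x p (s x) = - \<sigma> x (s x) p"
      using Q_facts(3) sx p by (intro alternating2_on_antisym) (auto simp: bm_form2_def)
    have "fused_form x p (s x) = 0" using ker sx by blast
    then have "- (1 / 2 * (ip G ?a \<xi> + ip G (Ad G (\<Phi>1 x) ?a) \<xi>)) - 1 / 2 * (ip G (\<xi> - Ad G (ginv G (\<Phi>1 x)) \<xi>) ?a) = 0"
      unfolding fused_form_eq anti eq[OF p] fs \<alpha>_fund \<beta>_fund b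
      by (simp add: linear_0[OF linear_Ad[OF G]] linear_0[OF ip_facts(1)[OF G]] linear_0[OF ip_facts(1)[OF H]]
          linear_neg[OF ip_facts(1)[OF G]] linear_add[OF ip_facts(2)[OF G]])
    moreover have "ip G (\<xi> - Ad G (ginv G (\<Phi>1 x)) \<xi>) ?a = ip G ?a \<xi> - ip G (Ad G (\<Phi>1 x) ?a) \<xi>"
      by (simp add: linear_diff[OF ip_facts(2)[OF G]] ip_Ad_ginv ip_facts(3)[OF G, of \<xi>])
    moreover have "- (1 / 2 * (a + b)) - 1 / 2 * c = 0 \<Longrightarrow> c = a - b \<Longrightarrow> a = 0" for a b c :: real
      by argo
    ultimately show ?thesis by blast
  qed
  then have a0: "?a = 0" using ip_facts(5)[OF G] by blast
  then have b0: "?b = 0" using b by simp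
  have "mderiv M (mfd G) \<Phi>1 x (fst p) = 0" using a0 by (simp add: \<alpha>_def theta_l_eq_0_iff[OF G])
  moreover have "mderiv M (mfd G) \<Phi>2 x (fst p) = 0"
  proof -
    have "theta_l G (\<Phi>2 x) (mderiv M (mfd G) \<Phi>2 x (fst p)) = Ad G (ginv G (\<Phi>2 x)) ?b"
      by (simp add: \<beta>_def theta_r_eq_Ad[OF G] Ad_inv[OF G])
    then show ?thesis by (simp add: b0 linear_0[OF linear_Ad[OF G]] theta_l_eq_0_iff[OF G])
  qed
  moreover have "mderiv M (mfd H) \<Phi>3 x (fst p) = 0" using t(2) by (simp add: \<gamma>_def theta_l_eq_0_iff[OF H])
  ultimately have "mderiv M (mfd (prod_lie G (prod_lie G H))) \<Phi> x (fst p) = 0" unfolding \<Phi>_mderiv by (simp add: zero_prod_def)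
  moreover have "\<sigma> x p q = 0" if "q \<in> bm_fibre B m x" for q
    using bspec[OF ker that] unfolding fused_form_eq a0 b0
    by (simp add: linear_0[OF ip_facts(1)[OF G]] linear_0[OF ip_facts(2)[OF G]])
  moreover have "\<forall>x. \<forall>p\<in>bm_fibre B m x. (\<forall>q\<in>bm_fibre B m x. \<sigma> x p q = 0) \<and>
      mderiv M (mfd (prod_lie G (prod_lie G H))) \<Phi> x (fst p) = 0 \<longrightarrow> p = 0"
    using Q unfolding singular_quasi_hamiltonian_def Let_def by (elim conjE) assumption
  ultimately show ?thesis using p by blast
qed

theorem singular_quasi_hamiltonian_fusion:
  "singular_quasi_hamiltonian (prod_lie G H) m B fused_action fused_form fused_moment"
proof -
  have fst_lift: "fst (bm_lift B m x u) = u" for x u by (simp add: bm_lift_def)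
  show ?thesis
    unfolding singular_quasi_hamiltonian_def Let_def bm_has_ext_deriv_def
    using Q_facts(1) bm_action_fused bm_form2_fused bm_invariant_fused equivariant_fused bm_form3_chi
    by (intro conjI allI impI ballI moment_condition_fused)
       (auto intro: nondegenerate_fused simp: ext_deriv2_fused fst_lift simp del: split_paired_All prod_lie_simps)
qed

end

section \<open>Local frames of \<open>b\<^sup>m\<close>-fields\<close>

lemma linear_functional_on_sum:
  assumes f: "linear_functional_on V f" and V: "subspace V" and e: "\<And>j. j \<in> J \<Longrightarrow> e j \<in> V"
  shows "f (\<Sum>j\<in>J. a j *\<^sub>R e j) = (\<Sum>j\<in>J. a j * f (e j))"
  using e
proof (induction J rule: infinite_finite_induct)
  case (insert j J)
  have "(\<Sum>j\<in>J. a j *\<^sub>R e j) \<in> V" "a j *\<^sub>R e j \<in> V"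
    using insert.prems V by (auto intro!: subspace_sum subspace_scale)
  then show ?case using insert f by (simp add: linear_functional_on_def)
next
  case empty
  have "f (0 *\<^sub>R 0) = 0 * f 0" using f subspace_0[OF V] unfolding linear_functional_on_def by blast
  then show ?case by simp
next
  case (infinite J)
  have "f (0 *\<^sub>R 0) = 0 * f 0" using f subspace_0[OF V] unfolding linear_functional_on_def by blast
  then show ?case using infinite by simp
qed

lemma alternating2_on_sum:
  assumes b: "alternating2_on V b" and V: "subspace V" and e: "\<And>j. j \<in> J \<Longrightarrow> e j \<in> V"
  shows "b (\<Sum>j\<in>J. a j *\<^sub>R e j) (\<Sum>k\<in>J. c k *\<^sub>R e k) = (\<Sum>j\<in>J. \<Sum>k\<in>J. a j * (c k * b (e j) (e k)))"
proof -
  have s: "(\<Sum>k\<in>J. c k *\<^sub>R e k) \<in> V" using e V by (intro subspace_sum subspace_scale) auto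
  have "b (\<Sum>j\<in>J. a j *\<^sub>R e j) (\<Sum>k\<in>J. c k *\<^sub>R e k) = (\<Sum>j\<in>J. a j * b (e j) (\<Sum>k\<in>J. c k *\<^sub>R e k))"
    by (rule linear_functional_on_sum[OF _ V e]) (use b s in \<open>auto simp: alternating2_on_def\<close>)
  also have "\<dots> = (\<Sum>j\<in>J. a j * (\<Sum>k\<in>J. c k * b (e j) (e k)))"
    by (intro sum.cong refl arg_cong2[where f = "(*)"] linear_functional_on_sum[OF _ V e])
       (use b e in \<open>auto simp: alternating2_on_def\<close>)
  finally show ?thesis by (simp add: sum_distrib_left)
qed

text \<open>Coefficients with respect to a local spanning family of \<open>b\<^sup>m\<close>-fields,
  indexed by the orthonormal basis and one further element \<open>None\<close>. The switch
  \<open>k\<close> is 1 near points of the hypersurface, where \<open>None\<close> stands for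
  \<open>t\<^sup>m \<partial>\<^sub>t\<close>, and 0 elsewhere, where the member for \<open>None\<close>
  is the zero field. Near the hypersurface the family is not linearly independent; what matters is that
  the coefficients of a smooth field are smooth.\<close>

definition frame_coeff ::
  "('m, 'e::fin_dim_inner) manifold \<Rightarrow> ('m, 'e) chart \<Rightarrow> real \<Rightarrow> 'e option \<Rightarrow> 'm \<Rightarrow> 'e \<times> real \<Rightarrow> real" where
  "frame_coeff M c k j x p = (case j of None \<Rightarrow> k * snd p | Some b \<Rightarrow> inner (components M c x (fst p)) b)"

abbreviation frame_index :: "'e::fin_dim_inner option set" where
  "frame_index \<equiv> insert None (Some ` onb)"

lemma sum_frame_index: "(\<Sum>j\<in>frame_index. f j) = f None + (\<Sum>b\<in>onb. f (Some b))"
  by (simp add: onb(1) sum.reindex)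

context
  fixes B :: "('m::{t2_space, second_countable_topology}, 'e::fin_dim_inner) b_manifold_data"
  assumes B: "b_manifold B"
begin

text \<open>Away from the hypersurface the lifts of the coordinate fields form a frame.\<close>

lemma bm_local_frame_off:
  assumes x0: "x0 \<notin> hypersurface B"
  defines "c \<equiv> chart_at (space B) x0"
  obtains U E where "open U" "x0 \<in> U" "U \<subseteq> fst c" "\<And>j. bm_field B m U (E j)"
    "\<And>x p. x \<in> U \<Longrightarrow> p \<in> bm_fibre B m x \<Longrightarrow> p = (\<Sum>j\<in>frame_index. frame_coeff (space B) c 0 j x p *\<^sub>R E j x)"
proof -
  note space_atlas = space_atlas[OF B]
  let ?U = "fst c \<inter> - hypersurface B"
  define E where "E j x = (case j of None \<Rightarrow> 0 | Some b \<Rightarrow> bm_lift B m x (coord_field (space B) c b x))" for j x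
  have c: "c \<in> atlas (space B)" "x0 \<in> fst c" unfolding c_def by (rule chart_at[OF space_atlas])+
  have U: "open ?U" "x0 \<in> ?U"
    using B chart_open[OF space_atlas c(1)] c x0 by (auto simp: b_manifold_def intro: open_Int)
  have fld: "field_at (space B) (coord_field (space B) c v) y" if "y \<in> ?U" for y v
    using field_along_coord_field[OF space_atlas space_atlas smooth_at_ident[OF space_atlas] c(1), of y "\<lambda>_. v"] that
    by (simp add: smooth_at_const[OF space_atlas smooth_atlas_vector])
  have E: "bm_field B m ?U (E j)" for j
  proof (cases j)
    case None
    have "bm_field B m ?U (\<lambda>y. bm_lift B m y (coord_field (space B) c 0 y))"
      using fld by (intro bm_field_lift[OF B U(1)]) auto
    moreover have "bm_lift B m y (coord_field (space B) c 0 y) = E None y" if "y \<in> ?U" for y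
    proof -
      have l: "y \<in> nbhd B \<Longrightarrow> linear (d_def_fun B y)" by (rule linear_mderiv[OF space_atlas smooth_atlas_vector def_fun_smooth[OF B]])
      show ?thesis using that linear_0[OF linear_coord_field[OF space_atlas c(1)]] linear_0[OF l]
        by (auto simp: E_def bm_lift_def zero_prod_def)
    qed
    ultimately show ?thesis using None
      unfolding bm_field_iff[OF B] using U(1)
      by (auto simp: E_def bm_fibre_def zero_prod_def
          intro: field_along_zero[OF space_atlas space_atlas smooth_at_ident[OF space_atlas]] smooth_at_const[OF space_atlas smooth_atlas_vector])
  next
    case (Some b)
    have "bm_field B m ?U (\<lambda>y. bm_lift B m y (coord_field (space B) c b y))"
      using fld by (intro bm_field_lift[OF B U(1)]) auto
    then show ?thesis using Some by (simp add: E_def[abs_def])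
  qed
  show thesis
  proof (rule that[OF U _ E])
    fix x p assume x: "x \<in> ?U" and p: "p \<in> bm_fibre B m x"
    let ?a = "\<lambda>b. inner (components (space B) c x (fst p)) b"
    have v: "(\<Sum>b\<in>onb. ?a b *\<^sub>R coord_field (space B) c b x) = fst p"
      using linear_onb_expansion[OF linear_coord_field[OF space_atlas c(1)], of x "components (space B) c x (fst p)"] x
      by (simp add: coord_field_components[OF space_atlas c(1)])
    have "p = bm_lift B m x (fst p)"
      using x p by (cases p) (auto simp: bm_lift_def bm_fibre_def hypersurface_def split: if_splits)
    also have "\<dots> = (\<Sum>b\<in>onb. ?a b *\<^sub>R bm_lift B m x (coord_field (space B) c b x))"
    proof (cases "x \<in> nbhd B")
      case True
      have l: "linear (d_def_fun B x)" by (rule linear_mderiv[OF space_atlas smooth_atlas_vector def_fun_smooth[OF B True]])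
      have "d_def_fun B x (fst p) = (\<Sum>b\<in>onb. ?a b * d_def_fun B x (coord_field (space B) c b x))"
      proof -
        have "(\<Sum>b\<in>onb. ?a b * d_def_fun B x (coord_field (space B) c b x)) =
            d_def_fun B x (\<Sum>b\<in>onb. ?a b *\<^sub>R coord_field (space B) c b x)"
          by (simp add: linear_sum[OF l] linear_cmul[OF l])
        then show ?thesis by (simp only: v)
      qed
      then show ?thesis
        using True v by (simp add: bm_lift_def prod_eq_iff fst_sum snd_sum sum_divide_distrib)
    next
      case False
      then show ?thesis using v by (simp add: bm_lift_def prod_eq_iff fst_sum snd_sum)
    qed
    finally show "p = (\<Sum>j\<in>frame_index. frame_coeff (space B) c 0 j x p *\<^sub>R E j x)"
      unfolding sum_frame_index by (simp add: frame_coeff_def E_def)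
  qed auto
qed

text \<open>At a point of the hypersurface, take a coordinate field \<open>V\<close> with \<open>dt(V)
  \<noteq> 0\<close>. The family consists of the coordinate fields, corrected by multiples of
  \<open>V\<close> so that \<open>dt\<close> vanishes on them, and of \<open>t\<^sup>m V /
  dt(V)\<close>.\<close>

lemma bm_local_frame_on:
  assumes x0: "x0 \<in> hypersurface B"
  defines "c \<equiv> chart_at (space B) x0"
  obtains U E where "open U" "x0 \<in> U" "U \<subseteq> fst c" "U \<subseteq> nbhd B" "\<And>j. bm_field B m U (E j)"
    "\<And>x p. x \<in> U \<Longrightarrow> p \<in> bm_fibre B m x \<Longrightarrow> p = (\<Sum>j\<in>frame_index. frame_coeff (space B) c 1 j x p *\<^sub>R E j x)"
proof -
  note space_atlas = space_atlas[OF B] and vb = smooth_at_vector_bilinear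
  let ?dt = "\<lambda>x. d_def_fun B x" and ?t = "def_fun B"
  have c: "c \<in> atlas (space B)" "x0 \<in> fst c" unfolding c_def by (rule chart_at[OF space_atlas])+
  have n0: "x0 \<in> nbhd B" using x0 by (simp add: hypersurface_def)
  obtain v0 where v0: "?dt x0 v0 \<noteq> 0" using B x0 by (auto simp: b_manifold_def)
  let ?V = "\<lambda>x. coord_field (space B) c v0 x"
  define \<tau> where "\<tau> x = ?dt x (?V x)" for x
  have fld: "field_at (space B) (coord_field (space B) c v) y" if "y \<in> fst c" for y v
    using field_along_coord_field[OF space_atlas space_atlas smooth_at_ident[OF space_atlas] c(1) that, of "\<lambda>_. v"]
    by (simp add: smooth_at_const[OF space_atlas smooth_atlas_vector])
  have dt: "smooth_at (space B) vector_manifold (\<lambda>x. ?dt x (X x)) x"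
    if "x \<in> nbhd B" "field_at (space B) X x" for X x
    using field_along_mderiv_vector[OF space_atlas space_atlas smooth_at_ident[OF space_atlas] chart_at[OF space_atlas] that(2)[unfolded field_along_def] def_fun_smooth[OF B that(1)]] .
  have \<tau>: "smooth_at (space B) vector_manifold \<tau> x" if "x \<in> nbhd B" "x \<in> fst c" for x
    unfolding \<tau>_def[abs_def] by (rule dt[OF that(1) fld[OF that(2)]])
  have \<tau>0: "\<tau> x0 \<noteq> 0" using v0 by (simp add: \<tau>_def c_def coord_field_chart_at[OF space_atlas])
  have "eventually (\<lambda>r. r \<noteq> 0) (nhds (\<tau> x0))" using \<tau>0 by (intro t1_space_nhds)
  then have "eventually (\<lambda>x. \<tau> x \<noteq> 0) (nhds x0)" by (rule smooth_at_pull_eventually[OF \<tau>[OF n0 c(2)]])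
  then obtain U0 where U0: "open U0" "x0 \<in> U0" "\<And>x. x \<in> U0 \<Longrightarrow> \<tau> x \<noteq> 0" by (auto simp: eventually_nhds)
  define U where "U = U0 \<inter> fst c \<inter> nbhd B"
  have U: "open U" "x0 \<in> U" "U \<subseteq> fst c" "U \<subseteq> nbhd B"
    using U0 chart_open[OF space_atlas c(1)] open_nbhd[OF B] c n0 by (auto simp: U_def intro!: open_Int)
  have Ux: "x \<in> fst c" "x \<in> nbhd B" "\<tau> x \<noteq> 0" if "x \<in> U" for x using that U0(3) by (auto simp: U_def)
  define E where "E j x = (case j of None \<Rightarrow> ((?t x ^ m * inverse (\<tau> x)) *\<^sub>R ?V x, 1 :: real)
     | Some b \<Rightarrow> (coord_field (space B) c b x + (- (?dt x (coord_field (space B) c b x) * inverse (\<tau> x))) *\<^sub>R ?V x, 0))" for j x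
  have l: "linear (?dt x)" if "x \<in> U" for x
    by (rule linear_mderiv[OF space_atlas smooth_atlas_vector def_fun_smooth[OF B Ux(2)[OF that]]])
  have E: "bm_field B m U (E j)" for j
    unfolding bm_field_iff[OF B]
  proof (intro conjI ballI impI U(1))
    fix x assume x: "x \<in> U"
    note i\<tau> = smooth_at_real_inverse[OF space_atlas \<tau>[OF Ux(2,1)[OF x]] Ux(3)[OF x]]
    note fa = field_along_scale[OF space_atlas space_atlas smooth_at_ident[OF space_atlas]] field_along_add[OF space_atlas space_atlas smooth_at_ident[OF space_atlas]]
    show "E j x \<in> bm_fibre B m x"
      using Ux[OF x] by (cases j) (auto simp: E_def bm_fibre_def linear_add[OF l[OF x]] linear_diff[OF l[OF x]] linear_cmul[OF l[OF x]] \<tau>_def[symmetric])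
    show "field_at (space B) (\<lambda>y. fst (E j y)) x"
    proof (cases j)
      case None
      have "field_at (space B) (\<lambda>x. (?t x ^ m * inverse (\<tau> x)) *\<^sub>R ?V x) x"
        by (intro fa(1) fld Ux x vb[OF space_atlas bounded_bilinear_mult] smooth_at_real_power[OF space_atlas] def_fun_smooth[OF B] i\<tau>)
      then show ?thesis using None by (simp add: E_def)
    next
      case (Some b)
      have "field_at (space B) (\<lambda>x. coord_field (space B) c b x + (- (?dt x (coord_field (space B) c b x) * inverse (\<tau> x))) *\<^sub>R ?V x) x"
        by (intro fa fld Ux x smooth_at_vector_uminus[OF space_atlas] vb[OF space_atlas bounded_bilinear_mult] dt i\<tau>)
      then show ?thesis using Some by (simp add: E_def)
    qed
    have "(\<lambda>y. snd (E j y)) = (\<lambda>y. if j = None then 1 else 0)" by (cases j) (auto simp: E_def)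
    then show "smooth_at (space B) vector_manifold (\<lambda>y. snd (E j y)) x"
      by (simp add: smooth_at_const[OF space_atlas smooth_atlas_vector])
  qed
  show thesis
  proof (rule that[OF U E])
    fix x p assume x: "x \<in> U" and p: "p \<in> bm_fibre B m x"
    let ?a = "\<lambda>b. inner (components (space B) c x (fst p)) b"
    have v: "(\<Sum>b\<in>onb. ?a b *\<^sub>R coord_field (space B) c b x) = fst p"
      using linear_onb_expansion[OF linear_coord_field[OF space_atlas c(1) Ux(1)[OF x]], of "components (space B) c x (fst p)"]
      by (simp add: coord_field_components[OF space_atlas c(1) Ux(1)[OF x]])
    have dv: "(\<Sum>b\<in>onb. ?a b * ?dt x (coord_field (space B) c b x)) = ?dt x (fst p)"
    proof -
      have "(\<Sum>b\<in>onb. ?a b * ?dt x (coord_field (space B) c b x)) = ?dt x (\<Sum>b\<in>onb. ?a b *\<^sub>R coord_field (space B) c b x)"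
        by (simp add: linear_sum[OF l[OF x]] linear_cmul[OF l[OF x]])
      then show ?thesis by (simp only: v)
    qed
    have dp: "?dt x (fst p) = ?t x ^ m * snd p" using p Ux(2)[OF x] by (cases p) (auto simp: bm_fibre_def)
    have "(\<Sum>b\<in>onb. ?a b *\<^sub>R E (Some b) x) = (fst p + (- (?dt x (fst p) * inverse (\<tau> x))) *\<^sub>R ?V x, 0)"
    proof -
      have "(\<Sum>b\<in>onb. ?a b *\<^sub>R E (Some b) x) = ((\<Sum>b\<in>onb. ?a b *\<^sub>R coord_field (space B) c b x)
          + (- ((\<Sum>b\<in>onb. ?a b * ?dt x (coord_field (space B) c b x)) * inverse (\<tau> x))) *\<^sub>R ?V x, 0)"
        by (simp add: E_def prod_eq_iff fst_sum snd_sum scaleR_right_distrib sum.distrib sum_distrib_right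
            scaleR_left.sum sum_negf scaleR_minus_left mult.assoc flip: scaleR_left.sum)
           (simp add: scaleR_left.sum sum_distrib_right sum_negf mult.assoc scaleR_right_diff_distrib sum_subtractf)
      then show ?thesis by (simp only: v dv)
    qed
    then show "p = (\<Sum>j\<in>frame_index. frame_coeff (space B) c 1 j x p *\<^sub>R E j x)"
      unfolding sum_frame_index by (simp add: frame_coeff_def dp prod_eq_iff) (simp add: E_def algebra_simps)
  qed
qed

lemma bm_local_frame:
  obtains U E k where "open U" "x0 \<in> U" "U \<subseteq> fst (chart_at (space B) x0)" "k = 0 \<or> U \<subseteq> nbhd B" "\<And>j. bm_field B m U (E j)"
    "\<And>x p. x \<in> U \<Longrightarrow> p \<in> bm_fibre B m x \<Longrightarrow>
      p = (\<Sum>j\<in>frame_index. frame_coeff (space B) (chart_at (space B) x0) k j x p *\<^sub>R E j x)"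
proof (cases "x0 \<in> hypersurface B")
  case True
  show ?thesis
    by (rule bm_local_frame_on[OF True], rule that[where k = 1]) (assumption | rule disjI2)+
next
  case False
  show ?thesis
    by (rule bm_local_frame_off[OF False], rule that[where k = 0]) (assumption | rule disjI1 refl)+
qed

text \<open>If \<open>e z \<noteq> 0\<close>, then \<open>t\<close> vanishes near \<open>z\<close>, in
  contradiction to \<open>dt \<noteq> 0\<close> at the points where \<open>t = 0\<close>.\<close>

lemma def_fun_power_cancel:
  assumes z: "z \<in> nbhd B" and e: "smooth_at (space B) vector_manifold (e :: 'm \<Rightarrow> real) z"
    and ev: "eventually (\<lambda>y. def_fun B y ^ m * e y = 0) (nhds z)"
  shows "e z = 0"
proof (rule ccontr)
  note space_atlas = space_atlas[OF B]
  assume ne: "e z \<noteq> 0"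
  then have "eventually (\<lambda>r. r \<noteq> 0) (nhds (e z))" by (intro t1_space_nhds)
  then have "eventually (\<lambda>y. e y \<noteq> 0) (nhds z)" by (rule smooth_at_pull_eventually[OF e])
  with ev have 0: "eventually (\<lambda>y. def_fun B y = 0) (nhds z)" by eventually_elim simp
  have "mderiv (space B) vector_manifold (def_fun B) z v = 0" for v
    using fun_cong[OF mderiv_cong[OF space_atlas 0], of vector_manifold v] by (simp add: mderiv_const)
  moreover have "z \<in> hypersurface B" using z eventually_nhds_x_imp_x[OF 0] by (simp add: hypersurface_def)
  ultimately show False using B unfolding b_manifold_def by blast
qed

text \<open>Smooth quotients by \<open>t\<^sup>m\<close> are unique by the preceding lemma, so locally
  existing ones patch together.\<close>

lemma def_fun_power_divide_glue:
  assumes loc: "\<And>z. z \<in> S \<Longrightarrow> z \<in> nbhd B \<Longrightarrow> \<exists>\<rho>. smooth_at (space B) vector_manifold \<rho> z \<and>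
      eventually (\<lambda>y. f y = def_fun B y ^ m * \<rho> y) (nhds z)"
  obtains r :: "'m \<Rightarrow> real" where "\<And>z. z \<in> S \<Longrightarrow> z \<in> nbhd B \<Longrightarrow> smooth_at (space B) vector_manifold r z"
    "\<And>z. z \<in> S \<Longrightarrow> z \<in> nbhd B \<Longrightarrow> f z = def_fun B z ^ m * r z" "\<And>z. z \<notin> nbhd B \<Longrightarrow> r z = 0"
proof -
  note space_atlas = space_atlas[OF B]
  define germ where "germ \<rho> z \<longleftrightarrow> smooth_at (space B) vector_manifold \<rho> z \<and>
      eventually (\<lambda>y. f y = def_fun B y ^ m * \<rho> y) (nhds z)" for \<rho> z
  define r where "r z = (if z \<in> nbhd B then (SOME \<rho>. germ \<rho> z) z else 0)" for z
  have r: "r z = \<rho> z" if g: "germ \<rho> z" and z: "z \<in> nbhd B" for \<rho> z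
  proof -
    define \<sigma> where "\<sigma> = (SOME \<rho>. germ \<rho> z)"
    have g': "germ \<sigma> z" unfolding \<sigma>_def by (rule someI[of "\<lambda>\<rho>. germ \<rho> z", OF g])
    have "\<sigma> z - \<rho> z = 0"
    proof (rule def_fun_power_cancel[OF z, of "\<lambda>y. \<sigma> y - \<rho> y"])
      show "smooth_at (space B) vector_manifold (\<lambda>y. \<sigma> y - \<rho> y) z"
        using g g' by (intro smooth_at_vector_diff[OF space_atlas]) (auto simp: germ_def)
      show "eventually (\<lambda>y. def_fun B y ^ m * (\<sigma> y - \<rho> y) = 0) (nhds z)"
        using conjunct2[OF g[unfolded germ_def]] conjunct2[OF g'[unfolded germ_def]]
        by eventually_elim (simp add: right_diff_distrib)
    qed
    then show ?thesis using z by (simp add: r_def \<sigma>_def)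
  qed
  show thesis
  proof (rule that[of r])
    fix z assume z: "z \<in> S" "z \<in> nbhd B"
    obtain \<rho> where \<rho>: "germ \<rho> z" using loc[OF z] unfolding germ_def by blast
    show "f z = def_fun B z ^ m * r z"
      using \<rho> r[OF \<rho> z(2)] by (auto simp: germ_def dest: eventually_nhds_x_imp_x)
    have "eventually (\<lambda>y. \<rho> y = r y) (nhds z)"
    proof -
      have "eventually (\<lambda>y. y \<in> nbhd B) (nhds z)" using open_nbhd[OF B] z(2) by (auto simp: eventually_nhds)
      moreover have "eventually (\<lambda>y. smooth_at (space B) vector_manifold \<rho> y) (nhds z)"
        using \<rho> by (intro smooth_at_eventually) (simp add: germ_def)
      moreover have "eventually (\<lambda>y. eventually (\<lambda>y. f y = def_fun B y ^ m * \<rho> y) (nhds y)) (nhds z)"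
        using \<rho> by (simp add: germ_def eventually_eventually)
      ultimately show ?thesis by eventually_elim (simp add: r germ_def)
    qed
    then show "smooth_at (space B) vector_manifold r z"
      by (rule smooth_at_cong[OF space_atlas smooth_atlas_vector conjunct1[OF \<rho>[unfolded germ_def]]])
  qed (simp add: r_def)
qed

end

section \<open>The product of a singular and an ordinary quasi-Hamiltonian space\<close>

lemma group_actionI:
  assumes K: "Group.group K" and c: "carrier K = UNIV" and one: "\<And>x. \<phi> \<one>\<^bsub>K\<^esub> x = x"
    and comp: "\<And>a b x. \<phi> (a \<otimes>\<^bsub>K\<^esub> b) x = \<phi> a (\<phi> b x)"
  shows "group_action K UNIV \<phi>"
proof -
  interpret K: Group.group K by (rule K)
  have inv: "\<phi> a (\<phi> (inv\<^bsub>K\<^esub> a) x) = x" "\<phi> (inv\<^bsub>K\<^esub> a) (\<phi> a x) = x" for a x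
    using c by (simp_all add: comp[symmetric] one)
  have "bij (\<phi> a)" for a by (rule bij_betw_byWitness[where f' = "\<phi> (inv\<^bsub>K\<^esub> a)"]) (auto simp: inv)
  then have B: "\<phi> a \<in> Bij UNIV" for a by (simp add: Bij_def extensional_def)
  have "\<phi> \<in> hom K (BijGroup UNIV)"
    by (intro homI) (auto simp: BijGroup_def B compose_def fun_eq_iff comp)
  then show ?thesis
    using K by (simp add: group_action_def group_hom_def group_hom_axioms_def group_BijGroup)
qed

text \<open>\<open>smooth_form2\<close> tests a form on fields of \<open>N\<close>, whereas here the
  vectors depend on a point of \<open>M\<close> mapped to \<open>N\<close>. Expanding them in coordinate
  fields of \<open>N\<close> moves this dependence into the coefficients.\<close>

lemma form2_along_smooth:
  assumes M: "smooth_atlas M" and N: "smooth_atlas N" and \<omega>: "smooth_form2 N \<omega>"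
    and q: "smooth_at M N q z" and X: "field_along M N q X z" and Y: "field_along M N q Y z"
  shows "smooth_at M vector_manifold (\<lambda>y. \<omega> (q y) (X y) (Y y)) z"
proof (rule smooth_at_cong[OF M smooth_atlas_vector])
  let ?c = "chart_at N (q z)"
  note c = chart_at[OF N, of "q z"]
  let ?E = "\<lambda>b. coord_field N ?c b"
  let ?a = "\<lambda>V b y. inner (components N ?c (q y) (V y)) b"
  have a: "smooth_at M vector_manifold (?a V b) z" if "field_along M N q V z" for V b
    using that unfolding field_along_def
    by (rule smooth_at_near_compose[OF M _ smooth_near_bounded_linear[OF bounded_linear_inner_left]])
  have E: "smooth_at N vector_manifold (\<lambda>u. \<omega> u (?E b u) (?E b' u)) (q z)" for b b'
  proof -
    have f: "smooth_field N (fst ?c) (?E b)" for b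
      unfolding smooth_field_iff[OF N]
      using chart_open[OF N c(1)] field_along_coord_field[OF N N smooth_at_ident[OF N] c(1), of _ "\<lambda>_. b"]
      by (simp add: smooth_at_const[OF N smooth_atlas_vector])
    then have "smooth_map_on N vector_manifold (fst ?c) (\<lambda>u. \<omega> u (?E b u) (?E b' u))"
      using \<omega> unfolding smooth_form2_def by blast
    then show ?thesis using c(2) unfolding smooth_map_on_iff[OF N smooth_atlas_vector] by blast
  qed
  show "smooth_at M vector_manifold (\<lambda>y. \<Sum>b\<in>onb. \<Sum>b'\<in>onb. ?a X b y * (?a Y b' y * \<omega> (q y) (?E b (q y)) (?E b' (q y)))) z"
    by (intro smooth_at_vector_sum[OF M] smooth_at_vector_bilinear[OF M bounded_bilinear_mult] a X Y
        smooth_at_compose[OF M N smooth_atlas_vector E q])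
  show "eventually (\<lambda>y. (\<Sum>b\<in>onb. \<Sum>b'\<in>onb. ?a X b y * (?a Y b' y * \<omega> (q y) (?E b (q y)) (?E b' (q y)))) =
      \<omega> (q y) (X y) (Y y)) (nhds z)"
    using smooth_at_pull_eventually[OF q eventually_chart_domain[OF N c]]
  proof eventually_elim
    case (elim y)
    have v: "(\<Sum>b\<in>onb. ?a V b y *\<^sub>R ?E b (q y)) = V y" for V
      using linear_onb_expansion[OF linear_coord_field[OF N c(1) elim], of "components N ?c (q y) (V y)"]
      by (simp add: coord_field_components[OF N c(1) elim])
    have "alternating2_on UNIV (\<omega> (q y))" using \<omega> by (simp add: smooth_form2_def)
    from alternating2_on_sum[OF this subspace_UNIV, of onb "\<lambda>b. ?E b (q y)" "\<lambda>b. ?a X b y" "\<lambda>b. ?a Y b y"]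
    show ?case by (simp add: v)
  qed
qed

text \<open>The projections of \<open>G \<times> G \<times> (H\<^sub>1 \<times> H\<^sub>2)\<close> to \<open>G \<times> H\<^sub>1\<close> and \<open>G \<times> H\<^sub>2\<close>.\<close>

definition proj1 :: "'a \<times> 'b \<times> 'c \<times> 'd \<Rightarrow> 'a \<times> 'c" where
  "proj1 a = (fst a, fst (snd (snd a)))"

definition proj2 :: "'a \<times> 'b \<times> 'c \<times> 'd \<Rightarrow> 'b \<times> 'd" where
  "proj2 a = (fst (snd a), snd (snd (snd a)))"

text \<open>A \<open>b\<^sup>m\<close>-vector of the product consists of one of the first factor, which
  carries the coefficient of \<open>t\<^sup>m \<partial>\<^sub>t\<close>, and an ordinary vector of the
  second.\<close>

definition b_part :: "('e \<times> 'f) \<times> real \<Rightarrow> 'e \<times> real" where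
  "b_part p = (fst (fst p), snd p)"

locale quasi_hamiltonian_product =
  fixes G :: "('g::{t2_space, second_countable_topology}, 'k::fin_dim_inner) lie_group_data"
    and H1 :: "('h1::{t2_space, second_countable_topology}, 'k1::fin_dim_inner) lie_group_data"
    and H2 :: "('h2::{t2_space, second_countable_topology}, 'k2::fin_dim_inner) lie_group_data"
    and m :: nat
    and B1 :: "('m1::{t2_space, second_countable_topology}, 'e1::fin_dim_inner) b_manifold_data"
    and N :: "('m2::{t2_space, second_countable_topology}, 'e2::fin_dim_inner) manifold"
    and o2 :: "'m2 \<Rightarrow> real"
    and act1 :: "'g \<times> 'h1 \<Rightarrow> 'm1 \<Rightarrow> 'm1" and act2 :: "'g \<times> 'h2 \<Rightarrow> 'm2 \<Rightarrow> 'm2"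
    and \<sigma>1 :: "('m1, 'e1 \<times> real) form2" and \<sigma>2 :: "('m2, 'e2) form2"
    and \<Phi>1 :: "'m1 \<Rightarrow> 'g \<times> 'h1" and \<Phi>2 :: "'m2 \<Rightarrow> 'g \<times> 'h2"
  assumes G: "lie_group G" and H1: "lie_group H1" and H2: "lie_group H2"
    and Q1: "singular_quasi_hamiltonian (prod_lie G H1) m B1 act1 \<sigma>1 \<Phi>1"
    and Q2: "quasi_hamiltonian (prod_lie G H2) N act2 \<sigma>2 \<Phi>2"
    and o2: "orientation N o2"
begin

abbreviation "M1 \<equiv> space B1"
abbreviation "M \<equiv> prod_manifold M1 N"
abbreviation "B \<equiv> prod_b_manifold B1 N o2"
abbreviation "K1 \<equiv> prod_lie G H1"
abbreviation "K2 \<equiv> prod_lie G H2"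
abbreviation "K \<equiv> prod_lie G (prod_lie G (prod_lie H1 H2))"
abbreviation "act \<equiv> prod_action act1 act2"
abbreviation "\<sigma> \<equiv> prod_bm_form2 \<sigma>1 \<sigma>2"
abbreviation "\<Phi> \<equiv> prod_moment \<Phi>1 \<Phi>2"

lemma lie_groups: "lie_group K1" "lie_group K2" "lie_group K" "lie_group (prod_lie G (prod_lie H1 H2))" "lie_group (prod_lie H1 H2)"
  by (intro lie_group_prod G H1 H2)+

lemma B_simps [simp]: "space B = M" "nbhd B = nbhd B1 \<times> UNIV" "def_fun B = (\<lambda>z. def_fun B1 (fst z))"
  "hypersurface B = hypersurface B1 \<times> UNIV"
  by (auto simp: prod_b_manifold_def hypersurface_def o_def)

lemma Q1_facts: "b_manifold B1" "bm_action K1 m B1 act1" "bm_form2 B1 m \<sigma>1" "bm_invariant m B1 act1 \<sigma>1"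
  "equivariant_moment_map K1 M1 act1 \<Phi>1"
  using Q1 by (simp_all only: singular_quasi_hamiltonian_def)

lemma Q2_facts: "smooth_atlas N" "smooth_action K2 N act2" "smooth_form2 N \<sigma>2"
  "\<sigma>2 (act2 b y) (mderiv N N (act2 b) y v) (mderiv N N (act2 b) y w) = \<sigma>2 y v w"
  "equivariant_moment_map K2 N act2 \<Phi>2"
  using Q2 unfolding quasi_hamiltonian_def by (simp_all only: smooth_manifold_atlas)

lemmas N_atlas = Q2_facts(1)

lemma M1_atlas: "smooth_atlas M1" by (rule space_atlas[OF Q1_facts(1)])

lemma M_atlas: "smooth_atlas M" by (rule smooth_atlas_prod[OF M1_atlas N_atlas])

lemmas projections = smooth_at_fst_mderiv[OF M1_atlas N_atlas] smooth_at_snd_mderiv[OF M1_atlas N_atlas]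

lemma \<sigma>_eq: "\<sigma> z p q = \<sigma>1 (fst z) (b_part p) (b_part q) + \<sigma>2 (snd z) (snd (fst p)) (snd (fst q))"
  by (simp add: prod_bm_form2_def b_part_def case_prod_unfold)

lemma act_eq: "act a z = (act1 (proj1 a) (fst z), act2 (proj2 a) (snd z))"
  by (simp add: prod_action_def proj1_def proj2_def case_prod_unfold)

lemma proj_gmult: "proj1 (gmult K a b) = gmult K1 (proj1 a) (proj1 b)" "proj2 (gmult K a b) = gmult K2 (proj2 a) (proj2 b)"
  "proj1 (gone K) = gone K1" "proj2 (gone K) = gone K2"
  by (simp_all add: proj1_def proj2_def)

subsection \<open>The product as a \<open>b\<close>-manifold\<close>

lemma d_def_fun_prod:
  assumes "z \<in> nbhd B" shows "d_def_fun B z v = d_def_fun B1 (fst z) (fst v)"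
  using mderiv_compose[OF M_atlas M1_atlas smooth_atlas_vector def_fun_smooth[OF Q1_facts(1)] projections(1), of z v] assms
  by (auto simp: projections(2))

lemma mderiv_def_fun_fst:
  "fst z \<in> nbhd B1 \<Longrightarrow> mderiv M vector_manifold (\<lambda>z. def_fun B1 (fst z)) z v = d_def_fun B1 (fst z) (fst v)"
  using d_def_fun_prod[of z v] by (cases z) simp

lemma b_manifold_prod: "b_manifold B"
  unfolding b_manifold_def
proof (intro conjI ballI)
  show "smooth_manifold (space B)" using M_atlas by (simp add: smooth_manifold_atlas)
  have "orientation M1 (orient B1)" using Q1_facts(1) by (simp add: b_manifold_def)
  then have "orientation M (\<lambda>(x, y). orient B1 x * o2 y)" by (rule orientation_prod[OF M1_atlas N_atlas _ o2])
  then show "orientation (space B) (orient B)" by (simp add: prod_b_manifold_def)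
  show "smooth_map_on (space B) vector_manifold (nbhd B) (def_fun B)"
    unfolding B_simps smooth_map_on_iff[OF M_atlas smooth_atlas_vector]
  proof (intro conjI ballI)
    show "open (nbhd B1 \<times> (UNIV :: 'm2 set))" using open_nbhd[OF Q1_facts(1)] by (intro open_Times) auto
    fix z assume "z \<in> nbhd B1 \<times> (UNIV :: 'm2 set)"
    then show "smooth_at M vector_manifold (\<lambda>z. def_fun B1 (fst z)) z"
      by (intro smooth_at_compose[OF M_atlas M1_atlas smooth_atlas_vector def_fun_smooth[OF Q1_facts(1)] projections(1)]) auto
  qed
  show "closed (hypersurface B)" using Q1_facts(1) by (simp add: b_manifold_def closed_Times)
  fix z assume z: "z \<in> hypersurface B"
  then obtain v where "d_def_fun B1 (fst z) v \<noteq> 0" using Q1_facts(1) by (auto simp: b_manifold_def)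
  moreover have "z \<in> nbhd B" using z by (auto simp: hypersurface_def)
  ultimately show "\<exists>v. d_def_fun B z v \<noteq> 0" using d_def_fun_prod[of z "(v, 0)"] by (intro exI[of _ "(v, 0)"]) simp
qed

lemma bm_fibre_prod: "p \<in> bm_fibre B m z \<longleftrightarrow> b_part p \<in> bm_fibre B1 m (fst z)"
  by (cases z; cases p) (auto simp: bm_fibre_def b_part_def mderiv_def_fun_fst)

lemma b_part_lift: "b_part (bm_lift B m z v) = bm_lift B1 m (fst z) (fst v)"
  by (cases z) (auto simp: bm_lift_def b_part_def mderiv_def_fun_fst)

lemma field_along_parts:
  assumes "field_at M X z"
  shows "field_along M M1 fst (\<lambda>z. fst (X z)) z" "field_along M N snd (\<lambda>z. snd (X z)) z"
  using field_along_push[OF M_atlas M_atlas M1_atlas smooth_at_ident[OF M_atlas] projections(1) assms]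
    field_along_push[OF M_atlas M_atlas N_atlas smooth_at_ident[OF M_atlas] projections(3) assms] by (simp_all add: projections)

lemma bm_field_prod_iff:
  "bm_field B m W s \<longleftrightarrow> open W \<and> (\<forall>z\<in>W. b_part (s z) \<in> bm_fibre B1 m (fst z) \<and> field_at M (\<lambda>y. fst (s y)) z \<and>
     (fst z \<in> nbhd B1 \<longrightarrow> smooth_at M vector_manifold (\<lambda>y. snd (s y)) z))"
  unfolding bm_field_iff[OF b_manifold_prod] bm_fibre_prod by (auto simp: mem_Times_iff)

text \<open>Restricted to a slice on which the second variable is constant, a field of the product is a
  field of \<open>M1\<close>. Statements about single points, such as invariance, are thereby reduced to
  the first factor.\<close>

lemma bm_field_slice:
  assumes s: "bm_field B m W s"
  shows "bm_field B1 m {x. (x, y) \<in> W} (\<lambda>x. b_part (s (x, y)))"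
  unfolding bm_field_iff[OF Q1_facts(1)]
proof (intro conjI ballI impI)
  have W: "open W" using s by (simp add: bm_field_prod_iff)
  have "open ((\<lambda>x. (x, y)) -` W)" by (intro open_vimage W continuous_intros)
  then show "open {x. (x, y) \<in> W}" by (simp add: vimage_def)
  fix x assume "x \<in> {x. (x, y) \<in> W}"
  then have x: "(x, y) \<in> W" by simp
  have i: "smooth_at M1 M (\<lambda>x. (x, y)) x"
    by (intro smooth_at_Pair_mderiv[OF M1_atlas N_atlas M1_atlas] smooth_at_const smooth_at_ident M1_atlas N_atlas)
  show "b_part (s (x, y)) \<in> bm_fibre B1 m x" using s x by (force simp: bm_field_prod_iff)
  have "field_at M (\<lambda>y. fst (s y)) (x, y)" using s x by (simp add: bm_field_prod_iff)
  from field_along_reparam[OF M_atlas M1_atlas M1_atlas i field_along_parts(1)[OF this]]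
  show "field_at M1 (\<lambda>x. fst (b_part (s (x, y)))) x" by (simp add: b_part_def)
  assume "x \<in> nbhd B1"
  then have "smooth_at M vector_manifold (\<lambda>y. snd (s y)) (x, y)" using s x by (force simp: bm_field_prod_iff)
  from smooth_at_compose[OF M1_atlas M_atlas smooth_atlas_vector this i]
  show "smooth_at M1 vector_manifold (\<lambda>x. snd (b_part (s (x, y)))) x" by (simp add: b_part_def)
qed

lemma frame_coeff_smooth:
  assumes s: "bm_field B m W s" and z: "z \<in> W" and k: "k = 0 \<or> fst z \<in> nbhd B1"
  shows "smooth_at M vector_manifold (\<lambda>y. frame_coeff M1 (chart_at M1 (fst z)) k j (fst y) (b_part (s y))) z"
proof (cases j)
  case None
  have "smooth_at M vector_manifold (\<lambda>y. k * snd (s y)) z"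
  proof (cases "k = 0")
    case True then show ?thesis by (simp add: smooth_at_const[OF M_atlas smooth_atlas_vector])
  next
    case False
    then have "smooth_at M vector_manifold (\<lambda>y. snd (s y)) z" using k s z by (simp add: bm_field_prod_iff)
    then show ?thesis by (rule smooth_at_vector_bilinear[OF M_atlas bounded_bilinear_mult smooth_at_const[OF M_atlas smooth_atlas_vector]])
  qed
  then show ?thesis using None by (simp add: frame_coeff_def b_part_def)
next
  case (Some b)
  have "field_at M (\<lambda>y. fst (s y)) z" using s z by (simp add: bm_field_prod_iff)
  from smooth_at_near_compose[OF M_atlas field_along_parts(1)[OF this, unfolded field_along_def]
      smooth_near_bounded_linear[OF bounded_linear_inner_left[of b]]]
  show ?thesis using Some by (simp add: frame_coeff_def b_part_def)
qed

text \<open>On slices smoothness is that of \<open>\<sigma>1\<close>. For smoothness in both variables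
  the fields are expanded in a local frame of \<open>M1\<close> with coefficients that are smooth on the
  product.\<close>

lemma bm_form2_prod: "bm_form2 B m \<sigma>"
  unfolding bm_form2_def
proof (intro conjI allI impI)
  fix z
  have "alternating2_on (bm_fibre B1 m (fst z)) (\<sigma>1 (fst z))" "alternating2_on UNIV (\<sigma>2 (snd z))"
    using Q1_facts(3) Q2_facts(3) by (simp_all add: bm_form2_def smooth_form2_def)
  moreover have "b_part (p + q) = b_part p + b_part q" "b_part (r *\<^sub>R p) = r *\<^sub>R b_part p" for p q :: "('e1 \<times> 'e2) \<times> real" and r
    by (simp_all add: b_part_def)
  ultimately show "alternating2_on (bm_fibre B m z) (\<sigma> z)"
    unfolding alternating2_on_def linear_functional_on_def
    by (simp add: \<sigma>_eq bm_fibre_prod algebra_simps del: split_paired_All)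
next
  fix W r s assume rs: "bm_field B m W r \<and> bm_field B m W s"
  have W: "open W" using rs by (simp add: bm_field_prod_iff)
  have "smooth_at M vector_manifold (\<lambda>z. \<sigma> z (r z) (s z)) z" if z: "z \<in> W" for z
    unfolding \<sigma>_eq
  proof (rule smooth_at_vector_add[OF M_atlas])
    have f: "field_at M (\<lambda>y. fst (r y)) z" "field_at M (\<lambda>y. fst (s y)) z" using rs z by (simp_all add: bm_field_prod_iff)
    show "smooth_at M vector_manifold (\<lambda>z. \<sigma>2 (snd z) (snd (fst (r z))) (snd (fst (s z)))) z"
      by (rule form2_along_smooth[OF M_atlas N_atlas Q2_facts(3) projections(3) field_along_parts(2)[OF f(1)] field_along_parts(2)[OF f(2)]])
    obtain U E k where U: "open U" "fst z \<in> U" "U \<subseteq> fst (chart_at M1 (fst z))" and k: "k = 0 \<or> U \<subseteq> nbhd B1" and E: "\<And>j. bm_field B1 m U (E j)"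
      and frame: "\<And>x p. x \<in> U \<Longrightarrow> p \<in> bm_fibre B1 m x \<Longrightarrow>
         p = (\<Sum>j\<in>frame_index. frame_coeff M1 (chart_at M1 (fst z)) k j x p *\<^sub>R E j x)"
      by (rule bm_local_frame[OF Q1_facts(1), of "fst z" m], rule that) assumption+
    let ?a = "\<lambda>s j y. frame_coeff M1 (chart_at M1 (fst z)) k j (fst y) (b_part (s y))"
    have k': "k = 0 \<or> fst z \<in> nbhd B1" using k U by blast
    have EE: "smooth_at M vector_manifold (\<lambda>y. \<sigma>1 (fst y) (E i (fst y)) (E j (fst y))) z" for i j
    proof (rule smooth_at_compose[OF M_atlas M1_atlas smooth_atlas_vector _ projections(1)])
      have "smooth_map_on M1 vector_manifold U (\<lambda>x. \<sigma>1 x (E i x) (E j x))"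
        using Q1_facts(3) E unfolding bm_form2_def by blast
      then show "smooth_at M1 vector_manifold (\<lambda>x. \<sigma>1 x (E i x) (E j x)) (fst z)"
        using U(2) unfolding smooth_map_on_iff[OF M1_atlas smooth_atlas_vector] by blast
    qed
    show "smooth_at M vector_manifold (\<lambda>z. \<sigma>1 (fst z) (b_part (r z)) (b_part (s z))) z"
    proof (rule smooth_at_cong[OF M_atlas smooth_atlas_vector])
      show "smooth_at M vector_manifold (\<lambda>y. \<Sum>i\<in>frame_index. \<Sum>j\<in>frame_index.
          ?a r i y * (?a s j y * \<sigma>1 (fst y) (E i (fst y)) (E j (fst y)))) z"
        using rs by (intro smooth_at_vector_sum[OF M_atlas] smooth_at_vector_bilinear[OF M_atlas bounded_bilinear_mult]
            frame_coeff_smooth[OF _ z k'] EE) auto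
      have "eventually (\<lambda>y. y \<in> W \<and> fst y \<in> U) (nhds z)"
        using W z smooth_at_pull_eventually[OF projections(1), of "\<lambda>x. x \<in> U" z] U by (auto simp: eventually_conj_iff eventually_nhds)
      then show "eventually (\<lambda>y. (\<Sum>i\<in>frame_index. \<Sum>j\<in>frame_index.
          ?a r i y * (?a s j y * \<sigma>1 (fst y) (E i (fst y)) (E j (fst y)))) = \<sigma>1 (fst y) (b_part (r y)) (b_part (s y))) (nhds z)"
      proof eventually_elim
        case (elim y)
        have p: "b_part (r y) \<in> bm_fibre B1 m (fst y)" "b_part (s y) \<in> bm_fibre B1 m (fst y)"
          using rs elim by (simp_all add: bm_field_prod_iff)
        have "alternating2_on (bm_fibre B1 m (fst y)) (\<sigma>1 (fst y))" using Q1_facts(3) by (simp add: bm_form2_def)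
        from alternating2_on_sum[OF this subspace_bm_fibre[OF Q1_facts(1)], of frame_index "\<lambda>j. E j (fst y)" "\<lambda>j. ?a r j y" "\<lambda>j. ?a s j y"]
        show ?case using E elim frame[of "fst y", OF _ p(1)] frame[of "fst y", OF _ p(2)]
          by (simp add: bm_field_iff[OF Q1_facts(1)])
      qed
    qed
  qed
  then show "smooth_map_on (space B) vector_manifold W (\<lambda>z. \<sigma> z (r z) (s z))"
    unfolding B_simps smooth_map_on_iff[OF M_atlas smooth_atlas_vector] using W by blast
qed

subsection \<open>The product action\<close>

lemma act12_smooth: "smooth_at M1 M1 (act1 a) x" "smooth_at N N (act2 b) y"
  "smooth_at (mfd K1) M1 (\<lambda>a. act1 a x) a" "smooth_at (mfd K2) N (\<lambda>b. act2 b y) b"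
proof -
  have 1: "smooth_action K1 M1 act1" using Q1_facts(2) by (simp add: bm_action_def)
  show "smooth_at M1 M1 (act1 a) x" "smooth_at N N (act2 b) y"
    "smooth_at (mfd K1) M1 (\<lambda>a. act1 a x) a" "smooth_at (mfd K2) N (\<lambda>b. act2 b y) b"
    by (rule smooth_action_smooth[OF group_atlas[OF lie_groups(1)] M1_atlas 1] smooth_action_smooth[OF group_atlas[OF lie_groups(2)] N_atlas Q2_facts(2)])+
qed

lemmas act1_laws = smooth_action_laws[OF lie_groups(1) Q1_facts(2)[unfolded bm_action_def, THEN conjunct1]]
lemmas act2_laws = smooth_action_laws[OF lie_groups(2) Q2_facts(2)]

lemma act_smooth_mderiv: "smooth_at M M (act a) z"
  "mderiv M M (act a) z v = (mderiv M1 M1 (act1 (proj1 a)) (fst z) (fst v), mderiv N N (act2 (proj2 a)) (snd z) (snd v))"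
  using smooth_at_map_prod_mderiv[OF M1_atlas N_atlas M1_atlas N_atlas act12_smooth(1)[of "proj1 a"] act12_smooth(2)[of "proj2 a"]]
  by (simp_all add: act_eq[abs_def])

lemma proj_smooth_mderiv:
  "smooth_at (mfd K) (mfd K1) proj1 a" "smooth_at (mfd K) (mfd K2) proj2 a"
  "mderiv (mfd K) (mfd K1) proj1 a v = proj1 v" "mderiv (mfd K) (mfd K2) proj2 a v = proj2 v"
proof -
  note A = group_atlas[OF G] group_atlas[OF H1] group_atlas[OF H2] group_atlas[OF lie_groups(5)] group_atlas[OF lie_groups(4)] group_atlas[OF lie_groups(3)]
  note A = A[unfolded prod_lie_simps]
  note p1 = smooth_at_fst_mderiv[OF A(1,5)] and p2 = smooth_at_snd_mderiv[OF A(1,5)]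
   and p3 = smooth_at_fst_mderiv[OF A(1,4)] and p4 = smooth_at_snd_mderiv[OF A(1,4)]
   and p5 = smooth_at_fst_mderiv[OF A(2,3)] and p6 = smooth_at_snd_mderiv[OF A(2,3)]
  note c2 = smooth_at_compose[OF A(6,5) _ _ p2(1)] mderiv_compose[OF A(6,5) _ _ p2(1)]
  have s2: "smooth_at (mfd K) (mfd G) (\<lambda>a. fst (snd a)) a" "mderiv (mfd K) (mfd G) (\<lambda>a. fst (snd a)) a v = fst (snd v)" for a v
    using c2(1)[OF A(1) p3(1)] c2(2)[OF A(1) p3(1)] by (simp_all add: p3(2) p2(2))
  have s3: "smooth_at (mfd K) (mfd (prod_lie H1 H2)) (\<lambda>a. snd (snd a)) a"
    "mderiv (mfd K) (mfd (prod_lie H1 H2)) (\<lambda>a. snd (snd a)) a v = snd (snd v)" for a v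
    using c2(1)[OF A(4) p4(1)] c2(2)[OF A(4) p4(1)] by (simp_all add: p4(2) p2(2))
  note s3' = s3[unfolded prod_lie_simps]
  have s4: "smooth_at (mfd K) (mfd H1) (\<lambda>a. fst (snd (snd a))) a" "mderiv (mfd K) (mfd H1) (\<lambda>a. fst (snd (snd a))) a v = fst (snd (snd v))"
    "smooth_at (mfd K) (mfd H2) (\<lambda>a. snd (snd (snd a))) a" "mderiv (mfd K) (mfd H2) (\<lambda>a. snd (snd (snd a))) a v = snd (snd (snd v))" for a v
    using smooth_at_compose[OF A(6,4,2) p5(1) s3'(1)] mderiv_compose[OF A(6,4,2) p5(1) s3'(1)]
      smooth_at_compose[OF A(6,4,3) p6(1) s3'(1)] mderiv_compose[OF A(6,4,3) p6(1) s3'(1)]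
    by (simp_all add: p5(2) p6(2) s3'(2))
  note s = s2[unfolded prod_lie_simps] s4[unfolded prod_lie_simps]
  show "smooth_at (mfd K) (mfd K1) proj1 a" "smooth_at (mfd K) (mfd K2) proj2 a"
    "mderiv (mfd K) (mfd K1) proj1 a v = proj1 v" "mderiv (mfd K) (mfd K2) proj2 a v = proj2 v"
    using smooth_at_Pair_mderiv[OF A(1,2,6) p1(1) s(3)] smooth_at_Pair_mderiv[OF A(1,3,6) s(1,5)]
    by (simp_all add: proj1_def[abs_def] proj2_def[abs_def] p1(2) s)
qed

lemma smooth_action_prod: "smooth_action K M act"
  unfolding smooth_action_def
proof
  show "group_action (grp K) UNIV act"
  proof (rule group_actionI)
    show "Group.group (grp K)" "carrier (grp K) = UNIV" using lie_groups(3) by (simp_all add: lie_group_def)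
    show "act (gone K) x = x" for x
      unfolding act_eq proj_gmult act1_laws act2_laws by simp
    show "act (gmult K a b) x = act a (act b x)" for a b x
      unfolding act_eq proj_gmult act1_laws act2_laws by simp
  qed
  note K_atlases = group_atlas[OF lie_groups(3)] group_atlas[OF lie_groups(1)] group_atlas[OF lie_groups(2)]
  note KM = smooth_atlas_prod[OF K_atlases(1) M_atlas] and K1M = smooth_atlas_prod[OF K_atlases(2) M1_atlas] and K2N = smooth_atlas_prod[OF K_atlases(3) N_atlas]
  have s1: "smooth_at (prod_manifold (mfd K1) M1) M1 (\<lambda>p. act1 (fst p) (snd p)) p" for p
    using Q1_facts(2) unfolding bm_action_def smooth_action_def smooth_map_on_iff[OF K1M M1_atlas] by (simp add: case_prod_unfold del: split_paired_All)
  have s2: "smooth_at (prod_manifold (mfd K2) N) N (\<lambda>p. act2 (fst p) (snd p)) p" for p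
    using Q2_facts(2) unfolding smooth_action_def smooth_map_on_iff[OF K2N N_atlas] by (simp add: case_prod_unfold del: split_paired_All)
  show "smooth_map_on (prod_manifold (mfd K) M) M UNIV (\<lambda>(a, x). act a x)"
    unfolding smooth_map_on_iff[OF KM M_atlas]
  proof (intro conjI ballI)
    fix p :: "('g \<times> 'g \<times> 'h1 \<times> 'h2) \<times> 'm1 \<times> 'm2"
    note q = smooth_at_fst_mderiv(1)[OF K_atlases(1) M_atlas, of p] smooth_at_snd_mderiv(1)[OF K_atlases(1) M_atlas, of p]
    have 1: "smooth_at (prod_manifold (mfd K) M) (prod_manifold (mfd K1) M1) (\<lambda>p. (proj1 (fst p), fst (snd p))) p"
      by (intro smooth_at_Pair_mderiv(1)[OF K_atlases(2) M1_atlas KM] smooth_at_compose[OF KM K_atlases(1,2) proj_smooth_mderiv(1) q(1)]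
          smooth_at_compose[OF KM M_atlas M1_atlas projections(1) q(2)])
    have 2: "smooth_at (prod_manifold (mfd K) M) (prod_manifold (mfd K2) N) (\<lambda>p. (proj2 (fst p), snd (snd p))) p"
      by (intro smooth_at_Pair_mderiv(1)[OF K_atlases(3) N_atlas KM] smooth_at_compose[OF KM K_atlases(1,3) proj_smooth_mderiv(2) q(1)]
          smooth_at_compose[OF KM M_atlas N_atlas projections(3) q(2)])
    have "smooth_at (prod_manifold (mfd K) M) M (\<lambda>p. (act1 (proj1 (fst p)) (fst (snd p)), act2 (proj2 (fst p)) (snd (snd p)))) p"
      using smooth_at_Pair_mderiv(1)[OF M1_atlas N_atlas KM smooth_at_compose[OF KM K1M M1_atlas s1 1] smooth_at_compose[OF KM K2N N_atlas s2 2]]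
      by simp
    then show "smooth_at (prod_manifold (mfd K) M) M (\<lambda>(a, x). act a x) p"
      by (simp add: act_eq case_prod_unfold)
  qed simp
qed

lemmas act_laws = smooth_action_laws[OF lie_groups(3) smooth_action_prod]

text \<open>Push-forward of a \<open>b\<^sup>m\<close>-field of the product. Locally it is a combination of push-forwards of frame
  fields of the first factor, with coefficients that are smooth on the product.\<close>

lemma bm_pushforward_prod:
  assumes s: "bm_field B m W s"
  shows "\<exists>s'. bm_pushforward B m (act a) W s s'"
proof -
  let ?F = "act a" and ?F' = "act (ginv K a)" and ?f = "act1 (proj1 a)"
  define X where "X z = mderiv M M ?F (?F' z) (fst (s (?F' z)))" for z
  \<comment> \<open>The field has to be defined on the image of \<open>W\<close>, so everything is
    pulled back by the inverse \<open>F'\<close>.\<close>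
  have im: "?F ` W = ?F' -` W"
  proof (intro Set.set_eqI iffI)
    fix z assume "z \<in> ?F ` W"
    then obtain w where "w \<in> W" "z = ?F w" by (rule imageE)
    then show "z \<in> ?F' -` W" by (simp only: vimage_eq act_laws(4))
  next
    fix z assume "z \<in> ?F' -` W"
    then have "?F (?F' z) \<in> ?F ` W" unfolding vimage_eq by (rule imageI)
    then show "z \<in> ?F ` W" by (simp only: act_laws(3))
  qed
  have W: "open W" using s by (simp add: bm_field_prod_iff)
  have F'lim: "filterlim ?F' (nhds (?F' z)) (nhds z)" for z by (rule smooth_at_filterlim[OF act_smooth_mderiv(1)])
  then have "continuous_on UNIV ?F'" using filterlim_nhds_iff_continuous_on[OF open_UNIV, of ?F'] by blast
  then have oW: "open (?F ` W)" unfolding im using open_vimage[OF W] by blast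
  have fX: "field_at M X z" if z: "?F' z \<in> W" for z
  proof -
    have "field_at M (\<lambda>y. fst (s y)) (?F' z)" using s z by (simp add: bm_field_prod_iff)
    from field_along_reparam[OF M_atlas M_atlas M_atlas act_smooth_mderiv(1)
        field_along_push[OF M_atlas M_atlas M_atlas smooth_at_ident[OF M_atlas] act_smooth_mderiv(1)[where a = a] this]]
    show ?thesis unfolding X_def[abs_def] act_laws(3) .
  qed
  \<comment> \<open>The coefficient of \<open>t\<^sup>m \<partial>\<^sub>t\<close> exists locally:
    pushing forward the members of a frame of \<open>M1\<close> gives fields \<open>E'\<close>, whose
    coefficients are combined linearly.\<close>
  have "\<exists>\<rho>. smooth_at (space B) vector_manifold \<rho> z \<and> eventually (\<lambda>y. d_def_fun B y (X y) = def_fun B y ^ m * \<rho> y) (nhds z)"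
    if z: "z \<in> ?F ` W" "z \<in> nbhd B" for z
  proof -
    let ?w = "?F' z" and ?x = "fst (?F' z)"
    have w: "?w \<in> W" using z(1) by (simp add: im)
    have n: "fst z \<in> nbhd B1" using z(2) by auto
    obtain U E k where U: "open U" "?x \<in> U" "U \<subseteq> fst (chart_at M1 ?x)" and k: "k = 0 \<or> U \<subseteq> nbhd B1" and E: "\<And>j. bm_field B1 m U (E j)"
      and frame: "\<And>x p. x \<in> U \<Longrightarrow> p \<in> bm_fibre B1 m x \<Longrightarrow>
         p = (\<Sum>j\<in>frame_index. frame_coeff M1 (chart_at M1 ?x) k j x p *\<^sub>R E j x)"
      by (rule bm_local_frame[OF Q1_facts(1), of ?x m], rule that) assumption+
    have k': "k = 0 \<or> ?x \<in> nbhd B1" using k U by blast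
    have "\<forall>j. \<exists>e. bm_pushforward B1 m ?f U (E j) e" using Q1_facts(2) E unfolding bm_action_def by blast
    then obtain E' where E': "\<And>j. bm_pushforward B1 m ?f U (E j) (E' j)" by metis
    have bE': "bm_field B1 m (?f ` U) (E' j)" for j using E'[of j] by (simp add: bm_pushforward_def)
    let ?c = "\<lambda>j y. frame_coeff M1 (chart_at M1 ?x) k j (fst y) (b_part (s y))"
    let ?\<rho> = "\<lambda>y. \<Sum>j\<in>frame_index. ?c j (?F' y) * snd (E' j (fst y))"
    have fst_F: "fst y = ?f (fst (?F' y))" for y
      using act_laws(3)[of a y] unfolding act_eq[of a] by (metis fst_conv)
    have zU: "fst z \<in> ?f ` U" using U(2) fst_F[of z] by blast
    have "smooth_at M vector_manifold ?\<rho> z"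
    proof (intro smooth_at_vector_sum[OF M_atlas] smooth_at_vector_bilinear[OF M_atlas bounded_bilinear_mult])
      fix j
      show "smooth_at M vector_manifold (\<lambda>y. ?c j (?F' y)) z"
        by (rule smooth_at_compose[OF M_atlas M_atlas smooth_atlas_vector frame_coeff_smooth[OF s w k'] act_smooth_mderiv(1)])
      show "smooth_at M vector_manifold (\<lambda>y. snd (E' j (fst y))) z"
        by (rule smooth_at_compose[OF M_atlas M1_atlas smooth_atlas_vector _ projections(1)])
           (use bE'[of j, unfolded bm_field_iff[OF Q1_facts(1)]] zU n in blast)
    qed
    moreover have "eventually (\<lambda>y. d_def_fun B y (X y) = def_fun B y ^ m * ?\<rho> y) (nhds z)"
    proof -
      have "eventually (\<lambda>y. y \<in> nbhd B) (nhds z)" using open_nbhd[OF b_manifold_prod] z(2) eventually_nhds by blast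
      moreover have "eventually (\<lambda>y. ?F' y \<in> W) (nhds z)"
        using W w by (intro eventually_compose_filterlim[OF _ F'lim]) (auto simp: eventually_nhds)
      moreover have "eventually (\<lambda>y. fst (?F' y) \<in> U) (nhds z)"
        by (intro eventually_compose_filterlim[OF _ F'lim] smooth_at_pull_eventually[OF projections(1)])
           (use U in \<open>auto simp: eventually_nhds\<close>)
      ultimately show ?thesis
      proof eventually_elim
        case (elim y)
        let ?u = "?F' y"
        have yn: "fst y \<in> nbhd B1" using elim(1) by auto
        have p: "b_part (s ?u) \<in> bm_fibre B1 m (fst ?u)" using s elim by (simp add: bm_field_prod_iff)
        have lf: "linear (mderiv M1 M1 ?f (fst ?u))" by (rule linear_mderiv[OF M1_atlas M1_atlas act12_smooth(1)])
        have ld: "linear (d_def_fun B1 (fst y))" by (rule linear_mderiv[OF M1_atlas smooth_atlas_vector def_fun_smooth[OF Q1_facts(1) yn]])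
        have push: "fst (E' j (fst y)) = mderiv M1 M1 ?f (fst ?u) (fst (E j (fst ?u)))" for j
          using E'[of j] elim(3) fst_F[of y] by (simp add: bm_pushforward_def)
        have fib: "E' j (fst y) \<in> bm_fibre B1 m (fst y)" for j
          using bE'[of j] elim(3) fst_F[of y] by (auto simp: bm_field_iff[OF Q1_facts(1)])
        have dE: "d_def_fun B1 (fst y) (fst (E' j (fst y))) = def_fun B1 (fst y) ^ m * snd (E' j (fst y))" for j
          using fib[of j] yn by (cases "E' j (fst y)") (simp add: bm_fibre_def)
        have "fst (fst (s ?u)) = (\<Sum>j\<in>frame_index. ?c j ?u *\<^sub>R fst (E j (fst ?u)))"
          using arg_cong[OF frame[OF elim(3) p], of fst] by (simp only: fst_sum fst_scaleR) (simp add: b_part_def)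
        then have "fst (X y) = (\<Sum>j\<in>frame_index. ?c j ?u *\<^sub>R fst (E' j (fst y)))"
          by (simp only: X_def act_smooth_mderiv(2) fst_conv linear_sum[OF lf] linear_cmul[OF lf] push)
        then have "d_def_fun B y (X y) = (\<Sum>j\<in>frame_index. ?c j ?u * (def_fun B1 (fst y) ^ m * snd (E' j (fst y))))"
          by (simp only: d_def_fun_prod[OF elim(1)] linear_sum[OF ld] linear_cmul[OF ld] dE real_scaleR_def)
        also have "\<dots> = def_fun B y ^ m * ?\<rho> y"
          by (simp only: sum_distrib_left B_simps(3)) (simp only: mult.left_commute)
        finally show ?case .
      qed
    qed
    ultimately show ?thesis by auto
  qed
  then obtain r where r: "\<And>z. z \<in> ?F ` W \<Longrightarrow> z \<in> nbhd B \<Longrightarrow> smooth_at (space B) vector_manifold r z"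
    "\<And>z. z \<in> ?F ` W \<Longrightarrow> z \<in> nbhd B \<Longrightarrow> d_def_fun B z (X z) = def_fun B z ^ m * r z" "\<And>z. z \<notin> nbhd B \<Longrightarrow> r z = 0"
    using def_fun_power_divide_glue[OF b_manifold_prod, of "?F ` W" "\<lambda>y. d_def_fun B y (X y)" m] by blast
  have "bm_field B m (?F ` W) (\<lambda>z. (X z, r z))"
    unfolding bm_field_iff[OF b_manifold_prod] fst_conv snd_conv
  proof (intro conjI ballI impI oW)
    fix z assume z: "z \<in> ?F ` W"
    show "(X z, r z) \<in> bm_fibre B m z" using r(2)[OF z] r(3)[of z] by (simp only: bm_fibre_def mem_Collect_eq case_prod_conv split: if_split) blast
    show "field_at (space B) X z" using fX z by (simp add: im)
    show "smooth_at (space B) vector_manifold r z" if "z \<in> nbhd B" by (rule r(1)[OF z that])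
  qed
  moreover have "X (?F z) = mderiv M M ?F z (fst (s z))" for z by (simp only: X_def act_laws(4))
  ultimately show ?thesis unfolding bm_pushforward_def by (intro exI[of _ "\<lambda>z. (X z, r z)"]) simp
qed

lemma bm_action_prod: "bm_action K m B act"
  unfolding bm_action_def using smooth_action_prod bm_pushforward_prod by simp

text \<open>The group maps slices to slices, so the invariance of \<open>\<sigma>1\<close> applies to
  the restrictions of the fields.\<close>

lemma bm_invariant_prod: "bm_invariant m B act \<sigma>"
  unfolding bm_invariant_def
proof (intro allI impI ballI)
  fix a W r s r' s' z
  assume h: "bm_field B m W r \<and> bm_field B m W s \<and> bm_pushforward B m (act a) W r r' \<and> bm_pushforward B m (act a) W s s'"
    and z: "z \<in> W"
  let ?f = "act1 (proj1 a)" and ?g = "act2 (proj2 a)"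
  obtain x y where xy: "z = (x, y)" by fastforce
  let ?S = "{x. (x, y) \<in> W}"
  have push: "bm_pushforward B1 m ?f ?S (\<lambda>x. b_part (s (x, y))) (\<lambda>x. b_part (s' (x, ?g y)))"
    if p: "bm_pushforward B m (act a) W s s'" for s s'
  proof -
    have "{x'. (x', ?g y) \<in> act a ` W} = ?f ` ?S"
    proof safe
      fix x' u v assume "(x', ?g y) = act a (u, v)" "(u, v) \<in> W"
      moreover from this have "v = y" using act2_laws(4)[of "proj2 a"] unfolding act_eq by (metis prod.inject snd_conv)
      ultimately show "x' \<in> ?f ` ?S" by (auto simp: act_eq)
    next
      fix u assume "(u, y) \<in> W"
      then show "(?f u, ?g y) \<in> act a ` W" by (force simp: act_eq)
    qed
    then have "bm_field B1 m (?f ` ?S) (\<lambda>x. b_part (s' (x, ?g y)))"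
      using bm_field_slice[of "act a ` W" s' "?g y"] p by (simp add: bm_pushforward_def)
    moreover have "fst (b_part (s' (?f u, ?g y))) = mderiv M1 M1 ?f u (fst (b_part (s (u, y))))" if "u \<in> ?S" for u
      using p that unfolding bm_pushforward_def by (force simp: act_eq b_part_def act_smooth_mderiv(2) dest: bspec[of _ _ "(u, y)"])
    ultimately show ?thesis unfolding bm_pushforward_def by blast
  qed
  have "\<sigma>1 (?f x) (b_part (r' (?f x, ?g y))) (b_part (s' (?f x, ?g y))) = \<sigma>1 x (b_part (r (x, y))) (b_part (s (x, y)))"
    using Q1_facts(4) bm_field_slice[of W r y] bm_field_slice[of W s y] push[of r r'] push[of s s'] h z
    unfolding bm_invariant_def xy by blast
  moreover have "snd (fst (r' (?f x, ?g y))) = mderiv N N ?g y (snd (fst (r (x, y))))"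
    "snd (fst (s' (?f x, ?g y))) = mderiv N N ?g y (snd (fst (s (x, y))))"
    using h z unfolding bm_pushforward_def by (force simp: xy act_eq act_smooth_mderiv(2) dest: bspec[of _ _ "(x, y)"])+
  ultimately show "\<sigma> (act a z) (r' (act a z)) (s' (act a z)) = \<sigma> z (r z) (s z)"
    by (simp add: \<sigma>_eq act_eq xy Q2_facts(4))
qed

subsection \<open>The product moment map\<close>

lemma \<Phi>12_smooth: "smooth_at M1 (mfd K1) \<Phi>1 x" "smooth_at N (mfd K2) \<Phi>2 y"
  using Q1_facts(5) Q2_facts(5) unfolding equivariant_moment_map_def
    smooth_map_on_iff[OF M1_atlas group_atlas[OF lie_groups(1)]] smooth_map_on_iff[OF N_atlas group_atlas[OF lie_groups(2)]] by blast+

lemma \<Phi>_smooth: "smooth_at M (mfd K) \<Phi> z"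
  and \<Phi>_mderiv: "mderiv M (mfd K) \<Phi> z v =
    (fst (mderiv M1 (mfd K1) \<Phi>1 (fst z) (fst v)), fst (mderiv N (mfd K2) \<Phi>2 (snd z) (snd v)),
     snd (mderiv M1 (mfd K1) \<Phi>1 (fst z) (fst v)), snd (mderiv N (mfd K2) \<Phi>2 (snd z) (snd v)))"
proof -
  note A = group_atlas[OF G] group_atlas[OF H1] group_atlas[OF H2] group_atlas[OF lie_groups(1)] group_atlas[OF lie_groups(2)] group_atlas[OF lie_groups(5)] group_atlas[OF lie_groups(4)]
  note A = A[unfolded prod_lie_simps]
  note S = \<Phi>12_smooth[unfolded prod_lie_simps]
  note p1 = smooth_at_fst_mderiv[OF A(1,2)] smooth_at_snd_mderiv[OF A(1,2)]
   and p2 = smooth_at_fst_mderiv[OF A(1,3)] smooth_at_snd_mderiv[OF A(1,3)]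
  have 1: "smooth_at M (mfd K1) (\<lambda>z. \<Phi>1 (fst z)) z" "mderiv M (mfd K1) (\<lambda>z. \<Phi>1 (fst z)) z v = mderiv M1 (mfd K1) \<Phi>1 (fst z) (fst v)"
    using smooth_at_compose[OF M_atlas M1_atlas A(4) S(1) projections(1)] mderiv_compose[OF M_atlas M1_atlas A(4) S(1) projections(1)] by (simp_all add: projections)
  have 2: "smooth_at M (mfd K2) (\<lambda>z. \<Phi>2 (snd z)) z" "mderiv M (mfd K2) (\<lambda>z. \<Phi>2 (snd z)) z v = mderiv N (mfd K2) \<Phi>2 (snd z) (snd v)"
    using smooth_at_compose[OF M_atlas N_atlas A(5) S(2) projections(3)] mderiv_compose[OF M_atlas N_atlas A(5) S(2) projections(3)] by (simp_all add: projections)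
  note 1 = 1[unfolded prod_lie_simps] and 2 = 2[unfolded prod_lie_simps]
  note c = smooth_at_compose[OF M_atlas A(4,1) p1(1) 1(1)] smooth_at_compose[OF M_atlas A(4,2) p1(3) 1(1)]
    smooth_at_compose[OF M_atlas A(5,1) p2(1) 2(1)] smooth_at_compose[OF M_atlas A(5,3) p2(3) 2(1)]
  note d = mderiv_compose[OF M_atlas A(4,1) p1(1) 1(1), of v] mderiv_compose[OF M_atlas A(4,2) p1(3) 1(1), of v]
    mderiv_compose[OF M_atlas A(5,1) p2(1) 2(1), of v] mderiv_compose[OF M_atlas A(5,3) p2(3) 2(1), of v]
  note P1 = smooth_at_Pair_mderiv[OF A(2,3) M_atlas c(2) c(4)]
  note P2 = smooth_at_Pair_mderiv[OF A(1,6) M_atlas c(3) P1(1)]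
  note P3 = smooth_at_Pair_mderiv[OF A(1,7) M_atlas c(1) P2(1)]
  have e: "\<Phi> = (\<lambda>z. (fst (\<Phi>1 (fst z)), fst (\<Phi>2 (snd z)), snd (\<Phi>1 (fst z)), snd (\<Phi>2 (snd z))))"
    by (simp add: prod_moment_def case_prod_unfold)
  show "smooth_at M (mfd K) \<Phi> z" unfolding e prod_lie_simps by (rule P3(1))
  show "mderiv M (mfd K) \<Phi> z v =
    (fst (mderiv M1 (mfd K1) \<Phi>1 (fst z) (fst v)), fst (mderiv N (mfd K2) \<Phi>2 (snd z) (snd v)),
     snd (mderiv M1 (mfd K1) \<Phi>1 (fst z) (fst v)), snd (mderiv N (mfd K2) \<Phi>2 (snd z) (snd v)))"
    unfolding e prod_lie_simps P3(2) P2(2) P1(2) d by (simp add: p1 p2 1(2) 2(2))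
qed

lemma equivariant_prod: "equivariant_moment_map K M act \<Phi>"
  unfolding equivariant_moment_map_def
proof (intro conjI allI)
  show "smooth_map_on M (mfd K) UNIV \<Phi>"
    unfolding smooth_map_on_iff[OF M_atlas group_atlas[OF lie_groups(3)]] using \<Phi>_smooth by simp
  fix a z
  have "\<Phi>1 (act1 b x) = gmult K1 (gmult K1 b (\<Phi>1 x)) (ginv K1 b)" "\<Phi>2 (act2 c y) = gmult K2 (gmult K2 c (\<Phi>2 y)) (ginv K2 c)" for b c x y
    using Q1_facts(5) Q2_facts(5) unfolding equivariant_moment_map_def by blast+
  then show "\<Phi> (act a z) = gmult K (gmult K a (\<Phi> z)) (ginv K a)"
    by (simp add: prod_moment_def case_prod_unfold act_eq proj1_def proj2_def ginv_prod_lie[OF G H1] ginv_prod_lie[OF G H2]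
      ginv_prod_lie[OF G lie_groups(4)] ginv_prod_lie[OF G lie_groups(5)] ginv_prod_lie[OF H1 H2])
qed

lemma chi_d\<Phi>: "chi K (\<Phi> z) (mderiv M (mfd K) \<Phi> z u) (mderiv M (mfd K) \<Phi> z v) (mderiv M (mfd K) \<Phi> z w) =
    chi K1 (\<Phi>1 (fst z)) (mderiv M1 (mfd K1) \<Phi>1 (fst z) (fst u)) (mderiv M1 (mfd K1) \<Phi>1 (fst z) (fst v)) (mderiv M1 (mfd K1) \<Phi>1 (fst z) (fst w))
  + chi K2 (\<Phi>2 (snd z)) (mderiv N (mfd K2) \<Phi>2 (snd z) (snd u)) (mderiv N (mfd K2) \<Phi>2 (snd z) (snd v)) (mderiv N (mfd K2) \<Phi>2 (snd z) (snd w))"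
  unfolding \<Phi>_mderiv chi_prod_lie[OF G lie_groups(4)] chi_prod_lie[OF G lie_groups(5)] chi_prod_lie[OF H1 H2]
    chi_prod_lie[OF G H1] chi_prod_lie[OF G H2]
  by (simp add: prod_moment_def case_prod_unfold)

text \<open>In a product chart a coordinate field splits into coordinate fields of the factors. So the
  functions to be differentiated are sums of a function of the first variable and one of the
  second.\<close>

lemma ext_deriv2_prod:
  assumes z: "z \<notin> hypersurface B"
  shows "ext_deriv2 M (\<lambda>y u v. \<sigma> y (bm_lift B m y u) (bm_lift B m y v)) z u v w
    = - chi K (\<Phi> z) (mderiv M (mfd K) \<Phi> z u) (mderiv M (mfd K) \<Phi> z v) (mderiv M (mfd K) \<Phi> z w)"
proof -
  obtain x y where xy: "z = (x, y)" by fastforce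
  have x: "x \<notin> hypersurface B1" using z by (simp add: xy)
  let ?c = "chart_at M1 x" and ?d = "chart_at N y"
  note c = chart_at[OF M1_atlas, of x] and d = chart_at[OF N_atlas, of y]
  define s where "s v w p = \<sigma>1 p (bm_lift B1 m p (coord_field M1 ?c v p)) (bm_lift B1 m p (coord_field M1 ?c w p))" for v w p
  define t where "t v w p = \<sigma>2 p (coord_field N ?d v p) (coord_field N ?d w p)" for v w p
  have ss: "smooth_at M1 vector_manifold (s v w) x" for v w
    unfolding s_def[abs_def] by (rule bm_form2_lift_coord_smooth[OF Q1_facts(1,3) x])
  have st: "smooth_at N vector_manifold (t v w) y" for v w
    unfolding t_def[abs_def]
    by (rule form2_along_smooth[OF N_atlas N_atlas Q2_facts(3) smooth_at_ident[OF N_atlas]])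
       (rule field_along_coord_field[OF N_atlas N_atlas smooth_at_ident[OF N_atlas] d smooth_at_const[OF N_atlas smooth_atlas_vector]])+
  have h: "mderiv M vector_manifold (\<lambda>p. \<sigma> p (bm_lift B m p (coord_field M (chart_at M z) v p)) (bm_lift B m p (coord_field M (chart_at M z) w p))) z u
      = mderiv M1 vector_manifold (s (fst v) (fst w)) x (fst u) + mderiv N vector_manifold (t (snd v) (snd w)) y (snd u)" for u v w
  proof -
    have c1: "smooth_at M vector_manifold (\<lambda>p. s (fst v) (fst w) (fst p)) z" "smooth_at M vector_manifold (\<lambda>p. t (snd v) (snd w) (snd p)) z"
      using smooth_at_compose[OF M_atlas M1_atlas smooth_atlas_vector _ projections(1), of "s (fst v) (fst w)" z]
       smooth_at_compose[OF M_atlas N_atlas smooth_atlas_vector _ projections(3), of "t (snd v) (snd w)" z] ss st by (simp_all add: xy)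
    have "mderiv M vector_manifold (\<lambda>p. \<sigma> p (bm_lift B m p (coord_field M (chart_at M z) v p)) (bm_lift B m p (coord_field M (chart_at M z) w p))) z u
        = mderiv M vector_manifold (\<lambda>p. s (fst v) (fst w) (fst p) + t (snd v) (snd w) (snd p)) z u"
    proof (rule fun_cong[OF mderiv_cong[OF M_atlas]])
      have "eventually (\<lambda>p. fst p \<in> fst ?c) (nhds z)" "eventually (\<lambda>p. snd p \<in> fst ?d) (nhds z)"
        using smooth_at_pull_eventually[OF projections(1), of "\<lambda>x. x \<in> fst ?c" z] smooth_at_pull_eventually[OF projections(3), of "\<lambda>x. x \<in> fst ?d" z]
          eventually_chart_domain[OF M1_atlas c] eventually_chart_domain[OF N_atlas d] by (simp_all add: xy)
      then show "eventually (\<lambda>p. \<sigma> p (bm_lift B m p (coord_field M (chart_at M z) v p)) (bm_lift B m p (coord_field M (chart_at M z) w p))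
          = s (fst v) (fst w) (fst p) + t (snd v) (snd w) (snd p)) (nhds z)"
      proof eventually_elim
        case (elim p)
        have cf: "coord_field M (chart_at M z) v p = (coord_field M1 ?c (fst v) (fst p), coord_field N ?d (snd v) (snd p))" for v
          using coord_field_prod[OF M1_atlas N_atlas c(1) elim(1) d(1) elim(2), of "fst v" "snd v"] by (simp add: xy)
        have sl: "fst (bm_lift B m p v) = v" for v by (simp add: bm_lift_def)
        show ?case unfolding \<sigma>_eq b_part_lift sl cf s_def t_def by simp
      qed
    qed
    also have "\<dots> = mderiv M1 vector_manifold (s (fst v) (fst w)) x (fst u) + mderiv N vector_manifold (t (snd v) (snd w)) y (snd u)"
      using mderiv_vector_add[OF M_atlas c1, of u] mderiv_compose[OF M_atlas M1_atlas smooth_atlas_vector _ projections(1), of "s (fst v) (fst w)" z u]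
        mderiv_compose[OF M_atlas N_atlas smooth_atlas_vector _ projections(3), of "t (snd v) (snd w)" z u] ss st by (simp add: xy projections)
    finally show ?thesis .
  qed
  have e1: "ext_deriv2 M1 (\<lambda>y u v. \<sigma>1 y (bm_lift B1 m y u) (bm_lift B1 m y v)) x a b c
      = - chi K1 (\<Phi>1 x) (mderiv M1 (mfd K1) \<Phi>1 x a) (mderiv M1 (mfd K1) \<Phi>1 x b) (mderiv M1 (mfd K1) \<Phi>1 x c)" for a b c
  proof -
    have "bm_has_ext_deriv B1 m \<sigma>1 (\<lambda>x p q r. - chi K1 (\<Phi>1 x) (mderiv M1 (mfd K1) \<Phi>1 x (fst p)) (mderiv M1 (mfd K1) \<Phi>1 x (fst q)) (mderiv M1 (mfd K1) \<Phi>1 x (fst r)))"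
      using Q1 unfolding singular_quasi_hamiltonian_def Let_def by (elim conjE) assumption
    then have "- chi K1 (\<Phi>1 x) (mderiv M1 (mfd K1) \<Phi>1 x (fst (bm_lift B1 m x a))) (mderiv M1 (mfd K1) \<Phi>1 x (fst (bm_lift B1 m x b)))
        (mderiv M1 (mfd K1) \<Phi>1 x (fst (bm_lift B1 m x c))) = ext_deriv2 M1 (\<lambda>y u v. \<sigma>1 y (bm_lift B1 m y u) (bm_lift B1 m y v)) x a b c"
      using x unfolding bm_has_ext_deriv_def by blast
    moreover have "fst (bm_lift B1 m x a) = a" for a by (simp add: bm_lift_def)
    ultimately show ?thesis by simp
  qed
  have e2: "ext_deriv2 N \<sigma>2 y a b c
      = - chi K2 (\<Phi>2 y) (mderiv N (mfd K2) \<Phi>2 y a) (mderiv N (mfd K2) \<Phi>2 y b) (mderiv N (mfd K2) \<Phi>2 y c)" for a b c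
  proof -
    have "\<forall>x u v w. ext_deriv2 N \<sigma>2 x u v w =
      - chi K2 (\<Phi>2 x) (mderiv N (mfd K2) \<Phi>2 x u) (mderiv N (mfd K2) \<Phi>2 x v) (mderiv N (mfd K2) \<Phi>2 x w)"
      using Q2 unfolding quasi_hamiltonian_def Let_def by (elim conjE) assumption
    then show ?thesis by (elim allE)
  qed
  show ?thesis
  proof -
    let ?d1 = "\<lambda>f. mderiv M1 vector_manifold f x" and ?d2 = "\<lambda>f. mderiv N vector_manifold f y"
    have 1: "?d1 (s (fst v) (fst w)) (fst u) - ?d1 (s (fst u) (fst w)) (fst v) + ?d1 (s (fst u) (fst v)) (fst w) =
       - chi K1 (\<Phi>1 x) (mderiv M1 (mfd K1) \<Phi>1 x (fst u)) (mderiv M1 (mfd K1) \<Phi>1 x (fst v)) (mderiv M1 (mfd K1) \<Phi>1 x (fst w))"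
      using e1[of "fst u" "fst v" "fst w"] unfolding ext_deriv2_def Let_def s_def[abs_def] .
    have 2: "?d2 (t (snd v) (snd w)) (snd u) - ?d2 (t (snd u) (snd w)) (snd v) + ?d2 (t (snd u) (snd v)) (snd w) =
       - chi K2 (\<Phi>2 y) (mderiv N (mfd K2) \<Phi>2 y (snd u)) (mderiv N (mfd K2) \<Phi>2 y (snd v)) (mderiv N (mfd K2) \<Phi>2 y (snd w))"
      using e2[of "snd u" "snd v" "snd w"] unfolding ext_deriv2_def Let_def t_def[abs_def] .
    have xz: "fst z = x" "snd z = y" by (simp_all add: xy)
    show ?thesis
      unfolding chi_d\<Phi> xz ext_deriv2_def Let_def h using 1 2 by linarith
  qed
qed

lemma fundamental_field_prod:
  "fundamental_field K M act \<xi> z = (fundamental_field K1 M1 act1 (proj1 \<xi>) (fst z), fundamental_field K2 N act2 (proj2 \<xi>) (snd z))"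
proof -
  note K_atlases = group_atlas[OF lie_groups(3)] group_atlas[OF lie_groups(1)] group_atlas[OF lie_groups(2)]
  note s = smooth_at_compose[OF K_atlases(1,2) M1_atlas act12_smooth(3)[where x = "fst z"] proj_smooth_mderiv(1)[where a = "gone K"]]
    smooth_at_compose[OF K_atlases(1,3) N_atlas act12_smooth(4)[where y = "snd z"] proj_smooth_mderiv(2)[where a = "gone K"]]
  have "mderiv (mfd K) M (\<lambda>a. act a z) (gone K) \<xi> = (mderiv (mfd K) M1 (\<lambda>a. act1 (proj1 a) (fst z)) (gone K) \<xi>,
      mderiv (mfd K) N (\<lambda>a. act2 (proj2 a) (snd z)) (gone K) \<xi>)"
    unfolding act_eq by (rule smooth_at_Pair_mderiv(2)[OF M1_atlas N_atlas K_atlases(1) s])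
  then show ?thesis
    unfolding fundamental_field_def mderiv_compose[OF K_atlases(1,2) M1_atlas act12_smooth(3) proj_smooth_mderiv(1)]
      mderiv_compose[OF K_atlases(1,3) N_atlas act12_smooth(4) proj_smooth_mderiv(2)] proj_smooth_mderiv proj_gmult by simp
qed

lemma moment_condition_prod:
  "\<exists>s. bm_field B m UNIV s \<and> fst \<circ> s = fundamental_field K M act \<xi> \<and>
     (\<forall>z. \<forall>p\<in>bm_fibre B m z. \<sigma> z (s z) p = 1 / 2 * ip K
        (theta_l K (\<Phi> z) (mderiv M (mfd K) \<Phi> z (fst p)) + theta_r K (\<Phi> z) (mderiv M (mfd K) \<Phi> z (fst p))) \<xi>)"
proof -
  have "\<forall>\<xi>. \<exists>s. bm_field B1 m UNIV s \<and> fst \<circ> s = fundamental_field K1 M1 act1 \<xi> \<and> (\<forall>x. \<forall>p\<in>bm_fibre B1 m x. \<sigma>1 x (s x) p =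
      1 / 2 * ip K1 (theta_l K1 (\<Phi>1 x) (mderiv M1 (mfd K1) \<Phi>1 x (fst p)) + theta_r K1 (\<Phi>1 x) (mderiv M1 (mfd K1) \<Phi>1 x (fst p))) \<xi>)"
    using Q1 unfolding singular_quasi_hamiltonian_def Let_def by (elim conjE) assumption
  then obtain s1 where s1: "bm_field B1 m UNIV s1" "fst \<circ> s1 = fundamental_field K1 M1 act1 (proj1 \<xi>)"
    and eq1: "\<forall>x. \<forall>p\<in>bm_fibre B1 m x. \<sigma>1 x (s1 x) p =
      1 / 2 * ip K1 (theta_l K1 (\<Phi>1 x) (mderiv M1 (mfd K1) \<Phi>1 x (fst p)) + theta_r K1 (\<Phi>1 x) (mderiv M1 (mfd K1) \<Phi>1 x (fst p))) (proj1 \<xi>)"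
    by blast
  let ?Y = "fundamental_field K2 N act2 (proj2 \<xi>)"
  have eq2: "\<sigma>2 y (?Y y) v = 1 / 2 * ip K2 (theta_l K2 (\<Phi>2 y) (mderiv N (mfd K2) \<Phi>2 y v) + theta_r K2 (\<Phi>2 y) (mderiv N (mfd K2) \<Phi>2 y v)) (proj2 \<xi>)" for y v
  proof -
    have "\<forall>\<xi> x v. \<sigma>2 x (fundamental_field K2 N act2 \<xi> x) v =
      1 / 2 * ip K2 (theta_l K2 (\<Phi>2 x) (mderiv N (mfd K2) \<Phi>2 x v) + theta_r K2 (\<Phi>2 x) (mderiv N (mfd K2) \<Phi>2 x v)) \<xi>"
      using Q2 unfolding quasi_hamiltonian_def Let_def by (elim conjE) assumption
    then show ?thesis by (elim allE)
  qed
  have fs: "fst (s1 x) = fundamental_field K1 M1 act1 (proj1 \<xi>) x" for x using fun_cong[OF s1(2), of x] by simp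
  let ?s = "\<lambda>z. ((fst (s1 (fst z)), ?Y (snd z)), snd (s1 (fst z)))"
  \<comment> \<open>The fundamental field is the push-forward under the action map of the constant field
    \<open>- proj2 \<xi>\<close> along \<open>y \<mapsto> (1, y)\<close>.\<close>
  have "field_at N ?Y y" for y
  proof -
    let ?K = "prod_manifold (mfd K2) N"
    note K_atlases = group_atlas[OF lie_groups(2)]
    note KN = smooth_atlas_prod[OF K_atlases N_atlas]
    have s: "smooth_at ?K N (\<lambda>p. act2 (fst p) (snd p)) p" for p
      using Q2_facts(2) unfolding smooth_action_def smooth_map_on_iff[OF KN N_atlas] by (simp add: case_prod_unfold del: split_paired_All)
    let ?q = "\<lambda>y. (gone K2, y)" and ?v = "- proj2 \<xi>"
    have q: "smooth_at N ?K ?q y" by (intro smooth_at_Pair_mderiv[OF K_atlases N_atlas N_atlas] smooth_at_const smooth_at_ident N_atlas K_atlases)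
    have "field_along N (mfd K2) (\<lambda>y. gone K2) (\<lambda>y. ?v) y"
      unfolding field_along_def by (rule smooth_at_const[OF N_atlas smooth_atlas_vector])
    then have "field_along N ?K ?q (\<lambda>y. (?v, 0)) y"
      by (intro field_along_Pair[OF N_atlas K_atlases N_atlas] field_along_zero[OF N_atlas N_atlas] smooth_at_const smooth_at_ident N_atlas K_atlases)
    from field_along_push[OF N_atlas KN N_atlas q s this]
    have "field_at N (\<lambda>y. mderiv ?K N (\<lambda>p. act2 (fst p) (snd p)) (?q y) (?v, 0)) y" by (simp add: act2_laws(1)[unfolded prod_lie_simps])
    moreover have "mderiv ?K N (\<lambda>p. act2 (fst p) (snd p)) (?q y) (?v, 0) = ?Y y" for y
    proof -
      have i: "smooth_at (mfd K2) ?K (\<lambda>b. (b, y)) (gone K2)" "mderiv (mfd K2) ?K (\<lambda>b. (b, y)) (gone K2) v = (v, 0)" for v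
        using smooth_at_Pair_mderiv[OF K_atlases N_atlas K_atlases smooth_at_ident[OF K_atlases] smooth_at_const[OF K_atlases N_atlas]]
        by (simp_all add: mderiv_ident[OF K_atlases] mderiv_const del: prod_lie_simps)
      have "mderiv (mfd K2) N (\<lambda>b. act2 b y) (gone K2) ?v = mderiv ?K N (\<lambda>p. act2 (fst p) (snd p)) (?q y) (?v, 0)"
        using mderiv_compose[OF K_atlases KN N_atlas s i(1), of ?v] by (simp only: i(2) fst_conv snd_conv)
      then show ?thesis
        unfolding fundamental_field_def using linear_neg[OF linear_mderiv[OF K_atlases N_atlas act12_smooth(4)]] by simp
    qed
    ultimately show ?thesis by simp
  qed
  note fY = this
  have "bm_field B m UNIV ?s"
    unfolding bm_field_prod_iff
  proof (intro conjI ballI impI)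
    fix z :: "'m1 \<times> 'm2"
    show "b_part (?s z) \<in> bm_fibre B1 m (fst z)" using s1(1) by (simp add: b_part_def bm_field_iff[OF Q1_facts(1)])
    have "field_at M1 (\<lambda>x. fst (s1 x)) (fst z)" using s1(1) by (simp add: bm_field_iff[OF Q1_facts(1)])
    then have "field_along M M1 fst (\<lambda>z. fst (s1 (fst z))) z" using field_along_reparam[OF M1_atlas M1_atlas M_atlas projections(1)] by blast
    moreover have "field_along M N snd (\<lambda>z. ?Y (snd z)) z" using field_along_reparam[OF N_atlas N_atlas M_atlas projections(3) fY] by blast
    ultimately show "field_at M (\<lambda>y. fst (?s y)) z" using field_along_Pair[OF M_atlas M1_atlas N_atlas projections(1) projections(3)] by simp
    assume "fst z \<in> nbhd B1"
    then have "smooth_at M1 vector_manifold (\<lambda>x. snd (s1 x)) (fst z)" using s1(1) by (simp add: bm_field_iff[OF Q1_facts(1)])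
    from smooth_at_compose[OF M_atlas M1_atlas smooth_atlas_vector this projections(1)]
    show "smooth_at M vector_manifold (\<lambda>y. snd (?s y)) z" by simp
  qed simp
  moreover have "fst \<circ> ?s = fundamental_field K M act \<xi>" by (simp add: fun_eq_iff fundamental_field_prod fs del: split_paired_All prod_lie_simps)
  moreover have "\<sigma> z (?s z) p = 1 / 2 * ip K
        (theta_l K (\<Phi> z) (mderiv M (mfd K) \<Phi> z (fst p)) + theta_r K (\<Phi> z) (mderiv M (mfd K) \<Phi> z (fst p))) \<xi>"
    if p: "p \<in> bm_fibre B m z" for z p
  proof -
    let ?d1 = "mderiv M1 (mfd K1) \<Phi>1 (fst z) (fst (fst p))" and ?d2 = "mderiv N (mfd K2) \<Phi>2 (snd z) (snd (fst p))"
    have 1: "b_part (?s z) = s1 (fst z)" "fst (b_part p) = fst (fst p)" by (simp_all add: b_part_def)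
    have 2: "b_part p \<in> bm_fibre B1 m (fst z)" using p by (simp only: bm_fibre_prod)
    have "\<sigma> z (?s z) p = 1 / 2 * ip K1 (theta_l K1 (\<Phi>1 (fst z)) ?d1 + theta_r K1 (\<Phi>1 (fst z)) ?d1) (proj1 \<xi>)
       + 1 / 2 * ip K2 (theta_l K2 (\<Phi>2 (snd z)) ?d2 + theta_r K2 (\<Phi>2 (snd z)) ?d2) (proj2 \<xi>)"
      unfolding \<sigma>_eq 1 eq1[rule_format, OF 2] fst_conv snd_conv eq2 ..
    also have "\<dots> = 1 / 2 * ip K
        (theta_l K (\<Phi> z) (mderiv M (mfd K) \<Phi> z (fst p)) + theta_r K (\<Phi> z) (mderiv M (mfd K) \<Phi> z (fst p))) \<xi>"
      unfolding \<Phi>_mderiv theta_l_prod_lie[OF G lie_groups(4)] theta_l_prod_lie[OF G lie_groups(5)] theta_l_prod_lie[OF H1 H2]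
        theta_l_prod_lie[OF G H1] theta_l_prod_lie[OF G H2]
        theta_r_prod_lie[OF G lie_groups(4)] theta_r_prod_lie[OF G lie_groups(5)] theta_r_prod_lie[OF H1 H2]
        theta_r_prod_lie[OF G H1] theta_r_prod_lie[OF G H2]
      by (simp add: prod_moment_def case_prod_unfold proj1_def proj2_def algebra_simps)
    finally show ?thesis .
  qed
  ultimately show ?thesis by (intro exI[of _ ?s]) blast
qed

text \<open>Test vectors with one component equal to zero separate the conditions on the two
  factors.\<close>

lemma nondegenerate_prod:
  assumes p: "p \<in> bm_fibre B m z" and ker: "\<forall>q\<in>bm_fibre B m z. \<sigma> z p q = 0" and d: "mderiv M (mfd K) \<Phi> z (fst p) = 0"
  shows "p = 0"
proof -
  let ?d1 = "mderiv M1 (mfd K1) \<Phi>1 (fst z) (fst (b_part p))" and ?d2 = "mderiv N (mfd K2) \<Phi>2 (snd z) (snd (fst p))"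
  have a1: "alternating2_on (bm_fibre B1 m (fst z)) (\<sigma>1 (fst z))" and a2: "alternating2_on UNIV (\<sigma>2 (snd z))"
    using Q1_facts(3) Q2_facts(3) by (simp_all add: bm_form2_def smooth_form2_def)
  have 0: "0 \<in> bm_fibre B1 m (fst z)" by (rule subspace_0[OF subspace_bm_fibre[OF Q1_facts(1)]])
  have p1: "b_part p \<in> bm_fibre B1 m (fst z)" using p by (simp add: bm_fibre_prod)
  have lin: "linear_functional_on (bm_fibre B1 m (fst z)) (\<sigma>1 (fst z) (b_part p))" "linear_functional_on UNIV (\<sigma>2 (snd z) (snd (fst p)))"
    using a1 a2 p1 by (auto simp: alternating2_on_def)
  have z1: "\<sigma>1 (fst z) (b_part p) 0 = 0" "\<sigma>2 (snd z) (snd (fst p)) 0 = 0"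
    using linear_functional_on_sum[OF lin(1) subspace_bm_fibre[OF Q1_facts(1)], of "{}"]
      linear_functional_on_sum[OF lin(2) subspace_UNIV, of "{}"] by simp_all
  have "\<sigma>1 (fst z) (b_part p) q = 0" if q: "q \<in> bm_fibre B1 m (fst z)" for q
  proof -
    have "((fst q, 0), snd q) \<in> bm_fibre B m z" using q by (simp add: bm_fibre_prod b_part_def)
    from bspec[OF ker this] show ?thesis by (simp add: \<sigma>_eq b_part_def z1(2)[unfolded b_part_def])
  qed
  moreover have "?d1 = 0" using d unfolding \<Phi>_mderiv by (simp add: b_part_def prod_eq_iff)
  moreover have "\<forall>x. \<forall>p\<in>bm_fibre B1 m x. (\<forall>q\<in>bm_fibre B1 m x. \<sigma>1 x p q = 0) \<and> mderiv M1 (mfd K1) \<Phi>1 x (fst p) = 0 \<longrightarrow> p = 0"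
    using Q1 unfolding singular_quasi_hamiltonian_def Let_def by (elim conjE) assumption
  ultimately have "b_part p = 0" using p1 by blast
  moreover have "snd (fst p) = 0"
  proof -
    have "\<sigma>2 (snd z) (snd (fst p)) v = 0" for v
    proof -
      have "((0, v), 0) \<in> bm_fibre B m z" using 0 by (simp add: bm_fibre_prod b_part_def zero_prod_def)
      from bspec[OF ker this] z1(1) show ?thesis by (simp add: \<sigma>_eq b_part_def zero_prod_def)
    qed
    moreover have "?d2 = 0" using d unfolding \<Phi>_mderiv by (simp add: prod_eq_iff)
    moreover have "\<forall>x u. (\<forall>v. \<sigma>2 x u v = 0) \<and> mderiv N (mfd K2) \<Phi>2 x u = 0 \<longrightarrow> u = 0"
      using Q2 unfolding quasi_hamiltonian_def Let_def by (elim conjE) assumption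
    ultimately show ?thesis by blast
  qed
  ultimately show ?thesis by (simp add: b_part_def prod_eq_iff)
qed

theorem singular_quasi_hamiltonian_product: "singular_quasi_hamiltonian K m B act \<sigma> \<Phi>"
proof -
  have fst_lift: "fst (bm_lift B m z u) = u" for z u by (simp add: bm_lift_def)
  have f3: "bm_form3 B m (\<lambda>x p q r. - chi K (\<Phi> x) (mderiv M (mfd K) \<Phi> x (fst p)) (mderiv M (mfd K) \<Phi> x (fst q)) (mderiv M (mfd K) \<Phi> x (fst r)))"
    using bm_form3_pullback_chi[OF b_manifold_prod lie_groups(3), of \<Phi> m] \<Phi>_smooth by (simp del: prod_lie_simps)
  show ?thesis
    unfolding singular_quasi_hamiltonian_def Let_def bm_has_ext_deriv_def B_simps(1)
    using b_manifold_prod bm_action_prod bm_form2_prod bm_invariant_prod equivariant_prod f3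
    by (intro conjI allI impI ballI moment_condition_prod)
       (auto intro: nondegenerate_prod simp: ext_deriv2_prod fst_lift simp del: split_paired_All prod_lie_simps B_simps)
qed

end

section \<open>The fusion product\<close>

theorem theorem23:
  fixes G :: "('g::{t2_space, second_countable_topology}, 'kg::fin_dim_inner) lie_group_data"
    and H1 :: "('h1::{t2_space, second_countable_topology}, 'k1::fin_dim_inner) lie_group_data"
    and H2 :: "('h2::{t2_space, second_countable_topology}, 'k2::fin_dim_inner) lie_group_data"
    and m :: nat
    and M1 :: "('m1::{t2_space, second_countable_topology}, 'e1::fin_dim_inner) b_manifold_data"
    and M2 :: "('m2::{t2_space, second_countable_topology}, 'e2::fin_dim_inner) manifold"
    and o2 :: "'m2 \<Rightarrow> real"
    and act1 :: "'g \<times> 'h1 \<Rightarrow> 'm1 \<Rightarrow> 'm1"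
    and act2 :: "'g \<times> 'h2 \<Rightarrow> 'm2 \<Rightarrow> 'm2"
    and \<sigma>1 :: "('m1, 'e1 \<times> real) form2"
    and \<sigma>2 :: "('m2, 'e2) form2"
    and \<Phi>1 :: "'m1 \<Rightarrow> 'g \<times> 'h1"
    and \<Phi>2 :: "'m2 \<Rightarrow> 'g \<times> 'h2"
  assumes "lie_group G" and "lie_group H1" and "lie_group H2"
    and "m \<ge> 1"
    and "singular_quasi_hamiltonian (prod_lie G H1) m M1 act1 \<sigma>1 \<Phi>1"
    and "quasi_hamiltonian (prod_lie G H2) M2 act2 \<sigma>2 \<Phi>2"
    and "orientation M2 o2"
  shows "let M = prod_b_manifold M1 M2 o2;
             act = prod_action act1 act2;
             \<sigma> = prod_bm_form2 \<sigma>1 \<sigma>2;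
             \<Phi> = prod_moment \<Phi>1 \<Phi>2
         in singular_quasi_hamiltonian (prod_lie G (prod_lie H1 H2)) m M
              (fusion_action act) (fusion_form G M \<Phi> \<sigma>) (fusion_moment G \<Phi>)"
proof -
  interpret quasi_hamiltonian_product G H1 H2 m M1 M2 o2 act1 act2 \<sigma>1 \<sigma>2 \<Phi>1 \<Phi>2
    by unfold_locales (fact assms)+
  have "fusion G (prod_lie H1 H2) m (prod_b_manifold M1 M2 o2) (prod_action act1 act2)
      (prod_bm_form2 \<sigma>1 \<sigma>2) (prod_moment \<Phi>1 \<Phi>2)"
    using assms(1) lie_groups(5) singular_quasi_hamiltonian_product by (rule fusion.intro)
  from fusion.singular_quasi_hamiltonian_fusion[OF this] show ?thesis by (simp only: Let_def)
qed

end
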